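(* Let $V$ be the multiplicative unitary (left regular corepresentation) of a locally compact quantum group and $\mathcal C(V)$ its tensor $W^*$-category of corepresentations with trivializing endofunctor $\iota$. Pick for each object $H$ in the image of $\iota$ an antiunitary operator $J_H:H\to\overline H$. For a corepresentation $W\in\mathcal C(V)$ on $H$, let $\pi_W$ be the corresponding representation of $\mathcal A_{\max}(V)$ on $H$, and let $\overline W$ denote the corepresentation of $V$ on $\overline H$ defined by the representation $A\mapsto J_H\pi_W(j'(A))J_H^{-1}$ of $\mathcal A_{\max}(V)$. Set $J_W:=J_{\iota(W)}$, whence $\overline{\iota(W)}=\iota(\overline W)$. For $T\in(W,W')$ set $\overline T:=J_{W'}TJ_W^{-1}\in(\overline W,\overline{W'})$. Then $T\in(W,W')\mapsto\overline T\in(\overline W,\overline{W'})$ is an antilinear functorial equivalence, and one obtains a semilinear tensor $W^*$-category with conjugation extending $\mathcal C(V)$, with natural unitary equivalences $$d_W:=J_{\overline W}\circ J_W\in(W,\overline{\overline W}),\qquad c_{W,W'}:=J_{W\times W'}\circ(J_W\times J_{W'})^*\in(\overline{W'}\times\overline W,\overline{W\times W'}),$$ where $J_W\times J_{W'}:=\theta(\overline H,\overline{H'})\circ (J_W\otimes J_{W'})$, $H,H'$ being the Hilbert spaces of $W,W'$.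
   Context: A locally compact quantum group (Kustermans–Vaes) is a $C^*$-algebra $\mathcal A$ with coassociative coproduct $\delta:\mathcal A\to M(\mathcal A\otimes\mathcal A)$ satisfying the usual density conditions, left and right invariant faithful lower semicontinuous densely defined KMS weights, left Haar weight $\phi$, and coinverse $\kappa=R\tau_{-i/2}$ with $R$ an involutive $^*$-antiautomorphism ($\delta R=\theta(R\otimes R)\delta$) and $\tau$ the scaling group, commuting with $R$. On $K=L^2(\mathcal A,\phi)$, $V$ is the unitary on $K\otimes K$ with $V^*(a\otimes b)=\delta(b)(a\otimes I)$ for $a,b$ with $\phi(a^*a),\phi(b^*b)<\infty$; it is multiplicative: $V_{12}V_{13}V_{23}=V_{23}V_{12}$. $\mathcal C(V)$: objects are corepresentations, i.e. unitaries $W$ on $K\otimes H$ with $V_{12}W_{13}W_{23}=W_{23}V_{12}$ ($H$ ranging over a strict tensor $W^*$-category of Hilbert spaces closed under the chosen $H\mapsto\overline H$); $(W,W')$ is the set of bounded $T:H\to H'$ with $(1_K\otimes T)W=W'(1_K\otimes T)$; $W\times W'=W_{12}W'_{13}$. $\iota$ sends a corepresentation on $H$ to the trivial corepresentation $1_{K\otimes H}$ on $H$ (identified with $H$) and is the identity on operators. $\hat{\mathcal M}(V)$ is the von Neumann algebra generated by the operators $(i\otimes\omega)(V)$ (i.e. by $\mathcal A$ on $L^2(\mathcal A,\phi)$), to which $R$ extends normally. For $\omega\in\hat{\mathcal M}(V)_*$ put $\pi_W(\omega)=(\omega\otimes i)(W)$. $\mathcal A_{\max}(V)$ is the $C^*$-completion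 of $\hat{\mathcal M}(V)_*$ in the norm $\sup_{W}\|\pi_W(\omega)\|$, with product determined by $\pi_W(\omega*\omega')=\pi_W(\omega)\pi_W(\omega')$ and adjoint by $\pi_W(\omega^* )=\pi_W(\omega)^*$; $W\mapsto\pi_W$ identifies corepresentations of $V$ with nondegenerate representations of $\mathcal A_{\max}(V)$. $j'=R'\circ{}^*$ is the antilinear involutive automorphism of $\mathcal A_{\max}(V)$ with $R'(\omega)=\omega\circ R$. Thus $(\omega\otimes i)(\overline W)=J_H\,\bigl(((\omega\circ R)\otimes i)(W)\bigr)^*J_H^{-1}$. $\theta(\overline H,\overline{H'})$ is the flip $\overline H\otimes\overline{H'}\to\overline{H'}\otimes\overline H$. A semilinear tensor $C^*$-(or $W^*$-)category has, besides linear arrows, spaces $(\rho,\sigma)_a$ of antilinear arrows (compositions being antilinear iff exactly one factor is), an adjoint with the $C^*$-property, and tensor products of two linear arrows and of two antilinear arrows; for $R\in(\rho,\sigma)_a,R'\in(\rho',\sigma')_a$ one has $R\times R'\in(\rho\rho',\sigma'\sigma)_a$, $S'\times S\circ R\times R'=(S\circ R)\times(S'\circ R')$ for $S,S'$ both linear or both antilinear, $R\times R'\circ P\times P'=(R\circ P)\times(R'\circ P')$ for $P,P'$ linear, and $(R\times R')^*=R'^*\times R^*$. It is "with conjugation" if every object is the source of an antiunitary. Such a structure is determined by an antilinear $^*$-functor $T\mapsto\overline T$ with natural unitaries $d,c$ satisfying $\overline{d_\rho}=d_{\overline\rho}$, $c_{\tau,\sigma\rho}\circ c_{\sigma,\rho}\times1_{\overline\tau}=c_{\tau\sigma,\rho}\circ1_{\overline\rho}\times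 c_{\tau,\sigma}$, $\overline{c_{\rho,\sigma}}\circ c_{\overline\sigma,\overline\rho}\circ d_\rho\times d_\sigma=d_{\rho\sigma}$; the antilinear arrows $W\to W'$ are the $S\circ J_W$ with $S\in(\overline W,W')$. *)

theory Defs
  imports "HOL-Analysis.Analysis"
begin

section \<open>Complex Hilbert spaces and their operators\<close>

text \<open>
  Inner products are linear in the second variable.  The real inner product underlying the norm is
  the real part of the complex one.
\<close>

class complex_hilbert = real_inner + banach +
  fixes scaleC :: "complex \<Rightarrow> 'a \<Rightarrow> 'a" (infixr "*\<^sub>C" 75)
    and cinner :: "'a \<Rightarrow> 'a \<Rightarrow> complex"
  assumes scaleC_add_right: "c *\<^sub>C (x + y) = c *\<^sub>C x + c *\<^sub>C y"
    and scaleC_add_left: "(c + d) *\<^sub>C x = c *\<^sub>C x + d *\<^sub>C x"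
    and scaleC_scaleC: "c *\<^sub>C d *\<^sub>C x = (c * d) *\<^sub>C x"
    and scaleC_of_real: "complex_of_real r *\<^sub>C x = scaleR r x"
    and cinner_commute: "cinner x y = cnj (cinner y x)"
    and cinner_add_right: "cinner x (y + z) = cinner x y + cinner x z"
    and cinner_scaleC_right: "cinner x (c *\<^sub>C y) = c * cinner x y"
    and inner_eq_Re_cinner: "inner x y = Re (cinner x y)"

instantiation complex :: complex_hilbert
begin
definition "scaleC (c::complex) (x::complex) = c * x"
definition "cinner (x::complex) (y::complex) = cnj x * y"
instance
  by standard
    (auto simp: scaleC_complex_def cinner_complex_def algebra_simps inner_complex_def scaleR_conv_of_real)
end

text \<open>
  All Hilbert spaces are closed complex subspaces of one ambient Hilbert space type \<open>'h\<close> (a type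
  variable, so every set of Hilbert spaces occurs, up to unitary equivalence, in this way).
  A bounded operator between two such subspaces is encoded by the operator on \<open>'h\<close> extending it by
  \<open>0\<close> on the orthogonal complement.  Under this encoding composition and adjoint are those of \<open>'h\<close>,
  the norm is unchanged and the identity of \<open>H\<close> is the projection onto \<open>H\<close>.  Elements of the library
  type of bounded linear maps are only real linear, so that it contains the linear operators
  (flag \<open>False\<close> below) as well as the antilinear ones (flag \<open>True\<close>).
\<close>

type_synonym 'h oper = "'h \<Rightarrow>\<^sub>L 'h"

definition closed_csubspace :: "'h::complex_hilbert set \<Rightarrow> bool" where
  "closed_csubspace H \<longleftrightarrow> subspace H \<and> (\<forall>c. \<forall>x\<in>H. c *\<^sub>C x \<in> H) \<and> closed H"

definition orth :: "'h::complex_hilbert set \<Rightarrow> 'h \<Rightarrow> bool" where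
  "orth H x \<longleftrightarrow> (\<forall>y\<in>H. cinner y x = 0)"

definition cj :: "bool \<Rightarrow> complex \<Rightarrow> complex" where
  "cj b c = (if b then cnj c else c)"

definition bop :: "bool \<Rightarrow> 'h::complex_hilbert set \<Rightarrow> 'h set \<Rightarrow> 'h oper set" where
  "bop b H H' = {T :: 'h oper. (\<forall>c x. T (c *\<^sub>C x) = cj b c *\<^sub>C T x) \<and> (\<forall>x. orth H x \<longrightarrow> T x = 0) \<and> (\<forall>x. T x \<in> H')}"

abbreviation blin :: "'h::complex_hilbert set \<Rightarrow> 'h set \<Rightarrow> 'h oper set" where
  "blin \<equiv> bop False"

abbreviation banti :: "'h::complex_hilbert set \<Rightarrow> 'h set \<Rightarrow> 'h oper set" where
  "banti \<equiv> bop True"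

definition idop :: "'h::complex_hilbert set \<Rightarrow> 'h oper" where
  "idop H = Blinfun (\<lambda>x. THE y. y \<in> H \<and> orth H (x - y))"

definition scl :: "complex \<Rightarrow> 'h::complex_hilbert oper \<Rightarrow> 'h oper" where
  "scl c T = Blinfun (\<lambda>x. c *\<^sub>C T x)"

text \<open>
  The adjoint for the real inner product \<open>Re \<langle>x,y\<rangle>\<close> is the Hilbert space adjoint
  \<open>\<langle>T x, y\<rangle> = \<langle>x, T\<^sup>* y\<rangle>\<close> when \<open>T\<close> is complex linear, and the antilinear adjoint
  \<open>\<langle>T x, y\<rangle> = cnj \<langle>x, T\<^sup>* y\<rangle>\<close> when \<open>T\<close> is antilinear.
\<close>

definition adj :: "'h::complex_hilbert oper \<Rightarrow> 'h oper" where
  "adj T = Blinfun (adjoint (blinfun_apply T))"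

definition unitary_op :: "bool \<Rightarrow> 'h::complex_hilbert set \<Rightarrow> 'h set \<Rightarrow> 'h oper \<Rightarrow> bool" where
  "unitary_op b H H' U \<longleftrightarrow> U \<in> bop b H H' \<and> adj U o\<^sub>L U = idop H \<and> U o\<^sub>L adj U = idop H'"

definition form_op :: "'h::complex_hilbert set \<Rightarrow> ('h \<Rightarrow> 'h \<Rightarrow> complex) \<Rightarrow> 'h oper" where
  "form_op H q = (THE T :: 'h oper. T \<in> blin H H \<and> (\<forall>\<xi>\<in>H. \<forall>\<eta>\<in>H. cinner \<eta> (T \<xi>) = q \<eta> \<xi>))"


section \<open>Strict tensor categories of Hilbert spaces\<close>

text \<open>
  Objects are names \<open>a :: 'o\<close> of Hilbert spaces \<open>hsp a\<close>; \<open>hvec a b x y\<close> is the vector \<open>x \<otimes> y\<close> of the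
  Hilbert space tensor product \<open>hsp (htens a b)\<close>.  The arrows are all bounded operators.
\<close>

record ('o, 'h) hilb_cat =
  hobj :: "'o set"
  hsp :: "'o \<Rightarrow> 'h set"
  htens :: "'o \<Rightarrow> 'o \<Rightarrow> 'o"
  hvec :: "'o \<Rightarrow> 'o \<Rightarrow> 'h \<Rightarrow> 'h \<Rightarrow> 'h"
  hunit :: 'o
  hone :: 'h

locale strict_hilb_cat =
  fixes D :: "('o, 'h::complex_hilbert, 'm) hilb_cat_scheme"
  assumes hsp: "a \<in> hobj D \<Longrightarrow> closed_csubspace (hsp D a)"
    and htens: "\<lbrakk>a \<in> hobj D; b \<in> hobj D\<rbrakk> \<Longrightarrow> htens D a b \<in> hobj D"
    and hvec_add_left: "\<lbrakk>a \<in> hobj D; b \<in> hobj D; x \<in> hsp D a; x' \<in> hsp D a; y \<in> hsp D b\<rbrakk>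
        \<Longrightarrow> hvec D a b (x + x') y = hvec D a b x y + hvec D a b x' y"
    and hvec_add_right: "\<lbrakk>a \<in> hobj D; b \<in> hobj D; x \<in> hsp D a; y \<in> hsp D b; y' \<in> hsp D b\<rbrakk>
        \<Longrightarrow> hvec D a b x (y + y') = hvec D a b x y + hvec D a b x y'"
    and hvec_scaleC_left: "\<lbrakk>a \<in> hobj D; b \<in> hobj D; x \<in> hsp D a; y \<in> hsp D b\<rbrakk>
        \<Longrightarrow> hvec D a b (c *\<^sub>C x) y = c *\<^sub>C hvec D a b x y"
    and hvec_scaleC_right: "\<lbrakk>a \<in> hobj D; b \<in> hobj D; x \<in> hsp D a; y \<in> hsp D b\<rbrakk>
        \<Longrightarrow> hvec D a b x (c *\<^sub>C y) = c *\<^sub>C hvec D a b x y"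
    and hvec_cinner: "\<lbrakk>a \<in> hobj D; b \<in> hobj D; x \<in> hsp D a; x' \<in> hsp D a; y \<in> hsp D b; y' \<in> hsp D b\<rbrakk>
        \<Longrightarrow> cinner (hvec D a b x y) (hvec D a b x' y') = cinner x x' * cinner y y'"
    and hsp_htens: "\<lbrakk>a \<in> hobj D; b \<in> hobj D\<rbrakk>
        \<Longrightarrow> hsp D (htens D a b) = closure (span {hvec D a b x y |x y. x \<in> hsp D a \<and> y \<in> hsp D b})"
    and htens_assoc: "\<lbrakk>a \<in> hobj D; b \<in> hobj D; d \<in> hobj D\<rbrakk>
        \<Longrightarrow> htens D (htens D a b) d = htens D a (htens D b d)"
    and hvec_assoc: "\<lbrakk>a \<in> hobj D; b \<in> hobj D; d \<in> hobj D; x \<in> hsp D a; y \<in> hsp D b; z \<in> hsp D d\<rbrakk>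
        \<Longrightarrow> hvec D (htens D a b) d (hvec D a b x y) z = hvec D a (htens D b d) x (hvec D b d y z)"
    and hunit: "hunit D \<in> hobj D" "hsp D (hunit D) = range (\<lambda>c. c *\<^sub>C hone D)" "norm (hone D) = 1"
    and htens_unit: "a \<in> hobj D \<Longrightarrow> htens D (hunit D) a = a" "a \<in> hobj D \<Longrightarrow> htens D a (hunit D) = a"
    and hvec_unit: "\<lbrakk>a \<in> hobj D; x \<in> hsp D a\<rbrakk> \<Longrightarrow> hvec D (hunit D) a (hone D) x = x"
      "\<lbrakk>a \<in> hobj D; x \<in> hsp D a\<rbrakk> \<Longrightarrow> hvec D a (hunit D) x (hone D) = x"

abbreviation hid :: "('o, 'h::complex_hilbert, 'm) hilb_cat_scheme \<Rightarrow> 'o \<Rightarrow> 'h oper" where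
  "hid D a \<equiv> idop (hsp D a)"

text \<open>\<open>optens D a b a' b' T S\<close> is \<open>T \<otimes> S\<close> for \<open>T : a \<rightarrow> a'\<close> and \<open>S : b \<rightarrow> b'\<close>, both linear or both
  antilinear; \<open>hflip D a b\<close> is the flip \<open>\<theta>(a,b) : a \<otimes> b \<rightarrow> b \<otimes> a\<close>.\<close>

definition optens ::
    "('o, 'h::complex_hilbert, 'm) hilb_cat_scheme \<Rightarrow> 'o \<Rightarrow> 'o \<Rightarrow> 'o \<Rightarrow> 'o \<Rightarrow> 'h oper \<Rightarrow> 'h oper \<Rightarrow> 'h oper" where
  "optens D a b a' b' T S = (THE X :: 'h oper. (\<forall>z. orth (hsp D (htens D a b)) z \<longrightarrow> X z = 0) \<and>
     (\<forall>x\<in>hsp D a. \<forall>y\<in>hsp D b. X (hvec D a b x y) = hvec D a' b' (T x) (S y)))"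

definition hflip :: "('o, 'h::complex_hilbert, 'm) hilb_cat_scheme \<Rightarrow> 'o \<Rightarrow> 'o \<Rightarrow> 'h oper" where
  "hflip D a b = (THE X :: 'h oper. (\<forall>z. orth (hsp D (htens D a b)) z \<longrightarrow> X z = 0) \<and>
     (\<forall>x\<in>hsp D a. \<forall>y\<in>hsp D b. X (hvec D a b x y) = hvec D b a y x))"

text \<open>Leg notation on \<open>a \<otimes> b \<otimes> c\<close>.\<close>

definition leg12 where
  "leg12 D a b c X = optens D (htens D a b) c (htens D a b) c X (hid D c)"

definition leg23 where
  "leg23 D a b c X = optens D a (htens D b c) a (htens D b c) (hid D a) X"

definition leg13 where
  "leg13 D a b c X = optens D a (htens D c b) a (htens D b c) (hid D a) (hflip D c b) o\<^sub>L leg12 D a c b X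
     o\<^sub>L optens D a (htens D b c) a (htens D c b) (hid D a) (hflip D b c)"

text \<open>Slices of an operator \<open>X\<close> on \<open>a \<otimes> b\<close>: \<open>vslice1\<close> is \<open>(\<omega> \<otimes> i)(X)\<close> and \<open>vslice2\<close> is
  \<open>(i \<otimes> \<omega>)(X)\<close> for the vector functional \<open>\<omega>(x) = \<langle>\<eta>, x \<xi>\<rangle>\<close>; \<open>slice1\<close> and \<open>slice2\<close> are the slices by a
  normal functional, which is applied to the vector slices along the other leg.\<close>

definition vslice1 where
  "vslice1 D a b \<eta> \<xi> X = form_op (hsp D b) (\<lambda>y x. cinner (hvec D a b \<eta> y) (blinfun_apply X (hvec D a b \<xi> x)))"

definition vslice2 where
  "vslice2 D a b \<eta> \<xi> X = form_op (hsp D a) (\<lambda>y x. cinner (hvec D a b y \<eta>) (blinfun_apply X (hvec D a b x \<xi>)))"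

definition slice1 where
  "slice1 D a b \<omega> X = form_op (hsp D b) (\<lambda>\<eta> \<xi>. \<omega> (vslice2 D a b \<eta> \<xi> X))"

definition slice2 where
  "slice2 D a b \<omega> X = form_op (hsp D a) (\<lambda>\<eta> \<xi>. \<omega> (vslice1 D a b \<eta> \<xi> X))"


section \<open>Operator algebras on a Hilbert space\<close>

definition op_linear_on :: "'h::complex_hilbert oper set \<Rightarrow> ('h oper \<Rightarrow> 'h oper) \<Rightarrow> bool" where
  "op_linear_on A f \<longleftrightarrow> (\<forall>a\<in>A. \<forall>b\<in>A. f (a + b) = f a + f b) \<and> (\<forall>c. \<forall>a\<in>A. f (scl c a) = scl c (f a))"

definition star_hom :: "'h::complex_hilbert oper set \<Rightarrow> 'h oper set \<Rightarrow> ('h oper \<Rightarrow> 'h oper) \<Rightarrow> bool" where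
  "star_hom A B f \<longleftrightarrow> f \<in> A \<rightarrow> B \<and> op_linear_on A f \<and> (\<forall>a\<in>A. \<forall>b\<in>A. f (a o\<^sub>L b) = f a o\<^sub>L f b)
     \<and> (\<forall>a\<in>A. f (adj a) = adj (f a))"

definition star_antihom :: "'h::complex_hilbert oper set \<Rightarrow> 'h oper set \<Rightarrow> ('h oper \<Rightarrow> 'h oper) \<Rightarrow> bool" where
  "star_antihom A B f \<longleftrightarrow> f \<in> A \<rightarrow> B \<and> op_linear_on A f \<and> (\<forall>a\<in>A. \<forall>b\<in>A. f (a o\<^sub>L b) = f b o\<^sub>L f a)
     \<and> (\<forall>a\<in>A. f (adj a) = adj (f a))"

definition cstar_alg :: "'h::complex_hilbert set \<Rightarrow> 'h oper set \<Rightarrow> bool" where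
  "cstar_alg H A \<longleftrightarrow> A \<subseteq> blin H H \<and> subspace A \<and> (\<forall>c. \<forall>a\<in>A. scl c a \<in> A) \<and>
     (\<forall>a\<in>A. \<forall>b\<in>A. a o\<^sub>L b \<in> A) \<and> (\<forall>a\<in>A. adj a \<in> A) \<and> closed A \<and>
     closure (span {blinfun_apply a x |a x. a \<in> A \<and> x \<in> H}) = H"

text \<open>The multiplier algebra of a nondegenerate \<open>C\<^sup>*\<close>-algebra of operators on \<open>H\<close>.\<close>

definition mult_alg :: "'h::complex_hilbert set \<Rightarrow> 'h oper set \<Rightarrow> 'h oper set" where
  "mult_alg H C = {X \<in> blin H H. \<forall>c\<in>C. X o\<^sub>L c \<in> C \<and> c o\<^sub>L X \<in> C}"

text \<open>Minimal tensor product; the elementary tensors are stable under complex scalars, so that their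
  real span is their complex span.\<close>

definition alg_tens where
  "alg_tens D a b A B = closure (span {optens D a b a b S T |S T. S \<in> A \<and> T \<in> B})"

definition commutant :: "'h::complex_hilbert set \<Rightarrow> 'h oper set \<Rightarrow> 'h oper set" where
  "commutant H S = {T \<in> blin H H. \<forall>s\<in>S. T o\<^sub>L s = s o\<^sub>L T}"

definition vn_gen :: "'h::complex_hilbert set \<Rightarrow> 'h oper set \<Rightarrow> 'h oper set" where
  "vn_gen H S = commutant H (commutant H (S \<union> adj ` S))"

text \<open>Elements of the predual of a von Neumann algebra \<open>M\<close> on \<open>H\<close>: functionals
  \<open>x \<mapsto> \<Sum>\<^sub>n \<langle>\<eta>\<^sub>n, x \<xi>\<^sub>n\<rangle>\<close> with \<open>\<Sum> \<parallel>\<eta>\<^sub>n\<parallel>\<^sup>2 < \<infinity>\<close>, \<open>\<Sum> \<parallel>\<xi>\<^sub>n\<parallel>\<^sup>2 < \<infinity>\<close>.  Only the values on \<open>M\<close> matter.\<close>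

definition normal_fun :: "'h::complex_hilbert set \<Rightarrow> 'h oper set \<Rightarrow> ('h oper \<Rightarrow> complex) \<Rightarrow> bool" where
  "normal_fun H M \<omega> \<longleftrightarrow> (\<exists>\<eta> \<xi> :: nat \<Rightarrow> 'h. range \<eta> \<subseteq> H \<and> range \<xi> \<subseteq> H \<and>
     summable (\<lambda>n. (norm (\<eta> n))\<^sup>2) \<and> summable (\<lambda>n. (norm (\<xi> n))\<^sup>2) \<and>
     (\<forall>x\<in>M. \<omega> x = (\<Sum>n. cinner (\<eta> n) (blinfun_apply x (\<xi> n)))))"


section \<open>Weights and one-parameter groups\<close>

definition pos_part :: "'h::complex_hilbert oper set \<Rightarrow> 'h oper set" where
  "pos_part A = {adj b o\<^sub>L b |b. b \<in> A}"

definition is_weight :: "'h::complex_hilbert oper set \<Rightarrow> ('h oper \<Rightarrow> ennreal) \<Rightarrow> bool" where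
  "is_weight A \<phi> \<longleftrightarrow> (\<forall>a\<in>pos_part A. \<forall>b\<in>pos_part A. \<phi> (a + b) = \<phi> a + \<phi> b) \<and>
     (\<forall>r\<ge>0. \<forall>a\<in>pos_part A. \<phi> (scaleR r a) = ennreal r * \<phi> a)"

definition faithful_weight :: "'h::complex_hilbert oper set \<Rightarrow> ('h oper \<Rightarrow> ennreal) \<Rightarrow> bool" where
  "faithful_weight A \<phi> \<longleftrightarrow> (\<forall>a\<in>pos_part A. \<phi> a = 0 \<longrightarrow> a = 0)"

definition lsc_weight :: "'h::complex_hilbert oper set \<Rightarrow> ('h oper \<Rightarrow> ennreal) \<Rightarrow> bool" where
  "lsc_weight A \<phi> \<longleftrightarrow> (\<forall>r. \<forall>a\<in>pos_part A. a \<in> closure {b \<in> pos_part A. \<phi> b \<le> r} \<longrightarrow> \<phi> a \<le> r)"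

definition densely_defined_weight :: "'h::complex_hilbert oper set \<Rightarrow> ('h oper \<Rightarrow> ennreal) \<Rightarrow> bool" where
  "densely_defined_weight A \<phi> \<longleftrightarrow> pos_part A \<subseteq> closure {b \<in> pos_part A. \<phi> b < \<infinity>}"

text \<open>The left ideal \<open>N\<^sub>\<phi>\<close> of square integrable elements.\<close>

definition sq_int :: "'h::complex_hilbert oper set \<Rightarrow> ('h oper \<Rightarrow> ennreal) \<Rightarrow> 'h oper set" where
  "sq_int A \<phi> = {a \<in> A. \<phi> (adj a o\<^sub>L a) < \<infinity>}"

definition one_param_group :: "'h::complex_hilbert oper set \<Rightarrow> (real \<Rightarrow> 'h oper \<Rightarrow> 'h oper) \<Rightarrow> bool" where
  "one_param_group A \<sigma> \<longleftrightarrow> (\<forall>t. star_hom A A (\<sigma> t) \<and> bij_betw (\<sigma> t) A A) \<and>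
     (\<forall>s t. \<forall>a\<in>A. \<sigma> (s + t) a = \<sigma> s (\<sigma> t a)) \<and> (\<forall>a\<in>A. continuous_on UNIV (\<lambda>t. \<sigma> t a))"

definition strip :: "complex \<Rightarrow> complex set" where
  "strip z = {w. min 0 (Im z) \<le> Im w \<and> Im w \<le> max 0 (Im z)}"

text \<open>\<open>an_ext A \<sigma> z a b\<close>: \<open>a\<close> is in the domain of \<open>\<sigma>\<^sub>z\<close> and \<open>\<sigma>\<^sub>z(a) = b\<close>.\<close>

definition an_ext ::
    "'h::complex_hilbert oper set \<Rightarrow> (real \<Rightarrow> 'h oper \<Rightarrow> 'h oper) \<Rightarrow> complex \<Rightarrow> 'h oper \<Rightarrow> 'h oper \<Rightarrow> bool" where
  "an_ext A \<sigma> z a b \<longleftrightarrow> a \<in> A \<and> (\<exists>f. f \<in> strip z \<rightarrow> A \<and> continuous_on (strip z) f \<and>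
     (\<forall>w\<in>interior (strip z). \<exists>d\<in>A. (f has_derivative (\<lambda>h. scl h d)) (at w)) \<and>
     (\<forall>t. f (complex_of_real t) = \<sigma> t a) \<and> f z = b)"

definition kms_weight :: "'h::complex_hilbert oper set \<Rightarrow> ('h oper \<Rightarrow> ennreal) \<Rightarrow> bool" where
  "kms_weight A \<phi> \<longleftrightarrow> (\<exists>\<sigma>. one_param_group A \<sigma> \<and> (\<forall>t. \<forall>a\<in>pos_part A. \<phi> (\<sigma> t a) = \<phi> a) \<and>
     (\<forall>a b. an_ext A \<sigma> (\<i> / 2) a b \<longrightarrow> \<phi> (adj a o\<^sub>L a) = \<phi> (b o\<^sub>L adj b)))"

definition haar_type_weight :: "'h::complex_hilbert oper set \<Rightarrow> ('h oper \<Rightarrow> ennreal) \<Rightarrow> bool" where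
  "haar_type_weight A \<phi> \<longleftrightarrow> is_weight A \<phi> \<and> faithful_weight A \<phi> \<and> lsc_weight A \<phi> \<and>
     densely_defined_weight A \<phi> \<and> kms_weight A \<phi>"

definition positive_functional :: "'h::complex_hilbert oper set \<Rightarrow> ('h oper \<Rightarrow> complex) \<Rightarrow> bool" where
  "positive_functional A \<omega> \<longleftrightarrow> (\<forall>a\<in>A. \<forall>b\<in>A. \<omega> (a + b) = \<omega> a + \<omega> b) \<and> (\<forall>c. \<forall>a\<in>A. \<omega> (scl c a) = c * \<omega> a) \<and>
     (\<forall>a\<in>pos_part A. \<omega> a \<in> \<real> \<and> 0 \<le> Re (\<omega> a))"

text \<open>For a positive functional this norm is the value \<open>\<omega>(1)\<close> of the extension of \<open>\<omega>\<close> to the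
  multiplier algebra.\<close>

definition functional_norm :: "'h::complex_hilbert oper set \<Rightarrow> ('h oper \<Rightarrow> complex) \<Rightarrow> real" where
  "functional_norm A \<omega> = Sup {cmod (\<omega> a) |a. a \<in> A \<and> norm a \<le> 1}"


section \<open>Locally compact quantum groups\<close>

text \<open>
  The \<open>C\<^sup>*\<close>-algebra \<open>qalg\<close> is identified with its image in the (faithful) GNS representation of the
  left Haar weight \<open>haarl\<close> on \<open>K = hsp qK\<close>; \<open>gns\<close> is the canonical map from \<open>N\<^sub>\<phi>\<close> to \<open>K = L\<^sup>2(A,\<phi>)\<close>.
  \<open>qR\<close>, \<open>qtau\<close> and \<open>qV\<close> are the unitary coinverse (extended to the von Neumann algebra), the
  scaling group and the multiplicative unitary.
\<close>

record (overloaded) ('o, 'h::complex_hilbert) qgroup = "('o, 'h) hilb_cat" +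
  qK :: 'o
  qalg :: "'h oper set"
  qdelta :: "'h oper \<Rightarrow> 'h oper"
  haarl :: "'h oper \<Rightarrow> ennreal"
  haarr :: "'h oper \<Rightarrow> ennreal"
  gns :: "'h oper \<Rightarrow> 'h"
  qR :: "'h oper \<Rightarrow> 'h oper"
  qtau :: "real \<Rightarrow> 'h oper \<Rightarrow> 'h oper"
  qV :: "'h oper"

abbreviation qKsp where "qKsp D \<equiv> hsp D (qK D)"

abbreviation qKK where "qKK D \<equiv> htens D (qK D) (qK D)"

abbreviation qid where "qid D \<equiv> hid D (qK D)"

abbreviation qtens where "qtens D S T \<equiv> optens D (qK D) (qK D) (qK D) (qK D) S T"

definition qalg2 where
  "qalg2 D = alg_tens D (qK D) (qK D) (qalg D) (qalg D)"

definition qmult2 where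
  "qmult2 D = mult_alg (hsp D (qKK D)) (qalg2 D)"

definition qmult3 where
  "qmult3 D = mult_alg (hsp D (htens D (qKK D) (qK D))) (alg_tens D (qKK D) (qK D) (qalg2 D) (qalg D))"

text \<open>\<open>\<delta> \<otimes> i\<close> and \<open>i \<otimes> \<delta>\<close> are the unique \<open>\<^sup>*\<close>-homomorphisms on \<open>M(A \<otimes> A)\<close> with the stated values on
  elementary tensors, since \<open>\<delta>\<close> is nondegenerate; likewise for \<open>R \<otimes> R\<close>.\<close>

definition coassociative where
  "coassociative D \<longleftrightarrow> (\<exists>\<Delta>1 \<Delta>2. star_hom (qmult2 D) (qmult3 D) \<Delta>1 \<and> star_hom (qmult2 D) (qmult3 D) \<Delta>2 \<and>
     (\<forall>a\<in>qalg D. \<forall>b\<in>qalg D.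
        \<Delta>1 (qtens D a b) = optens D (qKK D) (qK D) (qKK D) (qK D) (qdelta D a) b \<and>
        \<Delta>2 (qtens D a b) = optens D (qK D) (qKK D) (qK D) (qKK D) a (qdelta D b)) \<and>
     (\<forall>a\<in>qalg D. \<Delta>1 (qdelta D a) = \<Delta>2 (qdelta D a)))"

definition R_anticomultiplicative where
  "R_anticomultiplicative D \<longleftrightarrow> (\<exists>RR. star_antihom (qmult2 D) (qmult2 D) RR \<and>
     (\<forall>a\<in>qalg D. \<forall>b\<in>qalg D. RR (qtens D a b) = qtens D (qR D a) (qR D b)) \<and>
     (\<forall>a\<in>qalg D. qdelta D (qR D a) =
        hflip D (qK D) (qK D) o\<^sub>L RR (qdelta D a) o\<^sub>L hflip D (qK D) (qK D)))"

text \<open>Slices of elements of \<open>A \<otimes> A\<close> by an arbitrary bounded functional \<open>\<omega>\<close> on \<open>A\<close>, and then, via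
  \<open>((\<omega> \<otimes> i)(X)) d = (\<omega> \<otimes> i)(X (1 \<otimes> d))\<close>, of those multipliers \<open>X\<close> for which \<open>X (1 \<otimes> d) \<in> A \<otimes> A\<close>; the
  density conditions ensure this for \<open>X = \<delta>(a)\<close>.\<close>

definition aslice1 where
  "aslice1 D \<omega> = (SOME S. op_linear_on (qalg2 D) S \<and> (\<exists>C. \<forall>X\<in>qalg2 D. norm (S X) \<le> C * norm X) \<and>
     (\<forall>a\<in>qalg D. \<forall>b\<in>qalg D. S (qtens D a b) = scl (\<omega> a) b))"

definition aslice2 where
  "aslice2 D \<omega> = (SOME S. op_linear_on (qalg2 D) S \<and> (\<exists>C. \<forall>X\<in>qalg2 D. norm (S X) \<le> C * norm X) \<and>
     (\<forall>a\<in>qalg D. \<forall>b\<in>qalg D. S (qtens D a b) = scl (\<omega> b) a))"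

definition mslice1 where
  "mslice1 D \<omega> X = (THE Y. Y \<in> mult_alg (qKsp D) (qalg D) \<and>
     (\<forall>d\<in>qalg D. Y o\<^sub>L d = aslice1 D \<omega> (X o\<^sub>L qtens D (qid D) d)))"

definition mslice2 where
  "mslice2 D \<omega> X = (THE Y. Y \<in> mult_alg (qKsp D) (qalg D) \<and>
     (\<forall>d\<in>qalg D. Y o\<^sub>L d = aslice2 D \<omega> (X o\<^sub>L qtens D d (qid D))))"

definition left_invariant where
  "left_invariant D \<phi> \<longleftrightarrow> (\<forall>\<omega>. positive_functional (qalg D) \<omega> \<longrightarrow> (\<forall>a\<in>pos_part (qalg D). \<phi> a < \<infinity> \<longrightarrow>
     \<phi> (mslice1 D \<omega> (qdelta D a)) = ennreal (functional_norm (qalg D) \<omega>) * \<phi> a))"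

definition right_invariant where
  "right_invariant D \<psi> \<longleftrightarrow> (\<forall>\<omega>. positive_functional (qalg D) \<omega> \<longrightarrow> (\<forall>a\<in>pos_part (qalg D). \<psi> a < \<infinity> \<longrightarrow>
     \<psi> (mslice2 D \<omega> (qdelta D a)) = ennreal (functional_norm (qalg D) \<omega>) * \<psi> a))"

text \<open>\<open>gns2 D X \<zeta>\<close>: the element \<open>X\<close> of \<open>A \<otimes> A\<close>, square integrable for \<open>\<phi> \<otimes> \<phi>\<close>, is the vector \<open>\<zeta>\<close> of
  \<open>K \<otimes> K = L\<^sup>2(A \<otimes> A, \<phi> \<otimes> \<phi>)\<close>.  The GNS map of \<open>\<phi> \<otimes> \<phi>\<close> is the closure of the algebraic tensor square
  of that of \<open>\<phi>\<close>.\<close>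

definition gns2 where
  "gns2 D X \<zeta> \<longleftrightarrow> (X, \<zeta>) \<in> closure {(\<Sum>i<n. qtens D (a i) (b i),
        \<Sum>i<n. hvec D (qK D) (qK D) (gns D (a i)) (gns D (b i))) |(n::nat) a b.
      \<forall>i<n. a i \<in> sq_int (qalg D) (haarl D) \<and> b i \<in> sq_int (qalg D) (haarl D)}"

text \<open>The von Neumann algebra generated by the right slices of \<open>V\<close>.\<close>

definition Mhat where
  "Mhat D = vn_gen (qKsp D)
     {slice2 D (qK D) (qK D) \<omega> (qV D) |\<omega>. normal_fun (qKsp D) (blin (qKsp D) (qKsp D)) \<omega>}"

text \<open>\<open>coinverse_rel D a b\<close>: \<open>a\<close> is in the domain of \<open>\<kappa> = R \<tau>\<^bsub>-i/2\<^esub>\<close> and \<open>\<kappa>(a) = b\<close>.\<close>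

definition coinverse_rel where
  "coinverse_rel D a b \<longleftrightarrow> (\<exists>d. an_ext (qalg D) (qtau D) (- \<i> / 2) a d \<and> b = qR D d)"

text \<open>
  The last assumption identifies \<open>R\<close> and \<open>\<tau>\<close> as the constituents of the coinverse, through
  \<open>\<kappa>((i \<otimes> \<omega>)(V)) = (i \<otimes> \<omega>)(V\<^sup>*)\<close>.  That \<open>V\<close> is unitary and multiplicative, that its right slices and
  \<open>A\<close> generate the same von Neumann algebra, and that \<open>R\<close> extends normally to the latter are standard
  properties of locally compact quantum groups; they are recorded here as part of the structure.
\<close>

locale lc_quantum_group = strict_hilb_cat D
  for D :: "('o, 'h::complex_hilbert, 'm) qgroup_scheme" +
  assumes qK: "qK D \<in> hobj D"
    and qalg: "cstar_alg (qKsp D) (qalg D)"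
    and delta: "star_hom (qalg D) (qmult2 D) (qdelta D)"
    and coassoc: "coassociative D"
    and density:
      "closure (span {qdelta D a o\<^sub>L qtens D b (qid D) |a b. a \<in> qalg D \<and> b \<in> qalg D}) = qalg2 D"
      "closure (span {qdelta D a o\<^sub>L qtens D (qid D) b |a b. a \<in> qalg D \<and> b \<in> qalg D}) = qalg2 D"
    and haarl: "haar_type_weight (qalg D) (haarl D)" "left_invariant D (haarl D)"
    and haarr: "haar_type_weight (qalg D) (haarr D)" "right_invariant D (haarr D)"
    and gns_add: "\<lbrakk>a \<in> sq_int (qalg D) (haarl D); b \<in> sq_int (qalg D) (haarl D)\<rbrakk>
        \<Longrightarrow> gns D (a + b) = gns D a + gns D b"
    and gns_scl: "a \<in> sq_int (qalg D) (haarl D) \<Longrightarrow> gns D (scl c a) = c *\<^sub>C gns D a"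
    and gns_norm: "a \<in> sq_int (qalg D) (haarl D) \<Longrightarrow> ennreal ((norm (gns D a))\<^sup>2) = haarl D (adj a o\<^sub>L a)"
    and gns_mult: "\<lbrakk>a \<in> qalg D; b \<in> sq_int (qalg D) (haarl D)\<rbrakk> \<Longrightarrow> gns D (a o\<^sub>L b) = blinfun_apply a (gns D b)"
    and gns_dense: "closure (gns D ` sq_int (qalg D) (haarl D)) = qKsp D"
    and V_unitary: "unitary_op False (hsp D (qKK D)) (hsp D (qKK D)) (qV D)"
    and V_gns: "\<lbrakk>a \<in> sq_int (qalg D) (haarl D); b \<in> sq_int (qalg D) (haarl D)\<rbrakk>
        \<Longrightarrow> gns2 D (qdelta D b o\<^sub>L qtens D a (qid D))
              (blinfun_apply (adj (qV D)) (hvec D (qK D) (qK D) (gns D a) (gns D b)))"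
    and V_multiplicative:
      "leg12 D (qK D) (qK D) (qK D) (qV D) o\<^sub>L leg13 D (qK D) (qK D) (qK D) (qV D)
          o\<^sub>L leg23 D (qK D) (qK D) (qK D) (qV D)
        = leg23 D (qK D) (qK D) (qK D) (qV D) o\<^sub>L leg12 D (qK D) (qK D) (qK D) (qV D)"
    and Mhat_eq: "Mhat D = vn_gen (qKsp D) (qalg D)"
    and R_antiaut: "star_antihom (Mhat D) (Mhat D) (qR D)" "x \<in> Mhat D \<Longrightarrow> qR D (qR D x) = x"
      "qR D ` qalg D \<subseteq> qalg D"
    and R_normal: "normal_fun (qKsp D) (Mhat D) \<omega> \<Longrightarrow> normal_fun (qKsp D) (Mhat D) (\<omega> \<circ> qR D)"
    and R_delta: "R_anticomultiplicative D"
    and tau: "one_param_group (qalg D) (qtau D)" "a \<in> qalg D \<Longrightarrow> qR D (qtau D t a) = qtau D t (qR D a)"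
    and coinverse: "normal_fun (qKsp D) (blin (qKsp D) (qKsp D)) \<omega>
        \<Longrightarrow> coinverse_rel D (slice2 D (qK D) (qK D) \<omega> (qV D)) (slice2 D (qK D) (qK D) \<omega> (adj (qV D)))"


section \<open>Semilinear tensor categories\<close>

text \<open>
  The arrows of all hom spaces are taken from one real normed space \<open>'a\<close>, on which the complex scalars
  act by \<open>tscl\<close>.  \<open>ttar C \<rho> \<sigma> \<rho>' \<sigma>' S T\<close> is the tensor product of \<open>S : \<rho> \<rightarrow> \<sigma>\<close> and \<open>T : \<rho>' \<rightarrow> \<sigma>'\<close>.  The
  extension adds the antilinear arrows and their tensor product, for which
  \<open>S \<times> T : \<rho> \<rho>' \<rightarrow> \<sigma>' \<sigma>\<close>.
\<close>

record ('o, 'a) tensor_cat =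
  tobj :: "'o set"
  thom :: "'o \<Rightarrow> 'o \<Rightarrow> 'a set"
  tid :: "'o \<Rightarrow> 'a"
  tcomp :: "'a \<Rightarrow> 'a \<Rightarrow> 'a"
  tstar :: "'a \<Rightarrow> 'a"
  tscl :: "complex \<Rightarrow> 'a \<Rightarrow> 'a"
  tunit :: 'o
  ttob :: "'o \<Rightarrow> 'o \<Rightarrow> 'o"
  ttar :: "'o \<Rightarrow> 'o \<Rightarrow> 'o \<Rightarrow> 'o \<Rightarrow> 'a \<Rightarrow> 'a \<Rightarrow> 'a"

record ('o, 'a) semilinear_cat = "('o, 'a) tensor_cat" +
  tahom :: "'o \<Rightarrow> 'o \<Rightarrow> 'a set"
  ttara :: "'o \<Rightarrow> 'o \<Rightarrow> 'o \<Rightarrow> 'o \<Rightarrow> 'a \<Rightarrow> 'a \<Rightarrow> 'a"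

text \<open>The flag distinguishes linear (\<open>False\<close>) from antilinear (\<open>True\<close>) arrows.\<close>

definition arr :: "('o, 'a, 'm) semilinear_cat_scheme \<Rightarrow> bool \<Rightarrow> 'o \<Rightarrow> 'o \<Rightarrow> 'a set" where
  "arr C b = (if b then tahom C else thom C)"

definition arr_tens ::
    "('o, 'a, 'm) semilinear_cat_scheme \<Rightarrow> bool \<Rightarrow> 'o \<Rightarrow> 'o \<Rightarrow> 'o \<Rightarrow> 'o \<Rightarrow> 'a \<Rightarrow> 'a \<Rightarrow> 'a" where
  "arr_tens C b = (if b then ttara C else ttar C)"

definition tunitary :: "('o, 'a, 'm) tensor_cat_scheme \<Rightarrow> 'o \<Rightarrow> 'o \<Rightarrow> 'a \<Rightarrow> bool" where
  "tunitary C \<rho> \<sigma> u \<longleftrightarrow> u \<in> thom C \<rho> \<sigma> \<and> tcomp C (tstar C u) u = tid C \<rho> \<and> tcomp C u (tstar C u) = tid C \<sigma>"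

definition tantiunitary :: "('o, 'a, 'm) semilinear_cat_scheme \<Rightarrow> 'o \<Rightarrow> 'o \<Rightarrow> 'a \<Rightarrow> bool" where
  "tantiunitary C \<rho> \<sigma> u \<longleftrightarrow> u \<in> tahom C \<rho> \<sigma> \<and> tcomp C (tstar C u) u = tid C \<rho> \<and> tcomp C u (tstar C u) = tid C \<sigma>"

text \<open>Positivity in the \<open>C\<^sup>*\<close>-algebra \<open>(\<rho>,\<rho>)\<close>: selfadjoint with spectrum in \<open>[0,\<infinity>)\<close>.\<close>

definition tpositive :: "('o, 'a::real_normed_vector, 'm) tensor_cat_scheme \<Rightarrow> 'o \<Rightarrow> 'a \<Rightarrow> bool" where
  "tpositive C \<rho> p \<longleftrightarrow> p \<in> thom C \<rho> \<rho> \<and> tstar C p = p \<and>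
     (\<forall>z. \<not> (z \<in> \<real> \<and> 0 \<le> Re z) \<longrightarrow> (\<exists>q\<in>thom C \<rho> \<rho>.
        tcomp C q (p - tscl C z (tid C \<rho>)) = tid C \<rho> \<and> tcomp C (p - tscl C z (tid C \<rho>)) q = tid C \<rho>))"

text \<open>Dual Banach spaces: \<open>F\<close> is a predual of the complex normed space \<open>X\<close> (with scalar action \<open>s\<close>) if it
  is a closed subspace of the dual of \<open>X\<close> such that the canonical map from \<open>X\<close> to the dual of \<open>F\<close> is an
  isometry onto.  Functionals on \<open>X\<close> are extended by \<open>0\<close>.\<close>

definition clinear_on :: "'a::real_normed_vector set \<Rightarrow> (complex \<Rightarrow> 'a \<Rightarrow> 'a) \<Rightarrow> ('a \<Rightarrow> complex) \<Rightarrow> bool" where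
  "clinear_on X s f \<longleftrightarrow> (\<forall>x\<in>X. \<forall>y\<in>X. f (x + y) = f x + f y) \<and> (\<forall>c. \<forall>x\<in>X. f (s c x) = c * f x)"

definition dual_of :: "'a::real_normed_vector set \<Rightarrow> (complex \<Rightarrow> 'a \<Rightarrow> 'a) \<Rightarrow> ('a \<Rightarrow> complex) set" where
  "dual_of X s = {f. clinear_on X s f \<and> (\<exists>K. \<forall>x\<in>X. cmod (f x) \<le> K * norm x) \<and> (\<forall>x. x \<notin> X \<longrightarrow> f x = 0)}"

definition dual_norm :: "'a::real_normed_vector set \<Rightarrow> ('a \<Rightarrow> complex) \<Rightarrow> real" where
  "dual_norm X f = Sup {cmod (f x) |x. x \<in> X \<and> norm x \<le> 1}"

definition is_predual ::
    "'a::real_normed_vector set \<Rightarrow> (complex \<Rightarrow> 'a \<Rightarrow> 'a) \<Rightarrow> ('a \<Rightarrow> complex) set \<Rightarrow> bool" where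
  "is_predual X s F \<longleftrightarrow> F \<subseteq> dual_of X s \<and> (\<lambda>x. 0) \<in> F \<and>
     (\<forall>f\<in>F. \<forall>g\<in>F. (\<lambda>x. f x + g x) \<in> F) \<and> (\<forall>c. \<forall>f\<in>F. (\<lambda>x. c * f x) \<in> F) \<and>
     (\<forall>f\<in>dual_of X s. (\<forall>e>0. \<exists>g\<in>F. dual_norm X (\<lambda>x. f x - g x) < e) \<longrightarrow> f \<in> F) \<and>
     (\<forall>x\<in>X. norm x = Sup {cmod (f x) |f. f \<in> F \<and> dual_norm X f \<le> 1}) \<and>
     (\<forall>\<Phi>. (\<forall>f\<in>F. \<forall>g\<in>F. \<Phi> (\<lambda>x. f x + g x) = \<Phi> f + \<Phi> g) \<and> (\<forall>c. \<forall>f\<in>F. \<Phi> (\<lambda>x. c * f x) = c * \<Phi> f) \<and>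
          (\<exists>K. \<forall>f\<in>F. cmod (\<Phi> f) \<le> K * dual_norm X f)
        \<longrightarrow> (\<exists>x\<in>X. \<forall>f\<in>F. \<Phi> f = f x))"

text \<open>A map \<open>m : X \<rightarrow> Y\<close> is normal for the preduals \<open>F\<close> of \<open>X\<close> and \<open>G\<close> of \<open>Y\<close>.\<close>

definition normal_map :: "'a set \<Rightarrow> ('a \<Rightarrow> complex) set \<Rightarrow> ('a \<Rightarrow> complex) set \<Rightarrow> ('a \<Rightarrow> 'a) \<Rightarrow> bool" where
  "normal_map X F G m \<longleftrightarrow> (\<forall>g\<in>G. (\<lambda>x. if x \<in> X then g (m x) else 0) \<in> F)"

text \<open>In the laws below \<open>b\<close>, \<open>b'\<close> range over both kinds of arrows; a composite of arrows of kinds \<open>b\<close> and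
  \<open>b'\<close> has kind \<open>b \<noteq> b'\<close>, that is, it is antilinear iff exactly one factor is.\<close>

locale semilinear_tensor_Cstar_category =
  fixes C :: "('o, 'a::real_normed_vector, 'm) semilinear_cat_scheme"
  assumes arr_subspace: "\<lbrakk>\<rho> \<in> tobj C; \<sigma> \<in> tobj C\<rbrakk> \<Longrightarrow> subspace (arr C b \<rho> \<sigma>)"
    and arr_complete: "\<lbrakk>\<rho> \<in> tobj C; \<sigma> \<in> tobj C\<rbrakk> \<Longrightarrow> complete (arr C b \<rho> \<sigma>)"
    and scl_arr: "\<lbrakk>\<rho> \<in> tobj C; \<sigma> \<in> tobj C; T \<in> arr C b \<rho> \<sigma>\<rbrakk> \<Longrightarrow> tscl C z T \<in> arr C b \<rho> \<sigma>"
    and scl_add_right: "\<lbrakk>\<rho> \<in> tobj C; \<sigma> \<in> tobj C; S \<in> arr C b \<rho> \<sigma>; T \<in> arr C b \<rho> \<sigma>\<rbrakk>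
        \<Longrightarrow> tscl C z (S + T) = tscl C z S + tscl C z T"
    and scl_add_left: "\<lbrakk>\<rho> \<in> tobj C; \<sigma> \<in> tobj C; T \<in> arr C b \<rho> \<sigma>\<rbrakk>
        \<Longrightarrow> tscl C (z + w) T = tscl C z T + tscl C w T"
    and scl_scl: "\<lbrakk>\<rho> \<in> tobj C; \<sigma> \<in> tobj C; T \<in> arr C b \<rho> \<sigma>\<rbrakk>
        \<Longrightarrow> tscl C z (tscl C w T) = tscl C (z * w) T"
    and scl_of_real: "\<lbrakk>\<rho> \<in> tobj C; \<sigma> \<in> tobj C; T \<in> arr C b \<rho> \<sigma>\<rbrakk>
        \<Longrightarrow> tscl C (complex_of_real r) T = scaleR r T"
    and norm_scl: "\<lbrakk>\<rho> \<in> tobj C; \<sigma> \<in> tobj C; T \<in> arr C b \<rho> \<sigma>\<rbrakk> \<Longrightarrow> norm (tscl C z T) = cmod z * norm T"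
    and id_arr: "\<rho> \<in> tobj C \<Longrightarrow> tid C \<rho> \<in> thom C \<rho> \<rho>"
    and comp_arr: "\<lbrakk>\<rho> \<in> tobj C; \<sigma> \<in> tobj C; \<tau> \<in> tobj C; T \<in> arr C b \<rho> \<sigma>; S \<in> arr C b' \<sigma> \<tau>\<rbrakk>
        \<Longrightarrow> tcomp C S T \<in> arr C (b \<noteq> b') \<rho> \<tau>"
    and comp_assoc: "\<lbrakk>\<rho> \<in> tobj C; \<sigma> \<in> tobj C; \<tau> \<in> tobj C; \<upsilon> \<in> tobj C;
          T \<in> arr C b \<rho> \<sigma>; S \<in> arr C b' \<sigma> \<tau>; Q \<in> arr C b'' \<tau> \<upsilon>\<rbrakk>
        \<Longrightarrow> tcomp C (tcomp C Q S) T = tcomp C Q (tcomp C S T)"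
    and comp_id: "\<lbrakk>\<rho> \<in> tobj C; \<sigma> \<in> tobj C; T \<in> arr C b \<rho> \<sigma>\<rbrakk> \<Longrightarrow> tcomp C T (tid C \<rho>) = T"
      "\<lbrakk>\<rho> \<in> tobj C; \<sigma> \<in> tobj C; T \<in> arr C b \<rho> \<sigma>\<rbrakk> \<Longrightarrow> tcomp C (tid C \<sigma>) T = T"
    and comp_add_left: "\<lbrakk>\<rho> \<in> tobj C; \<sigma> \<in> tobj C; \<tau> \<in> tobj C; T \<in> arr C b \<rho> \<sigma>;
          S \<in> arr C b' \<sigma> \<tau>; S' \<in> arr C b' \<sigma> \<tau>\<rbrakk>
        \<Longrightarrow> tcomp C (S + S') T = tcomp C S T + tcomp C S' T"
    and comp_add_right: "\<lbrakk>\<rho> \<in> tobj C; \<sigma> \<in> tobj C; \<tau> \<in> tobj C; T \<in> arr C b \<rho> \<sigma>; T' \<in> arr C b \<rho> \<sigma>;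
          S \<in> arr C b' \<sigma> \<tau>\<rbrakk>
        \<Longrightarrow> tcomp C S (T + T') = tcomp C S T + tcomp C S T'"
    and comp_scl_left: "\<lbrakk>\<rho> \<in> tobj C; \<sigma> \<in> tobj C; \<tau> \<in> tobj C; T \<in> arr C b \<rho> \<sigma>; S \<in> arr C b' \<sigma> \<tau>\<rbrakk>
        \<Longrightarrow> tcomp C (tscl C z S) T = tscl C z (tcomp C S T)"
    and comp_scl_right: "\<lbrakk>\<rho> \<in> tobj C; \<sigma> \<in> tobj C; \<tau> \<in> tobj C; T \<in> arr C b \<rho> \<sigma>; S \<in> arr C b' \<sigma> \<tau>\<rbrakk>
        \<Longrightarrow> tcomp C S (tscl C z T) = tscl C (cj b' z) (tcomp C S T)"
    and norm_comp: "\<lbrakk>\<rho> \<in> tobj C; \<sigma> \<in> tobj C; \<tau> \<in> tobj C; T \<in> arr C b \<rho> \<sigma>; S \<in> arr C b' \<sigma> \<tau>\<rbrakk>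
        \<Longrightarrow> norm (tcomp C S T) \<le> norm S * norm T"
    and star_arr: "\<lbrakk>\<rho> \<in> tobj C; \<sigma> \<in> tobj C; T \<in> arr C b \<rho> \<sigma>\<rbrakk> \<Longrightarrow> tstar C T \<in> arr C b \<sigma> \<rho>"
    and star_add: "\<lbrakk>\<rho> \<in> tobj C; \<sigma> \<in> tobj C; S \<in> arr C b \<rho> \<sigma>; T \<in> arr C b \<rho> \<sigma>\<rbrakk>
        \<Longrightarrow> tstar C (S + T) = tstar C S + tstar C T"
    and star_scl: "\<lbrakk>\<rho> \<in> tobj C; \<sigma> \<in> tobj C; T \<in> arr C b \<rho> \<sigma>\<rbrakk>
        \<Longrightarrow> tstar C (tscl C z T) = tscl C (cj (\<not> b) z) (tstar C T)"
    and star_star: "\<lbrakk>\<rho> \<in> tobj C; \<sigma> \<in> tobj C; T \<in> arr C b \<rho> \<sigma>\<rbrakk> \<Longrightarrow> tstar C (tstar C T) = T"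
    and star_comp: "\<lbrakk>\<rho> \<in> tobj C; \<sigma> \<in> tobj C; \<tau> \<in> tobj C; T \<in> arr C b \<rho> \<sigma>; S \<in> arr C b' \<sigma> \<tau>\<rbrakk>
        \<Longrightarrow> tstar C (tcomp C S T) = tcomp C (tstar C T) (tstar C S)"
    and Cstar_norm: "\<lbrakk>\<rho> \<in> tobj C; \<sigma> \<in> tobj C; T \<in> arr C b \<rho> \<sigma>\<rbrakk>
        \<Longrightarrow> norm (tcomp C (tstar C T) T) = (norm T)\<^sup>2"
    and Cstar_positive: "\<lbrakk>\<rho> \<in> tobj C; \<sigma> \<in> tobj C; T \<in> arr C b \<rho> \<sigma>\<rbrakk>
        \<Longrightarrow> tpositive C \<rho> (tcomp C (tstar C T) T)"
    and unit_obj: "tunit C \<in> tobj C"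
    and tens_obj: "\<lbrakk>\<rho> \<in> tobj C; \<sigma> \<in> tobj C\<rbrakk> \<Longrightarrow> ttob C \<rho> \<sigma> \<in> tobj C"
    and tens_obj_assoc: "\<lbrakk>\<rho> \<in> tobj C; \<sigma> \<in> tobj C; \<tau> \<in> tobj C\<rbrakk>
        \<Longrightarrow> ttob C (ttob C \<rho> \<sigma>) \<tau> = ttob C \<rho> (ttob C \<sigma> \<tau>)"
    and tens_obj_unit: "\<rho> \<in> tobj C \<Longrightarrow> ttob C (tunit C) \<rho> = \<rho>" "\<rho> \<in> tobj C \<Longrightarrow> ttob C \<rho> (tunit C) = \<rho>"
    and tens_lin: "\<lbrakk>\<rho> \<in> tobj C; \<sigma> \<in> tobj C; \<rho>' \<in> tobj C; \<sigma>' \<in> tobj C; R \<in> thom C \<rho> \<sigma>; R' \<in> thom C \<rho>' \<sigma>'\<rbrakk>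
        \<Longrightarrow> ttar C \<rho> \<sigma> \<rho>' \<sigma>' R R' \<in> thom C (ttob C \<rho> \<rho>') (ttob C \<sigma> \<sigma>')"
    and tens_anti: "\<lbrakk>\<rho> \<in> tobj C; \<sigma> \<in> tobj C; \<rho>' \<in> tobj C; \<sigma>' \<in> tobj C; R \<in> tahom C \<rho> \<sigma>; R' \<in> tahom C \<rho>' \<sigma>'\<rbrakk>
        \<Longrightarrow> ttara C \<rho> \<sigma> \<rho>' \<sigma>' R R' \<in> tahom C (ttob C \<rho> \<rho>') (ttob C \<sigma>' \<sigma>)"
    and tens_add_left: "\<lbrakk>\<rho> \<in> tobj C; \<sigma> \<in> tobj C; \<rho>' \<in> tobj C; \<sigma>' \<in> tobj C;
          R \<in> arr C b \<rho> \<sigma>; S \<in> arr C b \<rho> \<sigma>; R' \<in> arr C b \<rho>' \<sigma>'\<rbrakk>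
        \<Longrightarrow> arr_tens C b \<rho> \<sigma> \<rho>' \<sigma>' (R + S) R' = arr_tens C b \<rho> \<sigma> \<rho>' \<sigma>' R R' + arr_tens C b \<rho> \<sigma> \<rho>' \<sigma>' S R'"
    and tens_add_right: "\<lbrakk>\<rho> \<in> tobj C; \<sigma> \<in> tobj C; \<rho>' \<in> tobj C; \<sigma>' \<in> tobj C;
          R \<in> arr C b \<rho> \<sigma>; R' \<in> arr C b \<rho>' \<sigma>'; S' \<in> arr C b \<rho>' \<sigma>'\<rbrakk>
        \<Longrightarrow> arr_tens C b \<rho> \<sigma> \<rho>' \<sigma>' R (R' + S') = arr_tens C b \<rho> \<sigma> \<rho>' \<sigma>' R R' + arr_tens C b \<rho> \<sigma> \<rho>' \<sigma>' R S'"
    and tens_scl_left: "\<lbrakk>\<rho> \<in> tobj C; \<sigma> \<in> tobj C; \<rho>' \<in> tobj C; \<sigma>' \<in> tobj C; R \<in> arr C b \<rho> \<sigma>; R' \<in> arr C b \<rho>' \<sigma>'\<rbrakk>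
        \<Longrightarrow> arr_tens C b \<rho> \<sigma> \<rho>' \<sigma>' (tscl C z R) R' = tscl C z (arr_tens C b \<rho> \<sigma> \<rho>' \<sigma>' R R')"
    and tens_scl_right: "\<lbrakk>\<rho> \<in> tobj C; \<sigma> \<in> tobj C; \<rho>' \<in> tobj C; \<sigma>' \<in> tobj C; R \<in> arr C b \<rho> \<sigma>; R' \<in> arr C b \<rho>' \<sigma>'\<rbrakk>
        \<Longrightarrow> arr_tens C b \<rho> \<sigma> \<rho>' \<sigma>' R (tscl C z R') = tscl C z (arr_tens C b \<rho> \<sigma> \<rho>' \<sigma>' R R')"
    and tens_id: "\<lbrakk>\<rho> \<in> tobj C; \<sigma> \<in> tobj C\<rbrakk> \<Longrightarrow> ttar C \<rho> \<rho> \<sigma> \<sigma> (tid C \<rho>) (tid C \<sigma>) = tid C (ttob C \<rho> \<sigma>)"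
    and tens_unit: "\<lbrakk>\<rho> \<in> tobj C; \<sigma> \<in> tobj C; R \<in> thom C \<rho> \<sigma>\<rbrakk>
        \<Longrightarrow> ttar C (tunit C) (tunit C) \<rho> \<sigma> (tid C (tunit C)) R = R"
      "\<lbrakk>\<rho> \<in> tobj C; \<sigma> \<in> tobj C; R \<in> thom C \<rho> \<sigma>\<rbrakk>
        \<Longrightarrow> ttar C \<rho> \<sigma> (tunit C) (tunit C) R (tid C (tunit C)) = R"
    and tens_assoc_lin: "\<lbrakk>\<rho> \<in> tobj C; \<sigma> \<in> tobj C; \<rho>' \<in> tobj C; \<sigma>' \<in> tobj C; \<rho>'' \<in> tobj C; \<sigma>'' \<in> tobj C;
          R \<in> thom C \<rho> \<sigma>; R' \<in> thom C \<rho>' \<sigma>'; R'' \<in> thom C \<rho>'' \<sigma>''\<rbrakk>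
        \<Longrightarrow> ttar C (ttob C \<rho> \<rho>') (ttob C \<sigma> \<sigma>') \<rho>'' \<sigma>'' (ttar C \<rho> \<sigma> \<rho>' \<sigma>' R R') R''
          = ttar C \<rho> \<sigma> (ttob C \<rho>' \<rho>'') (ttob C \<sigma>' \<sigma>'') R (ttar C \<rho>' \<sigma>' \<rho>'' \<sigma>'' R' R'')"
    and tens_assoc_anti: "\<lbrakk>\<rho> \<in> tobj C; \<sigma> \<in> tobj C; \<rho>' \<in> tobj C; \<sigma>' \<in> tobj C; \<rho>'' \<in> tobj C; \<sigma>'' \<in> tobj C;
          R \<in> tahom C \<rho> \<sigma>; R' \<in> tahom C \<rho>' \<sigma>'; R'' \<in> tahom C \<rho>'' \<sigma>''\<rbrakk>
        \<Longrightarrow> ttara C (ttob C \<rho> \<rho>') (ttob C \<sigma>' \<sigma>) \<rho>'' \<sigma>'' (ttara C \<rho> \<sigma> \<rho>' \<sigma>' R R') R''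
          = ttara C \<rho> \<sigma> (ttob C \<rho>' \<rho>'') (ttob C \<sigma>'' \<sigma>') R (ttara C \<rho>' \<sigma>' \<rho>'' \<sigma>'' R' R'')"
    and exchange_lin: "\<lbrakk>\<rho> \<in> tobj C; \<sigma> \<in> tobj C; \<tau> \<in> tobj C; \<rho>' \<in> tobj C; \<sigma>' \<in> tobj C; \<tau>' \<in> tobj C;
          P \<in> thom C \<rho> \<sigma>; P' \<in> thom C \<rho>' \<sigma>'; R \<in> arr C b \<sigma> \<tau>; R' \<in> arr C b \<sigma>' \<tau>'\<rbrakk>
        \<Longrightarrow> tcomp C (arr_tens C b \<sigma> \<tau> \<sigma>' \<tau>' R R') (ttar C \<rho> \<sigma> \<rho>' \<sigma>' P P')
          = arr_tens C b \<rho> \<tau> \<rho>' \<tau>' (tcomp C R P) (tcomp C R' P')"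
    and exchange_anti: "\<lbrakk>\<rho> \<in> tobj C; \<sigma> \<in> tobj C; \<tau> \<in> tobj C; \<rho>' \<in> tobj C; \<sigma>' \<in> tobj C; \<tau>' \<in> tobj C;
          R \<in> tahom C \<rho> \<sigma>; R' \<in> tahom C \<rho>' \<sigma>'; S \<in> arr C b \<sigma> \<tau>; S' \<in> arr C b \<sigma>' \<tau>'\<rbrakk>
        \<Longrightarrow> tcomp C (arr_tens C b \<sigma>' \<tau>' \<sigma> \<tau> S' S) (ttara C \<rho> \<sigma> \<rho>' \<sigma>' R R')
          = arr_tens C (\<not> b) \<rho> \<tau> \<rho>' \<tau>' (tcomp C S R) (tcomp C S' R')"
    and star_tens_lin: "\<lbrakk>\<rho> \<in> tobj C; \<sigma> \<in> tobj C; \<rho>' \<in> tobj C; \<sigma>' \<in> tobj C; R \<in> thom C \<rho> \<sigma>; R' \<in> thom C \<rho>' \<sigma>'\<rbrakk>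
        \<Longrightarrow> tstar C (ttar C \<rho> \<sigma> \<rho>' \<sigma>' R R') = ttar C \<sigma> \<rho> \<sigma>' \<rho>' (tstar C R) (tstar C R')"
    and star_tens_anti: "\<lbrakk>\<rho> \<in> tobj C; \<sigma> \<in> tobj C; \<rho>' \<in> tobj C; \<sigma>' \<in> tobj C; R \<in> tahom C \<rho> \<sigma>; R' \<in> tahom C \<rho>' \<sigma>'\<rbrakk>
        \<Longrightarrow> tstar C (ttara C \<rho> \<sigma> \<rho>' \<sigma>' R R') = ttara C \<sigma>' \<rho>' \<sigma> \<rho> (tstar C R') (tstar C R)"

locale semilinear_tensor_Wstar_category = semilinear_tensor_Cstar_category C
  for C :: "('o, 'a::real_normed_vector, 'm) semilinear_cat_scheme" +
  assumes Wstar: "\<exists>pd. (\<forall>b. \<forall>\<rho>\<in>tobj C. \<forall>\<sigma>\<in>tobj C. is_predual (arr C b \<rho> \<sigma>) (tscl C) (pd b \<rho> \<sigma>)) \<and>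
     (\<forall>b. \<forall>\<rho>\<in>tobj C. \<forall>\<sigma>\<in>tobj C. \<forall>\<rho>'\<in>tobj C. \<forall>\<sigma>'\<in>tobj C.
        (\<forall>R'\<in>arr C b \<rho>' \<sigma>'. normal_map (arr C b \<rho> \<sigma>) (pd b \<rho> \<sigma>)
           (pd b (ttob C \<rho> \<rho>') (if b then ttob C \<sigma>' \<sigma> else ttob C \<sigma> \<sigma>'))
           (\<lambda>R. arr_tens C b \<rho> \<sigma> \<rho>' \<sigma>' R R')) \<and>
        (\<forall>R\<in>arr C b \<rho> \<sigma>. normal_map (arr C b \<rho>' \<sigma>') (pd b \<rho>' \<sigma>')
           (pd b (ttob C \<rho> \<rho>') (if b then ttob C \<sigma>' \<sigma> else ttob C \<sigma> \<sigma>'))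
           (\<lambda>R'. arr_tens C b \<rho> \<sigma> \<rho>' \<sigma>' R R')))"

definition has_conjugation :: "('o, 'a, 'm) semilinear_cat_scheme \<Rightarrow> bool" where
  "has_conjugation C \<longleftrightarrow> (\<forall>\<rho>\<in>tobj C. \<exists>\<sigma>\<in>tobj C. \<exists>u. tantiunitary C \<rho> \<sigma> u)"

definition antilinear_star_functor ::
    "('o, 'a::real_normed_vector, 'm) tensor_cat_scheme \<Rightarrow> ('o \<Rightarrow> 'o) \<Rightarrow> ('o \<Rightarrow> 'o \<Rightarrow> 'a \<Rightarrow> 'a) \<Rightarrow> bool" where
  "antilinear_star_functor C F Fa \<longleftrightarrow> F \<in> tobj C \<rightarrow> tobj C \<and>
     (\<forall>\<rho>\<in>tobj C. Fa \<rho> \<rho> (tid C \<rho>) = tid C (F \<rho>)) \<and>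
     (\<forall>\<rho>\<in>tobj C. \<forall>\<sigma>\<in>tobj C. \<forall>T\<in>thom C \<rho> \<sigma>.
        Fa \<rho> \<sigma> T \<in> thom C (F \<rho>) (F \<sigma>) \<and> Fa \<sigma> \<rho> (tstar C T) = tstar C (Fa \<rho> \<sigma> T) \<and>
        (\<forall>z. Fa \<rho> \<sigma> (tscl C z T) = tscl C (cnj z) (Fa \<rho> \<sigma> T)) \<and>
        (\<forall>S\<in>thom C \<rho> \<sigma>. Fa \<rho> \<sigma> (S + T) = Fa \<rho> \<sigma> S + Fa \<rho> \<sigma> T) \<and>
        (\<forall>\<tau>\<in>tobj C. \<forall>S\<in>thom C \<sigma> \<tau>. Fa \<rho> \<tau> (tcomp C S T) = tcomp C (Fa \<sigma> \<tau> S) (Fa \<rho> \<sigma> T)))"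

text \<open>\<open>e\<close> is a natural unitary from the identity functor to the (linear) functor \<open>(F, Fa)\<close>.\<close>

definition natural_unitary_from_id ::
    "('o, 'a, 'm) tensor_cat_scheme \<Rightarrow> ('o \<Rightarrow> 'o) \<Rightarrow> ('o \<Rightarrow> 'o \<Rightarrow> 'a \<Rightarrow> 'a) \<Rightarrow> ('o \<Rightarrow> 'a) \<Rightarrow> bool" where
  "natural_unitary_from_id C F Fa e \<longleftrightarrow> (\<forall>\<rho>\<in>tobj C. tunitary C \<rho> (F \<rho>) (e \<rho>)) \<and>
     (\<forall>\<rho>\<in>tobj C. \<forall>\<sigma>\<in>tobj C. \<forall>T\<in>thom C \<rho> \<sigma>. tcomp C (e \<sigma>) T = tcomp C (Fa \<rho> \<sigma> T) (e \<rho>))"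

definition antilinear_equivalence ::
    "('o, 'a::real_normed_vector, 'm) tensor_cat_scheme \<Rightarrow> ('o \<Rightarrow> 'o) \<Rightarrow> ('o \<Rightarrow> 'o \<Rightarrow> 'a \<Rightarrow> 'a) \<Rightarrow> bool" where
  "antilinear_equivalence C F Fa \<longleftrightarrow> antilinear_star_functor C F Fa \<and>
     (\<exists>G Ga. antilinear_star_functor C G Ga \<and>
       (\<exists>e. natural_unitary_from_id C (\<lambda>\<rho>. G (F \<rho>)) (\<lambda>\<rho> \<sigma> T. Ga (F \<rho>) (F \<sigma>) (Fa \<rho> \<sigma> T)) e) \<and>
       (\<exists>e. natural_unitary_from_id C (\<lambda>\<rho>. F (G \<rho>)) (\<lambda>\<rho> \<sigma> T. Fa (G \<rho>) (G \<sigma>) (Ga \<rho> \<sigma> T)) e))"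


section \<open>Corepresentations\<close>

text \<open>\<open>cobj\<close> are the Hilbert spaces on which corepresentations are considered, \<open>cbar\<close> and \<open>cJ\<close> the chosen
  conjugate Hilbert spaces and the antiunitaries \<open>J\<^sub>H : H \<rightarrow> cbar H\<close>.\<close>

record (overloaded) ('o, 'h::complex_hilbert) corep_setting = "('o, 'h) qgroup" +
  cobj :: "'o set"
  cbar :: "'o \<Rightarrow> 'o"
  cJ :: "'o \<Rightarrow> 'h oper"

locale corep_setting = lc_quantum_group D
  for D :: "('o, 'h::complex_hilbert, 'm) corep_setting_scheme" +
  assumes cobj: "cobj D \<subseteq> hobj D" "hunit D \<in> cobj D"
      "\<lbrakk>a \<in> cobj D; b \<in> cobj D\<rbrakk> \<Longrightarrow> htens D a b \<in> cobj D"
    and cbar: "a \<in> cobj D \<Longrightarrow> cbar D a \<in> cobj D"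
    and cJ: "a \<in> cobj D \<Longrightarrow> unitary_op True (hsp D a) (hsp D (cbar D a)) (cJ D a)"

text \<open>A corepresentation is a Hilbert space together with a unitary.\<close>

definition coreps :: "('o, 'h::complex_hilbert, 'm) corep_setting_scheme \<Rightarrow> ('o \<times> 'h oper) set" where
  "coreps D = {(h, W). h \<in> cobj D \<and>
     unitary_op False (hsp D (htens D (qK D) h)) (hsp D (htens D (qK D) h)) W \<and>
     leg12 D (qK D) (qK D) h (qV D) o\<^sub>L leg13 D (qK D) (qK D) h W o\<^sub>L leg23 D (qK D) (qK D) h W
       = leg23 D (qK D) (qK D) h W o\<^sub>L leg12 D (qK D) (qK D) h (qV D)}"

definition triv_corep where
  "triv_corep D h = (h, hid D (htens D (qK D) h))"

text \<open>The trivializing functor, on objects; it is the identity on operators.\<close>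

definition ciota where
  "ciota D W = triv_corep D (fst W)"

definition corep_hom where
  "corep_hom D W W' = {T \<in> blin (hsp D (fst W)) (hsp D (fst W')).
     optens D (qK D) (fst W) (qK D) (fst W') (qid D) T o\<^sub>L snd W
       = snd W' o\<^sub>L optens D (qK D) (fst W) (qK D) (fst W') (qid D) T}"

definition corep_tens where
  "corep_tens D W W' = (htens D (fst W) (fst W'),
     leg12 D (qK D) (fst W) (fst W') (snd W) o\<^sub>L leg13 D (qK D) (fst W) (fst W') (snd W'))"

definition corep_cat ::
    "('o, 'h::complex_hilbert, 'm) corep_setting_scheme \<Rightarrow> ('o \<times> 'h oper, 'h oper) tensor_cat" where
  "corep_cat D = \<lparr>tobj = coreps D, thom = corep_hom D, tid = (\<lambda>W. hid D (fst W)), tcomp = (o\<^sub>L), tstar = adj,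
     tscl = scl, tunit = triv_corep D (hunit D), ttob = corep_tens D,
     ttar = (\<lambda>W1 W2 W1' W2'. optens D (fst W1) (fst W1') (fst W2) (fst W2'))\<rparr>"


section \<open>The maximal \<open>C\<^sup>*\<close>-algebra\<close>

text \<open>
  An element of \<open>A\<^bsub>max\<^esub>(V)\<close> is realized as the family of its images under the representations \<open>\<pi>\<^sub>W\<close>, so
  that \<open>\<omega>\<close> becomes the family \<open>W \<mapsto> (\<omega> \<otimes> i)(W)\<close>, the norm is the supremum of the norms of the
  components, and product and adjoint, being determined by those of all \<open>\<pi>\<^sub>W(\<omega>)\<close>, are componentwise.  The
  completion is the \<open>C\<^sup>*\<close>-algebra generated by the families of all \<open>\<omega>\<close> in the algebra of bounded families
  (which are \<open>0\<close> outside \<open>coreps D\<close>).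
\<close>

type_synonym ('o, 'h) corep_family = "'o \<times> 'h oper \<Rightarrow> 'h oper"

definition bounded_families :: "('o, 'h::complex_hilbert, 'm) corep_setting_scheme \<Rightarrow> ('o, 'h) corep_family set" where
  "bounded_families D = {A. (\<forall>W\<in>coreps D. A W \<in> blin (hsp D (fst W)) (hsp D (fst W))) \<and>
     (\<forall>W. W \<notin> coreps D \<longrightarrow> A W = 0) \<and> (\<exists>c. \<forall>W\<in>coreps D. norm (A W) \<le> c)}"

definition pi_family ::
    "('o, 'h::complex_hilbert, 'm) corep_setting_scheme \<Rightarrow> ('h oper \<Rightarrow> complex) \<Rightarrow> ('o, 'h) corep_family" where
  "pi_family D \<omega> W = (if W \<in> coreps D then slice1 D (qK D) (fst W) \<omega> (snd W) else 0)"

definition cstar_families ::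
    "('o, 'h::complex_hilbert, 'm) corep_setting_scheme \<Rightarrow> ('o, 'h) corep_family set \<Rightarrow> bool" where
  "cstar_families D S \<longleftrightarrow> S \<subseteq> bounded_families D \<and> (\<lambda>W. 0) \<in> S \<and>
     (\<forall>A\<in>S. \<forall>B\<in>S. (\<lambda>W. A W + B W) \<in> S \<and> (\<lambda>W. A W o\<^sub>L B W) \<in> S) \<and>
     (\<forall>A\<in>S. (\<lambda>W. adj (A W)) \<in> S \<and> (\<forall>c. (\<lambda>W. scl c (A W)) \<in> S)) \<and>
     (\<forall>A\<in>bounded_families D. (\<forall>e>0. \<exists>B\<in>S. \<forall>W\<in>coreps D. norm (A W - B W) \<le> e) \<longrightarrow> A \<in> S)"

definition Amax :: "('o, 'h::complex_hilbert, 'm) corep_setting_scheme \<Rightarrow> ('o, 'h) corep_family set" where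
  "Amax D = \<Inter>{S. cstar_families D S \<and> (\<forall>\<omega>. normal_fun (qKsp D) (Mhat D) \<omega> \<longrightarrow> pi_family D \<omega> \<in> S)}"

definition pi_rep :: "'o \<times> 'h oper \<Rightarrow> ('o, 'h::complex_hilbert) corep_family \<Rightarrow> 'h oper" where
  "pi_rep W A = A W"

text \<open>\<open>R'\<close> is the continuous linear \<open>\<^sup>*\<close>-antihomomorphism with \<open>R'(\<omega>) = \<omega> \<circ> R\<close>, and \<open>j' = R' \<circ> \<^sup>*\<close>.\<close>

definition Rmax ::
    "('o, 'h::complex_hilbert, 'm) corep_setting_scheme \<Rightarrow> ('o, 'h) corep_family \<Rightarrow> ('o, 'h) corep_family" where
  "Rmax D = (THE \<Phi>. \<Phi> \<in> Amax D \<rightarrow>\<^sub>E Amax D \<and>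
     (\<forall>A\<in>Amax D. \<forall>B\<in>Amax D. \<Phi> (\<lambda>W. A W + B W) = (\<lambda>W. \<Phi> A W + \<Phi> B W) \<and>
        \<Phi> (\<lambda>W. A W o\<^sub>L B W) = (\<lambda>W. \<Phi> B W o\<^sub>L \<Phi> A W)) \<and>
     (\<forall>A\<in>Amax D. \<Phi> (\<lambda>W. adj (A W)) = (\<lambda>W. adj (\<Phi> A W)) \<and>
        (\<forall>c. \<Phi> (\<lambda>W. scl c (A W)) = (\<lambda>W. scl c (\<Phi> A W)))) \<and>
     (\<exists>K. \<forall>A\<in>Amax D. \<forall>c. (\<forall>W\<in>coreps D. norm (A W) \<le> c) \<longrightarrow> (\<forall>W\<in>coreps D. norm (\<Phi> A W) \<le> K * c)) \<and>
     (\<forall>\<omega>. normal_fun (qKsp D) (Mhat D) \<omega> \<longrightarrow> \<Phi> (pi_family D \<omega>) = pi_family D (\<omega> \<circ> qR D)))"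

definition jmax ::
    "('o, 'h::complex_hilbert, 'm) corep_setting_scheme \<Rightarrow> ('o, 'h) corep_family \<Rightarrow> ('o, 'h) corep_family" where
  "jmax D A = Rmax D (\<lambda>W. adj (A W))"


section \<open>Conjugation of corepresentations\<close>

text \<open>Here and below \<open>J\<^sup>-\<^sup>1\<close> is \<open>adj J\<close>, as \<open>J\<close> is antiunitary.\<close>

definition is_conj_corep ::
    "('o, 'h::complex_hilbert, 'm) corep_setting_scheme \<Rightarrow> 'o \<times> 'h oper \<Rightarrow> 'o \<times> 'h oper \<Rightarrow> bool" where
  "is_conj_corep D W W' \<longleftrightarrow> W' \<in> coreps D \<and> fst W' = cbar D (fst W) \<and>
     (\<forall>A\<in>Amax D. pi_rep W' A = cJ D (fst W) o\<^sub>L pi_rep W (jmax D A) o\<^sub>L adj (cJ D (fst W)))"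

definition conj_corep ::
    "('o, 'h::complex_hilbert, 'm) corep_setting_scheme \<Rightarrow> 'o \<times> 'h oper \<Rightarrow> 'o \<times> 'h oper" where
  "conj_corep D W = (THE W'. is_conj_corep D W W')"

definition corep_J where
  "corep_J D W = cJ D (fst (ciota D W))"

definition conj_arr where
  "conj_arr D W W' T = corep_J D W' o\<^sub>L T o\<^sub>L adj (corep_J D W)"

text \<open>Tensor product of antilinear operators \<open>T : W1 \<rightarrow> W2\<close> and \<open>T' : W1' \<rightarrow> W2'\<close>: the usual one followed
  by a flip.\<close>

definition anti_tens where
  "anti_tens D W1 W2 W1' W2' T T' =
     hflip D (fst W2) (fst W2') o\<^sub>L optens D (fst W1) (fst W1') (fst W2) (fst W2') T T'"

definition conj_d where
  "conj_d D W = corep_J D (conj_corep D W) o\<^sub>L corep_J D W"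

definition conj_c where
  "conj_c D W W' = corep_J D (corep_tens D W W') o\<^sub>L
     adj (anti_tens D W (conj_corep D W) W' (conj_corep D W') (corep_J D W) (corep_J D W'))"

definition semilinear_corep_cat ::
    "('o, 'h::complex_hilbert, 'm) corep_setting_scheme \<Rightarrow> ('o \<times> 'h oper, 'h oper) semilinear_cat" where
  "semilinear_corep_cat D = tensor_cat.extend (corep_cat D)
     (semilinear_cat.fields (\<lambda>W W'. {S o\<^sub>L corep_J D W |S. S \<in> corep_hom D (conj_corep D W) W'}) (anti_tens D))"

end

theory Submission
  imports Defs
begin

text \<open>Slicing in the Hilbert space leg turns a corepresentation \<open>W\<close> into coefficients \<open>w\<^bsub>p,q\<^esub>\<close> in the von Neumann algebra,
on which the coinverse \<open>R\<close> acts. The conjugate has the coefficients \<open>R(w\<^bsub>q,p\<^esub>)\<close> at \<open>(J p, J q)\<close>; it is a corepresentation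
because \<open>\<delta> R = \<theta> (R \<otimes> R) \<delta>\<close> extends from \<open>A\<close> to its bicommutant. An antilinear \<open>T\<close> is an arrow iff
\<open>w'\<^bsub>p,Tq\<^esub> = R(w\<^bsub>q,T\<^sup>*p\<^esub>)\<close>, which makes composition, adjoints and tensor products direct computations. Spaces of arrows are cut out of all
bounded operators by equations \<open>\<langle>p, T x\<rangle> = \<langle>e, T y\<rangle>\<close>, hence have preduals.\<close>

text \<open>Formally the conjugate is the image of \<open>W\<close> under \<open>R\<close> on the
  first leg and \<open>x \<mapsto> J (adj x) J\<inverse>\<close> on the second. A tensor product of
  such normal antihomomorphisms is avoided: the operator is assembled from its coefficients by sums
  over an orthonormal basis, and \<open>R\<close> is applied termwise inside normal functionals. The
  corepresentation equation needs \<open>\<delta> R = \<theta> (R \<otimes> R) \<delta>\<close> at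
  coefficients of \<open>W\<close>, which lie in the von Neumann algebra, whereas
  \<open>\<delta>\<close> is given on \<open>A\<close> only. The formula
  \<open>\<delta>(x) = adj V (1 \<otimes> x) V\<close> gives both sides a meaning as normal
  functionals of \<open>x\<close>. That formula rests on closability of the GNS map of
  \<open>\<phi> \<otimes> \<phi>\<close>; agreement of the functionals beyond \<open>A\<close> is a
  bicommutant argument in which \<open>K\<close> itself plays the part of the multiplicity space.
  The antiautomorphism \<open>R'\<close> of the maximal algebra is read off from the conjugates: on
  families it is \<open>A \<mapsto> adj J (adj (A (bar W))) J\<close>. Linear and antilinear arrows
  are treated together by a flag \<open>b\<close>. Since \<open>R\<close> reverses products,
  antilinear arrows reverse the order of tensor factors.\<close>

abbreviation (input) ap :: "'a::real_normed_vector \<Rightarrow>\<^sub>L 'b::real_normed_vector => 'a => 'b" (infixr "$$" 90)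
 where "ap == blinfun_apply"

abbreviation (input) oc (infixl "oL" 55) where "oc == blinfun_compose"

abbreviation (input) "csub == closed_csubspace"

abbreviation (input) "cor == complex_of_real"

abbreviation (input) "ip == cinner"

lemmas bl_right = blinfun.bounded_linear_right

section \<open>Complex inner products\<close>

lemma cinner_add_left: "ip (x + y) z = ip x z + ip y z"
proof -
 have "ip (x + y) z = cnj (ip z (x + y))" by(rule cinner_commute)
 also have "... = cnj (ip z x) + cnj (ip z y)" by(simp add: cinner_add_right)
 finally show ?thesis by(simp add: cinner_commute[symmetric])
qed

lemma cinner_scaleC_left: "ip (c *\<^sub>C x) y = cnj c * ip x y"
proof -
 have "ip (c *\<^sub>C x) y = cnj (ip y (c *\<^sub>C x))" by(rule cinner_commute)
 also have "... = cnj c * cnj (ip y x)" by(simp add: cinner_scaleC_right)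
 finally show ?thesis by(simp add: cinner_commute[symmetric])
qed

lemma scaleR_scaleC: "scaleR r x = cor r *\<^sub>C x"
 by(simp add: scaleC_of_real)

lemma scaleC_one[simp]: "1 *\<^sub>C x = x"
 using scaleC_of_real[of 1 x] by simp

lemma scaleC_zero_left[simp]: "0 *\<^sub>C x = 0"
 using scaleC_of_real[of 0 x] by simp

lemma scaleC_minus_one: "(-1) *\<^sub>C x = - x"
 using scaleC_of_real[of "-1" x] by simp

lemma scaleC_zero_right[simp]: "c *\<^sub>C 0 = 0"
 using scaleC_add_right[of c 0 0] by simp

lemma scaleC_minus_right: "c *\<^sub>C (- x) = - (c *\<^sub>C x)"
 using scaleC_add_right[of c x "-x"] by(simp add: eq_neg_iff_add_eq_0 add.commute)

lemma scaleC_diff_right: "c *\<^sub>C (x - y) = c *\<^sub>C x - c *\<^sub>C y"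
 using scaleC_add_right[of c x "-y"] by(simp add: scaleC_minus_right)

lemma cinner_zero_left[simp]: "ip 0 x = 0"
 using cinner_scaleC_left[of 0 0 x] by simp

lemma cinner_zero_right[simp]: "ip x 0 = 0"
 using cinner_scaleC_right[of x 0 0] by simp

lemma cinner_minus_left: "ip (- x) y = - ip x y"
 using cinner_scaleC_left[of "-1" x y] by(simp add: scaleC_minus_one)

lemma cinner_minus_right: "ip x (- y) = - ip x y"
 using cinner_scaleC_right[of x "-1" y] by(simp add: scaleC_minus_one)

lemma cinner_diff_left: "ip (x - y) z = ip x z - ip y z"
 using cinner_add_left[of x "-y" z] by(simp add: cinner_minus_left)

lemma cinner_diff_right: "ip z (x - y) = ip z x - ip z y"
 using cinner_add_right[of z x "-y"] by(simp add: cinner_minus_right)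

lemma cinner_sum_left: "ip (SUM i:I. f i) y = (SUM i:I. ip (f i) y)"
 by(induction I rule: infinite_finite_induct) (auto simp: cinner_add_left)

lemma cinner_sum_right: "ip y (SUM i:I. f i) = (SUM i:I. ip y (f i))"
 by(induction I rule: infinite_finite_induct) (auto simp: cinner_add_right)

lemma cinner_scaleR_left: "ip (scaleR r x) y = r * ip x y"
 by(simp add: scaleR_scaleC cinner_scaleC_left)

lemma cinner_scaleR_right: "ip x (scaleR r y) = r * ip x y"
 by(simp add: scaleR_scaleC cinner_scaleC_right)

lemma cinner_self: "ip x x = cor ((norm x)^2)"
proof -
 have "Im (ip x x) = 0"
  using cinner_commute[of x x] by(metis cnj.simps(2) equation_minus_iff neg_equal_zero)
 moreover have "Re (ip x x) = (norm x)^2"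
  by(simp add: inner_eq_Re_cinner[symmetric] dot_square_norm)
 ultimately show ?thesis by(simp add: complex_eq_iff)
qed

lemma norm_scaleC: "norm (c *\<^sub>C x) = cmod c * norm x"
proof -
 have "cor ((norm (c *\<^sub>C x))^2) = cnj c * c * cor ((norm x)^2)"
  unfolding cinner_self[symmetric] by(simp add: cinner_scaleC_left cinner_scaleC_right)
 also have "... = cor ((cmod c * norm x)^2)"
  using complex_norm_square[of c] by(simp add: power_mult_distrib mult.commute)
 finally have "(norm (c *\<^sub>C x))^2 = (cmod c * norm x)^2" by(metis of_real_eq_iff)
 thus ?thesis by simp
qed

text \<open>Multiplying \<open>y\<close> by a phase makes the complex inner product equal to its
  modulus, hence real, and the real inequality applies.\<close>

lemma cinner_cauchy: "cmod (ip x y) <= norm x * norm y"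
proof (cases "ip x y = 0")
 case False
 define c where "c = cnj (ip x y) / cmod (ip x y)"
 have c: "cmod c = 1" using False by(simp add: c_def norm_divide)
 have "ip x (c *\<^sub>C y) = cor (cmod (ip x y))"
  using False complex_norm_square[of "ip x y"]
  by(simp add: cinner_scaleC_right c_def power2_eq_square mult.commute divide_simps)
 hence "cmod (ip x y) = inner x (c *\<^sub>C y)" by(simp add: inner_eq_Re_cinner)
 also have "... <= norm x * norm (c *\<^sub>C y)" by(rule norm_cauchy_schwarz)
 finally show ?thesis by(simp add: norm_scaleC c)
qed simp

lemma bb_cinner: "bounded_bilinear ip"
 by standard (auto simp: cinner_add_left cinner_add_right cinner_scaleR_left cinner_scaleR_right
  scaleR_conv_of_real intro!: exI[of _ 1] cinner_cauchy)

lemma bounded_bilinear_scaleC: "bounded_bilinear scaleC"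
 by standard (auto simp: scaleC_add_left scaleC_add_right scaleR_scaleC scaleC_scaleC norm_scaleC
  scaleR_conv_of_real mult_ac scaleC_complex_def intro!: exI[of _ 1])

lemmas tendsto_cinner = bounded_bilinear.tendsto[OF bb_cinner]
lemmas continuous_on_cinner[continuous_intros] = bounded_bilinear.continuous_on[OF bb_cinner]
lemmas bl_cinner_right = bounded_bilinear.bounded_linear_right[OF bb_cinner]
lemmas bounded_linear_scaleC_right = bounded_bilinear.bounded_linear_right[OF bounded_bilinear_scaleC]
lemmas continuous_on_scaleC[continuous_intros] = bounded_bilinear.continuous_on[OF bounded_bilinear_scaleC]

text \<open>The first slot is antilinear, so the real part of the product with
  \<open>\<i> *\<^sub>C x\<close> is the imaginary part of \<open>ip x y\<close>. This transfers
  facts about the real inner product to the complex one.\<close>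

lemma cinner_eq_inner: "ip x y = Complex (inner x y) (inner (\<i> *\<^sub>C x) y)"
 by(simp add: inner_eq_Re_cinner cinner_scaleC_left complex_eq_iff)

lemma cinner_eqI: "(!!z. ip z x = ip z y) ==> x = y"
 using cinner_self[of "x - y"] by(simp add: cinner_diff_right)

lemma cinner_self_zero_iff[simp]: "ip x x = 0 \<longleftrightarrow> x = 0"
 by(simp add: cinner_self)

lemma norm_sum_square: "cor ((norm (SUM i:I. f i))^2) = (SUM i:I. SUM j:I. ip (f i) (f j))"
 by(simp only: cinner_self[symmetric] cinner_sum_left cinner_sum_right) (rule sum.swap)

section \<open>Orthogonal projections\<close>

lemma subspace_closure:
 fixes S :: "'a::real_normed_vector set"
 assumes "subspace S"
 shows "subspace (closure S)"
proof (rule subspaceI)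
 show "0:closure S" using subspace_0[OF assms] closure_subset by blast
next
 fix x y assume "x:closure S" "y:closure S"
 then obtain f g where "!!n. f n:S" "f \<longlonglongrightarrow> x" "!!n. g n:S" "g \<longlonglongrightarrow> y"
  unfolding closure_sequential by blast
 thus "x + y:closure S"
  unfolding closure_sequential
  by(intro exI[of _ "%n. f n + g n"]) (auto intro: subspace_add[OF assms] tendsto_add)
next
 fix c x assume "x:closure S"
 then obtain f where "!!n. f n:S" "f \<longlonglongrightarrow> x" unfolding closure_sequential by blast
 thus "c *\<^sub>R x:closure S"
  unfolding closure_sequential
  by(intro exI[of _ "%n. c *\<^sub>R f n"]) (auto intro: subspace_mul[OF assms] tendsto_scaleR)
qed

text \<open>By the parallelogram law a minimizing sequence is Cauchy: the midpoint of two members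
  lies in \<open>S\<close>, so its distance from \<open>x\<close> is at least the infimum
  \<open>d\<close>.\<close>

lemma nearest_point_exists:
 fixes S :: "'a::{real_inner, complete_space} set"
 assumes S: "convex S" "closed S" "S ~= {}"
 shows "EX p:S. ALL y:S. dist x p <= dist x y"
proof -
 define d where "d = Inf ((%y. dist x y) ` S)"
 have bdd: "bdd_below ((%y. dist x y) ` S)" by(rule bdd_belowI[of _ 0]) auto
 have d0: "0 <= d" unfolding d_def using S(3) by(intro cInf_greatest) auto
 have dle: "d <= dist x y" if "y:S" for y unfolding d_def using that bdd by(intro cInf_lower) auto
 have "EX y:S. dist x y < d + 1 / Suc n" for n
 proof (rule ccontr)
  assume "\<not> ?thesis"
  hence "d + 1 / Suc n <= d"
  using S(3) by(subst (2) d_def, intro cInf_greatest) (auto simp: not_less)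
  thus False by(simp add: field_simps)
 qed
 then obtain f where f: "!!n. f n:S" "!!n. dist x (f n) < d + 1 / Suc n" by metis
 \<comment> \<open>The constant comes from
   \<open>4 (d + 1/N)\<^sup>2 - 4 d\<^sup>2 = 8 d/N + 4/N\<^sup>2\<close>, where \<open>N\<close>
   stands for \<open>Suc N\<close> and \<open>1/N\<^sup>2 \<le> 1/N\<close>.\<close>
 have est: "(dist (f m) (f n))^2 <= (8 * d + 4) / Suc N" if "m >= N" "n >= N" for m n N
 proof -
  have l: "dist x (f k) <= d + 1 / Suc N" if "k >= N" for k
  proof -
  have "1 / real (Suc k) <= 1 / Suc N" using that by(intro divide_left_mono) auto
  thus ?thesis using f(2)[of k] by linarith
  qed
  have sq: "(dist x (f k))^2 <= (d + 1 / Suc N)^2" if "k >= N" for k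
  using l[OF that] by(intro power_mono) auto
  have mid: "(1/2) *\<^sub>R f m + (1/2) *\<^sub>R f n:S"
  using S(1) f(1) by(intro convexD) auto
  have "d\<^sup>2 <= (dist x ((1/2) *\<^sub>R f m + (1/2) *\<^sub>R f n))^2"
  using dle[OF mid] d0 by(intro power_mono) auto
  moreover have "(dist (f m) (f n))^2 = 2 * (dist x (f m))^2 + 2 * (dist x (f n))^2
  - 4 * (dist x ((1/2) *\<^sub>R f m + (1/2) *\<^sub>R f n))^2"
  unfolding dist_norm power2_norm_eq_inner
  by(simp add: inner_diff_left inner_diff_right inner_add_left inner_add_right inner_commute field_simps)
  ultimately have "(dist (f m) (f n))^2 <= 4 * (d + 1 / Suc N)^2 - 4 * d\<^sup>2"
  using sq[OF that(1)] sq[OF that(2)] by linarith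
  also have "... = 8 * d / Suc N + 4 * (1 / Suc N)^2"
  by(simp add: power2_eq_square algebra_simps)
  also have "... <= 8 * d / Suc N + 4 * (1 / Suc N)"
  proof -
  have "(1 / real (Suc N))^2 <= 1 / Suc N"
  unfolding power2_eq_square by(intro mult_left_le_one_le) auto
  thus ?thesis by linarith
  qed
  finally show ?thesis by(simp add: add_divide_distrib)
 qed
 have "Cauchy f"
 proof (rule metric_CauchyI)
  fix e :: real assume e: "0 < e"
  obtain N where N: "(8 * d + 4) / e\<^sup>2 < real N" using reals_Archimedean2 by blast
  hence "(8 * d + 4) / Suc N < e\<^sup>2" using e d0
  by(simp add: field_simps) (smt (verit, best) mult_le_cancel_right zero_le_power2)
  thus "EX M. ALL m>=M. ALL n>=M. dist (f m) (f n) < e"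
  using est e by(intro exI[of _ N] allI impI) (smt (verit) power2_le_imp_le)
 qed
 then obtain p where p: "f \<longlonglongrightarrow> p" using Cauchy_convergent convergent_def by blast
 have "p:S" using p f(1) S(2) closed_sequentially by blast
 moreover have "dist x p <= d"
 proof (rule LIMSEQ_le)
  show "(%n. dist x (f n)) \<longlonglongrightarrow> dist x p" by(intro tendsto_intros p)
  show "(%n. d + 1 / Suc n) \<longlonglongrightarrow> d"
  using tendsto_add[OF tendsto_const[of d] LIMSEQ_inverse_real_of_nat] by(simp add: inverse_eq_divide)
 qed (use f(2) less_imp_le in blast)
 ultimately show ?thesis using dle by force
qed

text \<open>The separating direction is \<open>x - p\<close> with \<open>p\<close> the point of
  \<open>S\<close> nearest to \<open>x\<close>. This is the Hahn-Banach step of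
  \<open>gdom_total\<close>.\<close>

lemma convex_separation:
 fixes S :: "'a::{real_inner, complete_space} set"
 assumes S: "convex S" "closed S" "S ~= {}" and x: "x ~: S"
 shows "EX u M. (ALL y:S. inner u y <= M) & M < inner u x"
proof -
 obtain p where p: "p:S" "ALL y:S. dist x p <= dist x y" using nearest_point_exists[OF S] by blast
 have "inner (x - p) (y - p) <= 0" if "y:S" for y
  using any_closest_point_dot[OF S(1,2) p(1) that] p(2) by blast
 moreover have "inner (x - p) (x - p) > 0" using x p(1) by auto
 ultimately show ?thesis
  by(intro exI[of _ "x - p"] exI[of _ "inner (x - p) p"]) (auto simp: inner_diff_right)
qed

text \<open>The obtuse angle inequality at the nearest point \<open>p\<close>, applied to
  \<open>p + y\<close> and to \<open>p - y\<close>, leaves only equality.\<close>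

lemma proj_exists:
 fixes S :: "'a::{real_inner, complete_space} set"
 assumes S: "subspace S" "closed S"
 shows "EX p:S. ALL y:S. inner (x - p) y = 0"
proof -
 have ne: "S ~= {}" using S(1) subspace_0 by blast
 obtain p where p: "p:S" "ALL y:S. dist x p <= dist x y"
  using nearest_point_exists[OF subspace_imp_convex[OF S(1)] S(2) ne] by blast
 have le: "inner (x - p) (y - p) <= 0" if "y:S" for y
  using any_closest_point_dot[OF subspace_imp_convex[OF S(1)] S(2) p(1) that] p(2) by blast
 have "inner (x - p) y = 0" if y: "y:S" for y
  using le[of "p + y"] le[of "p - y"] subspace_add[OF S(1) p(1) y] subspace_diff[OF S(1) p(1) y]
  by simp
 thus ?thesis using p(1) by blast
qed

text \<open>For \<open>v\<close> orthogonal to the kernel the vector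
  \<open>f v *\<^sub>R y - f y *\<^sub>R v\<close> lies in the kernel; pairing it with
  \<open>v\<close> shows that a multiple of \<open>v\<close> represents \<open>f\<close>.\<close>

lemma riesz_representation:
 fixes f :: "'a::{real_inner, complete_space} => real"
 assumes f: "bounded_linear f"
 shows "EX u. ALL x. f x = inner u x"
proof (cases "ALL x. f x = 0")
 case True thus ?thesis by(intro exI[of _ 0]) simp
next
 case False
 interpret f: bounded_linear f by fact
 obtain x where x: "f x ~= 0" using False by blast
 have S: "subspace {x. f x = 0}" by(simp add: subspace_def f.add f.scaleR f.zero)
 have "closed {x. f x = 0}" using closed_Collect_eq[OF f.continuous_on[OF continuous_on_id] continuous_on_const]
  by simp
 then obtain p where p: "f p = 0" "!!y. f y = 0 ==> inner (x - p) y = 0"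
  using proj_exists[OF S, of x] by auto
 define v where "v = x - p"
 have fv: "f v = f x" using p by(simp add: v_def f.diff)
 have v0: "v ~= 0" using x fv f.zero by auto
 have "f y * inner v v = f v * inner v y" for y
 proof -
  have "f (f v *\<^sub>R y - f y *\<^sub>R v) = 0" by(simp add: f.diff f.scaleR)
  hence "inner v (f v *\<^sub>R y - f y *\<^sub>R v) = 0" using p(2) v_def by blast
  thus ?thesis by(simp add: inner_diff_right)
 qed
 hence "f y = inner ((f v / inner v v) *\<^sub>R v) y" for y
  using v0 by(simp add: field_simps)
 thus ?thesis by blast
qed

lemma csubD:
 assumes "csub H"
 shows "subspace H" "closed H" "c *\<^sub>C x = y ==> x:H ==> y:H" "0:H"
  "x:H ==> y:H ==> x + y:H" "x:H ==> y:H ==> x - y:H" "x:H ==> c *\<^sub>C x:H"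
  "x:H ==> r *\<^sub>R x:H" "x:H ==> - x:H"
 using assms unfolding closed_csubspace_def
 by(auto simp: subspace_0 subspace_add subspace_diff subspace_mul subspace_neg)

text \<open>\<open>H\<close> is stable under \<open>\<i>\<close>, so vanishing of all real parts
  forces vanishing of the imaginary parts.\<close>

lemma orth_iff_inner:
 assumes "csub H"
 shows "orth H x \<longleftrightarrow> (ALL y:H. inner x y = 0)"
proof
 assume r: "ALL y:H. inner x y = 0"
 show "orth H x" unfolding orth_def
 proof
  fix y assume y: "y:H"
  hence "inner x y = 0" "inner x (\<i> *\<^sub>C y) = 0" using r csubD(7)[OF assms] by auto
  thus "ip y x = 0" by(simp add: cinner_eq_inner inner_commute complex_eq_iff)
 qed
qed (simp add: orth_def inner_commute inner_eq_Re_cinner)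

lemma orth_add: "orth H x ==> orth H y ==> orth H (x + y)"
 by(simp add: orth_def cinner_add_right)

lemma orth_diff: "orth H x ==> orth H y ==> orth H (x - y)"
 by(simp add: orth_def cinner_diff_right)

lemma orth_scaleC: "orth H x ==> orth H (c *\<^sub>C x)"
 by(simp add: orth_def cinner_scaleC_right)

lemma orth_self_zero: "x:H ==> orth H x ==> x = 0"
 by(auto simp: orth_def)

text \<open>The function inside \<open>idop\<close>, named so that its bounded linearity can be
  established before the \<open>Blinfun\<close> is evaluated.\<close>

definition proj_on :: "'h::complex_hilbert set => 'h => 'h" where
 "proj_on H x = (THE y. y:H & orth H (x - y))"

lemma ex1_proj:
 assumes H: "csub H"
 shows "EX! y. y:H & orth H (x - y)"
proof -
 obtain p where p: "p:H" "orth H (x - p)"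
  using proj_exists[OF csubD(1,2)[OF H], of x] orth_iff_inner[OF H] by blast
 show ?thesis
 proof (rule ex1I[of _ p])
  fix y assume y: "y:H & orth H (x - y)"
  hence "orth H (p - y)" using orth_diff[of H "x - y" "x - p"] p by simp
  moreover have "p - y:H" using csubD(6)[OF H] p y by blast
  ultimately show "y = p" using orth_self_zero by fastforce
 qed (use p in blast)
qed

lemma proj_on:
 assumes "csub H"
 shows "proj_on H x:H" "orth H (x - proj_on H x)"
 using theI'[OF ex1_proj[OF assms, of x]] unfolding proj_on_def by auto

lemma proj_on_eqI: "csub H ==> y:H ==> orth H (x - y) ==> proj_on H x = y"
 using ex1_proj[of H x] proj_on[of H x] by blast

lemma proj_on_in: "csub H ==> x:H ==> proj_on H x = x"
 by(rule proj_on_eqI) (auto simp: orth_def)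

lemma proj_on_orth: "csub H ==> orth H x ==> proj_on H x = 0"
 by(rule proj_on_eqI) (auto simp: csubD)

lemma norm_proj_on_le:
 assumes "csub H"
 shows "norm (proj_on H x) <= norm x"
proof -
 have "inner (x - proj_on H x) (proj_on H x) = 0"
  using proj_on[OF assms] orth_iff_inner[OF assms] by blast
 hence "(norm x)^2 = (norm (proj_on H x))^2 + (norm (x - proj_on H x))^2"
  unfolding power2_norm_eq_inner by(simp add: inner_diff_left inner_diff_right inner_commute)
 thus ?thesis by(smt (verit) norm_ge_zero power2_le_imp_le zero_le_power2)
qed

lemma proj_on_linear:
 assumes H: "csub H"
 shows "bounded_linear (proj_on H)"
proof (rule bounded_linear_intro[where K = 1])
 fix x y :: 'a and r :: real
 show "proj_on H (x + y) = proj_on H x + proj_on H y"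
  using orth_add[OF proj_on(2)[OF H, of x] proj_on(2)[OF H, of y]]
  by(intro proj_on_eqI[OF H]) (auto simp: csubD[OF H] proj_on[OF H] algebra_simps)
 show "proj_on H (r *\<^sub>R x) = r *\<^sub>R proj_on H x"
  using orth_scaleC[OF proj_on(2)[OF H, of x], of "cor r"]
  by(intro proj_on_eqI[OF H])
  (auto simp: csubD[OF H] proj_on[OF H] scaleC_of_real algebra_simps)
qed (simp add: norm_proj_on_le[OF H])

lemma idop_eq: "idop H = Blinfun (proj_on H)"
 by(simp add: idop_def proj_on_def[abs_def])

lemma idop_apply: "csub H ==> idop H $$ x = proj_on H x"
 by(simp add: idop_eq bounded_linear_Blinfun_apply proj_on_linear)

text \<open>\<open>span\<close> is the real span; stability of the generators under complex scalars
  turns it into the complex one.\<close>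

lemma csub_closure_span:
 assumes "!!c x. x:B ==> c *\<^sub>C x:B"
 shows "csub (closure (span B))"
proof -
 have s: "c *\<^sub>C x:span B" if "x:span B" for c x
  using that
 proof (induction rule: span_induct_alt)
  case base show ?case by(simp add: span_zero)
 next
  case (step r x y)
  have "c *\<^sub>C (r *\<^sub>R x + y) = r *\<^sub>R (c *\<^sub>C x) + c *\<^sub>C y"
  by(simp add: scaleC_add_right scaleR_scaleC scaleC_scaleC mult.commute)
  thus ?case using step assms by(simp add: span_add span_scale span_base)
 qed
 have "c *\<^sub>C x:closure (span B)" if "x:closure (span B)" for c x
 proof -
  have "(*\<^sub>C) c ` closure (span B) <= closure ((*\<^sub>C) c ` span B)"
  using continuous_image_closure_subset[of UNIV "(*\<^sub>C) c" "span B"]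
  by(simp add: bounded_linear.continuous_on[OF bounded_linear_scaleC_right] continuous_on_id)
  also have "... <= closure (span B)" using s by(intro closure_mono) auto
  finally show ?thesis using that by blast
 qed
 thus ?thesis unfolding closed_csubspace_def by(auto intro: subspace_closure)
qed

section \<open>Adjoints and operators between closed subspaces\<close>

lemma adj_exists: "EX S :: 'h oper. ALL x y. inner (T $$ x) y = inner x (S $$ y)"
 for T :: "'h::complex_hilbert oper"
proof -
 have "EX u. ALL x. inner (T $$ x) y = inner u x" for y
  by(rule riesz_representation)
  (intro bounded_linear_inner_left_comp bl_right)
 then obtain f where f: "!!x y. inner (T $$ x) y = inner x (f y)"
  by(metis inner_commute)
 have "bounded_linear f"
 proof (rule bounded_linear_intro[where K = "norm T"])
  fix x y r
  show "f (x + y) = f x + f y"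
  by(rule vector_eq_rdot[THEN iffD1]) (simp add: f[symmetric] inner_add_right inner_add_left inner_commute[of "f _"] inner_commute[of "f (_ + _)"])
  show "f (r *\<^sub>R x) = r *\<^sub>R f x"
  by(rule vector_eq_rdot[THEN iffD1]) (simp add: f[symmetric] inner_commute[of "f _"])
  have "norm (f x) * norm (f x) = inner (T $$ f x) x"
  by(simp add: f dot_square_norm power2_eq_square)
  also have "... <= norm T * norm (f x) * norm x"
  by(rule order_trans[OF norm_cauchy_schwarz]) (intro mult_right_mono norm_blinfun norm_ge_zero)
  finally have "norm (f x) * norm (f x) <= norm (f x) * (norm x * norm T)" by(simp add: mult_ac)
  thus "norm (f x) <= norm x * norm T"
  by(cases "norm (f x) = 0") (auto simp: mult_le_cancel_left)
 qed
 thus ?thesis using f by(intro exI[of _ "Blinfun f"]) (simp add: bounded_linear_Blinfun_apply)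
qed

lemma adj_eqI:
 assumes "!!x y. inner (T $$ x) y = inner x (S $$ y)"
 shows "adj T = S"
 using adjoint_unique[of "blinfun_apply T" "blinfun_apply S"] assms
 by(simp add: adj_def blinfun_apply_inverse)

lemma adj_inner: "inner (T $$ x) y = inner x (adj T $$ y)"
 using adj_exists[of T] adj_eqI[of T] by metis

lemma adj_inner2: "inner x (T $$ y) = inner (adj T $$ x) y"
 by(metis adj_inner inner_commute)

lemma adj_adj[simp]: "adj (adj T) = T"
 by(rule adj_eqI) (simp add: adj_inner2)

lemma adj_comp: "adj (S oL T) = adj T oL adj S"
 by(rule adj_eqI) (simp add: adj_inner)

lemma adj_zero[simp]: "adj 0 = 0"
 by(rule adj_eqI) simp

lemma adj_add: "adj (S + T) = adj S + adj T"
 by(rule adj_eqI) (simp add: blinfun.add_left inner_add_left inner_add_right adj_inner)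

lemma adj_diff: "adj (S - T) = adj S - adj T"
 by(rule adj_eqI) (simp add: blinfun.diff_left inner_diff_left inner_diff_right adj_inner)

lemma adj_scaleR: "adj (r *\<^sub>R T) = r *\<^sub>R adj T"
 by(rule adj_eqI) (simp add: blinfun.scaleR_left adj_inner)

lemma norm_adj_comp: "norm (adj T oL T) = (norm T)^2"
proof (rule antisym)
 have le: "norm T <= norm (adj T)" for T :: "'a oper"
 proof (rule norm_blinfun_bound)
  fix x
  have "(norm (T $$ x))^2 = inner x (adj T $$ T $$ x)"
  by(simp add: adj_inner dot_square_norm[symmetric])
  also have "... <= norm x * (norm (adj T) * norm (T $$ x))"
  by(rule order_trans[OF norm_cauchy_schwarz]) (intro mult_left_mono norm_blinfun norm_ge_zero)
  finally have "norm (T $$ x) * norm (T $$ x) <= norm (T $$ x) * (norm (adj T) * norm x)"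
  by(simp add: power2_eq_square mult_ac)
  thus "norm (T $$ x) <= norm (adj T) * norm x"
  by(cases "norm (T $$ x) = 0") (auto simp: mult_le_cancel_left)
 qed simp
 have eq: "norm (adj T) = norm T" using le[of T] le[of "adj T"] by simp
 show "norm (adj T oL T) <= (norm T)^2"
  using norm_blinfun_compose[of "adj T" T] by(simp add: eq power2_eq_square)
 have "norm T <= sqrt (norm (adj T oL T))"
 proof (rule norm_blinfun_bound)
  fix x
  have "(norm (T $$ x))^2 = inner x ((adj T oL T) $$ x)"
  by(simp add: adj_inner dot_square_norm[symmetric])
  also have "... <= norm x * (norm (adj T oL T) * norm x)"
  by(rule order_trans[OF norm_cauchy_schwarz]) (intro mult_left_mono norm_blinfun norm_ge_zero)
  also have "... = (sqrt (norm (adj T oL T)) * norm x)^2" by(simp add: power2_eq_square)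
  finally show "norm (T $$ x) <= sqrt (norm (adj T oL T)) * norm x"
  by(rule power2_le_imp_le) simp
 qed simp
 thus "(norm T)^2 <= norm (adj T oL T)"
  using real_le_rsqrt[of "norm T"] by(metis norm_ge_zero power_mono real_sqrt_pow2)
qed

lemma norm_adj[simp]: "norm (adj T) = norm T"
proof -
 have le: "norm T <= norm (adj T)" for T :: "'a oper"
 proof (cases "norm T = 0")
  case False
  have "norm T * norm T <= norm (adj T) * norm T"
  using norm_adj_comp[of T] norm_blinfun_compose[of "adj T" T] by(simp add: power2_eq_square)
  thus ?thesis using False by(simp add: mult_le_cancel_right)
 qed simp
 show ?thesis using le[of T] le[of "adj T"] by simp
qed

lemma bounded_linear_adj: "bounded_linear adj"
 by(rule bounded_linear_intro[where K = 1]) (auto simp: adj_add adj_scaleR)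

lemma adj_eq_iff[simp]: "adj S = adj T \<longleftrightarrow> S = T"
 by(metis adj_adj)

lemma cj_simps[simp]: "cj False c = c" "cj True c = cnj c" "cj b 0 = 0" "cj b 1 = 1"
 "cj b (x + y) = cj b x + cj b y" "cj b (x * y) = cj b x * cj b y" "cj b (x - y) = cj b x - cj b y"
 "cj b (of_real r) = of_real r" "cj b (cj b' x) = cj (b ~= b') x" "cnj (cj b x) = cj b (cnj x)" "cmod (cj b x) = cmod x"
 by(auto simp: cj_def)

lemma cinner_swap_eq: "ip x y = z ==> ip y x = cnj z"
 using cinner_commute by metis

lemma scaleC_minus_left: "(- c) *\<^sub>C x = - (c *\<^sub>C x)"
 using scaleC_add_left[of c "-c" x] by(simp add: eq_neg_iff_add_eq_0 add.commute)

text \<open>The imaginary part is a real inner product with \<open>\<i> *\<^sub>C T x\<close>, and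
  moving \<open>\<i>\<close> through \<open>T\<close> costs a sign exactly in the antilinear
  case.\<close>

lemma adj_cinner:
 assumes "!!c x. T $$ (c *\<^sub>C x) = cj b c *\<^sub>C T $$ x"
 shows "ip (T $$ x) y = cj b (ip x (adj T $$ y))"
proof -
 have "\<i> *\<^sub>C T $$ x = (if b then -1 else 1) *\<^sub>R T $$ (\<i> *\<^sub>C x)"
  using assms[of \<i> x] by(cases b) (auto simp: scaleC_minus_left)
 hence "inner (\<i> *\<^sub>C T $$ x) y = (if b then -1 else 1) * inner (\<i> *\<^sub>C x) (adj T $$ y)"
  by(simp only: inner_scaleR_left adj_inner)
 thus ?thesis by(cases b) (auto simp: cinner_eq_inner adj_inner complex_eq_iff)
qed

lemma bopI:
 assumes "!!c x. T $$ (c *\<^sub>C x) = cj b c *\<^sub>C T $$ x"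
  "!!x. orth H x ==> T $$ x = 0" "!!x. T $$ x:H'"
 shows "T:bop b H H'"
 using assms unfolding bop_def by blast

lemma bop_scaleC: "T:bop b H H' ==> T $$ (c *\<^sub>C x) = cj b c *\<^sub>C T $$ x"
 and bop_orth: "T:bop b H H' ==> orth H x ==> T $$ x = 0"
 and bop_in: "T:bop b H H' ==> T $$ x:H'"
 unfolding bop_def by auto

lemma bop_cinner:
 assumes "T:bop b H H'"
 shows "ip (T $$ x) y = cj b (ip x (adj T $$ y))"
 by(rule adj_cinner) (rule bop_scaleC[OF assms])

lemma bop_cinner2:
 assumes "T:bop b H H'"
 shows "ip y (T $$ x) = cj b (ip (adj T $$ y) x)"
 using bop_cinner[OF assms, of x y] by(metis cinner_commute cj_simps(10))

lemma bop_proj: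
 assumes "csub H" "T:bop b H H'"
 shows "T $$ proj_on H x = T $$ x"
 using bop_orth[OF assms(2) proj_on(2)[OF assms(1), of x]] by(simp add: blinfun.diff_right)

lemma bop_eqI:
 assumes H: "csub H" and T: "T:bop b H H'" "S:bop b' H H''"
  and eq: "!!x. x:H ==> T $$ x = S $$ x"
 shows "T = S"
proof (rule blinfun_eqI)
 fix x
 show "T $$ x = S $$ x"
  using eq[OF proj_on(1)[OF H, of x]] by(simp add: bop_proj[OF H T(1)] bop_proj[OF H T(2)])
qed

lemma adj_bop:
 assumes H: "csub H" and T: "T:bop b H H'"
 shows "adj T:bop b H' H"
proof (rule bopI)
 fix c x
 show "adj T $$ (c *\<^sub>C x) = cj b c *\<^sub>C adj T $$ x"
 proof (rule cinner_eqI)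
  fix z
  have "cj b (ip z (adj T $$ (c *\<^sub>C x))) = cj b (ip z (cj b c *\<^sub>C adj T $$ x))"
  by(simp add: bop_cinner[OF T, symmetric] cinner_scaleC_right)
  thus "ip z (adj T $$ (c *\<^sub>C x)) = ip z (cj b c *\<^sub>C adj T $$ x)"
  by(cases b) auto
 qed
next
 fix x assume x: "orth H' x"
 have "inner z (adj T $$ x) = 0" for z
  unfolding adj_inner[symmetric] using x bop_in[OF T, of z] by(simp add: orth_def inner_eq_Re_cinner)
 thus "adj T $$ x = 0" using inner_eq_zero_iff by blast
next
 fix x
 \<comment> \<open>\<open>T\<close> vanishes on the complement of \<open>H\<close>, so
   \<open>adj T\<close> takes its values orthogonally to that complement and each value equals its
   projection.\<close>
 have 1: "inner (adj T $$ x - proj_on H (adj T $$ x)) z = 0"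
  if "orth H z" for z
 proof -
  have "inner (proj_on H (adj T $$ x)) z = 0"
  using that proj_on(1)[OF H] by(metis orth_iff_inner[OF H] inner_commute)
  thus ?thesis using bop_orth[OF T that] by(simp only: inner_diff_left adj_inner2[symmetric]) simp
 qed
 have "adj T $$ x = proj_on H (adj T $$ x)"
  using 1[OF proj_on(2)[OF H, of "adj T $$ x"]] by simp
 thus "adj T $$ x:H" using proj_on(1)[OF H] by metis
qed

lemma bop_comp:
 assumes "T:bop b H H'" "S:bop b' H' H''"
 shows "S oL T:bop (b ~= b') H H''"
 by(rule bopI) (cases b; cases b'; auto simp: bop_scaleC[OF assms(1)] bop_scaleC[OF assms(2)] bop_orth[OF assms(1)]
  bop_in[OF assms(2)])+

lemma idop_bop: "csub H ==> idop H:blin H H"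
proof (rule bopI)
 fix c x assume H: "csub H"
 have "proj_on H (c *\<^sub>C x) = c *\<^sub>C proj_on H x"
  using orth_scaleC[OF proj_on(2)[OF H, of x], of c]
  by(intro proj_on_eqI[OF H]) (auto simp: csubD[OF H] proj_on[OF H] scaleC_diff_right)
 thus "idop H $$ (c *\<^sub>C x) = cj False c *\<^sub>C idop H $$ x"
  by(simp add: idop_apply[OF H])
qed (auto simp: idop_apply proj_on_orth proj_on)

lemma idop_in: "csub H ==> x:H ==> idop H $$ x = x"
 by(simp add: idop_apply proj_on_in)

lemma comp_idop: "csub H ==> T:bop b H H' ==> T oL idop H = T"
 by(rule blinfun_eqI) (simp add: idop_apply bop_proj)

lemma idop_comp: "csub H' ==> T:bop b H H' ==> idop H' oL T = T"
 by(rule blinfun_eqI) (simp add: idop_apply proj_on_in bop_in)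

lemma adj_idop:
 assumes H: "csub H"
 shows "adj (idop H) = idop H"
proof (rule adj_eqI)
 fix x y
 have 1: "inner (x - proj_on H x) (proj_on H y) = 0" "inner (y - proj_on H y) (proj_on H x) = 0"
  using proj_on[OF H] unfolding orth_iff_inner[OF H] by blast+
 hence "inner (proj_on H x) y = inner x (proj_on H y)"
  by(simp add: inner_diff_left) (simp add: inner_commute)
 thus "inner (idop H $$ x) y = inner x (idop H $$ y)"
  by(simp add: idop_apply[OF H])
qed

lemma blinfun_compose_add_left: "(S + T) oL Q = (S oL Q) + (T oL Q)"
 and blinfun_compose_add_right: "Q oL (S + T) = (Q oL S) + (Q oL T)"
 and blinfun_compose_diff_left: "(S - T) oL Q = (S oL Q) - (T oL Q)"
 and blinfun_compose_diff_right: "Q oL (S - T) = (Q oL S) - (Q oL T)"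
 and blinfun_compose_scaleR_left: "(r *\<^sub>R S) oL Q = r *\<^sub>R (S oL Q)"
 and blinfun_compose_scaleR_right: "Q oL (r *\<^sub>R S) = r *\<^sub>R (Q oL S)"
 by(auto intro!: blinfun_eqI simp: blinfun.add_left blinfun.add_right blinfun.diff_left blinfun.diff_right
  blinfun.scaleR_left blinfun.scaleR_right)

lemma scl_apply: "scl c T $$ x = c *\<^sub>C T $$ x"
proof -
 have "bounded_linear (%x. c *\<^sub>C T $$ x)"
  by(rule bounded_linear_compose[OF bounded_linear_scaleC_right bl_right])
 thus ?thesis by(simp add: scl_def bounded_linear_Blinfun_apply)
qed

lemma bop_zero: "csub H' ==> 0:bop b H H'"
 by(rule bopI) (auto simp: csubD)

lemma bop_add: "csub H' ==> S:bop b H H' ==> T:bop b H H' ==> S + T:bop b H H'"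
 by(rule bopI) (auto simp: blinfun.add_left bop_scaleC bop_orth bop_in csubD scaleC_add_right)

lemma bop_diff: "csub H' ==> S:bop b H H' ==> T:bop b H H' ==> S - T:bop b H H'"
 by(rule bopI) (auto simp: blinfun.diff_left bop_scaleC bop_orth bop_in csubD scaleC_diff_right)

lemma bop_scl: "csub H' ==> T:bop b H H' ==> scl c T:bop b H H'"
 by(rule bopI) (auto simp: scl_apply bop_scaleC bop_orth bop_in csubD scaleC_scaleC mult.commute)

lemma scl_of_real: "scl (cor r) T = r *\<^sub>R T"
 by(rule blinfun_eqI) (simp add: scl_apply scaleC_of_real blinfun.scaleR_left)

lemma bop_scaleR: "csub H' ==> T:bop b H H' ==> r *\<^sub>R T:bop b H H'"
 using bop_scl[of H' T b H "cor r"] by(simp add: scl_of_real)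

lemma subspace_bop: "csub H' ==> subspace (bop b H H')"
 by(simp add: subspace_def bop_zero bop_add bop_scaleR)

lemma scl_add_right: "scl c (S + T) = scl c S + scl c T"
 and scl_add_left: "scl (c + d) T = scl c T + scl d T"
 and scl_scl: "scl c (scl d T) = scl (c * d) T"
 and scl_comp_left: "scl c S oL T = scl c (S oL T)"
 and scl_one[simp]: "scl 1 T = T"
 by(auto intro!: blinfun_eqI simp: scl_apply blinfun.add_left scaleC_add_right scaleC_add_left scaleC_scaleC)

lemma scl_minus_one: "scl (-1) T = - T"
 by(rule blinfun_eqI) (simp add: scl_apply scaleC_minus_one blinfun.minus_left)

lemma scl_comp_right: "S:bop b H H' ==> S oL scl c T = scl (cj b c) (S oL T)"
 by(rule blinfun_eqI) (simp add: scl_apply bop_scaleC)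

lemma adj_scl:
 assumes "csub H" "csub H'" "T:bop b H H'"
 shows "adj (scl c T) = scl (cj (\<not> b) c) (adj T)"
proof (rule adj_eqI)
 fix x y
 have "ip (scl c T $$ x) y = cj b (ip x (cj (\<not> b) c *\<^sub>C adj T $$ y))"
  by(cases b) (auto simp: scl_apply cinner_scaleC_left cinner_scaleC_right bop_cinner[OF assms(3)])
 thus "inner (scl c T $$ x) y = inner x (scl (cj (\<not> b) c) (adj T) $$ y)"
  by(cases b) (auto simp: inner_eq_Re_cinner scl_apply)
qed

lemma norm_scl: "norm (scl c T) = cmod c * norm T"
proof -
 have le: "norm (scl c T) <= cmod c * norm T" for c and T :: "'a oper"
  by(rule norm_blinfun_bound) (auto simp: scl_apply norm_scaleC mult.assoc intro!: mult_left_mono norm_blinfun)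
 show ?thesis
 proof (cases "c = 0")
  case True thus ?thesis using le[of c T] by simp
 next
  case False
  have "norm T = norm (scl (1/c) (scl c T))" using False by(simp add: scl_scl)
  also have "... <= norm (scl c T) / cmod c" using le[of "1/c" "scl c T"] by(simp add: norm_divide)
  finally show ?thesis using le[of c T] False by(simp add: field_simps)
 qed
qed

lemma closed_bop:
 assumes "csub H'"
 shows "closed (bop b H H')"
proof -
 have e: "bop b H H' = (\<Inter>c. \<Inter>x. {T. T $$ (c *\<^sub>C x) = cj b c *\<^sub>C T $$ x})
  \<inter> (\<Inter>x\<in>{x. orth H x}. {T. T $$ x = 0}) \<inter> (\<Inter>x. (%T. T $$ x) -` H')"
  by(auto simp: bop_def)
 have c: "continuous_on UNIV (%T :: 'a oper. T $$ x)" for x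
  by(intro continuous_intros)
 have "closed ((%T :: 'a oper. T $$ x) -` H')" for x
  using continuous_closed_vimage[OF csubD(2)[OF assms]] c
  by(metis continuous_on_eq_continuous_at open_UNIV UNIV_I)
 moreover have "closed {T :: 'a oper. T $$ (c *\<^sub>C x) = cj b c *\<^sub>C T $$ x}" for c x
  by(intro closed_Collect_eq continuous_intros)
 moreover have "closed {T :: 'a oper. T $$ x = 0}" for x
  by(intro closed_Collect_eq continuous_intros)
 ultimately show ?thesis unfolding e by blast
qed

section \<open>Unitary operators\<close>

lemma unitary_opD:
 assumes "csub H" "csub H'" "unitary_op b H H' U"
 shows "U:bop b H H'" "adj U:bop b H' H" "adj U oL U = idop H" "U oL adj U = idop H'"
  "x:H ==> adj U $$ U $$ x = x"
  "y:H' ==> U $$ adj U $$ y = y"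
  "unitary_op b H' H (adj U)"
proof -
 show *: "U:bop b H H'" "adj U oL U = idop H" "U oL adj U = idop H'"
  using assms(3) by(auto simp: unitary_op_def)
 show "adj U:bop b H' H" using adj_bop assms * by blast
 thus "unitary_op b H' H (adj U)" using * by(simp add: unitary_op_def)
 show "x:H ==> adj U $$ U $$ x = x"
  using *(2) by(metis assms(1) blinfun_apply_blinfun_compose idop_in)
 show "y:H' ==> U $$ adj U $$ y = y"
  using *(3) by(metis assms(2) blinfun_apply_blinfun_compose idop_in)
qed

lemma unitary_cinner:
 assumes "csub H" "csub H'" "unitary_op b H H' U" "x:H" "y:H"
 shows "ip (U $$ x) (U $$ y) = cj b (ip x y)"
 using assms by(simp add: bop_cinner[OF unitary_opD(1)[OF assms(1-3)]] unitary_opD(5)[OF assms(1-3)])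

lemma unitary_norm:
 assumes "csub H" "csub H'" "unitary_op b H H' U" "x:H"
 shows "norm (U $$ x) = norm x"
 using unitary_cinner[OF assms assms(4)] by(simp add: cinner_self flip: of_real_power)

section \<open>Square roots by fixed point iteration\<close>

text \<open>The map \<open>t \<mapsto> (x + t t)/2\<close> sends the selfadjoint ball of radius
  \<open>norm x\<close> into itself and contracts it by the factor \<open>norm x < 1\<close>.
  Solving for \<open>t\<close>, not for \<open>1 - t\<close>, keeps everything inside
  \<open>A\<close>, which may lack a unit.\<close>

lemma sqrt_fixpoint:
 fixes A :: "'h::complex_hilbert oper set"
 assumes A: "subspace A" "closed A" "!!a b. a:A ==> b:A ==> a oL b:A"
  and x: "x:A" "adj x = x" "norm x < 1"
 shows "EX t:A. adj t = t & 2 *\<^sub>R t - (t oL t) = x"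
proof -
 define S where "S = {t:A. adj t = t & norm t <= norm x}"
 define f where "f t = (1/2) *\<^sub>R (x + (t oL t))" for t
 have "closed S"
 proof -
  have "S = A \<inter> {t. adj t = t} \<inter> {t. norm t <= norm x}" by(auto simp: S_def)
  thus ?thesis
  by(auto intro!: closed_Int A(2) closed_Collect_eq closed_Collect_le continuous_intros
  bounded_linear.continuous_on[OF bounded_linear_adj])
 qed
 hence "complete S" by(simp add: complete_eq_closed)
 moreover have "S ~= {}" using x by(auto simp: S_def)
 moreover have "f ` S <= S"
 proof (clarsimp simp: S_def)
  fix t assume t: "t:A" "adj t = t" "norm t <= norm x"
  have "norm (f t) <= (1/2) * (norm x + norm t * norm t)"
  unfolding f_def using norm_blinfun_compose[of t t] norm_triangle_ineq[of x "t oL t"] by simp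
  also have "... <= (1/2) * (norm x + norm x * 1)"
  using t x by(intro mult_left_mono add_left_mono mult_mono) auto
  finally show "f t:A & adj (f t) = f t & norm (f t) <= norm x"
  using t x A by(auto simp: f_def adj_scaleR adj_add adj_comp intro!: subspace_mul subspace_add)
 qed
 moreover have "dist (f t) (f u) <= norm x * dist t u" if tu: "t:S" "u:S" for t u
 proof -
  have "f t - f u = (1/2) *\<^sub>R ((t oL (t - u)) + ((t - u) oL u))"
  by(simp add: f_def blinfun_compose_diff_left blinfun_compose_diff_right scaleR_diff_right scaleR_add_right)
  hence "norm (f t - f u) <= (1/2) * (norm t * norm (t - u) + norm (t - u) * norm u)"
  using norm_triangle_ineq[of "t oL (t - u)" "(t - u) oL u"] norm_blinfun_compose[of t "t - u"]
  norm_blinfun_compose[of "t - u" u] by simp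
  also have "... <= (1/2) * (norm x * norm (t - u) + norm (t - u) * norm x)"
  using tu by(intro mult_left_mono add_mono mult_mono) (auto simp: S_def)
  finally show ?thesis by(simp add: dist_norm mult.commute)
 qed
 ultimately obtain t where t: "t:S" "f t = t"
  using Banach_fix[of S "norm x" f] x by auto
 have "2 *\<^sub>R t - (t oL t) = 2 *\<^sub>R f t - (t oL t)" using t by simp
 also have "... = x" by(simp add: f_def)
 finally show ?thesis using t by(auto simp: S_def)
qed

text \<open>With \<open>s = 1 - t\<close> the fixed point provides the square root \<open>s\<close> of \<open>1 - x\<close> in the unitization.\<close>

lemma sqrt_fixpoint_norm:
 assumes "adj t = t" "2 *\<^sub>R t - (t oL t) = x"
 shows "(norm (v - t $$ v))^2 = (norm v)^2 - inner v (x $$ v)"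
proof -
 have "inner (t $$ v) v = inner v (t $$ v)" by(simp add: inner_commute)
 moreover have "inner (t $$ v) (t $$ v) = inner v (t $$ t $$ v)"
  using assms(1) by(simp add: adj_inner)
 ultimately show ?thesis unfolding assms(2)[symmetric] power2_norm_eq_inner
  by(simp add: inner_diff_left inner_diff_right blinfun.diff_left blinfun.scaleR_left)
qed

text \<open>Automatic contractivity: \<open>1 - f(x) = (1 - f(t))\<^sup>2 \<ge> 0\<close> if \<open>1 - x = (1 - t)\<^sup>2\<close>.\<close>

lemma star_antihom_contractive:
 fixes A :: "'h::complex_hilbert oper set"
 assumes A: "subspace A" "closed A" "!!a b. a:A ==> b:A ==> a oL b:A" "!!a. a:A ==> adj a:A"
  and B: "A <= B" and f: "star_antihom B C f" and a: "a:A"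
 shows "norm (f a) <= norm a"
proof -
 have fadd: "f (x + y) = f x + f y" and fmul: "f (x oL y) = f y oL f x" and fadj: "f (adj x) = adj (f x)"
  and fscl: "f (r *\<^sub>R x) = r *\<^sub>R f x" if "x:A" "y:A" for x y r
  using subsetD[OF B that(1)] subsetD[OF B that(2)] f
  unfolding star_antihom_def op_linear_on_def by(simp_all flip: scl_of_real)
 have 1: "norm (f a) <= 1" if a: "a:A" "norm a < 1" for a
 proof -
  define x where "x = adj a oL a"
  have x: "x:A" "adj x = x" "norm x < 1"
  using a A by(auto simp: x_def adj_comp norm_adj_comp power_less_one_iff)
  obtain t where t: "t:A" "adj t = t" "2 *\<^sub>R t - (t oL t) = x"
  using sqrt_fixpoint[OF A(1-3) x] by blast
  have tt: "t oL t:A" "2 *\<^sub>R t:A" using A t by(auto intro: subspace_mul)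
  have "f (2 *\<^sub>R t) = f (x + (t oL t))" using t(3) by(metis diff_add_cancel)
  hence "2 *\<^sub>R f t - (f t oL f t) = f x" using fadd[OF x(1) tt(1)] fscl t(1) fmul by(simp add: algebra_simps)
  moreover have "adj (f t) = f t" using fadj t by metis
  moreover have fx: "f x = f a oL adj (f a)" using fmul fadj a A by(simp add: x_def)
  ultimately have "(norm (adj (f a) $$ v))^2 <= (norm v)^2" for v
  using sqrt_fixpoint_norm[of "f t" "f x" v] zero_le_power2[of "norm (v - f t $$ v)"]
  by(simp add: dot_square_norm[symmetric] adj_inner2)
  hence "norm (adj (f a)) <= 1"
  by(intro norm_blinfun_bound) (auto simp: power2_le_iff_abs_le)
  thus ?thesis by simp
 qed
 show ?thesis
 proof (rule field_le_epsilon)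
  fix e :: real assume e: "0 < e"
  \<comment> \<open>The case just settled asks for norm strictly below \<open>1\<close>, hence the
    margin \<open>e\<close> in the normalization.\<close>
  define r where "r = norm a + e"
  have r: "r > 0" using e by(simp add: r_def add_nonneg_pos)
  have "norm (f ((1/r) *\<^sub>R a)) <= 1"
  using r e a A(1) by(intro 1) (auto simp: subspace_mul r_def)
  thus "norm (f a) <= norm a + e"
  using r fscl[OF a a] by(simp add: divide_simps r_def split: if_splits)
 qed
qed

section \<open>Extension of bounded linear relations\<close>

text \<open>The bound makes the relation single valued and extends it to the closure of its domain;
  on the orthogonal complement the value is \<open>0\<close>. Starting from a graph avoids choosing
  a representation of a vector as a sum of elementary tensors.\<close>

lemma extend_from_graph:
 fixes G :: "('a::{real_inner, complete_space} \<times> 'b::banach) set"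
 assumes G: "subspace G" and bd: "!!u v. (u, v):G ==> norm v <= C * norm u" and C: "0 <= C"
 shows "EX X :: 'a \<Rightarrow>\<^sub>L 'b. (ALL u v. (u, v):G --> X $$ u = v) &
  (ALL z. (ALL u:fst ` G. inner z u = 0) --> X $$ z = 0) &
  (ALL z. X $$ z:closure (snd ` G)) & norm X <= C"
proof -
 let ?G = "closure G"
 have sG: "subspace ?G" by(rule subspace_closure[OF G])
 have bd': "norm v <= C * norm u" if "(u, v):?G" for u v
 proof -
  have "closed {p :: 'a \<times> 'b. norm (snd p) <= C * norm (fst p)}"
  by(intro closed_Collect_le continuous_intros)
  moreover have "G <= {p. norm (snd p) <= C * norm (fst p)}" using bd by auto
  ultimately have "?G <= {p. norm (snd p) <= C * norm (fst p)}" by(intro closure_minimal)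
  thus ?thesis using that by auto
 qed
 define D where "D = fst ` ?G"
 have D: "subspace D"
  unfolding D_def by(intro linear_subspace_image sG bounded_linear.linear bounded_linear_fst)
 have Dc: "closed D"
 proof (rule closed_sequential_limits[THEN iffD2], intro allI impI, elim conjE)
  fix x l assume x: "ALL n. x n:D" "x \<longlonglongrightarrow> l"
  have "EX v. (x n, v):?G" for n using x(1)[rule_format, of n] unfolding D_def by auto
  then obtain v where v: "!!n. (x n, v n):?G" by metis
  have est: "dist (v m) (v n) <= C * dist (x m) (x n)" for m n
  using bd'[of "x m - x n" "v m - v n"] subspace_diff[OF sG v[of m] v[of n]] by(simp add: dist_norm)
  have "Cauchy v"
  proof (rule metric_CauchyI)
  fix e :: real assume e: "0 < e"
  obtain M where M: "!!m n. m >= M ==> n >= M ==> dist (x m) (x n) < e / (C + 1)"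
  using metric_CauchyD[OF LIMSEQ_imp_Cauchy[OF x(2)], of "e / (C + 1)"] e C by auto
  have "dist (v m) (v n) < e" if "m >= M" "n >= M" for m n
  proof -
  have "C * dist (x m) (x n) <= C * (e / (C + 1))" using M[OF that] C by(intro mult_left_mono) auto
  also have "... < e" using C e by(simp add: field_simps)
  finally show ?thesis using est[of m n] by simp
  qed
  thus "EX M. ALL m>=M. ALL n>=M. dist (v m) (v n) < e" by blast
  qed
  then obtain w where "v \<longlonglongrightarrow> w" using Cauchy_convergent convergent_def by blast
  hence "(%n. (x n, v n)) \<longlonglongrightarrow> (l, w)" by(intro tendsto_Pair x)
  hence "(l, w):?G" using closed_sequentially[OF closed_closure v] by simp
  thus "l:D" by(force simp: D_def)
 qed
 \<comment> \<open>\<open>v\<close> is the value of the closed graph at the projection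
   \<open>p\<close> of \<open>z\<close> onto the closed domain \<open>D\<close>.\<close>
 define r where "r z v \<longleftrightarrow> (EX p. (p, v):?G & (ALL y:D. inner (z - p) y = 0))" for z v
 have ex: "EX v. r z v" for z
  using proj_exists[OF D Dc, of z] unfolding r_def D_def by force
 have radd: "r (z + z') (v + v')" if zv: "r z v" "r z' v'" for z z' v v'
 proof -
  obtain p p' where p: "(p, v):?G" "ALL y:D. inner (z - p) y = 0" "(p', v'):?G" "ALL y:D. inner (z' - p') y = 0"
  using zv r_def by blast
  have "(p + p', v + v'):?G" using subspace_add[OF sG p(1,3)] by simp
  moreover have "ALL y:D. inner (z + z' - (p + p')) y = 0"
  using p by(simp add: inner_diff_left inner_add_left)
  ultimately show ?thesis using r_def by blast
 qed
 have rscale: "r (c *\<^sub>R z) (c *\<^sub>R v)" if zv: "r z v" for c z v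
 proof -
  obtain p where p: "(p, v):?G" "ALL y:D. inner (z - p) y = 0" using zv r_def by blast
  have "(c *\<^sub>R p, c *\<^sub>R v):?G" using subspace_mul[OF sG p(1)] by simp
  moreover have "ALL y:D. inner (c *\<^sub>R z - c *\<^sub>R p) y = 0"
  using p by(simp add: inner_diff_left)
  ultimately show ?thesis using r_def by blast
 qed
 have rnorm: "norm v <= C * norm z" if zv: "r z v" for z v
 proof -
  obtain p where p: "(p, v):?G" "ALL y:D. inner (z - p) y = 0" using zv r_def by blast
  have "inner (z - p) p = 0" using p by(force simp: D_def)
  hence "(norm p)^2 <= (norm z)^2"
  using inner_ge_zero[of "z - p"] unfolding power2_norm_eq_inner
  by(simp add: inner_diff_left inner_diff_right inner_commute)
  hence "norm p <= norm z" by(rule power2_le_imp_le) simp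
  hence "C * norm p <= C * norm z" using C by(rule mult_left_mono)
  thus ?thesis using bd'[OF p(1)] by simp
 qed
 have runique: "v = v'" if "r z v" "r z v'" for z v v'
  using rnorm[OF radd[OF that(1) rscale[OF that(2), of "-1"]]] by simp
 define f where "f z = (THE v. r z v)" for z
 have f: "r z (f z)" for z unfolding f_def using ex runique by(metis theI)
 have feq: "r z v ==> f z = v" for z v using runique f by blast
 have bl: "bounded_linear f"
  by(rule bounded_linear_intro[where K = C])
  (auto intro!: feq radd rscale f simp: mult.commute intro: order_trans[OF rnorm[OF f]])
 have [simp]: "Blinfun f $$ z = f z" for z by(rule bounded_linear_Blinfun_apply[OF bl, THEN fun_cong])
 show ?thesis
 proof (intro exI[of _ "Blinfun f"] conjI allI impI)
  fix u v assume "(u, v):G"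
  hence "(u, v):?G" by(rule subsetD[OF closure_subset])
  hence "r u v" unfolding r_def by(intro exI[of _ u]) simp
  thus "Blinfun f $$ u = v" by(simp add: feq)
 next
  fix z assume z: "ALL u:fst ` G. inner z u = 0"
  have "inner z y = 0" if "y:D" for y
  proof -
  have "closed {p :: 'a \<times> 'b. inner z (fst p) = 0}" by(intro closed_Collect_eq continuous_intros)
  hence "?G <= {p. inner z (fst p) = 0}" using z by(intro closure_minimal) auto
  thus ?thesis using that by(auto simp: D_def)
  qed
  hence "r z 0" unfolding r_def
  using subspace_0[OF sG] by(intro exI[of _ 0]) (simp add: zero_prod_def)
  thus "Blinfun f $$ z = 0" by(simp add: feq)
 next
  fix z
  obtain p where p: "(p, f z):?G" using f[of z] r_def by blast
  have "snd ` ?G <= closure (snd ` G)"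
  by(intro image_closure_subset continuous_intros closed_closure closure_subset)
  thus "Blinfun f $$ z:closure (snd ` G)" using imageI[OF p, of snd] by auto
 next
  show "norm (Blinfun f) <= C"
  by(intro norm_blinfun_bound C) (simp add: rnorm[OF f])
 qed
qed

lemma span_finite_sum:
 fixes B :: "'a::real_vector set"
 assumes B: "!!r b. b:B ==> r *\<^sub>R b:B" and z: "z:span B"
 shows "EX (n::nat) f. (ALL i<n. f i:B) & z = (SUM i<n. f i)"
 using z
proof (induction rule: span_induct_alt)
 case base
 show ?case by(intro exI[of _ 0]) auto
next
 case (step r x y)
 then obtain n :: nat and f where f: "ALL i<n. f i:B" "y = (SUM i<n. f i)" by blast
 show ?case
  using f B step
  by(intro exI[of _ "Suc n"] exI[of _ "%i. if i < n then f i else r *\<^sub>R x"]) auto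
qed

text \<open>The reversed graph of \<open>A\<close> is bounded by the first estimate, so the inverse
  exists on the closure of the range; the second estimate, for \<open>adj A\<close>, leaves no room
  orthogonal to the range. The lemma supplies the resolvents behind
  \<open>tpositive\<close>.\<close>

lemma bounded_below_invertible:
 assumes H: "csub H" and A: "A:blin H H" and c: "0 < c"
  and lb: "!!x. x:H ==> c * norm x <= norm (A $$ x)"
  "!!x. x:H ==> c * norm x <= norm (adj A $$ x)"
 shows "EX B:blin H H. B oL A = idop H & A oL B = idop H"
proof -
 define G where "G = (%x. (A $$ x, x)) ` H"
 have G: "subspace G"
  unfolding G_def
  by(intro linear_subspace_image csubD(1)[OF H] bounded_linear.linear bounded_linear_Pair
  bl_right bounded_linear_ident)
 have bd: "norm v <= (1/c) * norm u" if "(u, v):G" for u v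
  using that lb(1) c by(auto simp: G_def field_simps)
 have "0 <= 1/c" using c by simp
 then obtain X where XG: "ALL u v. (u, v):G --> X $$ u = v"
  and X: "ALL z. (ALL u:fst ` G. inner z u = 0) --> X $$ z = 0"
  "ALL z. X $$ z:closure (snd ` G)"
  using extend_from_graph[OF G bd] by blast
 have XA: "X $$ A $$ x = x" if "x:H" for x
  using XG that by(simp add: G_def)
 have XH: "X $$ z:H" for z
  using X(2)[rule_format, of z] csubD(2)[OF H] by(simp add: G_def image_image)
 have inj: "x = y" if "x:H" "y:H" "A $$ x = A $$ y" for x y
  using XA that by metis
 define S where "S = closure (blinfun_apply A ` H)"
 have S: "subspace S" "closed S"
  unfolding S_def
  by(auto intro!: subspace_closure linear_subspace_image csubD(1)[OF H] bounded_linear.linear bl_right)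
 have AX: "A $$ X $$ y = y" if y: "y:H" for y
 proof -
  obtain p where p: "p:S" "ALL z:S. inner (y - p) z = 0" using proj_exists[OF S] by blast
  have "S <= H" unfolding S_def
  using csubD(2)[OF H] bop_in[OF A] by(intro closure_minimal) auto
  hence yp: "y - p:H" using p y csubD(6)[OF H] by blast
  have yp0: "inner (adj A $$ (y - p)) z = 0" if "z:H" for z
  proof -
  have "A $$ z:S" unfolding S_def by(rule subsetD[OF closure_subset imageI[OF that]])
  thus ?thesis using p(2) unfolding adj_inner2[symmetric] by blast
  qed
  have "adj A $$ (y - p) = 0"
  using yp0[OF bop_in[OF adj_bop[OF H A]], of "y - p"] by(simp only: inner_eq_zero_iff)
  hence "c * norm (y - p) <= 0" using lb(2)[OF yp] by simp
  hence "y = p" using c by(simp add: mult_le_0_iff)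
  hence yS: "y:S" using p by simp
  have "closed {z. A $$ X $$ z = z}"
  by(intro closed_Collect_eq continuous_intros)
  hence "S <= {z. A $$ X $$ z = z}"
  unfolding S_def using XA by(intro closure_minimal) auto
  thus ?thesis using yS by blast
 qed
 have X0: "X $$ z = 0" if "orth H z" for z
  using that bop_in[OF A] by(intro X(1)[rule_format]) (auto simp: G_def orth_iff_inner[OF H])
 have Xproj: "X $$ proj_on H z = X $$ z" for z
  using X0[OF proj_on(2)[OF H, of z]] by(simp add: blinfun.diff_right)
 have XB: "X:blin H H"
 proof (rule bopI)
  fix k z
  have pk: "proj_on H (k *\<^sub>C z) = k *\<^sub>C proj_on H z"
  using bop_scaleC[OF idop_bop[OF H], of k z] by(simp add: idop_apply[OF H])
  have "X $$ (k *\<^sub>C proj_on H z) = k *\<^sub>C X $$ proj_on H z"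
  by(rule inj) (auto simp: XH csubD[OF H] AX proj_on[OF H] bop_scaleC[OF A])
  thus "X $$ (k *\<^sub>C z) = cj False k *\<^sub>C X $$ z"
  by(metis pk Xproj cj_simps(1))
 qed (auto simp: X0 XH)
 moreover have "X oL A = idop H"
  by(rule bop_eqI[OF H bop_comp[OF A XB] idop_bop[OF H]]) (simp add: XA idop_in[OF H])
 moreover have "A oL X = idop H"
  by(rule bop_eqI[OF H bop_comp[OF XB A] idop_bop[OF H]]) (simp add: AX idop_in[OF H])
 ultimately show ?thesis by blast
qed

section \<open>Tensor products of operators\<close>

lemma eq_on_closure_span:
 assumes "bounded_linear f" "bounded_linear g" "!!x. x:B ==> f x = g x" "z:closure (span B)"
 shows "f z = g z"
proof -
 interpret f: bounded_linear f by fact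
 interpret g: bounded_linear g by fact
 have "f x = g x" if "x:span B" for x
  using that by(induction rule: span_induct_alt) (auto simp: f.zero g.zero f.add g.add f.scaleR g.scaleR assms(3))
 moreover have "closed {x. f x = g x}"
  by(intro closed_Collect_eq f.continuous_on g.continuous_on continuous_on_id)
 ultimately have "closure (span B) <= {x. f x = g x}" by(intro closure_minimal) auto
 thus ?thesis using assms(4) by blast
qed

text \<open>\<open>s\<close> is the square root of \<open>r\<^sup>2 - adj T T\<close>, available
  through \<open>sqrt_fixpoint\<close> because \<open>norm T < r\<close>. It writes Gram matrices of
  \<open>T\<close>-images as differences of Gram matrices, which is how tensor products of operators
  are bounded below.\<close>

lemma gram_sqrt:
 assumes H: "csub H" "csub H'" and T: "T:bop b H H'" and r: "norm T < r"
 shows "EX s:blin H H. norm s <= r & (ALL x:H. ALL y:H. ip (s $$ x) (s $$ y)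
  = cor (r\<^sup>2) * ip x y - cj b (ip (T $$ x) (T $$ y)))"
proof -
 have r0: "0 < r" using r norm_ge_zero[of T] by linarith
 define x where "x = (1/r\<^sup>2) *\<^sub>R (adj T oL T)"
 have TT: "adj T oL T:blin H H" using bop_comp[OF T adj_bop[OF H(1) T]] by simp
 have xb: "x:blin H H" unfolding x_def by(rule bop_scaleR[OF H(1) TT])
 have "(norm T)^2 < r\<^sup>2" using r by(intro power_strict_mono) auto
 hence nx: "norm x < 1" using r0 by(simp add: x_def norm_adj_comp)
 have ax: "adj x = x" by(simp add: x_def adj_scaleR adj_comp)
 obtain t where t: "t:blin H H" "adj t = t" "2 *\<^sub>R t - (t oL t) = x"
  using sqrt_fixpoint[OF subspace_bop[OF H(1)] closed_bop[OF H(1)] _ xb ax nx] bop_comp by fastforce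
 define s where "s = r *\<^sub>R (idop H - t)"
 have s: "s:blin H H" unfolding s_def by(intro bop_scaleR bop_diff H idop_bop t)
 have eq: "ip (s $$ u) (s $$ v)
  = cor (r\<^sup>2) * ip u v - cj b (ip (T $$ u) (T $$ v))" if "u:H" "v:H" for u v
 proof -
  have "x $$ v = 2 *\<^sub>R t $$ v - t $$ t $$ v"
  unfolding t(3)[symmetric] by(simp add: blinfun.diff_left blinfun.scaleR_left)
  hence "ip (u - t $$ u) (v - t $$ v) = ip u v - ip u (x $$ v)"
  using bop_cinner[OF t(1)]
  by(simp add: cinner_diff_left cinner_diff_right t(2) cinner_scaleR_right)
  moreover have "ip u (x $$ v) = (1/r\<^sup>2) * cj b (ip (T $$ u) (T $$ v))"
  using bop_cinner[OF T, of u "T $$ v"]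
  by(simp add: x_def blinfun.scaleR_left cinner_scaleR_right)
  moreover have "ip (s $$ u) (s $$ v) = r * (r * ip (u - t $$ u) (v - t $$ v))"
  proof -
  have "s $$ w = r *\<^sub>R (w - t $$ w)" if "w:H" for w
  using that by(simp add: s_def blinfun.scaleR_left blinfun.diff_left idop_in[OF H(1)])
  thus ?thesis
  using \<open>u \<in> H\<close> \<open>v \<in> H\<close> by(simp add: cinner_scaleR_left cinner_scaleR_right)
  qed
  ultimately show ?thesis using r0
  by(simp add: power2_eq_square field_simps)
 qed
 have "norm s <= r"
 proof (rule norm_blinfun_bound)
  fix v
  have pv: "proj_on H v:H" using proj_on[OF H(1)] by blast
  have "cor ((norm (s $$ v))^2) = cor (r\<^sup>2 * (norm (proj_on H v))^2
  - (norm (T $$ proj_on H v))\<^sup>2)"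
  using eq[OF pv pv] by(simp add: bop_proj[OF H(1) s] cinner_self flip: of_real_power)
  hence "(norm (s $$ v))^2 <= r\<^sup>2 * (norm (proj_on H v))^2"
  by(metis add_diff_cancel_left' add_increasing2 diff_add_cancel le_add_diff_inverse of_real_eq_iff order_refl zero_le_power2 diff_le_eq)
  also have "... <= (r * norm v)^2"
  using norm_proj_on_le[OF H(1), of v] r0 by(simp add: power_mult_distrib mult_left_mono power_mono)
  finally show "norm (s $$ v) <= r * norm v" by(rule power2_le_imp_le) (use r0 in simp)
 qed (use r0 in simp)
 thus ?thesis using s eq by(intro bexI[of _ s]) auto
qed

text \<open>The vanishing clause of \<open>bop\<close> alone. Together with the values on elementary
  tensors it determines an operator, and it passes to composites whatever the left factor
  is.\<close>

definition zorth :: "'h::complex_hilbert set => 'h oper => bool" where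
 "zorth H X \<longleftrightarrow> (ALL z. orth H z --> X $$ z = 0)"

lemma zorth_bop: "X:bop b H H' ==> zorth H X"
 by(simp add: zorth_def bop_orth)

lemma zorth_oo: "zorth H T ==> zorth H (S oL T)"
 by(simp add: zorth_def)

lemma zorth_add: "zorth H T ==> zorth H S ==> zorth H (S + T)"
 by(simp add: zorth_def blinfun.add_left)

lemma zorth_scl: "zorth H T ==> zorth H (scl c T)"
 by(simp add: zorth_def scl_apply)

lemma blin_comp: "T:blin H H' ==> S:blin H' H'' ==> S oL T:blin H H''"
 using bop_comp[of T False H H' S False H''] by simp

context strict_hilb_cat begin

abbreviation (input) sp where "sp \<equiv> hsp D"
abbreviation (input) tn where "tn \<equiv> htens D"
abbreviation (input) vc where "vc \<equiv> hvec D"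
abbreviation (input) "Ob == hobj D"
abbreviation (input) "hI == hid D"
abbreviation (input) "hf == hflip D"
abbreviation (input) "l23 == leg23 D"
abbreviation (input) "l13 == leg13 D"
abbreviation (input) "l12 == leg12 D"
abbreviation (input) "ot == optens D"
abbreviation (input) BL where "BL a b \<equiv> blin (sp a) (sp b)"

lemma hvec_in: "[|a:Ob; b:Ob; x:sp a; y:sp b|] ==> vc a b x y:sp (tn a b)"
 by(simp add: hsp_htens, rule subsetD[OF closure_subset], rule span_base) blast

lemma norm_hvec: "[|a:Ob; b:Ob; x:sp a; y:sp b|] ==> norm (vc a b x y) = norm x * norm y"
proof -
 assume *: "a:Ob" "b:Ob" "x:sp a" "y:sp b"
 have "(norm (vc a b x y))^2 = (norm x * norm y)^2"
  using hvec_cinner[OF *(1,2,3,3,4,4)]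
  by(simp add: cinner_self power_mult_distrib flip: of_real_power of_real_mult)
 thus ?thesis by simp
qed

lemma hvec_scaleR: "[|a:Ob; b:Ob; x:sp a; y:sp b|] ==> vc a b (r *\<^sub>R x) y = r *\<^sub>R vc a b x y"
 "[|a:Ob; b:Ob; x:sp a; y:sp b|] ==> vc a b x (r *\<^sub>R y) = r *\<^sub>R vc a b x y"
 by(simp_all add: scaleR_scaleC hvec_scaleC_left hvec_scaleC_right)

lemma eq_on_tensor:
 assumes ab: "a:Ob" "b:Ob" and f: "bounded_linear f" "bounded_linear g"
  and eq: "!!x y. x:sp a ==> y:sp b ==> f (vc a b x y) = g (vc a b x y)" and z: "z:sp (tn a b)"
 shows "f z = g z"
 by(rule eq_on_closure_span[OF f, of "{vc a b x y |x y. x:sp a & y:sp b}"])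
  (use eq z hsp_htens[OF ab] in auto)

lemma tens_ext:
 assumes ab: "a:Ob" "b:Ob" and X: "zorth (sp (tn a b)) X" "zorth (sp (tn a b)) Y"
  and eq: "!!x y. x:sp a ==> y:sp b ==> X $$ vc a b x y = Y $$ vc a b x y"
 shows "X = Y"
proof (rule blinfun_eqI)
 fix z
 let ?p = "proj_on (sp (tn a b)) z"
 have p: "?p:sp (tn a b)" "orth (sp (tn a b)) (z - ?p)" using proj_on[OF hsp[OF htens[OF ab]]] by auto
 have "X $$ ?p = Y $$ ?p"
  by(rule eq_on_tensor[OF ab bl_right bl_right eq p(1)])
 moreover have "X $$ (z - ?p) = 0" "Y $$ (z - ?p) = 0"
  using X p(2) by(auto simp: zorth_def)
 ultimately show "X $$ z = Y $$ z" by(simp add: blinfun.diff_right)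
qed

lemma tens_total:
 assumes ab: "a:Ob" "b:Ob" and u: "u:sp (tn a b)" "v:sp (tn a b)"
  and eq: "!!x y. x:sp a ==> y:sp b ==> ip (vc a b x y) u = ip (vc a b x y) v"
 shows "u = v"
proof -
 have bl: "bounded_linear (%z. inner z w)" for w :: 'h by(rule bounded_linear_inner_left)
 have "inner z u = inner z v" if "z:sp (tn a b)" for z
  by(rule eq_on_tensor[OF ab bl bl _ that]) (simp add: inner_eq_Re_cinner eq)
 hence "inner (u - v) (u - v) = 0"
  using csubD(6)[OF hsp[OF htens[OF ab]] u] by(simp add: inner_diff_right)
 thus ?thesis by simp
qed

text \<open>The bound on finite sums already forces bilinearity, since a linear relation among
  elementary tensors makes its right-hand side \<open>0\<close>. Homogeneity in one variable keeps
  the generating set stable under real scalars and gives the (anti)linearity of the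
  extension.\<close>

lemma tensor_map_exists:
 assumes ab: "a:Ob" "b:Ob" and Z: "csub Z" and C: "0 <= C"
  and bd: "!!(n::nat) xs ys. (!!i. i < n ==> xs i:sp a & ys i:sp b) ==>
  norm (SUM i<n. f (xs i) (ys i)) <= C * norm (SUM i<n. vc a b (xs i) (ys i))"
  and sc: "!!c x y. x:sp a ==> y:sp b ==> f (c *\<^sub>C x) y = cj be c *\<^sub>C f x y"
  and rg: "!!x y. x:sp a ==> y:sp b ==> f x y:Z"
 shows "EX X:bop be (sp (tn a b)) Z. (ALL x:sp a. ALL y:sp b. X $$ vc a b x y = f x y) & norm X <= C"
proof -
 define B where "B = {(vc a b x y, f x y) |x y. x:sp a & y:sp b}"
 have Bs: "r *\<^sub>R p:B" if "p:B" for r p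
 proof -
  obtain x y where xy: "x:sp a" "y:sp b" "p = (vc a b x y, f x y)" using \<open>p \<in> B\<close> by(auto simp: B_def)
  hence "r *\<^sub>R p = (vc a b (r *\<^sub>R x) y, f (r *\<^sub>R x) y)"
  using ab sc[of x y "cor r"] by(simp add: hvec_scaleR scaleC_of_real)
  thus ?thesis using xy csubD(8)[OF hsp[OF ab(1)]] by(auto simp: B_def)
 qed
 have bdG: "norm v <= C * norm u" if "(u, v):span B" for u v
 proof -
  obtain n :: nat and p where p: "ALL i<n. p i:B" "(u, v) = (SUM i<n. p i)"
  using span_finite_sum[OF Bs \<open>(u, v) \<in> span B\<close>] by blast
  have "EX x y. x:sp a & y:sp b & p i = (vc a b x y, f x y)" if "i < n" for i
  using p(1) that unfolding B_def by blast
  then obtain xs ys where xy: "!!i. i < n ==> xs i:sp a & ys i:sp b & p i = (vc a b (xs i) (ys i), f (xs i) (ys i))"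
  by metis
  have "u = (SUM i<n. fst (p i))" "v = (SUM i<n. snd (p i))"
  using p(2) by(metis fst_conv fst_sum, metis snd_conv snd_sum)
  thus ?thesis using bd[of n xs ys] xy by simp
 qed
 obtain X where X: "ALL u v. (u, v):span B --> X $$ u = v"
  "ALL z. (ALL u:fst ` span B. inner z u = 0) --> X $$ z = 0"
  "ALL z. X $$ z:closure (snd ` span B)" "norm X <= C"
  using extend_from_graph[OF subspace_span bdG C] by blast
 have val: "X $$ vc a b x y = f x y" if "x:sp a" "y:sp b" for x y
 proof -
  have "(vc a b x y, f x y):span B" using that by(intro span_base) (auto simp: B_def)
  thus ?thesis using X(1) by blast
 qed
 have H: "csub (sp (tn a b))" using hsp htens ab by blast
 have fsp: "fst ` span B <= sp (tn a b)"
 proof -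
  have "fst ` span B = span (fst ` B)" by(rule linear_span_image[symmetric]) (rule linear_fst)
  also have "... <= sp (tn a b)"
  using hvec_in[OF ab] by(intro span_minimal csubD(1)[OF H]) (auto simp: B_def)
  finally show ?thesis .
 qed
 have ssp: "closure (snd ` span B) <= Z"
 proof -
  have "snd ` span B = span (snd ` B)" by(rule linear_span_image[symmetric]) (rule linear_snd)
  also have "... <= Z"
  using rg by(intro span_minimal csubD(1)[OF Z]) (auto simp: B_def)
  finally show ?thesis by(intro closure_minimal csubD(2)[OF Z])
 qed
 have X0: "X $$ z = 0" if "orth (sp (tn a b)) z" for z
  using that fsp unfolding orth_iff_inner[OF H] by(intro X(2)[rule_format]) blast
 have "X:bop be (sp (tn a b)) Z"
 proof (rule bopI)
  fix c z
  have on: "X $$ (c *\<^sub>C u) = cj be c *\<^sub>C X $$ u" if "u:sp (tn a b)" for u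
  using that
  proof (rule eq_on_tensor[OF ab, rotated -1])
  show "bounded_linear (%u. X $$ (c *\<^sub>C u))" "bounded_linear (%u. cj be c *\<^sub>C X $$ u)"
  by(intro bounded_linear_compose[OF bl_right bounded_linear_scaleC_right]
  bounded_linear_compose[OF bounded_linear_scaleC_right bl_right])+
  fix x y assume xy: "x:sp a" "y:sp b"
  have "c *\<^sub>C vc a b x y = vc a b (c *\<^sub>C x) y" using hvec_scaleC_left[OF ab xy] by simp
  thus "X $$ (c *\<^sub>C vc a b x y) = cj be c *\<^sub>C X $$ vc a b x y"
  using val xy csubD(7)[OF hsp[OF ab(1)] xy(1)] sc[OF xy] by simp
  qed
  let ?p = "proj_on (sp (tn a b)) z"
  have p: "?p:sp (tn a b)" "orth (sp (tn a b)) (z - ?p)" using proj_on[OF H] by auto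
  have "X $$ (c *\<^sub>C (z - ?p)) = 0" "X $$ (z - ?p) = 0"
  using X0 p(2) orth_scaleC by blast+
  thus "X $$ (c *\<^sub>C z) = cj be c *\<^sub>C X $$ z"
  using on[OF p(1)] by(simp add: blinfun.diff_right scaleC_diff_right)
 qed (use X0 X(3) ssp in auto)
 thus ?thesis using val X(4) by blast
qed

lemma norm_tensor_sum:
 assumes "a:Ob" "b:Ob" "!!i. i < (n::nat) ==> xs i:sp a & ys i:sp b"
 shows "cor ((norm (SUM i<n. vc a b (xs i) (ys i)))^2)
  = (SUM i<n. SUM j<n. ip (xs i) (xs j) * ip (ys i) (ys j))"
 unfolding norm_sum_square using assms by(intro sum.cong refl) (simp add: hvec_cinner)

text \<open>With \<open>s\<close> the square root of \<open>r\<^sup>2 - adj S S\<close>, the squared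
  norm of the sum with \<open>s\<close> applied to the \<open>ys\<close> is \<open>r\<^sup>2\<close>
  times the squared norm of the given sum minus that of its image under
  \<open>1 \<otimes> S\<close>. Being nonnegative, it yields the bound.\<close>

lemma right_tensor_bound:
 assumes o: "a:Ob" "b:Ob" "b':Ob" and S: "S:BL b b'" and q: "norm S <= q"
  and xy: "!!i. i < (n::nat) ==> xs i:sp a & ys i:sp b"
 shows "norm (SUM i<n. vc a b' (xs i) (S $$ ys i)) <= q * norm (SUM i<n. vc a b (xs i) (ys i))"
proof -
 have 1: "norm (SUM i<n. vc a b' (xs i) (S $$ ys i)) <= r * norm (SUM i<n. vc a b (xs i) (ys i))"
  if r: "norm S < r" for r
 proof -
  from gram_sqrt[OF hsp[OF o(2)] hsp[OF o(3)] S r]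
  obtain s where s: "s:BL b b" "ALL x:sp b. ALL y:sp b. ip (s $$ x) (s $$ y)
  = cor (r\<^sup>2) * ip x y - cj False (ip (S $$ x) (S $$ y))"
  by blast
  have "cor ((norm (SUM i<n. vc a b (xs i) (s $$ ys i)))^2) =
  (SUM i<n. SUM j<n. ip (xs i) (xs j) * ip (s $$ ys i) (s $$ ys j))"
  using xy o bop_in[OF s(1)] by(intro norm_tensor_sum) auto
  also have "... = (SUM i<n. SUM j<n. cor (r\<^sup>2) * (ip (xs i) (xs j) * ip (ys i) (ys j))
  - ip (xs i) (xs j) * ip (S $$ ys i) (S $$ ys j))"
  using xy by(intro sum.cong refl) (simp add: s(2)[rule_format] algebra_simps)
  also have "... = cor (r\<^sup>2) * cor ((norm (SUM i<n. vc a b (xs i) (ys i)))^2)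
  - cor ((norm (SUM i<n. vc a b' (xs i) (S $$ ys i)))^2)"
  using xy o bop_in[OF S]
  by(subst (1 2) norm_tensor_sum) (auto simp: sum_distrib_left sum_subtractf)
  finally have "cor ((norm (SUM i<n. vc a b (xs i) (s $$ ys i)))^2) =
  cor (r\<^sup>2 * (norm (SUM i<n. vc a b (xs i) (ys i)))^2
  - (norm (SUM i<n. vc a b' (xs i) (S $$ ys i)))\<^sup>2)"
  by simp
  hence "0 <= r\<^sup>2 * (norm (SUM i<n. vc a b (xs i) (ys i)))^2
  - (norm (SUM i<n. vc a b' (xs i) (S $$ ys i)))\<^sup>2"
  unfolding of_real_eq_iff by(metis zero_le_power2)
  hence "(norm (SUM i<n. vc a b' (xs i) (S $$ ys i)))^2 <= (r * norm (SUM i<n. vc a b (xs i) (ys i)))^2"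
  unfolding power_mult_distrib by linarith
  moreover have "0 <= r" using r norm_ge_zero[of S] by linarith
  ultimately show ?thesis by(rule power2_le_imp_le[OF _ mult_nonneg_nonneg[OF _ norm_ge_zero]])
 qed
 \<comment> \<open>The strict bound \<open>r = q + e\<close> is relaxed to \<open>q\<close> by
   letting \<open>e\<close> tend to \<open>0\<close> from above.\<close>
 show ?thesis
 proof (rule tendsto_lowerbound)
  show "((%e. (q + e) * norm (SUM i<n. vc a b (xs i) (ys i))) \<longlongrightarrow> q * norm (SUM i<n. vc a b (xs i) (ys i))) (at_right 0)"
  by(auto intro!: tendsto_eq_intros)
  show "\<forall>\<^sub>F e in at_right 0. norm (SUM i<n. vc a b' (xs i) (S $$ ys i)) <= (q + e) * norm (SUM i<n. vc a b (xs i) (ys i))"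
  using q by(auto simp: eventually_at intro!: exI[of _ 1] 1)
 qed simp
qed

text \<open>For antilinear factors \<open>T \<otimes> 1\<close> makes no sense, so the two factors
  are estimated together. Expanding
  \<open>(r\<^sup>2 - adj s s) \<otimes> (q\<^sup>2 - adj t t)\<close> gives four Gram terms; the
  mixed term with the unfavourable sign is absorbed by \<open>right_tensor_bound\<close>.\<close>

lemma tensor_bound:
 assumes o: "a:Ob" "b:Ob" "a':Ob" "b':Ob"
  and T: "T:bop be (sp a) (sp a')" and S: "S:bop be (sp b) (sp b')" and r: "norm T < r" "norm S < q"
  and xy: "!!i. i < (n::nat) ==> xs i:sp a & ys i:sp b"
 shows "norm (SUM i<n. vc a' b' (T $$ xs i) (S $$ ys i))
  <= r * q * norm (SUM i<n. vc a b (xs i) (ys i))"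
proof -
 obtain s where s: "s:BL a a" "norm s <= r" "ALL x:sp a. ALL y:sp a. ip (s $$ x) (s $$ y)
  = cor (r\<^sup>2) * ip x y - cj be (ip (T $$ x) (T $$ y))"
  using gram_sqrt[OF hsp[OF o(1)] hsp[OF o(3)] T r(1)] by blast
 obtain t where t: "t:BL b b" "norm t <= q" "ALL x:sp b. ALL y:sp b. ip (t $$ x) (t $$ y)
  = cor (q\<^sup>2) * ip x y - cj be (ip (S $$ x) (S $$ y))"
  using gram_sqrt[OF hsp[OF o(2)] hsp[OF o(4)] S r(2)] by blast
 let ?N = "%f g. cor ((norm (SUM i<n. vc a b (f i) (g i)))^2)"
 have c: "cj be (SUM i<n. SUM j<n. g i j) = (SUM i<n. SUM j<n. cj be (g i j))" for g :: "nat => nat => complex"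
  by(cases be) auto
 have "cor ((norm (SUM i<n. vc a' b' (T $$ xs i) (S $$ ys i)))^2)
  = cj be (cor ((norm (SUM i<n. vc a' b' (T $$ xs i) (S $$ ys i)))^2))"
  by(simp only: cj_simps)
 also have "... = (SUM i<n. SUM j<n. (cor (r\<^sup>2) * ip (xs i) (xs j) - ip (s $$ xs i) (s $$ xs j))
  * (cor (q\<^sup>2) * ip (ys i) (ys j) - ip (t $$ ys i) (t $$ ys j)))"
  using xy o s(3) t(3) bop_in[OF T] bop_in[OF S]
  by(subst norm_tensor_sum) (auto simp: c)
 also have "... = r\<^sup>2 * q\<^sup>2 * ?N xs ys - r\<^sup>2 * ?N xs (%i. t $$ ys i)
  - (q\<^sup>2 * ?N (%i. s $$ xs i) ys
  - ?N (%i. s $$ xs i) (%i. t $$ ys i))"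
  using xy o bop_in[OF s(1)] bop_in[OF t(1)]
  by(subst (1 2 3 4) norm_tensor_sum)
  (auto simp: sum_distrib_left sum_subtractf[symmetric] sum.distrib[symmetric] algebra_simps intro!: sum.cong)
 finally have eq: "(norm (SUM i<n. vc a' b' (T $$ xs i) (S $$ ys i)))^2
  = r\<^sup>2 * q\<^sup>2 * (norm (SUM i<n. vc a b (xs i) (ys i)))^2 - r\<^sup>2 * (norm (SUM i<n. vc a b (xs i) (t $$ ys i)))^2
  - (q\<^sup>2 * (norm (SUM i<n. vc a b (s $$ xs i) (ys i)))^2
  - (norm (SUM i<n. vc a b (s $$ xs i) (t $$ ys i)))\<^sup>2)"
  unfolding of_real_eq_iff[where 'a = complex, symmetric] by simp
 have q0: "0 <= q" "0 <= r" using r norm_ge_zero[of S] norm_ge_zero[of T] by linarith+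
 have "norm (SUM i<n. vc a b (s $$ xs i) (t $$ ys i)) <= q * norm (SUM i<n. vc a b (s $$ xs i) (ys i))"
  using bop_in[OF s(1)] xy by(intro right_tensor_bound[OF o(1,2,2) t(1,2)]) auto
 hence "(norm (SUM i<n. vc a b (s $$ xs i) (t $$ ys i)))^2 <= q\<^sup>2 * (norm (SUM i<n. vc a b (s $$ xs i) (ys i)))^2"
  unfolding power_mult_distrib[symmetric] by(intro power_mono) auto
 moreover have "0 <= r\<^sup>2 * (norm (SUM i<n. vc a b (xs i) (t $$ ys i)))^2" by simp
 ultimately have "(norm (SUM i<n. vc a' b' (T $$ xs i) (S $$ ys i)))^2
  <= (r * q * norm (SUM i<n. vc a b (xs i) (ys i)))^2"
  unfolding power_mult_distrib using eq by linarith
 thus ?thesis by(rule power2_le_imp_le) (intro mult_nonneg_nonneg norm_ge_zero q0)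
qed

text \<open>The increments by \<open>1\<close> provide the strict upper bounds asked for in
  \<open>tensor_bound\<close>. The resulting estimate is later the continuity needed for normality
  in each factor.\<close>

lemma optensI:
 assumes o: "a:Ob" "b:Ob" "a':Ob" "b':Ob"
  and T: "T:bop be (sp a) (sp a')" and S: "S:bop be (sp b) (sp b')"
 shows "ot a b a' b' T S:bop be (sp (tn a b)) (sp (tn a' b'))"
  "[|x:sp a; y:sp b|] ==> ot a b a' b' T S $$ vc a b x y = vc a' b' (T $$ x) (S $$ y)"
  "norm (ot a b a' b' T S) <= (norm T + 1) * (norm S + 1)"
proof -
 have "EX X:bop be (sp (tn a b)) (sp (tn a' b')). (ALL x:sp a. ALL y:sp b. X $$ vc a b x y
  = vc a' b' (T $$ x) (S $$ y)) & norm X <= (norm T + 1) * (norm S + 1)"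
 proof (rule tensor_map_exists[OF o(1,2) hsp[OF htens[OF o(3,4)]]])
  show "norm (SUM i<n. vc a' b' (T $$ xs i) (S $$ ys i))
  <= (norm T + 1) * (norm S + 1) * norm (SUM i<n. vc a b (xs i) (ys i))"
  if "!!i. i < n ==> xs i:sp a & ys i:sp b" for n :: nat and xs ys
  by(rule tensor_bound[OF o T S _ _ that]) auto
 qed (auto simp: o bop_scaleC[OF T] hvec_scaleC_left bop_in[OF T] bop_in[OF S] intro!: hvec_in)
 then obtain X where X: "X:bop be (sp (tn a b)) (sp (tn a' b'))"
  "ALL x:sp a. ALL y:sp b. X $$ vc a b x y = vc a' b' (T $$ x) (S $$ y)"
  "norm X <= (norm T + 1) * (norm S + 1)" by blast
 have "ot a b a' b' T S = X"
  unfolding optens_def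
 proof (rule the_equality)
  show "Y = X" if "(ALL z. orth (sp (tn a b)) z --> Y $$ z = 0) &
  (ALL x:sp a. ALL y:sp b. Y $$ vc a b x y = vc a' b' (T $$ x) (S $$ y))" for Y
  using that X zorth_bop[OF X(1)] by(intro tens_ext[OF o(1,2)]) (auto simp: zorth_def)
 qed (use X bop_orth in auto)
 thus "ot a b a' b' T S:bop be (sp (tn a b)) (sp (tn a' b'))"
  "[|x:sp a; y:sp b|] ==> ot a b a' b' T S $$ vc a b x y = vc a' b' (T $$ x) (S $$ y)"
  "norm (ot a b a' b' T S) <= (norm T + 1) * (norm S + 1)"
  using X by auto
qed

lemma hflip_works:
 assumes o: "a:Ob" "b:Ob"
 shows "hf a b:BL (tn a b) (tn b a)"
  "[|x:sp a; y:sp b|] ==> hf a b $$ vc a b x y = vc b a y x"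
proof -
 have "EX X:BL (tn a b) (tn b a). (ALL x:sp a. ALL y:sp b. X $$ vc a b x y = vc b a y x) & norm X <= 1"
 proof (rule tensor_map_exists[OF o hsp[OF htens[OF o(2,1)]]])
  show "norm (SUM i<n. vc b a (ys i) (xs i)) <= 1 * norm (SUM i<n. vc a b (xs i) (ys i))"
  if xy: "!!i. i < n ==> xs i:sp a & ys i:sp b" for n :: nat and xs ys
  proof -
  have "cor ((norm (SUM i<n. vc b a (ys i) (xs i)))^2) = cor ((norm (SUM i<n. vc a b (xs i) (ys i)))^2)"
  using xy by(subst (1 2) norm_tensor_sum) (auto simp: o mult.commute)
  hence "(norm (SUM i<n. vc b a (ys i) (xs i)))^2 = (norm (SUM i<n. vc a b (xs i) (ys i)))^2"
  by(simp only: of_real_eq_iff)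
  thus ?thesis by simp
  qed
 qed (auto simp: o hvec_scaleC_right intro!: hvec_in)
 then obtain X where X: "X:BL (tn a b) (tn b a)"
  "ALL x:sp a. ALL y:sp b. X $$ vc a b x y = vc b a y x" by blast
 have "hf a b = X"
  unfolding hflip_def
 proof (rule the_equality)
  show "Y = X" if "(ALL z. orth (sp (tn a b)) z --> Y $$ z = 0) &
  (ALL x:sp a. ALL y:sp b. Y $$ vc a b x y = vc b a y x)" for Y
  using that X zorth_bop[OF X(1)] by(intro tens_ext[OF o]) (auto simp: zorth_def)
 qed (use X bop_orth in auto)
 thus "hf a b:BL (tn a b) (tn b a)"
  "[|x:sp a; y:sp b|] ==> hf a b $$ vc a b x y = vc b a y x"
  using X by auto
qed

end

lemma oo_assoc: "(Q oL S) oL T = Q oL (S oL T)"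
 by(rule blinfun_eqI) simp

context strict_hilb_cat begin

lemma hid_bop: "a:Ob ==> hI a:BL a a"
 by(rule idop_bop[OF hsp])

lemma hid_apply: "a:Ob ==> x:sp a ==> hI a $$ x = x"
 by(rule idop_in[OF hsp])

lemma optens_eqI:
 assumes o: "a:Ob" "b:Ob" "a':Ob" "b':Ob"
  and T: "T:bop be (sp a) (sp a')" and S: "S:bop be (sp b) (sp b')"
  and X: "zorth (sp (tn a b)) X"
  "!!x y. x:sp a ==> y:sp b ==> X $$ vc a b x y = vc a' b' (T $$ x) (S $$ y)"
 shows "X = ot a b a' b' T S"
 by(rule tens_ext[OF o(1,2) X(1) zorth_bop[OF optensI(1)[OF o T S]]])
  (simp add: X optensI(2)[OF o T S])

lemma optens_comp:
 assumes o: "a:Ob" "b:Ob" "a':Ob" "b':Ob" "a'':Ob" "b'':Ob"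
  and T: "T:bop be (sp a) (sp a')" "S:bop be (sp b) (sp b')"
  and T': "T':bop be' (sp a') (sp a'')" "S':bop be' (sp b') (sp b'')"
 shows "ot a' b' a'' b'' T' S' oL ot a b a' b' T S = ot a b a'' b'' (T' oL T) (S' oL S)"
 by(rule optens_eqI[OF o(1,2,5,6) bop_comp[OF T(1) T'(1)] bop_comp[OF T(2) T'(2)]])
  (simp_all add: zorth_oo zorth_bop[OF optensI(1)[OF o(1-4) T]]
  optensI(2)[OF o(1-4) T] optensI(2)[OF o(3-6) T'] bop_in[OF T(1)] bop_in[OF T(2)])

lemma adj_optens:
 assumes o: "a:Ob" "b:Ob" "a':Ob" "b':Ob"
  and T: "T:bop be (sp a) (sp a')" and S: "S:bop be (sp b) (sp b')"
 shows "adj (ot a b a' b' T S) = ot a' b' a b (adj T) (adj S)"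
proof (rule optens_eqI[OF o(3,4,1,2) adj_bop[OF hsp[OF o(1)] T] adj_bop[OF hsp[OF o(2)] S]])
 note W = optensI[OF o T S]
 have A: "adj (ot a b a' b' T S):bop be (sp (tn a' b')) (sp (tn a b))"
  by(rule adj_bop[OF hsp[OF htens[OF o(1,2)]] W(1)])
 thus "zorth (sp (tn a' b')) (adj (ot a b a' b' T S))" by(rule zorth_bop)
 fix x y assume xy: "x:sp a'" "y:sp b'"
 have r: "adj T $$ x:sp a" "adj S $$ y:sp b"
  using bop_in[OF adj_bop[OF hsp[OF o(1)] T]] bop_in[OF adj_bop[OF hsp[OF o(2)] S]] by auto
 show "adj (ot a b a' b' T S) $$ vc a' b' x y = vc a b (adj T $$ x) (adj S $$ y)"
 proof (rule tens_total[OF o(1,2) bop_in[OF A] hvec_in[OF o(1,2) r]])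
  fix u v assume uv: "u:sp a" "v:sp b"
  have "cj be (ip (vc a b u v) (adj (ot a b a' b' T S) $$ vc a' b' x y))
  = ip (vc a' b' (T $$ u) (S $$ v)) (vc a' b' x y)"
  unfolding bop_cinner[OF W(1), symmetric] by(simp add: W(2)[OF uv])
  also have "... = cj be (ip (vc a b u v) (vc a b (adj T $$ x) (adj S $$ y)))"
  by(simp add: hvec_cinner[OF o(3,4)] hvec_cinner[OF o(1,2)] uv r xy bop_in[OF T] bop_in[OF S]
  bop_cinner[OF T] bop_cinner[OF S])
  finally show "ip (vc a b u v) (adj (ot a b a' b' T S) $$ vc a' b' x y)
  = ip (vc a b u v) (vc a b (adj T $$ x) (adj S $$ y))"
  by(cases be) auto
 qed
qed

lemma optens_id:
 assumes o: "a:Ob" "b:Ob"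
 shows "ot a b a b (hI a) (hI b) = hI (tn a b)"
 by(rule optens_eqI[OF o o hid_bop[OF o(1)] hid_bop[OF o(2)], symmetric])
  (auto simp: hid_apply o htens hvec_in zorth_bop[OF hid_bop])

lemma optens_add_left:
 assumes o: "a:Ob" "b:Ob" "a':Ob" "b':Ob"
  and T: "T:bop be (sp a) (sp a')" "T':bop be (sp a) (sp a')" and S: "S:bop be (sp b) (sp b')"
 shows "ot a b a' b' (T + T') S = ot a b a' b' T S + ot a b a' b' T' S"
 by(rule optens_eqI[OF o bop_add[OF hsp[OF o(3)] T] S, symmetric])
  (simp_all add: zorth_add zorth_bop[OF optensI(1)[OF o T(1) S]] zorth_bop[OF optensI(1)[OF o T(2) S]]
  blinfun.add_left optensI(2)[OF o T(1) S] optensI(2)[OF o T(2) S] hvec_add_left o bop_in[OF T(1)] bop_in[OF T(2)] bop_in[OF S])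

lemma optens_add_right:
 assumes o: "a:Ob" "b:Ob" "a':Ob" "b':Ob"
  and T: "T:bop be (sp a) (sp a')" and S: "S:bop be (sp b) (sp b')" "S':bop be (sp b) (sp b')"
 shows "ot a b a' b' T (S + S') = ot a b a' b' T S + ot a b a' b' T S'"
 by(rule optens_eqI[OF o T bop_add[OF hsp[OF o(4)] S], symmetric])
  (simp_all add: zorth_add zorth_bop[OF optensI(1)[OF o T S(1)]] zorth_bop[OF optensI(1)[OF o T S(2)]]
  blinfun.add_left optensI(2)[OF o T S(1)] optensI(2)[OF o T S(2)] hvec_add_right o bop_in[OF T] bop_in[OF S(1)] bop_in[OF S(2)])

lemma optens_scl:
 assumes o: "a:Ob" "b:Ob" "a':Ob" "b':Ob"
  and T: "T:bop be (sp a) (sp a')" and S: "S:bop be (sp b) (sp b')"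
 shows "ot a b a' b' (scl c T) S = scl c (ot a b a' b' T S)"
  "ot a b a' b' T (scl c S) = scl c (ot a b a' b' T S)"
 by(rule optens_eqI[OF o bop_scl[OF hsp[OF o(3)] T] S, symmetric]
  optens_eqI[OF o T bop_scl[OF hsp[OF o(4)] S], symmetric];
  simp add: zorth_scl zorth_bop[OF optensI(1)[OF o T S]] scl_apply
  optensI(2)[OF o T S] hvec_scaleC_left hvec_scaleC_right o bop_in[OF T] bop_in[OF S])+

lemma tens_ext3:
 assumes o: "a:Ob" "b:Ob" "c:Ob"
  and X: "zorth (sp (tn a (tn b c))) X" "zorth (sp (tn a (tn b c))) Y"
  and eq: "!!x y z. [|x:sp a; y:sp b; z:sp c|] ==>
  X $$ vc a (tn b c) x (vc b c y z) = Y $$ vc a (tn b c) x (vc b c y z)"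
 shows "X = Y"
proof -
 note H = hsp[OF htens[OF o(2,3)]]
 have "X $$ vc a (tn b c) x v = Y $$ vc a (tn b c) x v"
  if x: "x:sp a" and v: "v:sp (tn b c)" for x v
 proof -
  have p: "proj_on (sp (tn b c)) w:sp (tn b c)" for w by(rule proj_on[OF H])
  interpret p: bounded_linear "proj_on (sp (tn b c))" by(rule proj_on_linear[OF H])
  \<comment> \<open>\<open>hvec\<close> is controlled only on the subspaces. Composing with the
    projection gives a bounded linear map of the whole ambient space, to which the density argument
    applies.\<close>
  have "bounded_linear (%w. vc a (tn b c) x (proj_on (sp (tn b c)) w))"
  by(rule bounded_linear_intro[where K = "norm x"])
  (use norm_proj_on_le[OF H] in \<open>auto simp: p.add p.scaleR hvec_add_right hvec_scaleR norm_hvec o htens x p mult.commute[of "norm x"] intro!: mult_right_mono\<close>)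
  hence bl: "bounded_linear (%w. Z $$ vc a (tn b c) x (proj_on (sp (tn b c)) w))" for Z :: "'h oper"
  by(rule bounded_linear_compose[OF bl_right])
  show ?thesis
  using eq_on_tensor[OF o(2,3) bl[of X] bl[of Y] _ v] x v by(simp add: proj_on_in[OF H] hvec_in o eq)
 qed
 thus ?thesis using o X by(intro tens_ext[OF o(1) htens[OF o(2,3)]])
qed

lemma tens_total3:
 assumes o: "a:Ob" "b:Ob" "c:Ob"
  and u: "u:sp (tn a (tn b c))" "v:sp (tn a (tn b c))"
  and eq: "!!x y z. [|x:sp a; y:sp b; z:sp c|] ==>
  ip (vc a (tn b c) x (vc b c y z)) u = ip (vc a (tn b c) x (vc b c y z)) v"
 shows "u = v"
proof (rule tens_total[OF o(1) htens[OF o(2,3)] u])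
 note H = hsp[OF htens[OF o(2,3)]]
 fix x w assume x: "x:sp a" and w: "w:sp (tn b c)"
 have p: "proj_on (sp (tn b c)) w:sp (tn b c)" for w by(rule proj_on[OF H])
 interpret p: bounded_linear "proj_on (sp (tn b c))" by(rule proj_on_linear[OF H])
 have "bounded_linear (%w. vc a (tn b c) x (proj_on (sp (tn b c)) w))"
  by(rule bounded_linear_intro[where K = "norm x"])
  (use norm_proj_on_le[OF H] in \<open>auto simp: p.add p.scaleR hvec_add_right hvec_scaleR norm_hvec o htens x p mult.commute[of "norm x"] intro!: mult_right_mono\<close>)
 hence bl: "bounded_linear (%w. ip (vc a (tn b c) x (proj_on (sp (tn b c)) w)) z)" for z
  by(rule bounded_linear_compose[OF bounded_bilinear.bounded_linear_left[OF bb_cinner]])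
 show "ip (vc a (tn b c) x w) u = ip (vc a (tn b c) x w) v"
  using eq_on_tensor[OF o(2,3) bl[of u] bl[of v] _ w] x w by(simp add: proj_on_in[OF H] hvec_in o eq)
qed

lemma optens_assoc:
 assumes o: "a:Ob" "b:Ob" "c:Ob" "a':Ob" "b':Ob" "c':Ob"
  and T: "T:bop be (sp a) (sp a')" "S:bop be (sp b) (sp b')" "Q:bop be (sp c) (sp c')"
 shows "ot (tn a b) c (tn a' b') c' (ot a b a' b' T S) Q
  = ot a (tn b c) a' (tn b' c') T (ot b c b' c' S Q)"
proof -
 note W1 = optensI[OF o(1,2,4,5) T(1,2)] and W2 = optensI[OF o(2,3,5,6) T(2,3)]
 note W3 = optensI[OF htens[OF o(1,2)] o(3) htens[OF o(4,5)] o(6) W1(1) T(3)]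
 note W4 = optensI[OF o(1) htens[OF o(2,3)] o(4) htens[OF o(5,6)] T(1) W2(1)]
 show ?thesis
 proof (rule tens_ext3[OF o(1-3)])
  show "zorth (sp (tn a (tn b c))) (ot (tn a b) c (tn a' b') c' (ot a b a' b' T S) Q)"
  using zorth_bop[OF W3(1)] by(simp add: htens_assoc o)
  show "zorth (sp (tn a (tn b c))) (ot a (tn b c) a' (tn b' c') T (ot b c b' c' S Q))"
  by(rule zorth_bop[OF W4(1)])
  fix x y z assume xyz: "x:sp a" "y:sp b" "z:sp c"
  show "ot (tn a b) c (tn a' b') c' (ot a b a' b' T S) Q $$ vc a (tn b c) x (vc b c y z)
  = ot a (tn b c) a' (tn b' c') T (ot b c b' c' S Q) $$ vc a (tn b c) x (vc b c y z)"
  using W3(2)[OF hvec_in[OF o(1,2) xyz(1,2)] xyz(3)] xyz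
  by(simp add: W4(2) W2(2) W1(2) hvec_in o hvec_assoc bop_in[OF T(1)] bop_in[OF T(2)] bop_in[OF T(3)])
 qed
qed

lemma optens_unit_left:
 assumes o: "a:Ob" "a':Ob" and T: "T:BL a a'"
 shows "ot (hunit D) a (hunit D) a' (hI (hunit D)) T = T"
proof (rule optens_eqI[OF hunit(1) o(1) hunit(1) o(2) hid_bop[OF hunit(1)] T, symmetric])
 show "zorth (sp (tn (hunit D) a)) T" using zorth_bop[OF T] by(simp add: htens_unit o)
 fix x y assume xy: "x:sp (hunit D)" "y:sp a"
 then obtain c where c: "x = c *\<^sub>C hone D" using hunit(2) by auto
 have h: "hone D:sp (hunit D)" unfolding hunit(2) by(rule image_eqI[of _ _ 1]) auto
 show "T $$ vc (hunit D) a x y = vc (hunit D) a' (hI (hunit D) $$ x) (T $$ y)"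
  using xy h bop_in[OF T] by(simp add: hid_apply hunit(1) c hvec_scaleC_left hvec_unit o bop_scaleC[OF T])
qed

lemma optens_unit_right:
 assumes o: "a:Ob" "a':Ob" and T: "T:BL a a'"
 shows "ot a (hunit D) a' (hunit D) T (hI (hunit D)) = T"
proof (rule optens_eqI[OF o(1) hunit(1) o(2) hunit(1) T hid_bop[OF hunit(1)], symmetric])
 show "zorth (sp (tn a (hunit D))) T" using zorth_bop[OF T] by(simp add: htens_unit o)
 fix y x assume xy: "x:sp (hunit D)" "y:sp a"
 then obtain c where c: "x = c *\<^sub>C hone D" using hunit(2) by auto
 have h: "hone D:sp (hunit D)" unfolding hunit(2) by(rule image_eqI[of _ _ 1]) auto
 show "T $$ vc a (hunit D) y x = vc a' (hunit D) (T $$ y) (hI (hunit D) $$ x)"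
  using xy h bop_in[OF T] by(simp add: hid_apply hunit(1) c hvec_scaleC_right hvec_unit o bop_scaleC[OF T])
qed

lemma hflip_hflip:
 assumes o: "a:Ob" "b:Ob"
 shows "hf b a oL hf a b = hI (tn a b)"
 by(rule tens_ext[OF o])
  (auto intro: zorth_oo zorth_bop[OF hflip_works(1)[OF o]] zorth_bop[OF hid_bop]
  simp: htens o hflip_works(2) hid_apply hvec_in)

lemma adj_hflip:
 assumes o: "a:Ob" "b:Ob"
 shows "adj (hf a b) = hf b a"
proof (rule tens_ext[OF o(2,1)])
 note W = hflip_works[OF o] and W' = hflip_works[OF o(2,1)]
 have A: "adj (hf a b):BL (tn b a) (tn a b)"
  by(rule adj_bop[OF hsp[OF htens[OF o]] W(1)])
 thus "zorth (sp (tn b a)) (adj (hf a b))" by(rule zorth_bop)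
 show "zorth (sp (tn b a)) (hf b a)" by(rule zorth_bop[OF W'(1)])
 fix x y assume xy: "x:sp b" "y:sp a"
 show "adj (hf a b) $$ vc b a x y = hf b a $$ vc b a x y"
 proof (rule tens_total[OF o bop_in[OF A] bop_in[OF W'(1)]])
  fix u v assume uv: "u:sp a" "v:sp b"
  have "ip (vc a b u v) (adj (hf a b) $$ vc b a x y) = ip (vc b a v u) (vc b a x y)"
  using bop_cinner[OF W(1), of "vc a b u v"] by(simp add: W(2) uv)
  thus "ip (vc a b u v) (adj (hf a b) $$ vc b a x y)
  = ip (vc a b u v) (hf b a $$ vc b a x y)"
  by(simp add: W'(2) xy uv hvec_cinner o)
 qed
qed

lemma hflip_natural:
 assumes o: "a:Ob" "b:Ob" "a':Ob" "b':Ob"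
  and T: "T:bop be (sp a) (sp a')" and S: "S:bop be (sp b) (sp b')"
 shows "hf a' b' oL ot a b a' b' T S = ot b a b' a' S T oL hf a b"
 by(rule tens_ext[OF o(1,2)])
  (auto intro: zorth_oo zorth_bop[OF hflip_works(1)[OF o(1,2)]] zorth_bop[OF optensI(1)[OF o T S]]
  simp: o hflip_works(2) bop_in[OF T] bop_in[OF S] optensI(2)[OF o T S] optensI(2)[OF o(2,1,4,3) S T])

subsection \<open>Creation operators and slices\<close>

text \<open>Creation operators \<open>y \<mapsto> x \<otimes> y\<close> and, below,
  \<open>x \<mapsto> x \<otimes> y\<close>. Their adjoints contract a leg against a vector, so that
  slices become composites \<open>adj (rten a b p) X (rten a b q)\<close>.\<close>

definition lten where "lten a b x = Blinfun (%y. vc a b x (proj_on (sp b) y))"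
definition rten where "rten a b y = Blinfun (%x. vc a b (proj_on (sp a) x) y)"

lemma lten:
 assumes o: "a:Ob" "b:Ob" and x: "x:sp a"
 shows "lten a b x:BL b (tn a b)" "y:sp b ==> lten a b x $$ y = vc a b x y"
  "norm (lten a b x) <= norm x"
proof -
 note H = hsp[OF o(2)]
 have p: "proj_on (sp b) w:sp b" for w by(rule proj_on[OF H])
 interpret p: bounded_linear "proj_on (sp b)" by(rule proj_on_linear[OF H])
 have bl: "bounded_linear (%w. vc a b x (proj_on (sp b) w))"
  by(rule bounded_linear_intro[where K = "norm x"])
  (use norm_proj_on_le[OF H] in \<open>auto simp: p.add p.scaleR hvec_add_right hvec_scaleR norm_hvec o x p mult.commute[of "norm x"] intro!: mult_right_mono\<close>)
 have app: "lten a b x $$ y = vc a b x (proj_on (sp b) y)" for y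
  by(simp add: lten_def bounded_linear_Blinfun_apply[OF bl])
 have ps: "proj_on (sp b) (c *\<^sub>C w) = c *\<^sub>C proj_on (sp b) w" for c w
  using bop_scaleC[OF hid_bop[OF o(2)], of c w] by(simp add: idop_apply[OF H])
 have z: "vc a b x 0 = 0" using hvec_scaleC_right[OF o x, of 0 0] p.zero p[of 0] by simp
 show "lten a b x:BL b (tn a b)"
  by(rule bopI) (auto simp: app ps hvec_scaleC_right o x p proj_on_orth[OF H] z hvec_in)
 show "y:sp b ==> lten a b x $$ y = vc a b x y" by(simp add: app proj_on_in[OF H])
 show "norm (lten a b x) <= norm x"
  by(rule norm_blinfun_bound) (auto simp: app norm_hvec o x p intro!: mult_left_mono norm_proj_on_le[OF H])
qed

lemma rten:
 assumes o: "a:Ob" "b:Ob" and y: "y:sp b"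
 shows "rten a b y:BL a (tn a b)" "x:sp a ==> rten a b y $$ x = vc a b x y"
  "norm (rten a b y) <= norm y"
proof -
 note H = hsp[OF o(1)]
 have p: "proj_on (sp a) w:sp a" for w by(rule proj_on[OF H])
 interpret p: bounded_linear "proj_on (sp a)" by(rule proj_on_linear[OF H])
 have bl: "bounded_linear (%w. vc a b (proj_on (sp a) w) y)"
  by(rule bounded_linear_intro[where K = "norm y"])
  (use norm_proj_on_le[OF H] in \<open>auto simp: p.add p.scaleR hvec_add_left hvec_scaleR norm_hvec o y p intro!: mult_right_mono\<close>)
 have app: "rten a b y $$ x = vc a b (proj_on (sp a) x) y" for x
  by(simp add: rten_def bounded_linear_Blinfun_apply[OF bl])
 have ps: "proj_on (sp a) (c *\<^sub>C w) = c *\<^sub>C proj_on (sp a) w" for c w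
  using bop_scaleC[OF hid_bop[OF o(1)], of c w] by(simp add: idop_apply[OF H])
 have z: "vc a b 0 y = 0" using hvec_scaleC_left[OF o _ y, of 0 0] p.zero p[of 0] by simp
 show "rten a b y:BL a (tn a b)"
  by(rule bopI) (auto simp: app ps hvec_scaleC_left o y p proj_on_orth[OF H] z hvec_in)
 show "x:sp a ==> rten a b y $$ x = vc a b x y" by(simp add: app proj_on_in[OF H])
 show "norm (rten a b y) <= norm y"
  by(rule norm_blinfun_bound)
  (auto simp: app norm_hvec o y p mult.commute[of "norm y"] intro!: mult_right_mono norm_proj_on_le[OF H])
qed

lemma adj_lten:
 assumes o: "a:Ob" "b:Ob" and x: "x:sp a"
 shows "adj (lten a b x):BL (tn a b) b"
  "y:sp b ==> ip y (adj (lten a b x) $$ u) = ip (vc a b x y) u"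
  "[|x':sp a; y:sp b|] ==> adj (lten a b x) $$ vc a b x' y = ip x x' *\<^sub>C y"
proof -
 note L = lten[OF o x]
 show A: "adj (lten a b x):BL (tn a b) b" by(rule adj_bop[OF hsp[OF o(2)] L(1)])
 show B: "y:sp b ==> ip y (adj (lten a b x) $$ u) = ip (vc a b x y) u" for y u
  using bop_cinner[OF L(1), of y u] by(simp add: L(2))
 show "[|x':sp a; y:sp b|] ==> adj (lten a b x) $$ vc a b x' y = ip x x' *\<^sub>C y"
 proof -
  assume xy: "x':sp a" "y:sp b"
  define d where "d = adj (lten a b x) $$ vc a b x' y - ip x x' *\<^sub>C y"
  have d: "d:sp b" unfolding d_def using bop_in[OF A] csubD[OF hsp[OF o(2)]] xy by blast
  have "ip d d = 0"
  by(subst (2) d_def) (simp add: cinner_diff_right B[OF d] cinner_scaleC_right hvec_cinner o x xy d)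
  thus ?thesis by(simp add: d_def)
 qed
qed

lemma adj_rten:
 assumes o: "a:Ob" "b:Ob" and y: "y:sp b"
 shows "adj (rten a b y):BL (tn a b) a"
  "x:sp a ==> ip x (adj (rten a b y) $$ u) = ip (vc a b x y) u"
  "[|x:sp a; y':sp b|] ==> adj (rten a b y) $$ vc a b x y' = ip y y' *\<^sub>C x"
proof -
 note L = rten[OF o y]
 show A: "adj (rten a b y):BL (tn a b) a" by(rule adj_bop[OF hsp[OF o(1)] L(1)])
 show B: "x:sp a ==> ip x (adj (rten a b y) $$ u) = ip (vc a b x y) u" for x u
  using bop_cinner[OF L(1), of x u] by(simp add: L(2))
 show "[|x:sp a; y':sp b|] ==> adj (rten a b y) $$ vc a b x y' = ip y y' *\<^sub>C x"
 proof -
  assume xy: "x:sp a" "y':sp b"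
  define d where "d = adj (rten a b y) $$ vc a b x y' - ip y y' *\<^sub>C x"
  have d: "d:sp a" unfolding d_def using bop_in[OF A] csubD[OF hsp[OF o(1)]] xy by blast
  have "ip d d = 0"
  by(subst (2) d_def) (simp add: cinner_diff_right B[OF d] cinner_scaleC_right hvec_cinner o y xy d)
  thus ?thesis by(simp add: d_def)
 qed
qed

end

lemma form_op_eqI:
 assumes H: "csub H" and T: "T:blin H H"
  and q: "!!xi et. xi:H ==> et:H ==> ip et (T $$ xi) = q et xi"
 shows "form_op H q = T"
 unfolding form_op_def
proof (rule the_equality)
 show "T:blin H H & (ALL xi:H. ALL et:H. ip et (T $$ xi) = q et xi)" using T q by blast
 fix S assume S: "S:blin H H & (ALL xi:H. ALL et:H. ip et (S $$ xi) = q et xi)"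
 show "S = T"
 proof (rule bop_eqI[OF H])
  fix x assume x: "x:H"
  let ?d = "S $$ x - T $$ x"
  have d: "?d:H" using S T bop_in csubD(6)[OF H] by blast
  have "ip ?d ?d = 0" using S q x d by(simp add: cinner_diff_right)
  thus "S $$ x = T $$ x" by simp
 qed (use S T in auto)
qed

context strict_hilb_cat begin

lemma vslice2:
 assumes o: "a:Ob" "b:Ob" and X: "X:BL (tn a b) (tn a b)" and v: "et:sp b" "xi:sp b"
 shows "vslice2 D a b et xi X = adj (rten a b et) oL X oL rten a b xi"
  "vslice2 D a b et xi X:BL a a"
  "[|x:sp a; y:sp a|] ==> ip y ((vslice2 D a b et xi X) $$ x) = ip (vc a b y et) (X $$ (vc a b x xi))"
proof -
 have B: "adj (rten a b et) oL X oL rten a b xi:BL a a"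
  by(rule blin_comp[OF rten(1)[OF o v(2)] blin_comp[OF X adj_rten(1)[OF o v(1)]]])
 show e: "vslice2 D a b et xi X = adj (rten a b et) oL X oL rten a b xi"
  unfolding vslice2_def by(rule form_op_eqI[OF hsp[OF o(1)] B]) (simp add: adj_rten(2) rten(2) o v)
 show "vslice2 D a b et xi X:BL a a" unfolding e by(rule B)
 show "[|x:sp a; y:sp a|] ==> ip y ((vslice2 D a b et xi X) $$ x) = ip (vc a b y et) (X $$ (vc a b x xi))"
  unfolding e by(simp add: adj_rten(2) rten(2) o v)
qed

lemma vslice1:
 assumes o: "a:Ob" "b:Ob" and X: "X:BL (tn a b) (tn a b)" and v: "et:sp a" "xi:sp a"
 shows "vslice1 D a b et xi X = adj (lten a b et) oL X oL lten a b xi"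
  "vslice1 D a b et xi X:BL b b"
  "[|x:sp b; y:sp b|] ==> ip y ((vslice1 D a b et xi X) $$ x) = ip (vc a b et y) (X $$ (vc a b xi x))"
proof -
 have B: "adj (lten a b et) oL X oL lten a b xi:BL b b"
  by(rule blin_comp[OF lten(1)[OF o v(2)] blin_comp[OF X adj_lten(1)[OF o v(1)]]])
 show e: "vslice1 D a b et xi X = adj (lten a b et) oL X oL lten a b xi"
  unfolding vslice1_def by(rule form_op_eqI[OF hsp[OF o(2)] B]) (simp add: adj_lten(2) lten(2) o v)
 show "vslice1 D a b et xi X:BL b b" unfolding e by(rule B)
 show "[|x:sp b; y:sp b|] ==> ip y ((vslice1 D a b et xi X) $$ x) = ip (vc a b et y) (X $$ (vc a b xi x))"
  unfolding e by(simp add: adj_lten(2) lten(2) o v)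
qed

lemma tens_ext_coeff:
 assumes o: "a:Ob" "b:Ob" and X: "X:BL (tn a b) (tn a b)" "Y:BL (tn a b) (tn a b)"
  and eq: "!!x y x' y'. [|x:sp a; y:sp b; x':sp a; y':sp b|] ==>
  ip (vc a b x' y') (X $$ vc a b x y) = ip (vc a b x' y') (Y $$ vc a b x y)"
 shows "X = Y"
 by(rule tens_ext[OF o zorth_bop[OF X(1)] zorth_bop[OF X(2)]])
  (rule tens_total[OF o bop_in[OF X(1)] bop_in[OF X(2)]], rule eq)

lemma vslice2_ext:
 assumes o: "a:Ob" "b:Ob" and X: "X:BL (tn a b) (tn a b)" "Y:BL (tn a b) (tn a b)"
  and eq: "!!y y'. y:sp b ==> y':sp b ==> vslice2 D a b y' y X = vslice2 D a b y' y Y"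
 shows "X = Y"
 by(rule tens_ext_coeff[OF o X]) (simp add: vslice2(3)[OF o X(1), symmetric] vslice2(3)[OF o X(2), symmetric] eq)

subsection \<open>Leg notation\<close>

text \<open>\<open>ins a b c y\<close> inserts the vector \<open>y\<close> as a middle leg: \<open>x \<otimes> z \<mapsto> x \<otimes> y \<otimes> z\<close>.\<close>

definition ins where
 "ins a b c y = ot a (tn c b) a (tn b c) (hI a) (hf c b) oL rten (tn a c) b y"

context
 fixes a b c assumes o: "a:Ob" "b:Ob" "c:Ob"
begin

private lemma o': "tn a b:Ob" "tn b c:Ob" "tn a c:Ob" "tn c b:Ob"
 using o htens by auto

lemmas mid_flip = optensI[OF o(1) o'(4) o(1) o'(2) hid_bop[OF o(1)] hflip_works(1)[OF o(3,2)]]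
lemmas mid_flip' = optensI[OF o(1) o'(2) o(1) o'(4) hid_bop[OF o(1)] hflip_works(1)[OF o(2,3)]]

lemma ins_bop: "y:sp b ==> ins a b c y:BL (tn a c) (tn a (tn b c))"
 unfolding ins_def using rten(1)[OF o'(3) o(2)] mid_flip(1) by(intro blin_comp) (auto simp: htens_assoc o)

lemma ins_apply: "[|x:sp a; y:sp b; z:sp c|] ==>
  ins a b c y $$ vc a c x z = vc a (tn b c) x (vc b c y z)"
 unfolding ins_def using mid_flip(2)
 by(simp add: rten(2) o o' hvec_in hvec_assoc hid_apply hflip_works(2))

lemma mid_flip_comp: "ot a (tn b c) a (tn c b) (hI a) (hf b c) oL ot a (tn c b) a (tn b c) (hI a) (hf c b)
  = hI (tn a (tn c b))"
 using optens_comp[OF o(1) o'(4) o(1) o'(2) o(1) o'(4) hid_bop[OF o(1)] hflip_works(1)[OF o(3,2)] hid_bop[OF o(1)] hflip_works(1)[OF o(2,3)]]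
 by(simp add: hflip_hflip o comp_idop[OF hsp[OF o(1)] hid_bop[OF o(1)]] optens_id o')

lemma cinner_ins:
 assumes "y:sp b" "y':sp b" "u:sp (tn a c)" "u':sp (tn a c)"
 shows "ip (ins a b c y' $$ u') (ins a b c y $$ u) = ip y' y * ip u' u"
proof -
 have "adj (ot a (tn c b) a (tn b c) (hI a) (hf c b)) = ot a (tn b c) a (tn c b) (hI a) (hf b c)"
  using adj_optens[OF o(1) o'(4) o(1) o'(2) hid_bop[OF o(1)] hflip_works(1)[OF o(3,2)]]
  by(simp add: adj_idop[OF hsp[OF o(1)]] adj_hflip o)
 hence "blinfun_apply (adj (ot a (tn c b) a (tn b c) (hI a) (hf c b)))
  (ot a (tn c b) a (tn b c) (hI a) (hf c b) $$ w) = w" if "w:sp (tn a (tn c b))" for w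
  using mid_flip_comp that hid_apply[OF htens[OF o(1) o'(4)]] by(metis blinfun_apply_blinfun_compose)
 moreover have "vc (tn a c) b u y:sp (tn a (tn c b))"
  using hvec_in[OF o'(3) o(2)] assms by(simp add: htens_assoc o)
 ultimately show ?thesis
  using assms by(simp add: ins_def rten(2) o o' bop_cinner[OF mid_flip(1)] hvec_cinner mult.commute)
qed

lemma leg12:
 assumes X: "X:BL (tn a b) (tn a b)"
 shows "l12 a b c X:BL (tn a (tn b c)) (tn a (tn b c))"
  "[|v:sp (tn a b); z:sp c|] ==> l12 a b c X $$ vc (tn a b) c v z = vc (tn a b) c (X $$ v) z"
 using optensI(1,2)[OF o'(1) o(3) o'(1) o(3) X hid_bop[OF o(3)]]
 by(auto simp: leg12_def htens_assoc o hid_apply)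

lemma leg12_apply:
 assumes "X:BL (tn a b) (tn a b)" "x:sp a" "y:sp b" "z:sp c"
 shows "l12 a b c X $$ vc a (tn b c) x (vc b c y z) = vc (tn a b) c (X $$ vc a b x y) z"
 using leg12(2)[OF assms(1) hvec_in[OF o(1,2) assms(2,3)] assms(4)] by(simp add: hvec_assoc o assms)

lemma leg23:
 assumes X: "X:BL (tn b c) (tn b c)"
 shows "l23 a b c X:BL (tn a (tn b c)) (tn a (tn b c))"
  "[|x:sp a; v:sp (tn b c)|] ==> l23 a b c X $$ vc a (tn b c) x v = vc a (tn b c) x (X $$ v)"
 using optensI(1,2)[OF o(1) o'(2) o(1) o'(2) hid_bop[OF o(1)] X]
 by(auto simp: leg23_def o hid_apply)

lemma leg13:
 assumes X: "X:BL (tn a c) (tn a c)"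
 shows "l13 a b c X:BL (tn a (tn b c)) (tn a (tn b c))"
  "[|y:sp b; u:sp (tn a c)|] ==> l13 a b c X $$ ins a b c y $$ u = ins a b c y $$ X $$ u"
  "[|x:sp a; y:sp b; z:sp c|] ==> l13 a b c X $$ vc a (tn b c) x (vc b c y z) = ins a b c y $$ X $$ vc a c x z"
proof -
 have L: "l12 a c b X:BL (tn a (tn c b)) (tn a (tn c b))"
  "[|v:sp (tn a c); z:sp b|] ==> l12 a c b X $$ vc (tn a c) b v z = vc (tn a c) b (X $$ v) z" for v z
  using optensI(1,2)[OF o'(3) o(2) o'(3) o(2) X hid_bop[OF o(2)]]
  by(auto simp: leg12_def htens_assoc o hid_apply)
 show "l13 a b c X:BL (tn a (tn b c)) (tn a (tn b c))"
  unfolding leg13_def by(rule blin_comp[OF mid_flip'(1) blin_comp[OF L(1) mid_flip(1)]])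
 show B: "[|y:sp b; u:sp (tn a c)|] ==> l13 a b c X $$ ins a b c y $$ u = ins a b c y $$ X $$ u" for y u
 proof -
  assume yu: "y:sp b" "u:sp (tn a c)"
  have w: "vc (tn a c) b u y:sp (tn a (tn c b))"
  using hvec_in[OF o'(3) o(2)] yu by(simp add: htens_assoc o)
  have "ot a (tn b c) a (tn c b) (hI a) (hf b c) $$ ins a b c y $$ u = vc (tn a c) b u y"
  using mid_flip_comp hid_apply[OF htens[OF o(1) o'(4)] w] rten(2)[OF o'(3) o(2) yu]
  unfolding ins_def by(metis blinfun_apply_blinfun_compose)
  thus ?thesis using yu bop_in[OF X] by(simp add: leg13_def L(2) ins_def rten(2) o o')
 qed
 show "[|x:sp a; y:sp b; z:sp c|] ==> l13 a b c X $$ vc a (tn b c) x (vc b c y z) = ins a b c y $$ X $$ vc a c x z"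
  using B[of y "vc a c x z"] by(simp add: ins_apply hvec_in o)
qed

lemma leg12_comp:
 assumes X: "X:BL (tn a b) (tn a b)" "Y:BL (tn a b) (tn a b)"
 shows "l12 a b c (X oL Y) = l12 a b c X oL l12 a b c Y"
 unfolding leg12_def using optens_comp[OF o'(1) o(3) o'(1) o(3) o'(1) o(3) X(2) hid_bop[OF o(3)] X(1) hid_bop[OF o(3)]]
 by(simp add: comp_idop[OF hsp[OF o(3)] hid_bop[OF o(3)]])

lemma leg23_comp:
 assumes X: "X:BL (tn b c) (tn b c)" "Y:BL (tn b c) (tn b c)"
 shows "l23 a b c (X oL Y) = l23 a b c X oL l23 a b c Y"
 unfolding leg23_def using optens_comp[OF o(1) o'(2) o(1) o'(2) o(1) o'(2) hid_bop[OF o(1)] X(2) hid_bop[OF o(1)] X(1)]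
 by(simp add: comp_idop[OF hsp[OF o(1)] hid_bop[OF o(1)]])

lemma leg13_comp:
 assumes X: "X:BL (tn a c) (tn a c)" "Y:BL (tn a c) (tn a c)"
 shows "l13 a b c (X oL Y) = l13 a b c X oL l13 a b c Y"
 by(rule tens_ext3[OF o])
  (auto intro: zorth_oo zorth_bop[OF leg13(1)] blin_comp X
  simp: leg13 X blin_comp[OF X(2,1)] hvec_in o bop_in[OF X(2)])

lemma adj_leg12:
 assumes X: "X:BL (tn a b) (tn a b)"
 shows "adj (l12 a b c X) = l12 a b c (adj X)"
 unfolding leg12_def using adj_optens[OF o'(1) o(3) o'(1) o(3) X hid_bop[OF o(3)]]
 by(simp add: adj_idop[OF hsp[OF o(3)]])

lemma adj_leg23:
 assumes X: "X:BL (tn b c) (tn b c)"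
 shows "adj (l23 a b c X) = l23 a b c (adj X)"
 unfolding leg23_def using adj_optens[OF o(1) o'(2) o(1) o'(2) hid_bop[OF o(1)] X]
 by(simp add: adj_idop[OF hsp[OF o(1)]])

end

lemma adj_leg13:
 assumes o: "a:Ob" "b:Ob" "c:Ob" and X: "X:BL (tn a c) (tn a c)"
 shows "adj (l13 a b c X) = l13 a b c (adj X)"
 unfolding leg13_def adj_comp
 using adj_leg12[OF o(1,3,2) X]
  adj_optens[OF o(1) htens[OF o(3,2)] o(1) htens[OF o(2,3)] hid_bop[OF o(1)] hflip_works(1)[OF o(3,2)]]
  adj_optens[OF o(1) htens[OF o(2,3)] o(1) htens[OF o(3,2)] hid_bop[OF o(1)] hflip_works(1)[OF o(2,3)]]
 by(simp add: adj_idop[OF hsp[OF o(1)]] adj_hflip o oo_assoc)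

lemma leg_id:
 assumes o: "a:Ob" "b:Ob" "c:Ob"
 shows "l12 a b c (hI (tn a b)) = hI (tn a (tn b c))"
  "l23 a b c (hI (tn b c)) = hI (tn a (tn b c))"
  "l13 a b c (hI (tn a c)) = hI (tn a (tn b c))"
proof -
 show "l12 a b c (hI (tn a b)) = hI (tn a (tn b c))"
  unfolding leg12_def using optens_id[OF htens[OF o(1,2)] o(3)] by(simp add: htens_assoc o)
 show "l23 a b c (hI (tn b c)) = hI (tn a (tn b c))"
  unfolding leg23_def using optens_id[OF o(1) htens[OF o(2,3)]] by simp
 have h: "hI (tn a c):BL (tn a c) (tn a c)" by(rule hid_bop[OF htens[OF o(1,3)]])
 show "l13 a b c (hI (tn a c)) = hI (tn a (tn b c))"
  by(rule tens_ext3[OF o])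
  (auto intro: zorth_bop[OF leg13(1)[OF o h]] zorth_bop[OF hid_bop]
  simp: htens o leg13(3)[OF o h] hid_apply hvec_in ins_apply)
qed

end

section \<open>Bounded forms\<close>

text \<open>Riesz representation for each \<open>xi\<close>, with the form first composed with the
  projections because it is controlled on the subspaces only. The flag \<open>b\<close> in the
  second variable lets the resulting operator be antilinear.\<close>

lemma bounded_form_op:
 assumes H: "csub H" "csub H'" and C: "0 <= C"
  and add: "!!et et' xi. [|et:H'; et':H'; xi:H|] ==> q (et + et') xi = q et xi + q et' xi"
  "!!et xi xi'. [|et:H'; xi:H; xi':H|] ==> q et (xi + xi') = q et xi + q et xi'"
  and sc: "!!c et xi. [|et:H'; xi:H|] ==> q (c *\<^sub>C et) xi = cnj c * q et xi"
  "!!c et xi. [|et:H'; xi:H|] ==> q et (c *\<^sub>C xi) = cj b c * q et xi"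
  and bd: "!!et xi. [|et:H'; xi:H|] ==> cmod (q et xi) <= C * norm et * norm xi"
 shows "EX T:bop b H H'. (ALL xi:H. ALL et:H'. ip et (T $$ xi) = q et xi) & norm T <= C"
proof -
 define p where "p = proj_on H"
 define p' where "p' = proj_on H'"
 interpret p: bounded_linear p unfolding p_def by(rule proj_on_linear[OF H(1)])
 interpret p': bounded_linear p' unfolding p'_def by(rule proj_on_linear[OF H(2)])
 have pin: "p x:H" "p' x:H'" for x using proj_on(1) H by(auto simp: p_def p'_def)
 have pid: "x:H ==> p x = x" "x:H' ==> p' x = x" for x using proj_on_in H by(auto simp: p_def p'_def)
 have pn: "norm (p x) <= norm x" "norm (p' x) <= norm x" for x using norm_proj_on_le H by(auto simp: p_def p'_def)
 have pc: "p (c *\<^sub>C x) = c *\<^sub>C p x" for c x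
  using bop_scaleC[OF idop_bop[OF H(1)], of c x] by(simp add: idop_apply[OF H(1)] p_def)
 have pc': "p' (c *\<^sub>C x) = c *\<^sub>C p' x" for c x
  using bop_scaleC[OF idop_bop[OF H(2)], of c x] by(simp add: idop_apply[OF H(2)] p'_def)
 have bd': "cmod (q (p' et) (p xi)) <= C * norm et * norm xi" for et xi
  using bd[OF pin(2) pin(1)] by(rule order_trans) (intro mult_mono pn C mult_nonneg_nonneg; simp)
 have "EX u. ALL et. Re (q (p' et) (p xi)) = inner u et" for xi
 proof (rule riesz_representation, rule bounded_linear_intro[where K = "C * norm xi"])
  fix x y r
  show "Re (q (p' (x + y)) (p xi)) = Re (q (p' x) (p xi)) + Re (q (p' y) (p xi))"
  by(simp add: p'.add add pin)
  show "Re (q (p' (r *\<^sub>R x)) (p xi)) = r *\<^sub>R Re (q (p' x) (p xi))"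
  using sc(1)[OF pin(2) pin(1), of "cor r" x xi] by(simp add: p'.scaleR scaleC_of_real)
  have "norm (Re (q (p' x) (p xi))) <= cmod (q (p' x) (p xi))" using abs_Re_le_cmod by simp
  thus "norm (Re (q (p' x) (p xi))) <= norm x * (C * norm xi)" using bd'[of x xi] by(simp add: mult_ac)
 qed
 then obtain f where f: "!!xi et. Re (q (p' et) (p xi)) = inner (f xi) et" by metis
 have fc: "ip et (f xi) = q (p' et) (p xi)" for et xi
 proof -
  have "inner (\<i> *\<^sub>C et) (f xi) = Re (q (p' (\<i> *\<^sub>C et)) (p xi))" by(simp add: f inner_commute)
  also have "... = Im (q (p' et) (p xi))" by(simp add: pc' sc pin)
  finally show ?thesis by(simp add: cinner_eq_inner complex_eq_iff f inner_commute)
 qed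
 have bl: "bounded_linear f"
 proof (rule bounded_linear_intro[where K = C])
  fix x y r
  show "f (x + y) = f x + f y" by(rule cinner_eqI) (simp add: fc cinner_add_right p.add add pin)
  show "f (r *\<^sub>R x) = r *\<^sub>R f x"
  by(rule cinner_eqI) (simp add: scaleR_scaleC cinner_scaleC_right fc pc sc pin)
  have "cmod (ip (f x) (f x)) <= C * norm (f x) * norm x" unfolding fc by(rule bd')
  hence "norm (f x) * norm (f x) <= norm (f x) * (norm x * C)"
  by(simp add: cinner_self power2_eq_square norm_mult mult_ac)
  thus "norm (f x) <= norm x * C" by(cases "norm (f x) = 0") (use C in \<open>auto simp: mult_le_cancel_left\<close>)
 qed
 define T where "T = Blinfun f"
 have T: "blinfun_apply T = f" by(simp add: T_def bounded_linear_Blinfun_apply[OF bl])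
 show ?thesis
 proof (intro bexI[of _ T] conjI ballI)
  show "ip et (T $$ xi) = q et xi" if "xi:H" "et:H'" for xi et
  using that by(simp add: T fc pid)
  show "norm T <= C"
  proof (rule norm_blinfun_bound[OF C])
  fix x
  have "cmod (ip (f x) (f x)) <= C * norm (f x) * norm x" unfolding fc by(rule bd')
  hence "norm (f x) * norm (f x) <= norm (f x) * (C * norm x)"
  by(simp add: cinner_self power2_eq_square norm_mult mult_ac)
  thus "norm (T $$ x) <= C * norm x"
  by(cases "norm (f x) = 0") (use C in \<open>auto simp: mult_le_cancel_left T\<close>)
  qed
  show "T:bop b H H'"
  proof (rule bopI; (unfold T)?)
  show "f (c *\<^sub>C x) = cj b c *\<^sub>C f x" for c x
  by(rule cinner_eqI) (simp add: fc cinner_scaleC_right pc sc pin)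
  show "f x = 0" if "orth H x" for x
  proof (rule cinner_eqI)
  fix z
  have "q (p' z) 0 = 0" using sc(2)[OF pin(2) csubD(4)[OF H(1)], of z 0] by simp
  thus "ip z (f x) = ip z 0" using proj_on_orth[OF H(1) that] by(simp add: fc p_def)
  qed
  show "f x:H'" for x
  proof -
  have "ip z (f x - p' (f x)) = 0" for z
  proof -
  have o: "orth H' (f x - p' (f x))" using proj_on(2)[OF H(2)] by(simp add: p'_def)
  have "ip (z - p' z) (f x) = q (p' (z - p' z)) (p x)" by(rule fc)
  also have "p' (z - p' z) = 0" by(simp add: p'.diff pid pin)
  also have "q 0 (p x) = 0" using sc(1)[OF csubD(4)[OF H(2)] pin(1), of 0] by simp
  finally have 1: "ip (z - p' z) (f x) = 0" .
  have 2: "ip (z - p' z) (p' (f x)) = 0"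
  using proj_on(2)[OF H(2), of z] pin(2)[of "f x"] unfolding orth_def p'_def
  by(metis cinner_commute complex_cnj_zero)
  have 3: "ip (p' z) (f x - p' (f x)) = 0" using o pin(2) by(auto simp: orth_def)
  show ?thesis using 1 2 3 by(simp add: cinner_diff_left cinner_diff_right)
  qed
  from this[of "f x - p' (f x)"] have "f x = p' (f x)" by simp
  thus ?thesis using pin(2) by metis
  qed
  qed
 qed
qed

section \<open>Orthonormal bases\<close>

definition onb :: "'h::complex_hilbert set => 'h set => bool" where
 "onb H E \<longleftrightarrow> E <= H & (ALL e:E. ALL f:E. ip e f = (if e = f then 1 else 0)) &
  closure (span {c *\<^sub>C e |c e. e:E}) = H"

text \<open>A maximal orthonormal set is total: otherwise the normalized component of some vector
  orthogonal to its closed span could be added.\<close>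

lemma onb_exists:
 assumes H: "csub H"
 shows "EX E. onb H E"
proof -
 define A where "A = {E. E <= H & (ALL e:E. ALL f:E. ip e f = (if e = f then 1 else 0))}"
 have "EX M:A. ALL X:A. M <= X --> X = M"
 proof (rule subset_Zorn')
  fix C assume C: "subset.chain A C"
  show "\<Union>C:A"
  unfolding A_def
  proof (intro CollectI conjI ballI)
  show "\<Union>C <= H" using C by(auto simp: subset.chain_def A_def)
  fix e f assume "e:\<Union>C" "f:\<Union>C"
  then obtain X Y where XY: "X:C" "Y:C" "e:X" "f:Y" by blast
  hence "X <= Y \<or> Y <= X" using C by(auto simp: subset.chain_def)
  moreover have "X:A" "Y:A" using C XY by(auto simp: subset.chain_def)
  ultimately show "ip e f = (if e = f then 1 else 0)" using XY unfolding A_def by blast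
  qed
 qed
 then obtain E where E: "E:A" and mx: "!!X. X:A ==> E <= X ==> X = E" by blast
 have EH: "E <= H" and ort: "!!e f. e:E ==> f:E ==> ip e f = (if e = f then 1 else 0)"
  using E by(auto simp: A_def)
 let ?B = "{c *\<^sub>C e |c e. e:E}"
 let ?M = "closure (span ?B)"
 have M: "csub ?M" by(rule csub_closure_span) (auto simp: scaleC_scaleC, blast)
 have "?B <= H" using EH csubD(7)[OF H] by auto
 hence MH: "?M <= H"
  by(intro closure_minimal span_minimal csubD(1,2)[OF H])
 have "h:?M" if h: "h:H" for h
 proof (rule ccontr)
  assume hM: "h ~: ?M"
  define u where "u = h - proj_on ?M h"
  have u0: "u ~= 0" using hM proj_on(1)[OF M, of h] by(auto simp: u_def)
  have uH: "u:H" using h proj_on(1)[OF M, of h] MH csubD(6)[OF H] by(auto simp: u_def)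
  have uM: "ip e u = 0" if "e:E" for e
  proof -
  have "e:?B" using that scaleC_one by(metis (mono_tags, lifting) mem_Collect_eq)
  hence "e:?M" by(rule subsetD[OF closure_subset span_base])
  thus ?thesis using proj_on(2)[OF M, of h] by(simp add: u_def orth_def)
  qed
  define w where "w = cor (1 / norm u) *\<^sub>C u"
  have ww: "ip w w = 1"
  using u0 by(simp add: w_def cinner_self norm_scaleC norm_divide)
  have wE: "ip e w = 0" "ip w e = 0" if "e:E" for e
  using uM[OF that] cinner_commute[of w e] by(simp_all add: w_def cinner_scaleC_right)
  have wH: "w:H" using uH csubD(7)[OF H] by(simp add: w_def)
  have wn: "w ~: E" using wE(1)[of w] ww by auto
  have "insert w E:A" unfolding A_def
  proof (intro CollectI conjI ballI)
  show "insert w E <= H" using EH wH by simp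
  fix e f assume "e:insert w E" "f:insert w E"
  thus "ip e f = (if e = f then 1 else 0)"
  using wn ww wE ort by(cases "e = w"; cases "f = w") auto
  qed
  hence "w:E" using mx[of "insert w E"] by auto
  thus False using wn by simp
 qed
 hence "onb H E" using MH EH ort unfolding onb_def by blast
 thus ?thesis by blast
qed

section \<open>Expansion of tensors along an orthonormal basis of the second leg\<close>

context strict_hilb_cat begin

context
 fixes a b E assumes o: "a:Ob" "b:Ob" and E: "onb (sp b) E"
begin

text \<open>For finite \<open>F\<close> inside the basis this is the projection of \<open>u\<close>
  onto the tensors whose second leg lies in the span of \<open>F\<close>.\<close>

private definition pF where "pF F u = (SUM e:F. vc a b (adj (rten a b e) $$ u) e)"

private lemma Eb: "e:E ==> e:sp b" and ort: "e:E ==> f:E ==> ip e f = (if e = f then 1 else 0)"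
 using E by(auto simp: onb_def)

private lemma comp_in: "e:E ==> adj (rten a b e) $$ u:sp a"
 using bop_in[OF adj_rten(1)[OF o Eb]] by blast

private lemma cinner_pF:
 assumes "F <= E" shows "ip (pF F u) v = (SUM e:F. ip (adj (rten a b e) $$ u) (adj (rten a b e) $$ v))"
 unfolding pF_def cinner_sum_left
proof (rule sum.cong[OF refl])
 fix e assume "e:F"
 hence e: "e:E" using assms by blast
 show "ip (vc a b (adj (rten a b e) $$ u) e) v
  = ip (adj (rten a b e) $$ u) (adj (rten a b e) $$ v)"
  by(rule adj_rten(2)[OF o Eb[OF e] comp_in[OF e], symmetric])
qed

private lemma adj_pF:
 assumes F: "F <= E" "finite F" and e: "e:F"
 shows "adj (rten a b e) $$ pF F u = adj (rten a b e) $$ u"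
proof -
 have "adj (rten a b e) $$ pF F u
  = (SUM f:F. adj (rten a b e) $$ vc a b (adj (rten a b f) $$ u) f)"
  unfolding pF_def by(rule blinfun.sum_right)
 also have "... = (SUM f:F. if f = e then adj (rten a b e) $$ u else 0)"
 proof (rule sum.cong[OF refl])
  fix f assume "f:F"
  hence f: "f:E" and e': "e:E" using F e by auto
  show "adj (rten a b e) $$ vc a b (adj (rten a b f) $$ u) f
  = (if f = e then adj (rten a b e) $$ u else 0)"
  by(simp add: adj_rten(3)[OF o Eb[OF e'] comp_in[OF f] Eb[OF f]] ort[OF e' f])
 qed
 also have "... = adj (rten a b e) $$ u" using F(2) e by simp
 finally show ?thesis .
qed

private lemma pF_dist:
 assumes F: "F <= E" "finite F"
 shows "(norm (u - pF F u))^2 = (norm u)^2 - (SUM e:F. (norm (adj (rten a b e) $$ u))^2)"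
proof -
 let ?s = "cor (SUM e:F. (norm (adj (rten a b e) $$ u))^2)"
 have 1: "ip (pF F u) u = ?s" by(simp add: cinner_pF[OF F(1)] cinner_self)
 have 2: "ip u (pF F u) = ?s" using 1 cinner_swap_eq[of "pF F u" u] by simp
 have 3: "ip (pF F u) (pF F u) = ?s"
  by(subst cinner_pF[OF F(1)]) (simp add: adj_pF[OF F] cinner_self)
 have "cor ((norm (u - pF F u))^2) = cor ((norm u)^2) - ?s"
  unfolding cinner_self[symmetric] by(simp add: cinner_diff_left cinner_diff_right 1 2 3)
 thus ?thesis unfolding of_real_diff[symmetric] of_real_eq_iff .
qed

private lemma pF_add: "pF F (u + v) = pF F u + pF F v" if "F <= E"
 unfolding pF_def sum.distrib[symmetric]
 by(rule sum.cong[OF refl]) (use that in \<open>auto simp: blinfun.add_right hvec_add_left[OF o] comp_in Eb\<close>)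

private lemma pF_scaleR: "pF F (r *\<^sub>R u) = r *\<^sub>R pF F u" if "F <= E"
 unfolding pF_def scaleR_sum_right
 by(rule sum.cong[OF refl]) (use that in \<open>auto simp: blinfun.scaleR_right hvec_scaleR[OF o] comp_in Eb\<close>)

private lemma pF_contr: "norm (u - pF F u) <= norm u" if "F <= E" "finite F"
proof -
 have "(norm (u - pF F u))^2 <= (norm u)^2" unfolding pF_dist[OF that] by(simp add: sum_nonneg)
 thus ?thesis by(rule power2_le_imp_le) simp
qed

text \<open>\<open>u\<close> is the limit of its partial sums along the net of finite subsets of
  \<open>E\<close>. Such vectors form a closed subspace containing the elementary tensors, hence
  exhaust the tensor product.\<close>

private definition good where "good u \<longleftrightarrow> (ALL ep>0. EX F0. finite F0 & F0 <= E & (ALL F. finite F --> F0 <= F --> F <= E --> norm (u - pF F u) < ep))"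

private lemma good_add: assumes "good u" "good v" shows "good (u + v)"
 unfolding good_def
proof (intro allI impI)
 fix ep :: real assume "ep > 0"
 hence e: "ep/2 > 0" by simp
 obtain F0 where F0: "finite F0" "F0 <= E" "!!F. finite F ==> F0 <= F ==> F <= E ==> norm (u - pF F u) < ep/2"
  using assms(1) e unfolding good_def by metis
 obtain F1 where F1: "finite F1" "F1 <= E" "!!F. finite F ==> F1 <= F ==> F <= E ==> norm (v - pF F v) < ep/2"
  using assms(2) e unfolding good_def by metis
 show "EX F0. finite F0 & F0 <= E & (ALL F. finite F --> F0 <= F --> F <= E --> norm (u + v - pF F (u + v)) < ep)"
 proof (intro exI[of _ "F0 \<union> F1"] conjI allI impI)
  fix F assume F: "finite F" "F0 \<union> F1 <= F" "F <= E"
  have "u + v - pF F (u + v) = (u - pF F u) + (v - pF F v)" by(simp add: pF_add[OF F(3)])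
  moreover have "norm (u - pF F u) < ep/2" "norm (v - pF F v) < ep/2" using F0(3)[of F] F1(3)[of F] F by auto
  ultimately show "norm (u + v - pF F (u + v)) < ep"
  using norm_triangle_ineq[of "u - pF F u" "v - pF F v"] by(simp only:)
 qed (use F0 F1 in auto)
qed

private lemma good_zero: "good 0"
 unfolding good_def
proof (intro allI impI exI[of _ "{}"] conjI)
 fix ep :: real and F assume F: "finite F" "F <= E" and ep: "ep > 0"
 have "norm (0 - pF F 0) <= 0" using pF_contr[OF F(2,1), of 0] by simp
 thus "norm (0 - pF F 0) < ep" using ep by linarith
qed auto

private lemma good_scaleR: assumes "good u" shows "good (r *\<^sub>R u)"
proof (cases "r = 0")
 case False
 show ?thesis unfolding good_def
 proof (intro allI impI)
  fix ep :: real assume "ep > 0"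
  hence e: "ep / \<bar>r\<bar> > 0" using False by simp
  obtain F0 where F0: "finite F0" "F0 <= E" "!!F. finite F ==> F0 <= F ==> F <= E ==> norm (u - pF F u) < ep / \<bar>r\<bar>"
  using assms e unfolding good_def by metis
  show "EX F0. finite F0 & F0 <= E & (ALL F. finite F --> F0 <= F --> F <= E --> norm (r *\<^sub>R u - pF F (r *\<^sub>R u)) < ep)"
  proof (intro exI[of _ F0] conjI allI impI)
  fix F assume F: "finite F" "F0 <= F" "F <= E"
  have "r *\<^sub>R u - pF F (r *\<^sub>R u) = r *\<^sub>R (u - pF F u)" by(simp add: pF_scaleR[OF F(3)] scaleR_diff_right)
  hence "norm (r *\<^sub>R u - pF F (r *\<^sub>R u)) = \<bar>r\<bar> * norm (u - pF F u)" by(simp only: norm_scaleR)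
  thus "norm (r *\<^sub>R u - pF F (r *\<^sub>R u)) < ep" using F0(3)[OF F] False by(simp add: field_simps)
  qed (use F0 in auto)
 qed
qed (simp add: good_zero)

private lemma good_closed: "closed {u. good u}"
proof (rule closed_sequential_limits[THEN iffD2], intro allI impI, elim conjE)
 fix x l assume x: "ALL n. x n:{u. good u}" "x \<longlonglongrightarrow> l"
 have "good l" unfolding good_def
 proof (intro allI impI)
  fix ep :: real assume e: "ep > 0"
  obtain n where n: "norm (x n - l) < ep/2" using LIMSEQ_D[OF x(2), of "ep/2"] e by auto
  have "good (x n)" using x by blast
  then obtain F0 where F0: "finite F0" "F0 <= E" "!!F. finite F ==> F0 <= F ==> F <= E ==> norm (x n - pF F (x n)) < ep/2"
  unfolding good_def using e by(metis half_gt_zero)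
  show "EX F0. finite F0 & F0 <= E & (ALL F. finite F --> F0 <= F --> F <= E --> norm (l - pF F l) < ep)"
  proof (intro exI[of _ F0] conjI allI impI)
  fix F assume F: "finite F" "F0 <= F" "F <= E"
  have "l - pF F l = (x n - pF F (x n)) + ((l - x n) - pF F (l - x n))"
  using pF_add[OF F(3), of "l - x n" "x n"] by simp
  hence "norm (l - pF F l) <= norm (x n - pF F (x n)) + norm ((l - x n) - pF F (l - x n))"
  by(metis norm_triangle_ineq)
  also have "... < ep/2 + ep/2"
  using F0(3)[OF F] pF_contr[OF F(3,1), of "l - x n"] n by(simp add: norm_minus_commute)
  finally show "norm (l - pF F l) < ep" by simp
  qed (use F0 in auto)
 qed
 thus "l:{u. good u}" by simp
qed

private lemma good_all: "u:sp (tn a b) ==> good u"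
proof -
 have sub: "subspace {u. good u}" by(auto simp: subspace_def good_zero good_add good_scaleR)
 have g1: "good (vc a b k e)" if k: "k:sp a" and e: "e:E" for k e
  unfolding good_def
 proof (intro allI impI exI[of _ "{e}"] conjI)
  fix ep :: real and F assume F: "finite F" "{e} <= F" "F <= E" and ep: "ep > 0"
  have "pF F (vc a b k e) = (SUM f:F. if f = e then vc a b k e else 0)"
  unfolding pF_def
  proof (rule sum.cong[OF refl])
  fix f assume "f:F"
  hence f: "f:E" using F by auto
  show "vc a b (adj (rten a b f) $$ vc a b k e) f = (if f = e then vc a b k e else 0)"
  using hvec_scaleC_left[OF o k Eb[OF f], of 0]
  by(simp add: adj_rten(3)[OF o Eb[OF f] k Eb[OF e]] ort[OF f e])
  qed
  also have "... = vc a b k e" using F by simp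
  finally show "norm (vc a b k e - pF F (vc a b k e)) < ep" using ep by simp
 qed (use e in auto)
 have g2: "good (vc a b k h)" if k: "k:sp a" and h: "h:sp b" for k h
 proof -
  have "(blinfun_apply (lten a b k)) ` closure (span {c *\<^sub>C e |c e. e:E}) <= {u. good u}"
  proof (rule image_closure_subset)
  show "blinfun_apply (lten a b k) ` span {c *\<^sub>C e |c e. e:E} <= {u. good u}"
  proof (clarify)
  fix x assume "x:span {c *\<^sub>C e |c e. e:E}"
  thus "good (lten a b k $$ x)"
  proof (induction rule: span_induct_alt)
  case (step r x y)
  then obtain c e where ce: "x = c *\<^sub>C e" "e:E" by blast
  have "lten a b k $$ x = vc a b (c *\<^sub>C k) e"
  using ce k by(simp add: bop_scaleC[OF lten(1)[OF o k]] lten(2)[OF o k] Eb hvec_scaleC_left o)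
  hence "good (lten a b k $$ x)"
  using g1[of "c *\<^sub>C k" e] ce csubD(7)[OF hsp[OF o(1)] k] by simp
  thus ?case using step by(simp add: blinfun.add_right blinfun.scaleR_right good_add good_scaleR)
  qed (simp add: good_zero)
  qed
  qed (intro continuous_intros good_closed)+
  moreover have "closure (span {c *\<^sub>C e |c e. e:E}) = sp b" using E by(simp add: onb_def)
  ultimately have "good (lten a b k $$ h)" using h by blast
  thus ?thesis by(simp add: lten(2)[OF o k h])
 qed
 assume u: "u:sp (tn a b)"
 have "closure (span {vc a b x y |x y. x:sp a & y:sp b}) <= {u. good u}"
  using g2 by(intro closure_minimal span_minimal good_closed sub) auto
 thus "good u" using u by(auto simp: hsp_htens[OF o])
qed

lemma onb_expansion:
 assumes "u:sp (tn a b)"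
 shows "((%e. vc a b (adj (rten a b e) $$ u) e) has_sum u) E"
 unfolding has_sum_def tendsto_iff eventually_finite_subsets_at_top
proof (intro allI impI)
 fix ep :: real assume "0 < ep"
 then obtain F0 where F0: "finite F0" "F0 <= E" "!!F. finite F ==> F0 <= F ==> F <= E ==> norm (u - pF F u) < ep"
  using good_all[OF assms] unfolding good_def by metis
 thus "EX X. finite X & X <= E & (ALL Y. finite Y & X <= Y & Y <= E -->
  dist (SUM e:Y. vc a b (adj (rten a b e) $$ u) e) u < ep)"
  by(intro exI[of _ F0]) (auto simp: dist_norm norm_minus_commute pF_def)
qed

lemma parseval:
 assumes "u:sp (tn a b)"
 shows "((%e. ip (adj (rten a b e) $$ u) (adj (rten a b e) $$ v)) has_sum ip u v) E"
proof -
 have "bounded_linear (%w. ip w v)" by(rule bounded_bilinear.bounded_linear_left[OF bb_cinner])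
 hence 1: "((%e. ip (vc a b (adj (rten a b e) $$ u) e) v) has_sum ip u v) E"
  by(rule has_sum_bounded_linear) (rule onb_expansion[OF assms])
 show ?thesis
  by(rule has_sum_cong[THEN iffD1, OF _ 1]) (simp add: adj_rten(2)[OF o Eb comp_in])
qed

lemma parseval_norm:
 assumes "u:sp (tn a b)"
 shows "((%e. (norm (adj (rten a b e) $$ u))^2) has_sum (norm u)\<^sup>2) E"
 using has_sum_Re[OF parseval[OF assms, of u]] by(simp add: cinner_self)

end

end

section \<open>Normal functionals\<close>

lemma cinner_abs_summable:
 assumes "(%i. (norm (et i))^2) summable_on I" "(%i. (norm (xi i))^2) summable_on I"
 shows "(%i. norm (ip (et i) (x $$ (xi i)))) summable_on I"
proof (rule summable_on_comparison_test)
 show "(%i. norm x * ((norm (et i))^2 + (norm (xi i))^2)) summable_on I"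
  by(intro summable_on_cmult_right summable_on_add assms)
 fix i
 have "norm (ip (et i) (x $$ (xi i))) <= norm (et i) * (norm x * norm (xi i))"
  by(rule order_trans[OF cinner_cauchy]) (intro mult_left_mono norm_blinfun norm_ge_zero)
 also have "... = norm x * (norm (et i) * norm (xi i))" by simp
 also have "... <= norm x * ((norm (et i))^2 + (norm (xi i))^2)"
 proof (rule mult_left_mono)
  have "0 <= (norm (et i) - norm (xi i))^2 + (norm (et i))^2 + (norm (xi i))^2" by simp
  thus "norm (et i) * norm (xi i) <= (norm (et i))^2 + (norm (xi i))^2"
  by(simp add: power2_diff)
 qed simp
 finally show "norm (ip (et i) (x $$ (xi i))) <= norm x * ((norm (et i))^2 + (norm (xi i))^2)" .
qed simp

lemma cinner_summable:
 assumes "(%i. (norm (et i))^2) summable_on I" "(%i. (norm (xi i))^2) summable_on I"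
 shows "(%i. ip (et i) (x $$ (xi i))) summable_on I"
 by(rule abs_summable_summable[OF cinner_abs_summable[OF assms]])

text \<open>A representation of a normal functional with the series replaced by an unconditional
  sum, so that double sums may be interchanged.\<close>

definition normal_rep :: "'h::complex_hilbert set => 'h oper set => ('h oper => complex) => (nat => 'h) => (nat => 'h) => bool" where
 "normal_rep H M om et xi \<longleftrightarrow> (ALL n. et n:H) & (ALL n. xi n:H) & (%n. (norm (et n))^2) summable_on UNIV &
  (%n. (norm (xi n))^2) summable_on UNIV &
  (ALL x:M. ((%n. ip (et n) (x $$ (xi n))) has_sum om x) UNIV)"

lemma normal_repD:
 assumes "normal_rep H M om et xi"
 shows "et n:H" "xi n:H" "(%n. (norm (et n))^2) summable_on UNIV" "(%n. (norm (xi n))^2) summable_on UNIV"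
  "x:M ==> ((%n. ip (et n) (x $$ (xi n))) has_sum om x) UNIV"
 using assms by(auto simp: normal_rep_def)

lemma normal_fun_rep:
 fixes H :: "'h::complex_hilbert set"
 assumes "normal_fun H M om"
 shows "EX et xi. normal_rep H M om et xi"
proof -
 obtain et xi :: "nat => 'h" where e: "range et <= H" "range xi <= H" "summable (%n. (norm (et n))^2)"
  "summable (%n. (norm (xi n))^2)" "ALL x:M. om x = (\<Sum>n. ip (et n) (x $$ (xi n)))"
  using assms unfolding normal_fun_def by blast
 have s: "(%n. (norm (et n))^2) summable_on UNIV" "(%n. (norm (xi n))^2) summable_on UNIV"
  using e by(simp_all add: summable_on_UNIV_nonneg_real_iff)
 have "((%n. ip (et n) (x $$ (xi n))) has_sum om x) UNIV" if "x:M" for x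
 proof -
  have h: "((%n. ip (et n) (x $$ (xi n))) has_sum (infsum (%n. ip (et n) (x $$ (xi n))) UNIV)) UNIV"
  by(rule has_sum_infsum[OF cinner_summable[OF s]])
  have "om x = infsum (%n. ip (et n) (x $$ (xi n))) UNIV"
  using sums_unique[OF has_sum_imp_sums[OF h]] e(5) that by simp
  thus ?thesis using h by simp
 qed
 hence "normal_rep H M om et xi" using e(1,2) s by(auto simp: normal_rep_def)
 thus ?thesis by blast
qed

text \<open>Square summability leaves only countably many nonzero vectors, and these are renumbered
  by natural numbers. Functionals obtained from bases and from double sums thereby count as
  normal.\<close>

lemma normal_fun_index:
 fixes et xi :: "'i => 'h::complex_hilbert"
 assumes H: "0:H" "!!i. i:I ==> et i:H" "!!i. i:I ==> xi i:H"
  and s: "(%i. (norm (et i))^2) summable_on I" "(%i. (norm (xi i))^2) summable_on I"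
  and om: "!!x. x:M ==> ((%i. ip (et i) (x $$ (xi i))) has_sum om x) I"
 shows "normal_fun H M om"
proof -
 define J where "J = {i:I. et i ~= 0 \<or> xi i ~= 0}"
 have "J <= {i:I. (norm (et i))^2 ~= 0} \<union> {i:I. (norm (xi i))^2 ~= 0}" by(auto simp: J_def)
 moreover have "countable ({i:I. (norm (et i))^2 ~= 0} \<union> {i:I. (norm (xi i))^2 ~= 0})"
  using summable_countable_real[OF s(1)] summable_countable_real[OF s(2)] by blast
 ultimately have "countable J" by(rule countable_subset)
 then obtain f :: "'i => nat" where f: "inj_on f J" by(auto simp: countable_def)
 define et' where "et' n = (if n:f ` J then et (inv_into J f n) else 0)" for n
 define xi' where "xi' n = (if n:f ` J then xi (inv_into J f n) else 0)" for n
 have J: "J <= I" by(auto simp: J_def)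
 have tr: "((%i. g (et i) (xi i)) has_sum S) I \<longleftrightarrow> ((%n. g (et' n) (xi' n)) has_sum S) UNIV"
  if "g 0 0 = 0" for g :: "'h => 'h => 'z::{comm_monoid_add,topological_space}" and S
 proof -
  have "((%i. g (et i) (xi i)) has_sum S) I \<longleftrightarrow> ((%i. g (et i) (xi i)) has_sum S) J"
  by(rule has_sum_cong_neutral) (auto simp: J_def that)
  also have "... \<longleftrightarrow> ((%n. g (et' n) (xi' n)) \<circ> f has_sum S) J"
  by(rule has_sum_cong) (simp add: et'_def xi'_def inv_into_f_f[OF f])
  also have "... \<longleftrightarrow> ((%n. g (et' n) (xi' n)) has_sum S) (f ` J)"
  by(rule has_sum_reindex[OF f, symmetric])
  also have "... \<longleftrightarrow> ((%n. g (et' n) (xi' n)) has_sum S) UNIV"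
  by(rule has_sum_cong_neutral) (auto simp: et'_def xi'_def that)
  finally show ?thesis .
 qed
 show ?thesis unfolding normal_fun_def
 proof (rule exI[of _ et'], rule exI[of _ xi'], intro conjI ballI)
  show "range et' <= H" "range xi' <= H" using H J by(auto simp: et'_def xi'_def inv_into_f_f[OF f])
  show "summable (%n. (norm (et' n))^2)"
  using s(1) tr[of "%u v. (norm u)^2"] by(auto simp: summable_on_def intro!: summable_on_imp_summable)
  show "summable (%n. (norm (xi' n))^2)"
  using s(2) tr[of "%u v. (norm v)^2"] by(auto simp: summable_on_def intro!: summable_on_imp_summable)
  fix x assume "x:M"
  hence "((%n. ip (et' n) (x $$ (xi' n))) has_sum om x) UNIV"
  using om tr[of "%u v. ip u (x $$ v)" "om x"] by simp
  thus "om x = (\<Sum>n. ip (et' n) (x $$ (xi' n)))"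
  using has_sum_imp_sums sums_unique by blast
 qed
qed

lemma normal_fun_vector:
 assumes "et:H" "xi:H" "0:H"
 shows "normal_fun H M (%x. ip et (x $$ xi))"
 by(rule normal_fun_index[where I = "{()}" and et = "%_. et" and xi = "%_. xi"])
  (use assms in \<open>auto intro!: has_sum_finiteI\<close>)

lemma normal_fun_diff:
 assumes H: "csub H" and fg: "normal_fun H M f" "normal_fun H M g"
 shows "normal_fun H M (%x. f x - g x)"
proof -
 obtain et xi where "normal_rep H M f et xi" using normal_fun_rep[OF fg(1)] by blast
 note f = normal_repD[OF this]
 obtain et' xi' where "normal_rep H M g et' xi'" using normal_fun_rep[OF fg(2)] by blast
 note g = normal_repD[OF this]
 have inl: "(h has_sum s) UNIV ==> (case_sum h k has_sum s) (range Inl)"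
  and inr: "(k has_sum t) UNIV ==> (case_sum h k has_sum t) (range Inr)"
  for h k :: "nat => 'z::{comm_monoid_add,topological_space}" and s t
  by(subst has_sum_reindex; simp add: o_def)+
 have un: "(case_sum h k has_sum (s + t)) UNIV" if "(h has_sum s) UNIV" "(k has_sum t) UNIV"
  for h k :: "nat => 'z::topological_comm_monoid_add" and s t
 proof -
  have "range Inl \<inter> range Inr = ({} :: (nat + nat) set)" by auto
  thus ?thesis
  using has_sum_Un_disjoint[OF inl[OF that(1), of k] inr[OF that(2), of h]] by(simp only: UNIV_sum)
 qed
 have cs: "F (case_sum p q i) = case_sum (%n. F (p n)) (%n. F (q n)) i" for F :: "'a => real" and p q :: "nat => 'a" and i
  by(cases i) auto
 have cs2: "ip (case_sum p q i) (x $$ case_sum p' q' i)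
  = case_sum (%n. ip (p n) (x $$ p' n)) (%n. ip (q n) (x $$ q' n)) i"
  for p q p' q' :: "nat => 'a" and i x
  by(cases i) auto
 show ?thesis
 proof (rule normal_fun_index[where I = UNIV and et = "case_sum et (%n. - et' n)" and xi = "case_sum xi xi'"])
  show "(%i. (norm (case_sum et (%n. - et' n) i))^2) summable_on UNIV"
  unfolding cs[of "%v. (norm v)^2"] norm_minus_cancel using f(3) g(3) un unfolding summable_on_def by blast
  show "(%i. (norm (case_sum xi xi' i))^2) summable_on UNIV"
  unfolding cs[of "%v. (norm v)^2"] using f(4) g(4) un unfolding summable_on_def by blast
  show "0:H" by(rule csubD(4)[OF H])
  fix i show "case_sum et (%n. - et' n) i:H" "case_sum xi xi' i:H"
  using f g csubD(9)[OF H] by(cases i; simp)+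
 next
  fix x assume x: "x:M"
  have "((%n. ip (- et' n) (x $$ (xi' n))) has_sum - g x) UNIV"
  unfolding cinner_minus_left using g(5)[OF x] by(simp add: has_sum_uminus)
  thus "((%i. ip (case_sum et (%n. - et' n) i) (x $$ (case_sum xi xi' i))) has_sum f x - g x) UNIV"
  unfolding cs2 using un[OF f(5)[OF x]] by(metis add_uminus_conv_diff)
 qed
qed

section \<open>Normal functionals on a bicommutant\<close>

text \<open>By Pythagoras a finite tail of the sum has as squared norm the corresponding tail of the
  sum of squared norms.\<close>

lemma orthogonal_summable:
 fixes g :: "'i => 'a::{real_inner, complete_space}"
 assumes ort: "!!e f. [|e:E; f:E; e ~= f|] ==> inner (g e) (g f) = 0"
  and s: "((%e. (norm (g e))^2) has_sum S) E"
 shows "g summable_on E" "(norm (infsum g E))^2 = S"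
proof -
 have pyth: "(norm (SUM e:F. g e))^2 = (SUM e:F. (norm (g e))^2)" if F: "finite F" "F <= E" for F
  using F
 proof (induction F rule: finite_induct)
  case (insert x F)
  have "inner (g x) (SUM e:F. g e) = 0"
  unfolding inner_sum_right using insert ort by(intro sum.neutral) auto
  thus ?case using insert
  by(simp add: power2_norm_eq_inner inner_add_left inner_add_right inner_commute)
 qed simp
 have fin: "EX F. finite F & F <= E & (ALL G. finite G --> F <= G --> G <= E --> norm ((SUM e:G. g e) - (SUM e:F. g e)) < d)" if d: "d > 0" for d
 proof -
  have "\<forall>\<^sub>F F in finite_subsets_at_top E. dist (SUM e:F. (norm (g e))^2) S < d\<^sup>2 / 2"
  using s d unfolding has_sum_def by(intro tendstoD) auto
  hence "EX F. finite F & F <= E & (ALL G. finite G & F <= G & G <= E --> dist (SUM e:G. (norm (g e))^2) S < d\<^sup>2 / 2)"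
  by(simp only: eventually_finite_subsets_at_top)
  then obtain F where F: "finite F" "F <= E" "ALL G. finite G & F <= G & G <= E --> dist (SUM e:G. (norm (g e))^2) S < d\<^sup>2 / 2"
  by(elim exE conjE)
  have "norm ((SUM e:G. g e) - (SUM e:F. g e)) < d" if G: "finite G" "F <= G" "G <= E" for G
  proof -
  have "(SUM e:G. g e) - (SUM e:F. g e) = (SUM e:G - F. g e)" using G F by(simp add: sum_diff)
  hence "(norm ((SUM e:G. g e) - (SUM e:F. g e)))^2 = (SUM e:G - F. (norm (g e))^2)"
  using pyth[of "G - F"] G by auto
  also have "... = (SUM e:G. (norm (g e))^2) - (SUM e:F. (norm (g e))^2)" using G F by(simp add: sum_diff)
  also have "... < d\<^sup>2" using F(3)[rule_format, of G, OF conjI[OF G(1) conjI[OF G(2,3)]]] F(3)[rule_format, of F, OF conjI[OF F(1) conjI[OF subset_refl F(2)]]] unfolding dist_real_def by linarith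
  finally show ?thesis using d by(simp add: power_less_imp_less_base)
  qed
  thus ?thesis using F by blast
 qed
 have "ALL n. EX F. finite F & F <= E & (ALL G. finite G --> F <= G --> G <= E --> norm ((SUM e:G. g e) - (SUM e:F. g e)) < inverse (real (Suc n)))"
  using fin by(simp del: of_nat_Suc)
 then obtain F where F: "!!n. finite (F n)" "!!n. F n <= E"
  "!!n G. finite G ==> F n <= G ==> G <= E ==> norm ((SUM e:G. g e) - (SUM e:F n. g e)) < inverse (real (Suc n))"
  by metis
 define x where "x n = (SUM e:F n. g e)" for n
 have d2: "norm (x m - x n) < 2 * inverse (real (Suc N))" if "m >= N" "n >= N" for m n N
 proof -
  have le: "inverse (real (Suc k)) <= inverse (real (Suc N))" if "k >= N" for k using that by(simp add: field_simps)
  let ?G = "F m \<union> F n"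
  have G: "finite ?G" "?G <= E" using F(1,2) by auto
  have "norm ((SUM e:?G. g e) - x m) < inverse (real (Suc m))" "norm ((SUM e:?G. g e) - x n) < inverse (real (Suc n))"
  unfolding x_def by(rule F(3)[OF G(1) _ G(2)], blast)+
  moreover have "norm (x m - x n) <= norm ((SUM e:?G. g e) - x m) + norm ((SUM e:?G. g e) - x n)"
  by(metis add.commute dist_commute dist_norm dist_triangle3 norm_minus_commute)
  ultimately show ?thesis using le[OF that(1)] le[OF that(2)] by linarith
 qed
 have "Cauchy x"
 proof (rule CauchyI)
  fix e :: real assume "0 < e"
  then obtain N where N: "inverse (real (Suc N)) < e / 2" using reals_Archimedean[of "e/2"] by auto
  show "EX M. ALL m>=M. ALL n>=M. norm (x m - x n) < e"
  proof (intro exI[of _ N] allI impI)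
  fix m n assume "N <= m" "N <= n"
  from d2[OF this] N show "norm (x m - x n) < e" by linarith
  qed
 qed
 then obtain L where L: "x \<longlonglongrightarrow> L" using Cauchy_convergent convergent_def by blast
 have hs: "(g has_sum L) E"
  unfolding has_sum_def tendsto_iff eventually_finite_subsets_at_top
 proof (intro allI impI)
  fix e :: real assume e: "0 < e"
  obtain N1 where N1: "!!n. n >= N1 ==> norm (x n - L) < e / 2" using LIMSEQ_D[OF L, of "e/2"] e by auto
  obtain N2 where N2: "inverse (real (Suc N2)) < e / 2" using reals_Archimedean[of "e/2"] e by auto
  define n where "n = max N1 N2"
  have le: "inverse (real (Suc n)) <= inverse (real (Suc N2))" by(simp add: n_def field_simps)
  show "EX X. finite X & X <= E & (ALL Y. finite Y & X <= Y & Y <= E --> dist (sum g Y) L < e)"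
  proof (intro exI[of _ "F n"] conjI allI impI)
  fix Y assume Y: "finite Y & F n <= Y & Y <= E"
  have "norm (sum g Y - x n) < inverse (real (Suc n))" using F(3)[of Y n] Y by(simp add: x_def)
  moreover have "norm (x n - L) < e/2" by(rule N1) (simp add: n_def)
  moreover have "dist (sum g Y) L <= norm (sum g Y - x n) + norm (x n - L)"
  by(simp add: dist_norm[symmetric] dist_triangle)
  ultimately show "dist (sum g Y) L < e" using N2 le by linarith
  qed (use F in auto)
 qed
 thus sm: "g summable_on E" by(rule has_sum_imp_summable)
 have "((%F. (norm (SUM e:F. g e))^2) \<longlongrightarrow> (norm L)\<^sup>2) (finite_subsets_at_top E)"
  using hs unfolding has_sum_def by(intro tendsto_intros)
 moreover have "\<forall>\<^sub>F F in finite_subsets_at_top E. (norm (SUM e:F. g e))^2 = (SUM e:F. (norm (g e))^2)"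
  using pyth by(intro eventually_finite_subsets_at_top_weakI)
 ultimately have "((%F. SUM e:F. (norm (g e))^2) \<longlongrightarrow> (norm L)\<^sup>2) (finite_subsets_at_top E)"
  by(rule Lim_transform_eventually)
 hence "((%e. (norm (g e))^2) has_sum (norm L)\<^sup>2) E" by(simp add: has_sum_def)
 thus "(norm (infsum g E))^2 = S" using s has_sum_unique infsumI[OF hs] by metis
qed

lemma has_sum_sum:
 fixes f :: "'i => 'n => 'a::{comm_monoid_add,topological_comm_monoid_add}"
 assumes "finite F" "!!i. i:F ==> (f i has_sum s i) A"
 shows "((%n. SUM i:F. f i n) has_sum (SUM i:F. s i)) A"
 using assms by(induction rule: finite_induct) (simp_all add: has_sum_add)

lemma onb_finite_expansion:
 assumes E: "onb H E" "finite E" and H: "csub H" and u: "u:H"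
 shows "u = (SUM e:E. ip e u *\<^sub>C e)"
proof -
 define v where "v = u - (SUM e:E. ip e u *\<^sub>C e)"
 have EH: "E <= H" and ee: "!!e f. e:E ==> f:E ==> ip e f = (if e = f then 1 else 0)"
  and cl: "closure (span {c *\<^sub>C e |c e. e:E}) = H" using E(1) by(auto simp: onb_def)
 have vH: "v:H" unfolding v_def
  by(intro csubD(6)[OF H u] subspace_sum[OF csubD(1)[OF H]] csubD(7)[OF H]) (use EH in auto)
 have "ip f v = 0" if "f:E" for f
  using that E(2) by(simp add: v_def cinner_diff_right cinner_sum_right cinner_scaleC_right ee if_distrib[of "(*) _"] sum.delta cong: if_cong)
 hence z: "ip (c *\<^sub>C f) v = 0" if "f:E" for f c using that by(simp add: cinner_scaleC_left)
 have "ip v v = 0"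
 proof (rule eq_on_closure_span[where f = "%x. ip x v" and g = "%_. 0" and B = "{c *\<^sub>C e |c e. e:E}"])
  show "bounded_linear (%x. ip x v)" by(rule bounded_bilinear.bounded_linear_left[OF bb_cinner])
 qed (use z cl vH in auto)
 thus ?thesis by(simp add: v_def)
qed

context strict_hilb_cat begin

lemma rten_natural:
 assumes o: "a:Ob" "a':Ob" "b:Ob" and t: "t:BL a a'" and q: "q:sp b"
 shows "ot a b a' b t (hI b) oL rten a b q = rten a' b q oL t"
  "adj (rten a' b q) oL ot a b a' b t (hI b) = t oL adj (rten a b q)"
proof -
 note X = optensI[OF o(1,3,2,3) t hid_bop[OF o(3)]]
 show "ot a b a' b t (hI b) oL rten a b q = rten a' b q oL t"
  by(rule bop_eqI[OF hsp[OF o(1)] blin_comp[OF rten(1)[OF o(1,3) q] X(1)] blin_comp[OF t rten(1)[OF o(2,3) q]]])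
  (simp add: rten(2) o q X(2) hid_apply bop_in[OF t])
 show "adj (rten a' b q) oL ot a b a' b t (hI b) = t oL adj (rten a b q)"
  by(rule tens_ext[OF o(1,3)])
  (auto intro: zorth_oo zorth_bop[OF X(1)] zorth_bop[OF adj_rten(1)[OF o(1,3) q]]
  simp: X(2) adj_rten(3) o q hid_apply bop_in[OF t] bop_scaleC[OF t])
qed

text \<open>\<open>t \<otimes> 1\<close> slides through creation operators of the second leg, and an
  operator is determined by its slices; hence commuting with all slices of \<open>X\<close>
  suffices.\<close>

lemma commute_tensor:
 assumes o: "a:Ob" "b:Ob" and t: "t:BL a a" and X: "X:BL (tn a b) (tn a b)"
  and c: "!!p q. p:sp b ==> q:sp b ==> t oL vslice2 D a b p q X = vslice2 D a b p q X oL t"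
 shows "ot a b a b t (hI b) oL X = X oL ot a b a b t (hI b)"
proof -
 let ?t = "ot a b a b t (hI b)"
 note T = optensI(1)[OF o o t hid_bop[OF o(2)]]
 show ?thesis
 proof (rule vslice2_ext[OF o blin_comp[OF X T] blin_comp[OF T X]])
  fix q p assume pq: "q:sp b" "p:sp b"
  note r = rten_natural[OF o(1) o(1) o(2) t]
  have "vslice2 D a b p q (?t oL X) = (adj (rten a b p) oL ?t) oL X oL rten a b q"
  by(simp add: vslice2(1)[OF o blin_comp[OF X T] pq(2,1)] oo_assoc)
  also have "... = t oL vslice2 D a b p q X"
  by(simp add: r(2)[OF pq(2)] vslice2(1)[OF o X pq(2,1)] oo_assoc)
  also have "... = vslice2 D a b p q X oL t" by(rule c[OF pq(2,1)])
  also have "... = adj (rten a b p) oL X oL (?t oL rten a b q)"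
  by(simp add: r(1)[OF pq(1), symmetric] vslice2(1)[OF o X pq(2,1)] oo_assoc)
  also have "... = vslice2 D a b p q (X oL ?t)"
  by(simp add: vslice2(1)[OF o blin_comp[OF T X] pq(2,1)] oo_assoc)
  finally show "vslice2 D a b p q (?t oL X) = vslice2 D a b p q (X oL ?t)" .
 qed
qed

context
 fixes k A assumes o: "k:Ob" and A: "A <= BL k k" "subspace A" "!!c a. a:A ==> scl c a:A"
  "!!a b. a:A ==> b:A ==> a oL b:A" "!!a. a:A ==> adj a:A"
  and nd: "closure (span {a $$ x |a x. a:A & x:sp k}) = sp k"
begin

text \<open>A functional \<open>y \<mapsto> \<Sum>\<^sub>e \<langle>\<eta>\<^sub>e, y \<xi>\<^sub>e\<rangle>\<close> indexed by an orthonormal basis of \<open>k\<close> is \<open>y \<mapsto> \<langle>\<theta>, (y \<otimes> 1) \<zeta>\<rangle>\<close> with \<open>\<zeta> = \<Sum>\<^sub>e \<xi>\<^sub>e \<otimes> e\<close>, and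
  the projection onto the closure of \<open>(A \<otimes> 1) \<zeta>\<close> commutes with \<open>A \<otimes> 1\<close>, hence with \<open>x \<otimes> 1\<close> for \<open>x\<close> in the bicommutant.\<close>

lemma basis_functional_zero:
 assumes E: "onb (sp k) E" and v: "!!e. e:E ==> et e:sp k" "!!e. e:E ==> xi e:sp k"
  and s: "(%e. (norm (et e))^2) summable_on E" "(%e. (norm (xi e))^2) summable_on E"
  and zero: "!!a. a:A ==> ((%e. ip (et e) (a $$ (xi e))) has_sum 0) E"
  and x: "x:commutant (sp k) (commutant (sp k) A)"
 shows "((%e. ip (et e) (x $$ (xi e))) has_sum 0) E"
proof -
 note oo = o o and H = hsp[OF o] and HK = hsp[OF htens[OF o o]]
 have EH: "e:sp k" if "e:E" for e using E that by(auto simp: onb_def)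
 have EE: "ip e e' = (if e = e' then 1 else 0)" if "e:E" "e':E" for e e' using E that by(auto simp: onb_def)
 \<comment> \<open>A square summable family indexed by the basis is the family of components of one
   vector of \<open>k \<otimes> k\<close>: its terms \<open>f e \<otimes> e\<close> are
   orthogonal.\<close>
 have vec: "EX z:sp (tn k k). ALL e:E. adj (rten k k e) $$ z = f e"
  if f: "!!e. e:E ==> f e:sp k" and fs: "(%e. (norm (f e))^2) summable_on E" for f
 proof -
  have m: "vc k k (f e) e:sp (tn k k)" if "e:E" for e by(rule hvec_in[OF oo f[OF that] EH[OF that]])
  have n: "norm (vc k k (f e) e) = norm (f e)" if "e:E" for e
  proof -
  have "cor ((norm e)^2) = 1" using EE[OF that that] cinner_self[of e] by simp
  hence "norm e = 1" using norm_ge_zero[of e] by(simp flip: of_real_power add: power2_eq_1_iff)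
  thus ?thesis by(simp add: norm_hvec[OF oo f[OF that] EH[OF that]])
  qed
  have "(%e. vc k k (f e) e) summable_on E"
  proof (rule orthogonal_summable(1))
  have "((%e. (norm (vc k k (f e) e))^2) has_sum infsum (%e. (norm (f e))^2) E) E \<longleftrightarrow> ((%e. (norm (f e))^2) has_sum infsum (%e. (norm (f e))^2) E) E"
  by(rule has_sum_cong) (simp add: n)
  thus "((%e. (norm (vc k k (f e) e))^2) has_sum infsum (%e. (norm (f e))^2) E) E" using has_sum_infsum[OF fs] by blast
  qed (simp add: inner_eq_Re_cinner hvec_cinner oo f EH EE)
  then obtain z where z: "((%e. vc k k (f e) e) has_sum z) E" by(auto simp: summable_on_def)
  have zp: "z = proj_on (sp (tn k k)) z"
  proof (rule has_sum_unique[OF z])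
  have "((%e. proj_on (sp (tn k k)) (vc k k (f e) e)) has_sum proj_on (sp (tn k k)) z) E"
  by(rule has_sum_bounded_linear[OF proj_on_linear[OF HK] z])
  thus "((%e. vc k k (f e) e) has_sum proj_on (sp (tn k k)) z) E"
  using has_sum_cong[of E "%e. proj_on (sp (tn k k)) (vc k k (f e) e)" "%e. vc k k (f e) e"] proj_on_in[OF HK m] by simp
  qed
  have "adj (rten k k e) $$ z = f e" if e: "e:E" for e
  proof (rule has_sum_unique[OF has_sum_bounded_linear[OF bl_right z]])
  show "((%e'. adj (rten k k e) $$ vc k k (f e') e') has_sum f e) E"
  by(rule has_sum_finite_neutralI[of "{e}"]) (use e EE EH f in \<open>auto simp: adj_rten(3) oo\<close>)
  qed
  thus ?thesis using zp proj_on(1)[OF HK, of z] by(intro bexI[of _ z]) auto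
 qed
 obtain ze where ze: "ze:sp (tn k k)" "ALL e:E. adj (rten k k e) $$ ze = xi e" using vec[OF v(2) s(2)] by blast
 obtain \<theta> where \<theta>: "\<theta>:sp (tn k k)" "ALL e:E. adj (rten k k e) $$ \<theta> = et e" using vec[OF v(1) s(1)] by blast
 let ?t = "%y. ot k k k k y (hI k)"
 note tB = optensI(1)[OF oo oo _ hid_bop[OF o]]
 have AB: "y:A ==> y:BL k k" for y using A(1) by blast
 have xB: "x:BL k k" using x by(simp add: commutant_def)
 have rt: "adj (rten k k e) $$ ?t y $$ u = y $$ adj (rten k k e) $$ u"
  if "y:BL k k" "e:sp k" for y e u
  using arg_cong[OF rten_natural(2)[OF o o o that], of "%T. T $$ u"] by simp
 have pair: "((%e. ip (et e) (y $$ (xi e))) has_sum ip \<theta> (?t y $$ ze)) E" if y: "y:BL k k" for y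
 proof -
  have "((%e. ip (adj (rten k k e) $$ \<theta>) (adj (rten k k e) $$ ?t y $$ ze)) has_sum ip \<theta> (?t y $$ ze)) E
  \<longleftrightarrow> ((%e. ip (et e) (y $$ (xi e))) has_sum ip \<theta> (?t y $$ ze)) E"
  by(rule has_sum_cong) (simp add: rt[OF y EH] ze \<theta>)
  thus ?thesis using parseval[OF oo E \<theta>(1)] by blast
 qed
 let ?B = "{?t y $$ ze |y. y:A}"
 define Z where "Z = closure (span ?B)"
 have Z: "csub Z" unfolding Z_def
 proof (rule csub_closure_span)
  fix c w assume "w:?B"
  then obtain y where y: "w = ?t y $$ ze" "y:A" by blast
  thus "c *\<^sub>C w:?B" using optens_scl(1)[OF oo oo AB[OF y(2)] hid_bop[OF o], of c] A(3)[OF y(2), of c]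
  by(auto simp: scl_apply intro!: exI[of _ "scl c y"])
 qed
 have ZK: "Z <= sp (tn k k)" unfolding Z_def
  by(intro closure_minimal span_minimal csubD(1,2)[OF HK]) (use bop_in[OF tB[OF AB]] in auto)
 define P where "P = idop Z"
 have P: "P $$ u:Z" "u:Z ==> P $$ u = u" for u
  using bop_in[OF idop_bop[OF Z]] idop_in[OF Z] by(auto simp: P_def)
 have PB: "P:BL (tn k k) (tn k k)"
 proof (rule bopI)
  show "P $$ (c *\<^sub>C u) = cj False c *\<^sub>C P $$ u" for c u unfolding P_def by(rule bop_scaleC[OF idop_bop[OF Z]])
  show "orth (sp (tn k k)) u ==> P $$ u = 0" for u
  unfolding P_def by(rule bop_orth[OF idop_bop[OF Z]]) (use ZK in \<open>auto simp: orth_def\<close>)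
  show "P $$ u:sp (tn k k)" for u using P(1) ZK by blast
 qed
 have inv: "?t y $$ u:Z" if y: "y:A" and u: "u:Z" for y u
 proof -
  have "blinfun_apply (?t y) ` closure (span ?B) <= Z"
  proof (rule image_closure_subset)
  show "blinfun_apply (?t y) ` span ?B <= Z"
  unfolding linear_span_image[OF bounded_linear.linear[OF bl_right], symmetric]
  proof (rule span_minimal[OF _ csubD(1)[OF Z]], clarify)
  fix y' assume y': "y':A"
  have "?t y oL ?t y' = ?t (y oL y')"
  using optens_comp[OF oo oo oo AB[OF y'] hid_bop[OF o] AB[OF y] hid_bop[OF o]] by(simp add: idop_comp[OF H hid_bop[OF o]])
  from arg_cong[OF this, of "%T. T $$ ze"]
  have "?t y $$ ?t y' $$ ze:?B" using A(4)[OF y y'] by auto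
  thus "?t y $$ ?t y' $$ ze:Z" unfolding Z_def by(rule subsetD[OF closure_subset span_base])
  qed
  qed (use csubD(2)[OF Z] in \<open>auto intro: continuous_intros\<close>)
  thus ?thesis using u by(auto simp: Z_def)
 qed
 \<comment> \<open>The range of \<open>P\<close> is invariant under \<open>A \<otimes> 1\<close>,
   and \<open>A\<close> is stable under adjoints, so taking adjoints turns invariance into
   commutation.\<close>
 have com: "P oL ?t y = ?t y oL P" if y: "y:A" for y
 proof -
  have e: "P oL (?t y' oL P) = ?t y' oL P" if "y':A" for y' by(rule blinfun_eqI) (simp add: P inv[OF that])
  have a: "adj (?t (adj y)) = ?t y"
  using adj_optens[OF oo oo adj_bop[OF H AB[OF y]] hid_bop[OF o]] by(simp add: adj_idop[OF H])
  have "P oL ?t y = adj (?t (adj y) oL P)" by(simp add: adj_comp a) (simp add: P_def adj_idop[OF Z])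
  also have "... = adj (P oL (?t (adj y) oL P))" by(simp only: e[OF A(5)[OF y]])
  also have "... = P oL (?t y oL P)" by(simp add: adj_comp a oo_assoc) (simp add: P_def adj_idop[OF Z])
  finally show ?thesis by(simp only: e[OF y])
 qed
 have xP: "?t x oL P = P oL ?t x"
 proof (rule commute_tensor[OF oo xB PB])
  fix p q assume pq: "p:sp k" "q:sp k"
  let ?s = "vslice2 D k k p q P"
  have "?s oL y = y oL ?s" if y: "y:A" for y
  proof -
  note r = rten_natural[OF o o o AB[OF y]]
  have "?s oL y = adj (rten k k p) oL (P oL ?t y) oL rten k k q"
  by(simp add: vslice2(1)[OF oo PB pq] oo_assoc r(1)[OF pq(2)])
  also have "... = (adj (rten k k p) oL ?t y) oL P oL rten k k q" unfolding com[OF y] by(simp only: oo_assoc)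
  finally show ?thesis by(simp add: r(2)[OF pq(1)] vslice2(1)[OF oo PB pq] oo_assoc)
  qed
  hence "?s:commutant (sp k) A" using vslice2(2)[OF oo PB pq] by(simp add: commutant_def)
  thus "x oL ?s = ?s oL x" using x by(simp add: commutant_def)
 qed
 \<comment> \<open>\<open>A\<close> may lack a unit, so \<open>ze\<close> has to be shown to lie in
   the closure of its orbit: the difference is annihilated by \<open>A \<otimes> 1\<close>, its
   slices are orthogonal to all \<open>a $$ x\<close>, and nondegeneracy makes them vanish.\<close>
 have "ze = P $$ ze"
 proof -
  define u where "u = ze - P $$ ze"
  have uK: "u:sp (tn k k)" unfolding u_def by(rule csubD(6)[OF HK ze(1) bop_in[OF PB]])
  have tu: "?t y $$ u = 0" if y: "y:A" for y
  proof -
  have "?t y $$ ze:Z" unfolding Z_def by(rule subsetD[OF closure_subset span_base]) (use y in blast)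
  thus ?thesis using arg_cong[OF com[OF y], of "%T. T $$ ze"] P(2) by(simp add: u_def blinfun.diff_right)
  qed
  have sl: "adj (rten k k e) $$ u = 0" if e: "e:sp k" for e
  proof -
  let ?u = "adj (rten k k e) $$ u"
  have "ip w ?u = 0" if wB: "w:{a $$ x |a x. a:A & x:sp k}" for w
  proof -
  obtain a z where w: "w = a $$ z" "a:A" using wB by blast
  have "adj a $$ ?u = 0" using rt[OF AB[OF A(5)[OF w(2)]] e, of u] tu[OF A(5)[OF w(2)]] by simp
  thus ?thesis using bop_cinner[OF AB[OF w(2)], of z ?u] w(1) by simp
  qed
  hence "ip ?u ?u = 0"
  using eq_on_closure_span[OF bounded_bilinear.bounded_linear_left[OF bb_cinner] bounded_linear_zero,
  of "{a $$ x |a x. a:A & x:sp k}" ?u ?u] nd bop_in[OF adj_rten(1)[OF oo e]] by blast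
  thus ?thesis by simp
  qed
  have "u = 0"
  by(rule tens_total[OF oo uK csubD(4)[OF HK]]) (simp add: adj_rten(2)[OF oo, symmetric] sl)
  thus ?thesis by(simp add: u_def)
 qed
 hence "?t x $$ ze = P $$ ?t x $$ ze" using arg_cong[OF xP, of "%T. T $$ ze"] by simp
 hence xZ: "?t x $$ ze:closure (span ?B)" unfolding Z_def[symmetric] by(rule ssubst[where P="%u. u:Z"]) (rule P(1))
 have "ip \<theta> (?t x $$ ze) = 0"
 proof (rule eq_on_closure_span[OF bl_cinner_right bounded_linear_zero _ xZ])
  fix w assume "w:?B"
  then obtain y where y: "w = ?t y $$ ze" "y:A" by blast
  show "ip \<theta> w = 0" unfolding y(1) by(rule has_sum_unique[OF pair[OF AB[OF y(2)]] zero[OF y(2)]])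
 qed
 thus ?thesis using pair[OF xB] by simp
qed

text \<open>A normal functional is given by sequences, which would call for an amplification by a
  sequence space. Re-indexing them by an orthonormal basis of \<open>k\<close> allows the
  amplification to take place in \<open>k \<otimes> k\<close>, an object of the category.\<close>

lemma normal_fun_eq_on_bicommutant:
 assumes AM: "A <= M" and fg: "normal_fun (sp k) M f" "normal_fun (sp k) M g" "!!a. a:A ==> f a = g a"
  and x: "x:M" "x:commutant (sp k) (commutant (sp k) A)"
 shows "f x = g x"
proof -
 note H = hsp[OF o]
 obtain et xi where r: "normal_rep (sp k) M (%x. f x - g x) et xi"
  using normal_fun_rep[OF normal_fun_diff[OF H fg(1,2)]] by blast
 note d = normal_repD[OF r]
 obtain E where E: "onb (sp k) E" using onb_exists[OF H] by blast
 have EH: "e:sp k" if "e:E" for e using E that by(auto simp: onb_def)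
 have "EX et' xi'. (ALL e:E. et' e:sp k & xi' e:sp k) & (%e. (norm (et' e))^2) summable_on E & (%e. (norm (xi' e))^2) summable_on E &
  (ALL y:M \<inter> BL k k. ((%e. ip (et' e) (y $$ (xi' e))) has_sum (f y - g y)) E)"
 proof (cases "finite E")
  \<comment> \<open>With a finite basis each \<open>xi n\<close> is expanded in it and the sum over
    \<open>n\<close> is absorbed into \<open>et'\<close>; the right-hand vectors become the basis
    itself.\<close>
  case True
  have su: "(%n. cnj (ip e (xi n)) *\<^sub>C et n) summable_on UNIV" if "e:E" for e
  proof (rule abs_summable_summable, rule summable_on_comparison_test)
  show "(%n. (norm e) * ((norm (xi n))^2 + (norm (et n))^2)) summable_on UNIV"
  by(intro summable_on_cmult_right summable_on_add d(3,4))
  fix n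
  have "norm (cnj (ip e (xi n)) *\<^sub>C et n) <= (norm e * norm (xi n)) * norm (et n)"
  unfolding norm_scaleC complex_mod_cnj by(intro mult_right_mono cinner_cauchy norm_ge_zero)
  also have "... <= norm e * ((norm (xi n))^2 + (norm (et n))^2)"
  proof -
  have "0 <= (norm (xi n) - norm (et n))^2 + (norm (xi n))^2 + (norm (et n))^2" by simp
  hence "norm (xi n) * norm (et n) <= (norm (xi n))^2 + (norm (et n))^2" by(simp add: power2_diff)
  thus ?thesis by(simp add: mult.assoc mult_left_mono)
  qed
  finally show "norm (cnj (ip e (xi n)) *\<^sub>C et n) <= norm e * ((norm (xi n))^2 + (norm (et n))^2)" .
  qed simp
  define et' where "et' e = proj_on (sp k) (infsum (%n. cnj (ip e (xi n)) *\<^sub>C et n) UNIV)" for e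
  have val: "((%e. ip (et' e) (y $$ e)) has_sum (f y - g y)) E" if y: "y:M" "y:BL k k" for y
  proof -
  have "((%n. ip e (xi n) * ip (et n) (y $$ e)) has_sum ip (et' e) (y $$ e)) UNIV" if e: "e:E" for e
  proof -
  have "((%n. ip (proj_on (sp k) (cnj (ip e (xi n)) *\<^sub>C et n)) (y $$ e)) has_sum ip (et' e) (y $$ e)) UNIV"
  unfolding et'_def by(rule has_sum_bounded_linear[OF bounded_linear_compose[OF bounded_bilinear.bounded_linear_left[OF bb_cinner] proj_on_linear[OF H]] has_sum_infsum[OF su[OF e]]])
  thus ?thesis by(simp add: proj_on_in[OF H] csubD(7)[OF H] d(1) cinner_scaleC_left)
  qed
  hence "((%n. SUM e:E. ip e (xi n) * ip (et n) (y $$ e)) has_sum (SUM e:E. ip (et' e) (y $$ e))) UNIV"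
  by(rule has_sum_sum[OF True])
  moreover have "(SUM e:E. ip e (xi n) * ip (et n) (y $$ e)) = ip (et n) (y $$ (xi n))" for n
  using arg_cong[OF onb_finite_expansion[OF E True H d(2)[of n]], of "%u. ip (et n) (y $$ u)"]
  by(simp add: blinfun.sum_right cinner_sum_right bop_scaleC[OF y(2)] cinner_scaleC_right)
  ultimately have "(SUM e:E. ip (et' e) (y $$ e)) = f y - g y"
  using has_sum_unique[OF d(5)[OF y(1)]] by simp
  thus ?thesis using True by(simp add: has_sum_finiteI)
  qed
  thus ?thesis using True EH proj_on(1)[OF H] by(intro exI[of _ et'] exI[of _ "%e. e"]) (auto simp: et'_def)
 next
  \<comment> \<open>An infinite basis contains a copy of the natural numbers. The sequences are
    placed along it and continued by \<open>0\<close>.\<close>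
  case False
  then obtain j :: "nat => 'h" where j: "inj j" "range j <= E" using infinite_countable_subset by blast
  define F where "F v e = (if e:range j then v (inv j e) else 0)" for v :: "nat => 'h" and e
  have Fj: "F v (j n) = v n" for v n using j(1) by(simp add: F_def)
  have S: "(G has_sum s) E \<longleftrightarrow> ((%n. G (j n)) has_sum s) UNIV" if "!!e. e ~: range j ==> G e = 0"
  for G :: "'h => 'c::{comm_monoid_add,topological_space}" and s
  proof -
  have "(G has_sum s) E \<longleftrightarrow> (G has_sum s) (range j)" by(rule has_sum_cong_neutral) (use that j(2) in auto)
  thus ?thesis by(simp add: has_sum_reindex[OF j(1)] o_def)
  qed
  have S': "(%e. (norm (F v e))^2) summable_on E" if "(%n. (norm (v n))^2) summable_on UNIV" for v
  using that S[of "%e. (norm (F v e))^2"] unfolding summable_on_def by(simp add: Fj) (simp add: F_def)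
  have "((%e. ip (F et e) (y $$ (F xi e))) has_sum (f y - g y)) E" if "y:M" for y
  using d(5)[OF that] S[of "%e. ip (F et e) (y $$ (F xi e))"] by(simp add: Fj) (simp add: F_def)
  thus ?thesis using S' d(1-4) csubD(4)[OF H] by(intro exI[of _ "F et"] exI[of _ "F xi"]) (auto simp: F_def)
 qed
 then obtain et' xi' where e: "ALL e:E. et' e:sp k & xi' e:sp k" "(%e. (norm (et' e))^2) summable_on E" "(%e. (norm (xi' e))^2) summable_on E"
  and val: "ALL y:M \<inter> BL k k. ((%e. ip (et' e) (y $$ (xi' e))) has_sum (f y - g y)) E" by(elim exE conjE)
 have "((%e. ip (et' e) (x $$ (xi' e))) has_sum 0) E"
 proof (rule basis_functional_zero[OF E _ _ e(2,3) _ x(2)])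
  fix a assume a: "a:A"
  hence "a:M \<inter> BL k k" using AM A(1) by blast
  from bspec[OF val this] show "((%e. ip (et' e) (a $$ (xi' e))) has_sum 0) E" using fg(3)[OF a] by simp
 qed (use e(1) in auto)
 moreover have "x:M \<inter> BL k k" using x by(simp add: commutant_def)
 ultimately show ?thesis using has_sum_unique[OF bspec[OF val]] by fastforce
qed

end

end

section \<open>The GNS map and the multiplicative unitary\<close>

lemma closure_span_oper_closed:
 fixes B :: "'h::complex_hilbert oper set"
 shows "(!!S T. S:B ==> T:B ==> S oL T:B) ==> X:closure (span B) ==> Y:closure (span B) ==> X oL Y:closure (span B)"
  "(!!S. S:B ==> adj S:B) ==> X:closure (span B) ==> adj X:closure (span B)"
proof -
 note sub = subspace_closure[OF subspace_span[of B]]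
 have ext: "f X:closure (span B)" if f: "bounded_linear f" "!!S. S:B ==> f S:closure (span B)"
  and X: "X:closure (span B)" for f :: "'h oper => 'h oper" and X
 proof -
  have "f S:closure (span B)" if "S:span B" for S
  using that
  proof (induction rule: span_induct_alt)
  case base thus ?case using subspace_0[OF sub] by(simp add: linear_0[OF bounded_linear.linear[OF f(1)]])
  next
  case (step c x y)
  thus ?case using f(2)[of x] subspace_add[OF sub] subspace_mul[OF sub]
  by(simp add: linear_add[OF bounded_linear.linear[OF f(1)]] linear_scale[OF bounded_linear.linear[OF f(1)]])
  qed
  hence "f ` closure (span B) <= closure (span B)"
  by(intro image_closure_subset bounded_linear.continuous_on[OF f(1)] continuous_on_id closed_closure) auto
  thus ?thesis using X by blast
 qed
 show "X oL Y:closure (span B)" if B: "!!S T. S:B ==> T:B ==> S oL T:B" and XY: "X:closure (span B)" "Y:closure (span B)"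
 proof (rule ext[OF _ _ XY(1)])
  show "bounded_linear (%X. X oL Y)" by(rule bounded_bilinear.bounded_linear_left[OF bounded_bilinear_blinfun_compose])
  fix S assume S: "S:B"
  show "S oL Y:closure (span B)"
  by(rule ext[OF bounded_bilinear.bounded_linear_right[OF bounded_bilinear_blinfun_compose] _ XY(2)])
  (rule subsetD[OF closure_subset span_base], rule B[OF S])
 qed
 show "adj X:closure (span B)" if B: "!!S. S:B ==> adj S:B" and X: "X:closure (span B)"
  by(rule ext[OF bounded_linear_adj _ X]) (rule subsetD[OF closure_subset span_base], rule B)
qed

context lc_quantum_group begin

abbreviation (input) K where "K \<equiv> qK D"
abbreviation (input) \<A> where "\<A> \<equiv> qalg D"
abbreviation (input) Lm where "Lm \<equiv> gns D"
abbreviation (input) \<phi> where "\<phi> \<equiv> haarl D"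
abbreviation (input) NN where "NN \<equiv> sq_int (qalg D) (haarl D)"

lemmas K_obj[simp] = qK
lemma KK_obj[simp]: "tn K K:Ob" by(rule htens[OF qK qK])
lemma K_sub: "csub (sp K)" by(rule hsp[OF qK])
lemma KK_sub: "csub (sp (tn K K))" by(rule hsp[OF KK_obj])

lemma alg:
 shows "\<A> <= BL K K" "subspace \<A>" "a:\<A> ==> scl c a:\<A>" "a:\<A> ==> b:\<A> ==> a oL b:\<A>"
  "a:\<A> ==> adj a:\<A>" "closed \<A>" "closure (span {a $$ x |a x. a:\<A> & x:sp K}) = sp K"
 using qalg unfolding cstar_alg_def by blast+

lemma alg_bop: "a:\<A> ==> a:BL K K"
 using alg(1) by blast

lemma weight:
 "x:pos_part \<A> ==> y:pos_part \<A> ==> \<phi> (x + y) = \<phi> x + \<phi> y"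
 "0 <= r ==> x:pos_part \<A> ==> \<phi> (r *\<^sub>R x) = ennreal r * \<phi> x"
 using haarl(1) unfolding haar_type_weight_def is_weight_def by blast+

lemma pos_partI: "b:\<A> ==> adj b oL b:pos_part \<A>"
 by(auto simp: pos_part_def)

lemma pos_part_scaleR: "0 <= r ==> b:\<A> ==> r *\<^sub>R (adj b oL b):pos_part \<A>"
proof -
 assume r: "0 <= r" and b: "b:\<A>"
 have "r *\<^sub>R (adj b oL b) = adj (sqrt r *\<^sub>R b) oL (sqrt r *\<^sub>R b)"
  using r by(simp add: adj_scaleR blinfun_compose_scaleR_left blinfun_compose_scaleR_right)
 thus ?thesis using pos_partI[of "sqrt r *\<^sub>R b"] subspace_mul[OF alg(2) b] by simp
qed

lemma NN_alg: "a:NN ==> a:\<A>"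
 by(simp add: sq_int_def)

text \<open>The weight is additive on positive elements but carries no order relation of its own, so
  \<open>adj (a b) (a b) \<le> r\<^sup>2 adj b b\<close> is witnessed explicitly: the difference is
  \<open>r\<^sup>2 adj s s\<close>, where \<open>s\<close> is \<open>b\<close> multiplied by the
  square root of \<open>1 - adj a a/r\<^sup>2\<close>.\<close>

lemma NN_mult:
 assumes a: "a:\<A>" and b: "b:NN"
 shows "a oL b:NN"
proof -
 have bA: "b:\<A>" and fb: "\<phi> (adj b oL b) < \<infinity>" using b by(auto simp: sq_int_def)
 define r where "r = norm a + 1"
 have r0: "0 < r" and ra: "norm a < r" by(auto simp: r_def add_nonneg_pos)
 define x where "x = (1/r\<^sup>2) *\<^sub>R (adj a oL a)"
 have x: "x:\<A>" "adj x = x" using a by(auto simp: x_def adj_scaleR adj_comp intro!: subspace_mul[OF alg(2)] alg)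
 have "(norm a)^2 < r\<^sup>2" using ra by(intro power_strict_mono) auto
 hence nx: "norm x < 1" using r0 by(simp add: x_def norm_adj_comp)
 obtain t where t: "t:\<A>" "adj t = t" "2 *\<^sub>R t - (t oL t) = x"
  using sqrt_fixpoint[OF alg(2,6,4) x nx] by blast
 \<comment> \<open>\<open>1 - t\<close> is that square root; the product with \<open>b\<close> lies
   in \<open>A\<close> although \<open>1\<close> need not.\<close>
 define s where "s = b - (t oL b)"
 have s: "s:\<A>" unfolding s_def by(intro subspace_diff[OF alg(2)] alg bA t)
 have "adj s oL s = (adj b oL b) - (adj b oL (2 *\<^sub>R t - (t oL t)) oL b)"
  unfolding s_def by(rule blinfun_eqI)
  (simp add: adj_diff adj_comp t(2) blinfun.diff_left blinfun.diff_right blinfun.add_left blinfun.add_right scaleR_2)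
 also have "... = (adj b oL b) - (1/r\<^sup>2) *\<^sub>R (adj (a oL b) oL (a oL b))"
  unfolding t(3) x_def by(rule blinfun_eqI) (simp add: adj_comp blinfun.diff_left blinfun.scaleR_left blinfun.scaleR_right)
 finally have "r\<^sup>2 *\<^sub>R (adj b oL b) = r\<^sup>2 *\<^sub>R (adj s oL s) + (adj (a oL b) oL (a oL b))"
  using r0 by(simp add: scaleR_diff_right)
 hence "\<phi> (r\<^sup>2 *\<^sub>R (adj b oL b)) = \<phi> (r\<^sup>2 *\<^sub>R (adj s oL s)) + \<phi> (adj (a oL b) oL (a oL b))"
  using weight(1)[OF pos_part_scaleR[of "r\<^sup>2" s] pos_partI[of "a oL b"]] s a bA alg(4) by simp
 hence "\<phi> (adj (a oL b) oL (a oL b)) <= ennreal (r\<^sup>2) * \<phi> (adj b oL b)"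
  using weight(2)[of "r\<^sup>2", OF _ pos_partI[OF bA]] by(simp add: add_increasing)
 also have "... < \<infinity>" using fb by(simp add: ennreal_mult_less_top)
 finally show ?thesis using a bA alg(4) by(simp add: sq_int_def)
qed

lemma NN_scl: "a:NN ==> scl c a:NN"
proof -
 assume a: "a:NN"
 have "scl c a = scl c (qid D) oL a" using alg_bop[OF NN_alg[OF a]] by(simp add: scl_comp_left idop_comp[OF K_sub])
 have aA: "a:\<A>" using NN_alg[OF a] .
 have "adj (scl c a) oL scl c a = (cmod c)^2 *\<^sub>R (adj a oL a)"
 proof (rule blinfun_eqI)
  fix v
  have "(adj (scl c a) oL scl c a) $$ v = (cnj c * c) *\<^sub>C (adj a oL a) $$ v"
  using alg_bop[OF alg(5)[OF aA]] by(simp add: adj_scl[OF K_sub K_sub alg_bop[OF aA]] scl_apply bop_scaleC scaleC_scaleC)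
  also have "cnj c * c = cor ((cmod c)^2)" using complex_norm_square[of c] by(simp add: mult.commute)
  finally show "(adj (scl c a) oL scl c a) $$ v = ((cmod c)^2 *\<^sub>R (adj a oL a)) $$ v"
  by(simp only: scaleC_of_real blinfun.scaleR_left)
 qed
 hence "\<phi> (adj (scl c a) oL scl c a) = ennreal ((cmod c)^2) * \<phi> (adj a oL a)"
  using weight(2)[of "(cmod c)^2", OF _ pos_partI[OF aA]] by simp
 thus ?thesis using a aA alg(3) by(simp add: sq_int_def ennreal_mult_less_top)
qed

lemma NN_scaleR: "a:NN ==> r *\<^sub>R a:NN"
 using NN_scl[of a "cor r"] by(simp add: scl_of_real)

text \<open>In the parallelogram identity the weights of \<open>a + b\<close> and of
  \<open>a - b\<close> add up to a finite value, so each of them is finite.\<close>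

lemma NN_add:
 assumes "a:NN" "b:NN"
 shows "a + b:NN"
proof -
 have A: "a:\<A>" "b:\<A>" using assms NN_alg by auto
 have pA: "a + b:\<A>" "a - b:\<A>" using A by(auto intro: subspace_add[OF alg(2)] subspace_diff[OF alg(2)])
 have "(adj (a + b) oL (a + b)) + (adj (a - b) oL (a - b)) = 2 *\<^sub>R (adj a oL a) + 2 *\<^sub>R (adj b oL b)"
  by(rule blinfun_eqI)
  (simp add: adj_add adj_diff blinfun.add_left blinfun.add_right blinfun.diff_left blinfun.diff_right blinfun.scaleR_left scaleR_2)
 hence "\<phi> (adj (a + b) oL (a + b)) + \<phi> (adj (a - b) oL (a - b)) = ennreal 2 * \<phi> (adj a oL a) + ennreal 2 * \<phi> (adj b oL b)"
  using weight(1)[OF pos_partI[OF pA(1)] pos_partI[OF pA(2)]] weight(1)[OF pos_part_scaleR[of 2 a] pos_part_scaleR[of 2 b]]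
  weight(2)[of 2, OF _ pos_partI[OF A(1)]] weight(2)[of 2, OF _ pos_partI[OF A(2)]] A by simp
 moreover have "ennreal 2 * \<phi> (adj a oL a) + ennreal 2 * \<phi> (adj b oL b) < \<infinity>"
  using assms by(simp add: sq_int_def ennreal_mult_less_top)
 ultimately have "\<phi> (adj (a + b) oL (a + b)) + \<phi> (adj (a - b) oL (a - b)) < \<infinity>" by simp
 hence "\<phi> (adj (a + b) oL (a + b)) < \<infinity>" by simp
 thus ?thesis using pA by(simp add: sq_int_def)
qed

lemma NN_diff: "a:NN ==> b:NN ==> a - b:NN"
 using NN_add[of a "scl (-1) b"] NN_scl[of b "-1"] by(simp add: scl_minus_one)

lemma gns_diff: "a:NN ==> b:NN ==> Lm (a - b) = Lm a - Lm b"
 using gns_add[of a "scl (-1) b"] gns_scl[of b "-1"] NN_scl[of b "-1"] by(simp add: scl_minus_one scaleC_minus_one)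

lemma gns_scaleR: "a:NN ==> Lm (r *\<^sub>R a) = r *\<^sub>R Lm a"
 using gns_scl[of a "cor r"] by(simp add: scl_of_real scaleC_of_real)

lemma gns_in: "a:NN ==> Lm a:sp K"
 using subsetD[OF closure_subset imageI, of a NN Lm] by(simp add: gns_dense)

lemma NN_zero: "0:NN"
proof -
 have "\<phi> 0 = 0" using weight(2)[of 0, OF _ pos_partI[OF subspace_0[OF alg(2)]]] by simp
 thus ?thesis using subspace_0[OF alg(2)] by(simp add: sq_int_def)
qed

lemma gns_zero: "Lm 0 = 0"
 using gns_scaleR[OF NN_zero, of 0] by simp

lemma NN_sum: "(!!i. i:I ==> f i:NN) ==> (SUM i:I. f i):NN & Lm (SUM i:I. f i) = (SUM i:I. Lm (f i))"
 by(induction I rule: infinite_finite_induct) (auto simp: NN_zero gns_zero NN_add gns_add)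

text \<open>Lower semicontinuity of the weight makes \<open>\<Lambda>\<close> closable.\<close>

lemma gns_closable:
 assumes a: "!!n::nat. a n:NN" "a \<longlonglongrightarrow> 0" "(%n. Lm (a n)) \<longlonglongrightarrow> ze"
 shows "ze = 0"
proof -
 have "(%n. Lm (a n)) \<longlonglongrightarrow> 0"
 proof (rule LIMSEQ_I)
  fix r :: real assume r: "0 < r"
  obtain N where N: "!!m n. m >= N ==> n >= N ==> norm (Lm (a m) - Lm (a n)) < r/2"
  using CauchyD[OF LIMSEQ_imp_Cauchy[OF a(3)], of "r/2"] r by auto
  show "EX no. ALL n>=no. norm (Lm (a n) - 0) < r"
  proof (intro exI[of _ N] allI impI)
  fix n assume n: "N <= n"
  let ?S = "{b:pos_part \<A>. \<phi> b <= ennreal ((r/2)^2)}"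
  \<comment> \<open>For fixed \<open>n\<close> these elements converge in norm to
    \<open>adj (a n) (a n)\<close> while their weights stay below \<open>(r/2)\<^sup>2\<close>;
    lower semicontinuity carries the bound to the limit.\<close>
  define b where "b m = adj (a n - a m) oL (a n - a m)" for m
  have "b (m + N):?S" for m
  proof -
  have d: "a n - a (m + N):NN" using a(1) NN_diff by blast
  have "\<phi> (b (m + N)) = ennreal ((norm (Lm (a n) - Lm (a (m + N))))^2)"
  using gns_norm[OF d] a(1) by(simp add: b_def gns_diff)
  also have "... <= ennreal ((r/2)^2)"
  using N[OF n, of "m + N"] by(intro ennreal_leI power_mono) auto
  finally show ?thesis using pos_partI[OF NN_alg[OF d]] by(simp add: b_def)
  qed
  moreover have "(%m. b (m + N)) \<longlonglongrightarrow> (adj (a n - 0) oL (a n - 0))"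
  unfolding b_def
  by(intro bounded_bilinear.tendsto[OF bounded_bilinear_blinfun_compose] bounded_linear.tendsto[OF bounded_linear_adj]
  tendsto_diff tendsto_const LIMSEQ_ignore_initial_segment a(2))
  ultimately have "adj (a n) oL a n:closure ?S" unfolding closure_sequential
  by(intro exI[of _ "%m. b (m + N)"]) simp
  hence "\<phi> (adj (a n) oL a n) <= ennreal ((r/2)^2)"
  using haarl(1) pos_partI[OF NN_alg[OF a(1)]] unfolding haar_type_weight_def lsc_weight_def by blast
  hence "(norm (Lm (a n)))^2 <= (r/2)^2"
  unfolding gns_norm[OF a(1), symmetric] by(simp add: ennreal_le_iff)
  hence "norm (Lm (a n)) <= r/2" by(rule power2_le_imp_le) (use r in simp)
  thus "norm (Lm (a n) - 0) < r" using r by simp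
  qed
 qed
 thus ?thesis using a(3) LIMSEQ_unique by blast
qed

text \<open>The domain of the adjoint of \<open>\<Lambda>\<close>, regarded as a densely defined
  operator from the normed space \<open>A\<close> to \<open>K\<close>.\<close>

definition gdom where
 "gdom = {xi:sp K. EX C>=0. ALL a:NN. cmod (ip xi (Lm a)) <= C * norm a}"

text \<open>Density of the domain of the adjoint is dual to closability. If all multiples of
  \<open>ze\<close> were in the closure of the image \<open>B\<close> of the unit ball, then
  rescaling would give elements tending to \<open>0\<close> with images tending to
  \<open>ze\<close>. A multiple outside is separated from \<open>B\<close>, and the separating
  vector, projected to \<open>K\<close>, lies in \<open>gdom\<close> without being orthogonal to
  \<open>ze\<close>.\<close>

lemma gdom_total:
 assumes ze: "ze:sp K" and z: "!!xi. xi:gdom ==> ip xi ze = 0"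
 shows "ze = 0"
proof (rule ccontr)
 assume n0: "ze ~= 0"
 define B where "B = Lm ` {a:NN. norm a <= 1}"
 have "EX n::nat. real (Suc n) *\<^sub>R ze ~: closure B"
 proof (rule ccontr)
  assume "\<not> ?thesis"
  hence "real (Suc n) *\<^sub>R ze:closure B" for n by blast
  hence "EX y:B. dist y (real (Suc n) *\<^sub>R ze) < 1" for n
  using closure_approachable[of "real (Suc n) *\<^sub>R ze" B] zero_less_one by blast
  hence "EX a. a:NN & norm a <= 1 & dist (Lm a) (real (Suc n) *\<^sub>R ze) < 1" for n
  by(auto simp: B_def)
  then obtain a where a: "!!n. a n:NN" "!!n. norm (a n) <= 1" "!!n. dist (Lm (a n)) (real (Suc n) *\<^sub>R ze) < 1" by metis
  define b where "b n = inverse (real (Suc n)) *\<^sub>R a n" for n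
  have "b n:NN" for n using a(1) NN_scaleR by(simp add: b_def)
  moreover have "b \<longlonglongrightarrow> 0"
  proof (rule Lim_null_comparison[OF _ LIMSEQ_inverse_real_of_nat])
  show "\<forall>\<^sub>F n in sequentially. norm (b n) <= inverse (real (Suc n))"
  using a(2) by(intro always_eventually) (simp add: b_def mult_left_le)
  qed
  moreover have "(%n. Lm (b n)) \<longlonglongrightarrow> ze"
  proof (rule LIM_zero_cancel, rule Lim_null_comparison[OF _ LIMSEQ_inverse_real_of_nat])
  have "norm (Lm (b n) - ze) <= inverse (real (Suc n))" for n
  proof -
  have "Lm (b n) - ze = inverse (real (Suc n)) *\<^sub>R (Lm (a n) - real (Suc n) *\<^sub>R ze)"
  using a(1) by(simp add: b_def gns_scaleR scaleR_diff_right del: of_nat_Suc)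
  hence "norm (Lm (b n) - ze) = inverse (real (Suc n)) * dist (Lm (a n)) (real (Suc n) *\<^sub>R ze)"
  by(simp add: dist_norm)
  also have "... <= inverse (real (Suc n)) * 1" using a(3)[of n] by(intro mult_left_mono) auto
  finally show ?thesis by simp
  qed
  thus "\<forall>\<^sub>F n in sequentially. norm (Lm (b n) - ze) <= inverse (real (Suc n))" by simp
  qed
  ultimately show False using gns_closable n0 by blast
 qed
 then obtain n where n: "real (Suc n) *\<^sub>R ze ~: closure B" by blast
 have "convex B"
 proof (rule convexI)
  fix x y u v :: real and p q assume pq: "p:B" "q:B" "0 <= u" "0 <= v" "u + v = 1"
  then obtain a b where ab: "p = Lm a" "q = Lm b" "a:NN" "b:NN" "norm a <= 1" "norm b <= 1" by(auto simp: B_def)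
  have "norm (u *\<^sub>R a + v *\<^sub>R b) <= u * norm a + v * norm b"
  using norm_triangle_ineq[of "u *\<^sub>R a" "v *\<^sub>R b"] pq by simp
  also have "... <= u * 1 + v * 1" using ab pq by(intro add_mono mult_left_mono) auto
  finally have "norm (u *\<^sub>R a + v *\<^sub>R b) <= 1" using pq by simp
  moreover have "u *\<^sub>R p + v *\<^sub>R q = Lm (u *\<^sub>R a + v *\<^sub>R b)"
  using ab by(simp add: gns_add NN_scaleR gns_scaleR)
  ultimately show "u *\<^sub>R p + v *\<^sub>R q:B" using ab NN_add NN_scaleR unfolding B_def by blast
 qed
 hence cv: "convex (closure B)" by(rule convex_closure)
 have B0: "0:closure B" using closure_subset[of B] NN_zero gns_zero by(force simp: B_def)
 have ne: "closure B ~= {}"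
 proof
  assume "closure B = {}"
  thus False using B0 by simp
 qed
 obtain u M where uM: "ALL y:closure B. inner u y <= M" "M < inner u (real (Suc n) *\<^sub>R ze)"
  using convex_separation[OF cv closed_closure ne n] by(elim exE conjE)
 have M0: "0 <= M" using uM(1) B0 by force
 define xi where "xi = proj_on (sp K) u"
 have xiK: "xi:sp K" using proj_on(1)[OF K_sub] by(simp add: xi_def)
 have eq: "inner xi y = inner u y" if "y:sp K" for y
  using proj_on(2)[OF K_sub, of u] that unfolding orth_iff_inner[OF K_sub] by(simp add: xi_def inner_diff_left)
 have "cmod (ip xi (Lm a)) <= M * norm a" if a: "a:NN" for a
 proof (cases "a = 0 \<or> ip xi (Lm a) = 0")
  case True thus ?thesis using M0 by(auto simp: gns_zero)
 next
  case False
  define w where "w = ip xi (Lm a)"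
  \<comment> \<open>The scalar brings \<open>a\<close> to norm \<open>1\<close> and turns
    \<open>w\<close> into the real number \<open>cmod w / norm a\<close>, so that the one-sided
    separation bounds the modulus.\<close>
  define c where "c = cnj w / cor (cmod w * norm a)"
  have w0: "w ~= 0" "norm a ~= 0" using False by(auto simp: w_def)
  have cn: "cmod c * norm a = 1" using w0 by(simp add: c_def norm_divide norm_mult)
  have "norm (scl c a) <= 1" using cn by(simp add: norm_scl)
  hence "Lm (scl c a):B" using NN_scl[OF a] unfolding B_def by blast
  hence "inner u (Lm (scl c a)) <= M" using uM(1) closure_subset by blast
  hence "inner xi (Lm (scl c a)) <= M" using eq[OF gns_in[OF NN_scl[OF a]]] by simp
  moreover have "ip xi (Lm (scl c a)) = cor (cmod w / norm a)"
  using w0 complex_norm_square[of w]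
  by(simp add: gns_scl[OF a] cinner_scaleC_right w_def[symmetric] c_def power2_eq_square mult.commute divide_simps)
  ultimately have "cmod w / norm a <= M" by(simp add: inner_eq_Re_cinner)
  thus ?thesis using w0 by(simp add: w_def divide_simps split: if_splits)
 qed
 hence "xi:gdom" using xiK M0 by(auto simp: gdom_def)
 hence "inner xi ze = 0" using z by(simp add: inner_eq_Re_cinner)
 thus False using uM(2) M0 eq[OF ze] by simp
qed

lemma optens_alg:
 assumes "a:BL K K" "b:BL K K"
 shows "qtens D a b:BL (tn K K) (tn K K)"
  "[|x:sp K; y:sp K|] ==> qtens D a b $$ vc K K x y = vc K K (a $$ x) (b $$ y)"
 using optensI[OF qK qK qK qK assms] by auto

lemma vslice1_qtens:
 assumes "a:BL K K" "b:BL K K" "p:sp K" "q:sp K"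
 shows "vslice1 D K K p q (qtens D a b) = scl (ip p (a $$ q)) b"
proof (rule bop_eqI[OF K_sub])
 note v = vslice1[OF qK qK optens_alg(1)[OF assms(1,2)] assms(3,4)]
 show "vslice1 D K K p q (qtens D a b):BL K K" by(rule v(2))
 show "scl (ip p (a $$ q)) b:BL K K" by(rule bop_scl[OF K_sub assms(2)])
 fix x assume x: "x:sp K"
 thus "vslice1 D K K p q (qtens D a b) $$ x = scl (ip p (a $$ q)) b $$ x"
  using assms by(simp add: v(1) lten(2) optens_alg(2) adj_lten(3) bop_in[OF assms(1)] bop_in[OF assms(2)] scl_apply)
qed

definition ggraph where "ggraph = span {(qtens D a b, vc K K (Lm a) (Lm b)) |a b. a:NN & b:NN}"

lemma gns2_graph: "gns2 D X ze \<longleftrightarrow> (X, ze):closure ggraph"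
proof -
 let ?B = "{(qtens D a b, vc K K (Lm a) (Lm b)) |a b. a:NN & b:NN}"
 have sc: "r *\<^sub>R p:?B" if "p:?B" for r p
 proof -
  obtain a b where ab: "p = (qtens D a b, vc K K (Lm a) (Lm b))" "a:NN" "b:NN" using \<open>p \<in> ?B\<close> by blast
  have "r *\<^sub>R p = (qtens D (r *\<^sub>R a) b, vc K K (Lm (r *\<^sub>R a)) (Lm b))"
  using ab optens_scl(1)[OF qK qK qK qK alg_bop[OF NN_alg] alg_bop[OF NN_alg], of a b "cor r"]
  by(simp add: gns_scaleR hvec_scaleR gns_in scl_of_real)
  thus ?thesis using ab NN_scaleR by blast
 qed
 have "ggraph = {(SUM i<n. qtens D (a i) (b i), SUM i<n. vc K K (Lm (a i)) (Lm (b i))) |(n::nat) a b.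
  ALL i<n. a i:NN & b i:NN}" (is "_ = ?R")
 proof (intro equalityI subsetI)
  fix p assume "p:ggraph"
  then obtain n :: nat and f where f: "ALL i<n. f i:?B" "p = (SUM i<n. f i)"
  using span_finite_sum[OF sc] unfolding ggraph_def by blast
  have "EX a b. f i = (qtens D a b, vc K K (Lm a) (Lm b)) & a:NN & b:NN" if "i < n" for i using f(1) that by blast
  then obtain a b where ab: "!!i. i < n ==> f i = (qtens D (a i) (b i), vc K K (Lm (a i)) (Lm (b i))) & a i:NN & b i:NN"
  by metis
  have "p = (SUM i<n. (qtens D (a i) (b i), vc K K (Lm (a i)) (Lm (b i))))" using f(2) ab by(auto intro: sum.cong)
  hence "p = (SUM i<n. qtens D (a i) (b i), SUM i<n. vc K K (Lm (a i)) (Lm (b i)))"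
  by(simp add: sum_prod)
  thus "p:?R" using ab by blast
 next
  fix p assume "p:?R"
  then obtain n :: nat and a b where ab: "ALL i<n. a i:NN & b i:NN"
  "p = (SUM i<n. qtens D (a i) (b i), SUM i<n. vc K K (Lm (a i)) (Lm (b i)))" by blast
  have "p = (SUM i<n. (qtens D (a i) (b i), vc K K (Lm (a i)) (Lm (b i))))" using ab(2) by(simp add: sum_prod)
  also have "...:ggraph" unfolding ggraph_def by(intro span_sum span_base) (use ab(1) in blast)
  finally show "p:ggraph" .
 qed
 thus ?thesis by(simp add: gns2_def)
qed

text \<open>The functionals \<open>\<langle>\<xi>, \<Lambda>(\<cdot>)\<rangle>\<close> with \<open>\<xi>\<close> in the domain of the adjoint are bounded, and a tensor product of two
  bounded functionals is bounded for the operator norm, as slicing with vector functionals shows.\<close>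

lemma gdom_tensor_bound:
 assumes xi: "xi:gdom" "xi':gdom"
 shows "EX C>=0. ALL X ze. (X, ze):closure ggraph --> cmod (ip (vc K K xi xi') ze) <= C * norm X"
proof -
 obtain C where C: "0 <= C" "!!a. a:NN ==> cmod (ip xi (Lm a)) <= C * norm a" using xi(1) by(auto simp: gdom_def)
 obtain C' where C': "0 <= C'" "!!a. a:NN ==> cmod (ip xi' (Lm a)) <= C' * norm a" using xi(2) by(auto simp: gdom_def)
 have xiK: "xi:sp K" "xi':sp K" using xi by(auto simp: gdom_def)
 have bd: "cmod (ip (vc K K xi xi') (SUM i<n. vc K K (Lm (a i)) (Lm (b i)))) <= C * C' * norm (SUM i<n. qtens D (a i) (b i))"
  if ab: "ALL i<n. a i:NN & b i:NN" for n :: nat and a b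
 proof -
  define X where "X = (SUM i<n. qtens D (a i) (b i))"
  have XB: "X:BL (tn K K) (tn K K)" unfolding X_def
  using ab by(intro subspace_sum[OF subspace_bop[OF KK_sub]] optens_alg(1) alg_bop NN_alg) auto
  \<comment> \<open>\<open>s\<close> is the slice of \<open>X\<close> by the functional of
    \<open>xi'\<close> on the second leg. Its norm at a vector \<open>q\<close> is found by pairing
    with \<open>p = s $$ q\<close>: this pairing is the functional of \<open>xi'\<close> at the
    vector slice \<open>t\<close> of \<open>X\<close>, which again lies in
    \<open>NN\<close>.\<close>
  define s where "s = (SUM i<n. scl (ip xi' (Lm (b i))) (a i))"
  have s: "s:NN & Lm s = (SUM i<n. Lm (scl (ip xi' (Lm (b i))) (a i)))"
  unfolding s_def by(rule NN_sum) (use ab NN_scl in auto)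
  have 1: "ip (vc K K xi xi') (SUM i<n. vc K K (Lm (a i)) (Lm (b i))) = ip xi (Lm s)"
  using s ab xiK unfolding cinner_sum_right
  by(auto simp: cinner_sum_right hvec_cinner gns_in gns_scl cinner_scaleC_right intro!: sum.cong)
  have "norm s <= C' * norm X"
  proof (rule norm_blinfun_bound)
  fix q
  define q' where "q' = proj_on (sp K) q"
  have q': "q':sp K" using proj_on(1)[OF K_sub] by(simp add: q'_def)
  have sB: "s:BL K K" using s alg_bop NN_alg by blast
  define p where "p = s $$ q"
  have p: "p:sp K" using bop_in[OF sB] by(simp add: p_def)
  define t where "t = (SUM i<n. scl (ip p (a i $$ q')) (b i))"
  have t: "t:NN & Lm t = (SUM i<n. Lm (scl (ip p (a i $$ q')) (b i)))"
  unfolding t_def by(rule NN_sum) (use ab NN_scl in auto)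
  have "ip p p = ip p (s $$ q')" by(simp add: p_def q'_def bop_proj[OF K_sub sB])
  also have "... = ip xi' (Lm t)"
  using t ab unfolding s_def
  by(auto simp: blinfun.sum_left cinner_sum_right scl_apply cinner_scaleC_right gns_scl mult.commute intro!: sum.cong)
  finally have cpp: "ip p p = ip xi' (Lm t)" .
  have pp: "(norm p)^2 <= C' * norm t"
  proof -
  note cpp
  moreover have "cmod (ip p p) = (norm p)^2" by(simp only: cinner_self norm_of_real) simp
  ultimately show ?thesis using C'(2)[of t] t by simp
  qed
  have "vslice1 D K K p q' X = (SUM i<n. vslice1 D K K p q' (qtens D (a i) (b i)))"
  proof -
  have l: "vslice1 D K K p q' Y = adj (lten K K p) oL Y oL lten K K q'" if "Y:BL (tn K K) (tn K K)" for Y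
  using vslice1(1)[OF qK qK that p q'] .
  have "vslice1 D K K p q' X = adj (lten K K p) oL X oL lten K K q'" by(rule l[OF XB])
  also have "... = (SUM i<n. adj (lten K K p) oL qtens D (a i) (b i) oL lten K K q')"
  unfolding X_def by(rule blinfun_eqI) (simp add: blinfun.sum_left blinfun.sum_right)
  also have "... = (SUM i<n. vslice1 D K K p q' (qtens D (a i) (b i)))"
  using ab by(intro sum.cong refl l[symmetric] optens_alg(1) alg_bop NN_alg) auto
  finally show ?thesis .
  qed
  also have "... = t" unfolding t_def
  using ab p q' by(intro sum.cong refl vslice1_qtens alg_bop NN_alg) auto
  finally have "norm t = norm (adj (lten K K p) oL X oL lten K K q')" using vslice1(1)[OF qK qK XB p q'] by simp
  also have "... <= norm (adj (lten K K p) oL X) * norm (lten K K q')" by(rule norm_blinfun_compose)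
  also have "... <= (norm (adj (lten K K p)) * norm X) * norm (lten K K q')"
  by(intro mult_right_mono norm_blinfun_compose norm_ge_zero)
  also have "... <= (norm p * norm X) * norm q"
  using lten(3)[OF qK qK p] lten(3)[OF qK qK q'] norm_proj_on_le[OF K_sub, of q]
  by(intro mult_mono) (auto simp: q'_def)
  finally have "C' * norm t <= C' * (norm p * norm X * norm q)" by(intro mult_left_mono C')
  hence "norm p * norm p <= norm p * (C' * norm X * norm q)"
  using pp by(simp add: power2_eq_square mult_ac)
  hence "norm p <= C' * norm X * norm q"
  by(cases "norm p = 0") (use C' in \<open>auto simp: mult_le_cancel_left\<close>)
  thus "norm (s $$ q) <= C' * norm X * norm q" by(simp add: p_def)
  qed (use C' in simp)
  hence "C * norm s <= C * (C' * norm X)" by(intro mult_left_mono C)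
  thus ?thesis unfolding 1 using C(2)[of s] s by(simp add: X_def mult.assoc)
 qed
 let ?F = "{p :: 'h oper \<times> 'h. cmod (ip (vc K K xi xi') (snd p)) <= C * C' * norm (fst p)}"
 have "gns2 D X ze ==> (X, ze):?F" for X ze
  unfolding gns2_def
 proof (erule subsetD[OF closure_minimal, rotated -1])
  show "closed ?F" by(intro closed_Collect_le continuous_intros)
  show "{(SUM i<n. qtens D (a i) (b i), SUM i<n. vc K K (Lm (a i)) (Lm (b i))) |(n::nat) a b. ALL i<n. a i:NN & b i:NN} <= ?F"
  using bd by auto
 qed
 thus ?thesis using C C' by(intro exI[of _ "C * C'"]) (auto simp: gns2_graph)
qed

text \<open>Closability of \<open>\<Lambda> \<otimes> \<Lambda>\<close>: by
  \<open>gdom_tensor_bound\<close> a difference of two values over the same \<open>X\<close> is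
  orthogonal to all \<open>xi \<otimes> xi'\<close> with both vectors in \<open>gdom\<close>, and
  \<open>gdom\<close> is total.\<close>

lemma gns2_unique:
 assumes "gns2 D X ze" "gns2 D X ze'" "ze:sp (tn K K)" "ze':sp (tn K K)"
 shows "ze = ze'"
proof -
 define d where "d = ze - ze'"
 have dK: "d:sp (tn K K)" using assms csubD(6)[OF KK_sub] by(simp add: d_def)
 have "subspace (closure ggraph)" unfolding ggraph_def by(intro subspace_closure subspace_span)
 hence "(X, ze) - (X, ze'):closure ggraph" using assms(1,2) unfolding gns2_graph by(rule subspace_diff)
 hence d: "(0, d):closure ggraph" by(simp add: d_def)
 have z: "ip (vc K K xi xi') d = 0" if "xi:gdom" "xi':gdom" for xi xi'
  using gdom_tensor_bound[OF that] d by fastforce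
 have gK: "xi:gdom ==> xi:sp K" for xi by(simp add: gdom_def)
 have z1: "ip (vc K K xi y) d = 0" if xi: "xi:gdom" and y: "y:sp K" for xi y
 proof -
  have "adj (lten K K xi) $$ d = 0"
  by(rule gdom_total[OF bop_in[OF adj_lten(1)[OF qK qK gK[OF xi]]]]) (simp add: adj_lten(2)[OF qK qK gK[OF xi] gK] z xi)
  thus ?thesis using adj_lten(2)[OF qK qK gK[OF xi] y, of d] by simp
 qed
 have "d = 0"
 proof (rule tens_total[OF qK qK dK csubD(4)[OF KK_sub]])
  fix x y assume xy: "x:sp K" "y:sp K"
  have "adj (rten K K y) $$ d = 0"
  by(rule gdom_total[OF bop_in[OF adj_rten(1)[OF qK qK xy(2)]]]) (simp add: adj_rten(2)[OF qK qK xy(2) gK] z1 xy)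
  thus "ip (vc K K x y) d = ip (vc K K x y) 0" using adj_rten(2)[OF qK qK xy(2,1), of d] by simp
 qed
 thus ?thesis by(simp add: d_def)
qed

text \<open>For elementary tensors \<open>Y\<close> this is
  \<open>\<Lambda>(a b) = a \<Lambda>(b)\<close> in each leg, extended along the closed graph; the
  step to general \<open>Y\<close> is norm continuity of
  \<open>Y \<mapsto> (Y X, Y ze)\<close>.\<close>

lemma gns2_mult:
 assumes Y: "Y:qalg2 D" and X: "gns2 D X ze"
 shows "gns2 D (Y oL X) (Y $$ ze)"
proof -
 let ?G = "closure ggraph"
 have sG: "subspace ?G" unfolding ggraph_def by(intro subspace_closure subspace_span)
 define f where "f Y = (%p :: 'h oper \<times> 'h. (Y oL fst p, Y $$ snd p))" for Y :: "'h oper"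
 have fl: "bounded_linear (f Y)" for Y unfolding f_def
  by(intro bounded_linear_Pair bounded_linear_compose[OF bounded_bilinear.bounded_linear_right[OF bounded_bilinear_blinfun_compose] bounded_linear_fst]
  bounded_linear_compose[OF bl_right bounded_linear_snd])
 have el: "f (qtens D a b) p:?G" if ab: "a:\<A>" "b:\<A>" and p: "p:?G" for a b p
 proof -
  have "f (qtens D a b) q:?G" if "q:ggraph" for q
  using that unfolding ggraph_def
  proof (induction rule: span_induct_alt)
  case base thus ?case using subspace_0[OF sG] by(simp add: linear_0[OF bounded_linear.linear[OF fl]] ggraph_def)
  next
  case (step c x y)
  obtain a' b' where x: "x = (qtens D a' b', vc K K (Lm a') (Lm b'))" "a':NN" "b':NN" using step by blast
  have "f (qtens D a b) x = (qtens D (a oL a') (b oL b'), vc K K (Lm (a oL a')) (Lm (b oL b')))"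
  using x ab optens_comp[OF qK qK qK qK qK qK alg_bop[OF NN_alg[OF x(2)]] alg_bop[OF NN_alg[OF x(3)]] alg_bop[OF ab(1)] alg_bop[OF ab(2)]]
  by(simp add: f_def optens_alg(2) alg_bop gns_in gns_mult)
  also have "...:ggraph" unfolding ggraph_def using x ab NN_mult by(intro span_base) blast
  finally have "f (qtens D a b) x:?G" using closure_subset by blast
  thus ?case using step subspace_add[OF sG] subspace_mul[OF sG]
  by(simp add: linear_add[OF bounded_linear.linear[OF fl]] linear_scale[OF bounded_linear.linear[OF fl]] ggraph_def)
  qed
  hence "f (qtens D a b) ` ?G <= ?G"
  by(intro image_closure_subset bounded_linear.continuous_on[OF fl] continuous_on_id closed_closure) auto
  thus ?thesis using p by blast
 qed
 define g where "g = (%Y. f Y (X, ze))"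
 have gl: "bounded_linear g" unfolding g_def f_def
  by(auto intro!: bounded_linear_Pair bounded_bilinear.bounded_linear_left[OF bounded_bilinear_blinfun_compose]
  blinfun.bounded_linear_left)
 have XG: "(X, ze):?G" using X by(simp add: gns2_graph)
 have "g Y:?G" if "Y:span {qtens D S T |S T. S:\<A> & T:\<A>}" for Y
  using that
 proof (induction rule: span_induct_alt)
  case base thus ?case using subspace_0[OF sG] by(simp add: linear_0[OF bounded_linear.linear[OF gl]])
 next
  case (step c x y)
  hence "g x:?G" using el[OF _ _ XG] by(auto simp: g_def)
  thus ?case using step subspace_add[OF sG] subspace_mul[OF sG]
  by(simp add: linear_add[OF bounded_linear.linear[OF gl]] linear_scale[OF bounded_linear.linear[OF gl]])
 qed
 hence "g ` closure (span {qtens D S T |S T. S:\<A> & T:\<A>}) <= ?G"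
  by(intro image_closure_subset bounded_linear.continuous_on[OF gl] continuous_on_id closed_closure) auto
 hence "g Y:?G" using Y by(auto simp: qalg2_def alg_tens_def)
 thus ?thesis by(simp add: gns2_graph g_def f_def)
qed

lemma alg_nondeg:
 assumes w: "w:sp K" and z: "!!a x. a:\<A> ==> x:sp K ==> ip (a $$ x) w = 0"
 shows "w = 0"
proof -
 have bl: "bounded_linear (%y. inner y w)" by(rule bounded_linear_inner_left)
 have "inner y w = 0" if "y:sp K" for y
  by(rule eq_on_closure_span[OF bl bounded_linear_zero, of "{a $$ x |a x. a:\<A> & x:sp K}"])
  (use z that in \<open>auto simp: alg(7) inner_eq_Re_cinner\<close>)
 from this[OF w] show ?thesis by simp
qed

text \<open>Nondegeneracy of \<open>A\<close> in each leg. It permits testing against vectors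
  \<open>(a $$ x) \<otimes> (b $$ y)\<close> only, which is how multipliers are brought into
  \<open>A \<otimes> A\<close>.\<close>

lemma alg2_nondeg:
 assumes w: "w:sp (tn K K)"
  and z: "!!a b x y. [|a:\<A>; b:\<A>; x:sp K; y:sp K|] ==> ip (vc K K (a $$ x) (b $$ y)) w = 0"
 shows "w = 0"
proof -
 have r: "a:\<A> ==> a $$ x:sp K" for a x using alg_bop bop_in by blast
 have z1: "ip (vc K K (a $$ x) y) w = 0" if a: "a:\<A>" and x: "x:sp K" and y: "y:sp K" for a x y
 proof -
  have "adj (lten K K (a $$ x)) $$ w = 0"
  by(rule alg_nondeg[OF bop_in[OF adj_lten(1)[OF qK qK r[OF a]]]]) (simp add: adj_lten(2) r a x z)
  thus ?thesis using adj_lten(2)[OF qK qK r[OF a] y, of x w] by simp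
 qed
 show ?thesis
 proof (rule tens_total[OF qK qK w csubD(4)[OF KK_sub]])
  fix x y assume xy: "x:sp K" "y:sp K"
  have "adj (rten K K y) $$ w = 0"
  by(rule alg_nondeg[OF bop_in[OF adj_rten(1)[OF qK qK xy(2)]]]) (simp add: adj_rten(2) r xy z1)
  thus "ip (vc K K x y) w = ip (vc K K x y) 0" using adj_rten(2)[OF qK qK xy(2,1), of w] by simp
 qed
qed

lemma delta_mult:
 assumes "a:\<A>"
 shows "qdelta D a:BL (tn K K) (tn K K)" "E:qalg2 D ==> E oL qdelta D a:qalg2 D"
  "E:qalg2 D ==> qdelta D a oL E:qalg2 D" "b:\<A> ==> qdelta D (a oL b) = qdelta D a oL qdelta D b"
  "qdelta D a:qmult2 D"
 using delta assms unfolding star_hom_def qmult2_def mult_alg_def by auto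

lemmas V_bop = unitary_opD[OF KK_sub KK_sub V_unitary]

lemma one_tens:
 assumes "c:BL K K"
 shows "qtens D (qid D) c:BL (tn K K) (tn K K)"
  "[|x:sp K; y:sp K|] ==> qtens D (qid D) c $$ vc K K x y = vc K K x (c $$ y)"
 using optens_alg[OF hid_bop[OF qK] assms] by(auto simp: hid_apply qK)

lemma qtens_in_alg2: "a:\<A> ==> b:\<A> ==> qtens D a b:qalg2 D"
 unfolding qalg2_def alg_tens_def by(rule subsetD[OF closure_subset span_base]) blast

text \<open>The defining property makes \<open>adj V\<close> send
  \<open>\<Lambda>(a) \<otimes> \<Lambda>(b)\<close> to the GNS vector of
  \<open>\<delta>(b)(a \<otimes> 1)\<close>, and multiplying by \<open>\<delta>(c)\<close> replaces
  \<open>b\<close> by \<open>c b\<close>. As \<open>\<delta>(c)\<close> is merely a multiplier, the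
  comparison is made after multiplying by elements \<open>E\<close> of \<open>A \<otimes> A\<close>,
  where \<open>gns2_mult\<close> and \<open>gns2_unique\<close> apply; nondegeneracy removes
  \<open>E\<close>.\<close>

lemma delta_implemented:
 assumes c: "c:\<A>"
 shows "qdelta D c = adj (qV D) oL qtens D (qid D) c oL qV D"
proof -
 note cB = alg_bop[OF c]
 have VB: "adj (qV D):BL (tn K K) (tn K K)" by(rule V_bop(2))
 let ?X = "qdelta D c oL adj (qV D)" and ?Y = "adj (qV D) oL qtens D (qid D) c"
 have XB: "?X:BL (tn K K) (tn K K)" by(rule blin_comp[OF VB delta_mult(1)[OF c]])
 have YB: "?Y:BL (tn K K) (tn K K)" by(rule blin_comp[OF one_tens(1)[OF cB] VB])
 have base: "?X $$ vc K K (Lm a) (Lm b) = ?Y $$ vc K K (Lm a) (Lm b)"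
  if a: "a:NN" and b: "b:NN" for a b
 proof -
  define ze where "ze = adj (qV D) $$ vc K K (Lm a) (Lm b)"
  define ze' where "ze' = adj (qV D) $$ vc K K (Lm a) (Lm (c oL b))"
  have cb: "c oL b:NN" by(rule NN_mult[OF c b])
  have E: "E $$ qdelta D c $$ ze = E $$ ze'" if E: "E:qalg2 D" and EB: "E:BL (tn K K) (tn K K)" for E
  proof -
  have "gns2 D ((E oL qdelta D c) oL (qdelta D b oL qtens D a (qid D))) ((E oL qdelta D c) $$ ze)"
  unfolding ze_def by(rule gns2_mult[OF delta_mult(2)[OF c E] V_gns[OF a b]])
  moreover have "gns2 D (E oL (qdelta D (c oL b) oL qtens D a (qid D))) (E $$ ze')"
  unfolding ze'_def by(rule gns2_mult[OF E V_gns[OF a cb]])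
  moreover have "E oL (qdelta D (c oL b) oL qtens D a (qid D)) = (E oL qdelta D c) oL (qdelta D b oL qtens D a (qid D))"
  by(simp add: delta_mult(4)[OF c NN_alg[OF b]] oo_assoc)
  ultimately have "(E oL qdelta D c) $$ ze = E $$ ze'"
  using gns2_unique bop_in[OF EB] by(metis blinfun_apply_blinfun_compose)
  thus ?thesis by simp
  qed
  define w where "w = qdelta D c $$ ze - ze'"
  have wK: "w:sp (tn K K)" unfolding w_def ze'_def
  by(rule csubD(6)[OF KK_sub bop_in[OF delta_mult(1)[OF c]] bop_in[OF VB]])
  have "w = 0"
  proof (rule alg2_nondeg[OF wK])
  fix a' b' x y assume *: "a':\<A>" "b':\<A>" "x:sp K" "y:sp K"
  let ?E = "qtens D (adj a') (adj b')"
  note B = alg_bop[OF *(1)] alg_bop[OF *(2)] alg_bop[OF alg(5)[OF *(1)]] alg_bop[OF alg(5)[OF *(2)]]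
  have "adj ?E = qtens D a' b'" using adj_optens[OF qK qK qK qK B(3,4)] by simp
  hence "ip (vc K K (a' $$ x) (b' $$ y)) w = ip (adj ?E $$ vc K K x y) w"
  by(simp add: optens_alg(2)[OF B(1,2)] *)
  also have "... = ip (vc K K x y) (?E $$ w)"
  using bop_cinner2[OF optens_alg(1)[OF B(3,4)], of "vc K K x y" w] by simp
  also have "?E $$ w = 0"
  using E[OF qtens_in_alg2[OF alg(5)[OF *(1)] alg(5)[OF *(2)]] optens_alg(1)[OF B(3,4)]] by(simp add: w_def blinfun.diff_right)
  finally show "ip (vc K K (a' $$ x) (b' $$ y)) w = 0" by simp
  qed
  hence "qdelta D c $$ ze = ze'" by(simp add: w_def)
  thus ?thesis
  by(simp add: ze_def ze'_def one_tens(2)[OF cB] gns_in a b gns_mult[OF c b])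
 qed
 have cl: "x:sp K ==> x:closure (Lm ` NN)" for x using gns_dense by simp
 have base1: "?X $$ vc K K x (Lm b) = ?Y $$ vc K K x (Lm b)" if x: "x:sp K" and b: "b:NN" for x b
 proof -
  note R = rten[OF qK qK gns_in[OF b]]
  have "closed {x. (?X oL rten K K (Lm b)) $$ x = (?Y oL rten K K (Lm b)) $$ x}"
  by(intro closed_Collect_eq continuous_intros)
  hence "closure (Lm ` NN) <= {x. (?X oL rten K K (Lm b)) $$ x = (?Y oL rten K K (Lm b)) $$ x}"
  using base b R(2) gns_in by(intro closure_minimal) auto
  thus ?thesis using cl[OF x] R(2)[OF x] by auto
 qed
 have "?X = ?Y"
 proof (rule tens_ext[OF qK qK zorth_bop[OF XB] zorth_bop[OF YB]])
  fix x y assume xy: "x:sp K" "y:sp K"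
  note L = lten[OF qK qK xy(1)]
  have "closed {x'. (?X oL lten K K x) $$ x' = (?Y oL lten K K x) $$ x'}"
  by(intro closed_Collect_eq continuous_intros)
  hence "closure (Lm ` NN) <= {x'. (?X oL lten K K x) $$ x' = (?Y oL lten K K x) $$ x'}"
  using base1 xy L(2) gns_in by(intro closure_minimal) auto
  thus "?X $$ vc K K x y = ?Y $$ vc K K x y" using cl[OF xy(2)] L(2)[OF xy(2)] by auto
 qed
 hence "?X oL qV D = ?Y oL qV D" by simp
 thus ?thesis
  by(simp add: oo_assoc V_bop(3) comp_idop[OF KK_sub delta_mult(1)[OF c]])
qed

end

lemma norm_cinner_sq_bound:
 "norm (ip et (X $$ xi)) <= norm X * ((norm et)^2 + (norm xi)^2)"
proof -
 have "norm (ip et (X $$ xi)) <= norm et * (norm X * norm xi)"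
  by(rule order_trans[OF cinner_cauchy]) (intro mult_left_mono norm_blinfun norm_ge_zero)
 also have "... = norm X * (norm et * norm xi)" by simp
 also have "... <= norm X * ((norm et)^2 + (norm xi)^2)"
 proof (rule mult_left_mono)
  have "0 <= (norm et - norm xi)^2 + (norm et)^2 + (norm xi)^2" by simp
  thus "norm et * norm xi <= (norm et)^2 + (norm xi)^2" by(simp add: power2_diff)
 qed simp
 finally show ?thesis .
qed

lemma bounded_linear_normal:
 fixes et xi :: "'i => 'h::complex_hilbert"
 assumes s: "(%i. (norm (et i))^2) summable_on I" "(%i. (norm (xi i))^2) summable_on I"
 shows "bounded_linear (%X. infsum (%i. ip (et i) (X $$ (xi i))) I)"
proof (rule bounded_linear_intro[where K = "infsum (%i. (norm (et i))^2 + (norm (xi i))^2) I"])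
 fix X Y :: "'h oper" and r :: real
 show "infsum (%i. ip (et i) ((X + Y) $$ (xi i))) I
  = infsum (%i. ip (et i) (X $$ (xi i))) I + infsum (%i. ip (et i) (Y $$ (xi i))) I"
  by(simp add: blinfun.add_left cinner_add_right infsum_add cinner_summable[OF s])
 show "infsum (%i. ip (et i) ((r *\<^sub>R X) $$ (xi i))) I = r *\<^sub>R infsum (%i. ip (et i) (X $$ (xi i))) I"
  by(simp add: blinfun.scaleR_left cinner_scaleR_right infsum_cmult_right' scaleR_conv_of_real)
 have "norm (infsum (%i. ip (et i) (X $$ (xi i))) I) <= infsum (%i. norm (ip (et i) (X $$ (xi i)))) I"
  by(rule norm_infsum_bound[OF cinner_abs_summable[OF s]])
 also have "... <= infsum (%i. norm X * ((norm (et i))^2 + (norm (xi i))^2)) I"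
  by(intro infsum_mono cinner_abs_summable[OF s] summable_on_cmult_right summable_on_add s norm_cinner_sq_bound)
 also have "... = norm X * infsum (%i. (norm (et i))^2 + (norm (xi i))^2) I" by(rule infsum_cmult_right')
 finally show "norm (infsum (%i. ip (et i) (X $$ (xi i))) I) <= norm X * infsum (%i. (norm (et i))^2 + (norm (xi i))^2) I" .
qed

context lc_quantum_group begin

section \<open>The unitary coinverse on the von Neumann algebra\<close>

lemma Mhat_bicommutant: "Mhat D = commutant (sp K) (commutant (sp K) \<A>)"
proof -
 have "\<A> \<union> adj ` \<A> = \<A>" using alg(5) by auto
 thus ?thesis using Mhat_eq by(simp add: vn_gen_def)
qed

lemma Mhat_bop: "x:Mhat D ==> x:BL K K"
 by(simp add: Mhat_bicommutant commutant_def)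

lemma alg_Mhat: "a:\<A> ==> a:Mhat D"
 using alg_bop by(simp add: Mhat_bicommutant commutant_def)

lemma commutant_alg_adj: "t:commutant (sp K) \<A> ==> adj t:commutant (sp K) \<A>"
 unfolding commutant_def using adj_bop[OF K_sub] alg(5) by(auto simp: adj_comp[symmetric]) (metis adj_adj adj_comp)

lemma Mhat_closed:
 shows "x:Mhat D ==> y:Mhat D ==> x oL y:Mhat D"
  "x:Mhat D ==> adj x:Mhat D" "qid D:Mhat D"
  "x:Mhat D ==> y:Mhat D ==> x + y:Mhat D" "x:Mhat D ==> scl c x:Mhat D"
  "subspace (Mhat D)" "closed (Mhat D)"
proof -
 have I: "x:Mhat D \<longleftrightarrow> x:BL K K & (ALL t:commutant (sp K) \<A>. x oL t = t oL x)" for x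
  by(simp add: Mhat_bicommutant commutant_def[of _ "commutant (sp K) \<A>"])
 have tB: "t:commutant (sp K) \<A> ==> t:BL K K" for t by(simp add: commutant_def)
 show "x:Mhat D ==> y:Mhat D ==> x oL y:Mhat D"
  unfolding I by(auto intro: blin_comp) (metis oo_assoc)
 show "x:Mhat D ==> adj x:Mhat D"
  unfolding I using adj_bop[OF K_sub] commutant_alg_adj by(auto, metis adj_adj adj_comp)
 show "qid D:Mhat D"
  unfolding I
 proof (intro conjI ballI hid_bop qK)
  fix t assume "t:commutant (sp K) \<A>"
  from tB[OF this] show "qid D oL t = t oL qid D" by(simp only: comp_idop[OF K_sub] idop_comp[OF K_sub])
 qed
 show add: "x:Mhat D ==> y:Mhat D ==> x + y:Mhat D" for x y
  unfolding I by(auto simp: bop_add[OF K_sub] blinfun_compose_add_left blinfun_compose_add_right)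
 show sc: "x:Mhat D ==> scl c x:Mhat D" for c x
  unfolding I
 proof (intro conjI ballI; elim conjE)
  assume x: "x:BL K K" "ALL t:commutant (sp K) \<A>. x oL t = t oL x"
  show "scl c x:BL K K" by(rule bop_scl[OF K_sub x(1)])
  fix t assume t: "t:commutant (sp K) \<A>"
  thus "scl c x oL t = t oL scl c x" using x by(simp add: scl_comp_left scl_comp_right[OF tB[OF t]])
 qed
 have "0:Mhat D" using bop_zero[OF K_sub] unfolding I by(auto intro!: blinfun_eqI)
 thus "subspace (Mhat D)" using add sc by(auto simp: subspace_def simp flip: scl_of_real)
 have "Mhat D = BL K K \<inter> (\<Inter>t\<in>commutant (sp K) \<A>. {x. x oL t = t oL x})"
  using I by blast
 thus "closed (Mhat D)"
  by(auto intro!: closed_Int closed_bop[OF K_sub] closed_INT closed_Collect_eq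
  bounded_linear.continuous_on[OF bounded_bilinear.bounded_linear_left[OF bounded_bilinear_blinfun_compose]]
  bounded_linear.continuous_on[OF bounded_bilinear.bounded_linear_right[OF bounded_bilinear_blinfun_compose]])
qed

lemma R_simps:
 shows "x:Mhat D ==> qR D x:Mhat D" "x:Mhat D ==> y:Mhat D ==> qR D (x oL y) = qR D y oL qR D x"
  "x:Mhat D ==> qR D (adj x) = adj (qR D x)" "x:Mhat D ==> y:Mhat D ==> qR D (x + y) = qR D x + qR D y"
  "x:Mhat D ==> qR D (scl c x) = scl c (qR D x)" "qR D (qid D) = qid D"
  "x:Mhat D ==> norm (qR D x) <= norm x"
proof -
 show r: "x:Mhat D ==> qR D x:Mhat D" for x using R_antiaut(1) by(auto simp: star_antihom_def)
 show mult: "x:Mhat D ==> y:Mhat D ==> qR D (x oL y) = qR D y oL qR D x" for x y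
  using R_antiaut(1) by(auto simp: star_antihom_def)
 show "x:Mhat D ==> qR D (adj x) = adj (qR D x)" "x:Mhat D ==> y:Mhat D ==> qR D (x + y) = qR D x + qR D y"
  "x:Mhat D ==> qR D (scl c x) = scl c (qR D x)"
  using R_antiaut(1) by(auto simp: star_antihom_def op_linear_on_def)
 have i: "qid D:Mhat D" by(rule Mhat_closed(3))
 \<comment> \<open>\<open>R\<close> is involutive and reverses products, so this evaluates to
   \<open>1 = R(1)\<close>.\<close>
 have "qR D (qR D (qid D) oL qid D) = qR D (qid D) oL qR D (qR D (qid D))" using mult[OF r[OF i] i] .
 thus "qR D (qid D) = qid D"
  unfolding comp_idop[OF K_sub Mhat_bop[OF r[OF i]]] R_antiaut(2)[OF i] by simp
 show "x:Mhat D ==> norm (qR D x) <= norm x"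
  by(rule star_antihom_contractive[OF Mhat_closed(6,7,1,2) subset_refl R_antiaut(1)])
qed

lemma R_alg: "a:\<A> ==> qR D a:\<A>"
 using R_antiaut(3) by blast

lemma normal_R:
 assumes "k':sp K" "k:sp K"
 shows "EX et xi. normal_rep (sp K) (Mhat D) (%y. ip k' (qR D y $$ k)) et xi"
 using normal_fun_rep[OF R_normal[OF normal_fun_vector[OF assms csubD(4)[OF K_sub]]]]
 by(simp add: o_def)

lemma alg2:
 shows "qalg2 D <= BL (tn K K) (tn K K)" "subspace (qalg2 D)" "closed (qalg2 D)"
  "X:qalg2 D ==> Y:qalg2 D ==> X oL Y:qalg2 D" "X:qalg2 D ==> adj X:qalg2 D" "qalg2 D <= qmult2 D"
proof -
 let ?B = "{qtens D S T |S T. S:\<A> & T:\<A>}"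
 have e: "qalg2 D = closure (span ?B)" by(simp add: qalg2_def alg_tens_def)
 show bl: "qalg2 D <= BL (tn K K) (tn K K)" unfolding e
  by(intro closure_minimal span_minimal subspace_bop[OF KK_sub] closed_bop[OF KK_sub]) (auto intro: optens_alg(1) alg_bop)
 show "subspace (qalg2 D)" "closed (qalg2 D)" unfolding e by(auto intro: subspace_closure)
 have Bm: "S oL T:?B" if ST: "S:?B" "T:?B" for S T
 proof -
  obtain a b a' b' where *: "S = qtens D a b" "T = qtens D a' b'" "a:\<A>" "b:\<A>" "a':\<A>" "b':\<A>" using ST by blast
  hence "S oL T = qtens D (a oL a') (b oL b')"
  using optens_comp[OF qK qK qK qK qK qK alg_bop[of a'] alg_bop[of b'] alg_bop[of a] alg_bop[of b]] by simp
  thus ?thesis using * alg(4) by blast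
 qed
 have Ba: "adj S:?B" if S: "S:?B" for S
 proof -
  obtain a b where *: "S = qtens D a b" "a:\<A>" "b:\<A>" using S by blast
  hence "adj S = qtens D (adj a) (adj b)" using adj_optens[OF qK qK qK qK alg_bop[of a] alg_bop[of b]] by simp
  thus ?thesis using * alg(5) by blast
 qed
 show m: "X:qalg2 D ==> Y:qalg2 D ==> X oL Y:qalg2 D" for X Y
  unfolding e by(rule closure_span_oper_closed(1)[OF Bm])
 show "X:qalg2 D ==> adj X:qalg2 D"
  unfolding e by(rule closure_span_oper_closed(2)[OF Ba])
 show "qalg2 D <= qmult2 D" using bl m by(auto simp: qmult2_def mult_alg_def)
qed

lemma hvec_sq_summable:
 assumes "!!n. et n:sp K" "!!n. et' n:sp K" "(%n::nat. (norm (et n))^2) summable_on UNIV" "(%n::nat. (norm (et' n))^2) summable_on UNIV"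
 shows "(%p. (norm (vc K K (et (fst p)) (et' (snd p))))^2) summable_on UNIV \<times> UNIV"
proof (rule summable_on_SigmaI[where g = "%n. (norm (et n))^2 * infsum (%n. (norm (et' n))^2) UNIV"])
 show "((%m. (norm (vc K K (et (fst (n, m))) (et' (snd (n, m)))))^2) has_sum (norm (et n))\<^sup>2 * infsum (%n. (norm (et' n))^2) UNIV) UNIV" for n
  by(simp add: norm_hvec assms power_mult_distrib has_sum_cmult_right has_sum_infsum)
 show "(%n. (norm (et n))^2 * infsum (%n. (norm (et' n))^2) UNIV) summable_on UNIV"
  by(rule summable_on_cmult_left[OF assms(3)])
qed simp

text \<open>\<open>R \<otimes> R\<close> is known through its values on elementary tensors. As a
  \<open>*\<close>-antihomomorphism it is contractive on \<open>A \<otimes> A\<close>, and the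
  tensor product of two normal functionals is norm continuous, so the identity of their coefficients
  extends from elementary tensors.\<close>

lemma RR_normal:
 assumes RR: "star_antihom (qmult2 D) (qmult2 D) RR" "!!a b. a:\<A> ==> b:\<A> ==> RR (qtens D a b) = qtens D (qR D a) (qR D b)"
  and k: "p:sp K" "k:sp K" "p':sp K" "k':sp K"
  and r: "normal_rep (sp K) (Mhat D) (%y. ip p (qR D y $$ k)) et xi"
  and r': "normal_rep (sp K) (Mhat D) (%y. ip p' (qR D y $$ k')) et' xi'"
  and X: "X:qalg2 D"
 shows "((%q. ip (vc K K (et (fst q)) (et' (snd q))) (X $$ vc K K (xi (fst q)) (xi' (snd q))))
  has_sum ip (vc K K p p') (RR X $$ vc K K k k')) (UNIV \<times> UNIV)"
proof -
 note d = normal_repD[OF r] and d' = normal_repD[OF r']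
 define f where "f X q = ip (vc K K (et (fst q)) (et' (snd q))) (X $$ vc K K (xi (fst q)) (xi' (snd q)))" for X q
 define G where "G X = infsum (f X) (UNIV \<times> UNIV)" for X
 note sq = hvec_sq_summable[OF d(1) d'(1) d(3) d'(3)] hvec_sq_summable[OF d(2) d'(2) d(4) d'(4)]
 have sm: "f X summable_on UNIV \<times> UNIV" for X unfolding f_def by(rule cinner_summable[OF sq])
 have Gl: "bounded_linear G" unfolding G_def f_def by(rule bounded_linear_normal[OF sq])
 define L where "L X = ip (vc K K p p') (RR X $$ vc K K k k')" for X
 have RRl: "RR (X + Y) = RR X + RR Y" "RR (r *\<^sub>R X) = r *\<^sub>R RR X" if "X:qalg2 D" "Y:qalg2 D" for X Y r
  using RR(1) subsetD[OF alg2(6) that(1)] subsetD[OF alg2(6) that(2)]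
  unfolding star_antihom_def op_linear_on_def by(simp_all flip: scl_of_real)
 have RRn: "norm (RR X) <= norm X" if "X:qalg2 D" for X
  by(rule star_antihom_contractive[OF alg2(2-5,6) RR(1) that])
 have elem: "G (qtens D a b) = L (qtens D a b)" if ab: "a:\<A>" "b:\<A>" for a b
 proof -
  have "(f (qtens D a b) has_sum ip p (qR D a $$ k) * ip p' (qR D b $$ k')) (UNIV \<times> UNIV)"
  proof (rule has_sum_SigmaI[OF _ _ sm])
  fix n
  have "((%m. ip (et n) (a $$ (xi n)) * ip (et' m) (b $$ (xi' m)))
  has_sum ip (et n) (a $$ (xi n)) * ip p' (qR D b $$ k')) UNIV"
  by(rule has_sum_cmult_right[OF d'(5)[OF alg_Mhat[OF ab(2)]]])
  moreover have "f (qtens D a b) (n, m) = ip (et n) (a $$ (xi n)) * ip (et' m) (b $$ (xi' m))" for m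
  by(simp add: f_def optens_alg(2)[OF alg_bop alg_bop] ab d d' hvec_cinner bop_in[OF alg_bop])
  ultimately show "((%m. f (qtens D a b) (n, m)) has_sum ip (et n) (a $$ (xi n)) * ip p' (qR D b $$ k')) UNIV"
  by simp
  next
  show "((%n. ip (et n) (a $$ (xi n)) * ip p' (qR D b $$ k')) has_sum
  ip p (qR D a $$ k) * ip p' (qR D b $$ k')) UNIV"
  by(rule has_sum_cmult_left[OF d(5)[OF alg_Mhat[OF ab(1)]]])
  qed
  hence "G (qtens D a b) = ip p (qR D a $$ k) * ip p' (qR D b $$ k')"
  unfolding G_def by(rule infsumI)
  thus ?thesis
  using R_alg[OF ab(1)] R_alg[OF ab(2)] k
  by(simp add: L_def RR(2) ab optens_alg(2)[OF alg_bop alg_bop] hvec_cinner bop_in[OF alg_bop])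
 qed
 have sp: "G X = L X & X:qalg2 D" if "X:span {qtens D S T |S T. S:\<A> & T:\<A>}" for X
  using that
 proof (induction rule: span_induct_alt)
  case base
  have z: "0:qalg2 D" using subspace_0[OF alg2(2)] .
  have "RR 0 = 0" using RRl(2)[OF z z, of 0] by simp
  thus ?case using z by(simp add: L_def linear_0[OF bounded_linear.linear[OF Gl]])
 next
  case (step c x y)
  hence x: "x:qalg2 D" "G x = L x" using elem qtens_in_alg2 by auto
  have cx: "c *\<^sub>R x:qalg2 D" by(rule subspace_mul[OF alg2(2) x(1)])
  show ?case using step x subspace_add[OF alg2(2) cx] RRl(1)[OF cx, of y] RRl(2)[OF x(1) x(1), of c]
  by(simp add: L_def linear_add[OF bounded_linear.linear[OF Gl]] linear_scale[OF bounded_linear.linear[OF Gl]]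
  blinfun.add_left blinfun.scaleR_left cinner_add_right cinner_scaleR_right scaleR_conv_of_real)
 qed
 obtain Y where Y: "!!n. Y n:span {qtens D S T |S T. S:\<A> & T:\<A>}" "Y \<longlonglongrightarrow> X"
  using X unfolding qalg2_def alg_tens_def closure_sequential by blast
 have "(%n. RR (Y n)) \<longlonglongrightarrow> RR X"
 proof (rule LIM_zero_cancel, rule Lim_null_comparison)
  show "(%n. norm (Y n - X)) \<longlonglongrightarrow> 0" using Y(2) by(simp add: LIM_zero tendsto_norm_zero)
  have "norm (RR (Y n) - RR X) <= norm (Y n - X)" for n
  proof -
  have Yn: "Y n:qalg2 D" using sp Y by blast
  have m: "(-1) *\<^sub>R X:qalg2 D" by(rule subspace_mul[OF alg2(2) X])
  have "RR (Y n - X) = RR (Y n) - RR X" using RRl(1)[OF Yn m] RRl(2)[OF X X, of "-1"] by simp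
  thus ?thesis using RRn[OF subspace_diff[OF alg2(2) Yn X]] by simp
  qed
  thus "\<forall>\<^sub>F n in sequentially. norm (RR (Y n) - RR X) <= norm (Y n - X)" by simp
 qed
 hence "(%n. L (Y n)) \<longlonglongrightarrow> L X" unfolding L_def
  by(intro tendsto_cinner tendsto_const bounded_linear.tendsto[OF blinfun.bounded_linear_left])
 moreover have "(%n. L (Y n)) \<longlonglongrightarrow> G X"
  using bounded_linear.tendsto[OF Gl Y(2)] sp Y(1) by simp
 ultimately have "G X = L X" using LIMSEQ_unique by blast
 thus ?thesis using has_sum_infsum[OF sm[of X]] by(simp add: G_def L_def f_def[abs_def])
qed

text \<open>The functional \<open>x \<mapsto> \<langle>u, (1 \<otimes> x) v\<rangle>\<close> is
  normal, with the components of \<open>u\<close> and \<open>v\<close> along a basis of the first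
  leg as its vectors. The flip moves that leg to the second place, where \<open>parseval\<close> is
  available.\<close>

lemma one_tens_expansion:
 assumes E: "onb (sp K) E" and u: "u:sp (tn K K)" and v: "v:sp (tn K K)" and x: "x:BL K K"
 defines "lg \<equiv> %e w. adj (rten K K e) $$ hf K K $$ w"
 shows "((%e. ip (lg e u) (x $$ lg e v)) has_sum ip u (qtens D (qid D) x $$ v)) E"
  "((%e. (norm (lg e u))^2) has_sum (norm u)\<^sup>2) E" "e:E ==> lg e u:sp K"
proof -
 note F = hflip_works[OF qK qK]
 have iso: "ip (hf K K $$ w) (hf K K $$ w') = ip w w'" if "w:sp (tn K K)" "w':sp (tn K K)" for w w'
  using hflip_hflip[OF qK qK] that hid_apply[OF KK_obj]
  by(simp add: bop_cinner[OF F(1)] adj_hflip[OF qK qK] flip: blinfun_apply_blinfun_compose)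
 have Fin: "hf K K $$ w:sp (tn K K)" for w by(rule bop_in[OF F(1)])
 have EK: "e:E ==> e:sp K" for e using E by(auto simp: onb_def)
 show "e:E ==> lg e u:sp K" unfolding lg_def by(rule bop_in[OF adj_rten(1)[OF qK qK EK]])
 have "(norm (hf K K $$ u))^2 = (norm u)^2"
  using iso[OF u u] by(simp add: cinner_self flip: of_real_power)
 thus "((%e. (norm (lg e u))^2) has_sum (norm u)\<^sup>2) E"
  using parseval_norm[OF qK qK E Fin[of u]] by(simp add: lg_def)
 have xx: "adj (rten K K e) $$ hf K K $$ qtens D (qid D) x $$ v = x $$ lg e v"
  if e: "e:E" for e
 proof -
  have 1: "hf K K oL qtens D (qid D) x = qtens D x (qid D) oL hf K K"
  by(rule hflip_natural[OF qK qK qK qK hid_bop[OF qK] x])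
  note X = optens_alg[OF x hid_bop[OF qK]]
  have 2: "adj (rten K K e) oL qtens D x (qid D) = x oL adj (rten K K e)"
  proof (rule tens_ext[OF qK qK])
  show "zorth (sp (tn K K)) (adj (rten K K e) oL qtens D x (qid D))" "zorth (sp (tn K K)) (x oL adj (rten K K e))"
  by(intro zorth_oo zorth_bop[OF X(1)] zorth_bop[OF adj_rten(1)[OF qK qK EK[OF e]]])+
  fix p q assume "p:sp K" "q:sp K"
  thus "(adj (rten K K e) oL qtens D x (qid D)) $$ vc K K p q = (x oL adj (rten K K e)) $$ vc K K p q"
  by(simp add: X(2) adj_rten(3)[OF qK qK EK[OF e]] hid_apply bop_in[OF x] bop_scaleC[OF x])
  qed
  show ?thesis unfolding lg_def
  using arg_cong[OF 1, of "%T. T $$ v"] arg_cong[OF 2, of "%T. T $$ hf K K $$ v"] by simp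
 qed
 have "ip (hf K K $$ u) (hf K K $$ qtens D (qid D) x $$ v)
  = ip u (qtens D (qid D) x $$ v)"
  by(rule iso[OF u bop_in[OF one_tens(1)[OF x]]])
 thus "((%e. ip (lg e u) (x $$ lg e v)) has_sum ip u (qtens D (qid D) x $$ v)) E"
  using parseval[OF qK qK E Fin[of u], of "hf K K $$ qtens D (qid D) x $$ v"]
  by(simp add: lg_def[symmetric] xx[unfolded lg_def] cong: has_sum_cong) (simp add: lg_def)
qed

text \<open>The relation \<open>\<delta> R = \<theta> (R \<otimes> R) \<delta>\<close> on the von Neumann algebra, in terms of normal functionals.  It is first checked
  on \<open>A\<close>, where the multipliers \<open>\<delta>(a)\<close> are pushed into \<open>A \<otimes> A\<close> by the factors \<open>c\<^sub>1\<close>, \<open>c\<^sub>2\<close>, and then extended by \<open>\<sigma>\<close>-weak density.\<close>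

lemma delta_R:
 assumes c: "c1:\<A>" "c2:\<A>" and k: "p1:sp K" "p2:sp K" "k1:sp K" "k2:sp K"
 shows "EX et1 xi1 et2 xi2. normal_rep (sp K) (Mhat D) (%y. ip (c1 $$ p1) (qR D y $$ k1)) et1 xi1 &
  normal_rep (sp K) (Mhat D) (%y. ip (c2 $$ p2) (qR D y $$ k2)) et2 xi2 &
  (ALL x:Mhat D. ((%q. ip (qV D $$ vc K K (et2 (fst q)) (et1 (snd q)))
  (qtens D (qid D) x $$ qV D $$ vc K K (xi2 (fst q)) (xi1 (snd q))))
  has_sum ip (qV D $$ vc K K (c1 $$ p1) (c2 $$ p2))
  (qtens D (qid D) (qR D x) $$ qV D $$ vc K K k1 k2)) (UNIV \<times> UNIV))"
proof -
 obtain RR where RR: "star_antihom (qmult2 D) (qmult2 D) RR" "ALL a:\<A>. ALL b:\<A>. RR (qtens D a b) = qtens D (qR D a) (qR D b)"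
  "ALL a:\<A>. qdelta D (qR D a) = hf K K oL RR (qdelta D a) oL hf K K"
  using R_delta unfolding R_anticomultiplicative_def by blast
 obtain et1 ze1 where r1: "normal_rep (sp K) (Mhat D) (%y. ip p1 (qR D y $$ k1)) et1 ze1" using normal_R[OF k(1,3)] by blast
 obtain et2 ze2 where r2: "normal_rep (sp K) (Mhat D) (%y. ip p2 (qR D y $$ k2)) et2 ze2" using normal_R[OF k(2,4)] by blast
 \<comment> \<open>Since \<open>R(d1) = adj c1\<close>, the factor \<open>c1\<close> in front of
   \<open>p1\<close> becomes right multiplication of the argument of \<open>R\<close> by
   \<open>d1\<close>; a representing sequence for \<open>p1\<close> yields one for
   \<open>c1 $$ p1\<close> by applying \<open>d1\<close> to its right-hand vectors.\<close>
 define d1 where "d1 = qR D (adj c1)"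
 define d2 where "d2 = qR D (adj c2)"
 have d: "d1:\<A>" "d2:\<A>" using c alg(5) R_alg by(auto simp: d1_def d2_def)
 have Rd: "qR D d1 = adj c1" "qR D d2 = adj c2"
  using R_antiaut(2)[OF alg_Mhat[OF alg(5)[OF c(1)]]] R_antiaut(2)[OF alg_Mhat[OF alg(5)[OF c(2)]]] by(auto simp: d1_def d2_def)
 have shift: "normal_rep (sp K) (Mhat D) (%y. ip (c $$ p) (qR D y $$ k)) et (%n. e $$ (ze n))"
  if r: "normal_rep (sp K) (Mhat D) (%y. ip p (qR D y $$ k)) et ze" and e: "e:\<A>" "qR D e = adj c" and cA: "c:\<A>" for p k c e et ze
  unfolding normal_rep_def
 proof (intro conjI allI ballI)
  note rd = normal_repD[OF r]
  show "et n:sp K" "e $$ (ze n):sp K" for n using rd bop_in[OF alg_bop[OF e(1)]] by auto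
  show "(%n. (norm (et n))^2) summable_on UNIV" by(rule rd(3))
  show "(%n. (norm (e $$ (ze n)))^2) summable_on UNIV"
  by(rule summable_on_comparison_test[OF summable_on_cmult_right[OF rd(4), of "(norm e)^2"]])
  (auto simp: power_mult_distrib[symmetric] intro!: power_mono norm_blinfun)
  fix y assume y: "y:Mhat D"
  have "((%n. ip (et n) ((y oL e) $$ (ze n))) has_sum ip p (qR D (y oL e) $$ k)) UNIV"
  by(rule rd(5)[OF Mhat_closed(1)[OF y alg_Mhat[OF e(1)]]])
  moreover have "ip p (qR D (y oL e) $$ k) = ip (c $$ p) (qR D y $$ k)"
  by(simp add: R_simps(2)[OF y alg_Mhat[OF e(1)]] e(2) bop_cinner[OF alg_bop[OF cA]])
  ultimately show "((%n. ip (et n) (y $$ e $$ (ze n))) has_sum ip (c $$ p) (qR D y $$ k)) UNIV"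
  by simp
 qed
 define xi1 where "xi1 n = d1 $$ (ze1 n)" for n
 define xi2 where "xi2 n = d2 $$ (ze2 n)" for n
 have R1: "normal_rep (sp K) (Mhat D) (%y. ip (c1 $$ p1) (qR D y $$ k1)) et1 xi1"
  unfolding xi1_def by(rule shift[OF r1 d(1) Rd(1) c(1)])
 have R2: "normal_rep (sp K) (Mhat D) (%y. ip (c2 $$ p2) (qR D y $$ k2)) et2 xi2"
  unfolding xi2_def by(rule shift[OF r2 d(2) Rd(2) c(2)])
 note n1 = normal_repD[OF R1] and n2 = normal_repD[OF R2] and m1 = normal_repD[OF r1] and m2 = normal_repD[OF r2]
 let ?u = "qV D $$ vc K K (c1 $$ p1) (c2 $$ p2)" and ?v = "qV D $$ vc K K k1 k2"
 have cp: "c1 $$ p1:sp K" "c2 $$ p2:sp K" using bop_in[OF alg_bop] c by auto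
 have VK: "qV D $$ w:sp (tn K K)" for w by(rule bop_in[OF V_bop(1)])
 define Fu where "Fu x = ip ?u (qtens D (qid D) (qR D x) $$ ?v)" for x
 define g where "g x q = ip (qV D $$ vc K K (et2 (fst q)) (et1 (snd q)))
  (qtens D (qid D) x $$ qV D $$ vc K K (xi2 (fst q)) (xi1 (snd q)))" for x q
 have Vn: "norm (qV D $$ vc K K x y) = norm (vc K K x y)" if "x:sp K" "y:sp K" for x y
  by(rule unitary_norm[OF KK_sub KK_sub V_unitary hvec_in[OF qK qK that]])
 have sq: "(%q. (norm (qV D $$ vc K K (et2 (fst q)) (et1 (snd q))))^2) summable_on UNIV \<times> UNIV"
  "(%q. (norm (qV D $$ vc K K (xi2 (fst q)) (xi1 (snd q))))^2) summable_on UNIV \<times> UNIV"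
  using hvec_sq_summable[OF n2(1) n1(1) n2(3) n1(3)] hvec_sq_summable[OF n2(2) n1(2) n2(4) n1(4)]
  by(simp_all add: Vn n1 n2)
 have gs: "g x summable_on UNIV \<times> UNIV" for x unfolding g_def by(rule cinner_summable[OF sq])
 define G where "G x = infsum (g x) (UNIV \<times> UNIV)" for x
 \<comment> \<open>The factor \<open>d2 \<otimes> d1\<close> pushes \<open>\<delta>(a)\<close> into
   \<open>A \<otimes> A\<close>, where \<open>RR_normal\<close> applies. The flip in the relation
   for \<open>\<delta> R\<close> is responsible for the order of the indices \<open>2\<close> and
   \<open>1\<close>.\<close>
 have onA: "Fu a = G a" if a: "a:\<A>" for a
 proof -
  note dB = delta_mult(1)[OF a]
  have dd: "qtens D d2 d1:qalg2 D" by(rule qtens_in_alg2[OF d(2,1)])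
  have Xq: "qdelta D a oL qtens D d2 d1:qalg2 D" by(rule delta_mult(3)[OF a dd])
  have mu: "RR (qdelta D a oL qtens D d2 d1) = qtens D (adj c2) (adj c1) oL RR (qdelta D a)"
  using RR(1) delta_mult(5)[OF a] subsetD[OF alg2(6) dd] RR(2) d
  unfolding star_antihom_def by(simp add: Rd)
  have cB: "c1:BL K K" "c2:BL K K" using c alg_bop by auto
  have adc: "adj (qtens D c2 c1) = qtens D (adj c2) (adj c1)" by(rule adj_optens[OF qK qK qK qK cB(2,1)])
  have s0: "((%q. ip (vc K K (et2 (fst q)) (et1 (snd q))) ((qdelta D a oL qtens D d2 d1) $$ vc K K (ze2 (fst q)) (ze1 (snd q))))
  has_sum ip (vc K K p2 p1) (RR (qdelta D a oL qtens D d2 d1) $$ vc K K k2 k1)) (UNIV \<times> UNIV)"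
  by(rule RR_normal[OF RR(1) _ k(2,4,1,3) r2 r1 Xq]) (use RR(2) in blast)
  have t1: "ip (vc K K (et2 (fst q)) (et1 (snd q))) ((qdelta D a oL qtens D d2 d1) $$ vc K K (ze2 (fst q)) (ze1 (snd q))) = g a q" for q
  using V_bop(2) m1 m2
  by(simp add: g_def xi1_def xi2_def optens_alg(2)[OF alg_bop[OF d(2)] alg_bop[OF d(1)]] delta_implemented[OF a]
  bop_cinner[OF V_bop(1)])
  have "ip (vc K K p2 p1) (RR (qdelta D a oL qtens D d2 d1) $$ vc K K k2 k1)
  = ip (qtens D c2 c1 $$ vc K K p2 p1) (RR (qdelta D a) $$ vc K K k2 k1)"
  by(simp add: mu bop_cinner[OF optens_alg(1)[OF cB(2,1)]] adc)
  also have "... = ip (vc K K (c2 $$ p2) (c1 $$ p1)) (RR (qdelta D a) $$ vc K K k2 k1)"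
  by(simp add: optens_alg(2)[OF cB(2,1)] k)
  also have "... = ip (vc K K (c1 $$ p1) (c2 $$ p2)) (qdelta D (qR D a) $$ vc K K k1 k2)"
  using RR(3) a bop_cinner2[OF hflip_works(1)[OF qK qK]]
  by(simp add: hflip_works(2)[OF qK qK] k cp adj_hflip[OF qK qK])
  also have "... = Fu a"
  by(simp add: Fu_def delta_implemented[OF R_alg[OF a]] bop_cinner[OF V_bop(1)])
  finally have "(g a has_sum Fu a) (UNIV \<times> UNIV)" using s0 unfolding t1 by simp
  thus ?thesis unfolding G_def by(simp add: infsumI)
 qed
 obtain E where E: "onb (sp K) E" using onb_exists[OF K_sub] by blast
 define lg where "lg e w = adj (rten K K e) $$ hf K K $$ w" for e w
 note ex = one_tens_expansion[OF E, folded lg_def]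
 have z: "0:sp K" by(rule csubD(4)[OF K_sub])
 have sE: "(%e. (norm (lg e (qV D $$ w)))^2) summable_on E" for w
  by(rule has_sum_imp_summable[OF ex(2)[OF VK VK idop_bop[OF K_sub]]])
 \<comment> \<open>Both sides, as functions of \<open>x\<close>, have to be normal on the von
   Neumann algebra before the bicommutant argument applies; \<open>R_normal\<close> covers the
   composition with \<open>R\<close>.\<close>
 have F0: "normal_fun (sp K) (Mhat D) (%x. ip ?u (qtens D (qid D) x $$ ?v))"
  by(rule normal_fun_index[where I = E and et = "%e. lg e ?u" and xi = "%e. lg e ?v"])
  (use ex(1)[OF VK VK Mhat_bop] ex(3)[OF VK VK K_sub[THEN idop_bop]] z in \<open>auto intro: sE\<close>)
 have FN: "normal_fun (sp K) (Mhat D) Fu"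
  using R_normal[OF F0] by(simp add: o_def Fu_def[abs_def])
 have GN: "normal_fun (sp K) (Mhat D) G"
 proof (rule normal_fun_index[where I = "(UNIV \<times> UNIV) \<times> E"
  and et = "%(q, e). lg e (qV D $$ vc K K (et2 (fst q)) (et1 (snd q)))"
  and xi = "%(q, e). lg e (qV D $$ vc K K (xi2 (fst q)) (xi1 (snd q)))"])
  note ex2 = ex(2)[OF VK VK K_sub[THEN idop_bop]] and ex3 = ex(3)[OF VK VK K_sub[THEN idop_bop]]
  show s1: "(%i. (norm (case i of (q, e) => lg e (qV D $$ vc K K (et2 (fst q)) (et1 (snd q)))))^2) summable_on (UNIV \<times> UNIV) \<times> E"
  by(rule summable_on_SigmaI[OF _ sq(1)]) (use ex2 in auto)
  show s2: "(%i. (norm (case i of (q, e) => lg e (qV D $$ vc K K (xi2 (fst q)) (xi1 (snd q)))))^2) summable_on (UNIV \<times> UNIV) \<times> E"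
  by(rule summable_on_SigmaI[OF _ sq(2)]) (use ex2 in auto)
  fix x assume x: "x:Mhat D"
  have "(g x has_sum G x) (UNIV \<times> UNIV)" unfolding G_def by(rule has_sum_infsum[OF gs])
  thus "((%i. ip (case i of (q, e) => lg e (qV D $$ vc K K (et2 (fst q)) (et1 (snd q))))
  (x $$ (case i of (q, e) => lg e (qV D $$ vc K K (xi2 (fst q)) (xi1 (snd q)))))) has_sum G x) ((UNIV \<times> UNIV) \<times> E)"
  by(intro has_sum_SigmaI[where g = "g x"] cinner_summable[OF s1 s2])
  (use ex(1)[OF VK VK Mhat_bop[OF x]] in \<open>auto simp: g_def\<close>)
 qed (use z ex(3)[OF VK VK K_sub[THEN idop_bop]] in auto)
 have eq: "Fu x = G x" if x: "x:Mhat D" for x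
  by(rule normal_fun_eq_on_bicommutant[OF qK alg(1,2) alg(3,4,5) alg(7) _ FN GN onA x])
  (use x alg_Mhat Mhat_bicommutant in auto)
 have "(g x has_sum Fu x) (UNIV \<times> UNIV)" if "x:Mhat D" for x
  using has_sum_infsum[OF gs[of x]] eq[OF that] by(simp add: G_def)
 thus ?thesis using R1 R2 unfolding g_def Fu_def by blast
qed

end

lemma commute_comp:
 fixes T A B :: "'a::real_normed_vector \<Rightarrow>\<^sub>L 'a"
 assumes "T oL A = A oL T" "T oL B = B oL T"
 shows "T oL (A oL B) = A oL B oL T"
proof -
 have "T oL (A oL B) = (T oL A) oL B" by(simp only: oo_assoc)
 also have "... = A oL (T oL B)" by(simp only: assms(1) oo_assoc)
 finally show ?thesis by(simp only: assms(2) oo_assoc)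
qed

lemma unitary_commutes_adj:
 assumes H: "csub H" and U: "unitary_op False H H U" and T: "T:blin H H" "T oL U = U oL T"
 shows "T oL adj U = adj U oL T"
proof -
 note u = unitary_opD[OF H H U]
 have "adj U oL (T oL U) oL adj U = adj U oL (U oL T) oL adj U" by(simp add: T(2))
 moreover have "adj U oL (T oL U) oL adj U = adj U oL T"
  using comp_idop[OF H blin_comp[OF T(1) u(2)]] by(simp add: oo_assoc u(4))
 moreover have "adj U oL (U oL T) oL adj U = T oL adj U"
  by(simp only: oo_assoc[symmetric] u(3) idop_comp[OF H T(1)])
 ultimately show ?thesis by simp
qed

context strict_hilb_cat begin

lemma vslice2_linear:
 assumes o: "a:Ob" "b:Ob" and X: "X:BL (tn a b) (tn a b)" and v: "p:sp b" "p':sp b" "q:sp b" "q':sp b"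
 shows "vslice2 D a b p (q + q') X = vslice2 D a b p q X + vslice2 D a b p q' X"
  "vslice2 D a b p (c *\<^sub>C q) X = scl c (vslice2 D a b p q X)"
  "vslice2 D a b (p + p') q X = vslice2 D a b p q X + vslice2 D a b p' q X"
  "vslice2 D a b (c *\<^sub>C p) q X = scl (cnj c) (vslice2 D a b p q X)"
  "norm (vslice2 D a b p q X) <= norm p * norm X * norm q"
  "adj (vslice2 D a b p q X) = vslice2 D a b q p (adj X)"
proof -
 note H = hsp[OF o(1)] and Hb = hsp[OF o(2)]
 note cl = csubD(5)[OF Hb] csubD(7)[OF Hb]
 note s = vslice2[OF o X]
 have eqI: "S = T" if "S:BL a a" "T:BL a a"
  "!!x y. [|x:sp a; y:sp a|] ==> ip y (S $$ x) = ip y (T $$ x)" for S T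
 proof (rule bop_eqI[OF H that(1,2)])
  fix x assume x: "x:sp a"
  let ?d = "S $$ x - T $$ x"
  have "?d:sp a" using bop_in[OF that(1)] bop_in[OF that(2)] csubD(6)[OF H] by blast
  hence "ip ?d ?d = 0" using that(3)[OF x, of ?d] by(simp add: cinner_diff_right)
  thus "S $$ x = T $$ x" by simp
 qed
 show "vslice2 D a b p (q + q') X = vslice2 D a b p q X + vslice2 D a b p q' X"
  by(rule eqI) (auto simp: s(2,3) v cl blinfun.add_left blinfun.add_right cinner_add_right hvec_add_right o intro!: s(2) bop_add[OF H])
 show "vslice2 D a b p (c *\<^sub>C q) X = scl c (vslice2 D a b p q X)"
  by(rule eqI) (auto simp: s(3) v cl scl_apply bop_scaleC[OF X] cinner_scaleC_right hvec_scaleC_right o intro!: s(2) bop_scl[OF H])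
 show "vslice2 D a b (p + p') q X = vslice2 D a b p q X + vslice2 D a b p' q X"
  by(rule eqI) (auto simp: s(3) v cl blinfun.add_left cinner_add_left cinner_add_right hvec_add_right o intro!: s(2) bop_add[OF H])
 show "vslice2 D a b (c *\<^sub>C p) q X = scl (cnj c) (vslice2 D a b p q X)"
  by(rule eqI) (auto simp: s(3) v cl scl_apply cinner_scaleC_left cinner_scaleC_right hvec_scaleC_right o intro!: s(2) bop_scl[OF H])
 show "norm (vslice2 D a b p q X) <= norm p * norm X * norm q"
 proof -
  have "norm (adj (rten a b p) oL X oL rten a b q) <= norm (adj (rten a b p) oL X) * norm (rten a b q)" by(rule norm_blinfun_compose)
  also have "... <= (norm (adj (rten a b p)) * norm X) * norm (rten a b q)"
  by(intro mult_right_mono norm_blinfun_compose norm_ge_zero)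
  also have "... <= (norm p * norm X) * norm q"
  using rten(3)[OF o v(1)] rten(3)[OF o v(3)] by(intro mult_mono) auto
  finally show ?thesis by(simp add: s(1) v)
 qed
 show "adj (vslice2 D a b p q X) = vslice2 D a b q p (adj X)"
  by(simp add: s(1) v vslice2(1)[OF o adj_bop[OF hsp[OF htens[OF o]] X]] adj_comp oo_assoc)
qed

text \<open>The middle leg is inert under \<open>X\<close> on legs \<open>1\<close> and
  \<open>3\<close>, so pairing with \<open>y'\<close> contracts it out of \<open>v\<close>
  beforehand.\<close>

lemma leg13_coeff:
 assumes o: "a:Ob" "b:Ob" "c:Ob" and X: "X:BL (tn a c) (tn a c)"
  and x: "x:sp a" "x':sp a" "y':sp b" "z':sp c" "v:sp (tn b c)"
 shows "ip (vc a (tn b c) x' (vc b c y' z')) (l13 a b c X $$ vc a (tn b c) x v)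
  = ip (vc a c x' z') (X $$ vc a c x (adj (lten b c y') $$ v))"
proof -
 note ac = o(1,3) and bc = o(2,3)
 have Lv: "lten a (tn b c) x $$ v = vc a (tn b c) x v" by(rule lten(2)[OF o(1) htens[OF bc] x(1,5)])
 have "ip (vc a (tn b c) x' (vc b c y' z')) (l13 a b c X $$ lten a (tn b c) x $$ v)
  = ip (vc a c x' z') (X $$ lten a c x $$ adj (lten b c y') $$ v)"
 proof (rule eq_on_tensor[OF bc _ _ _ x(5)])
  show "bounded_linear (%v. ip (vc a (tn b c) x' (vc b c y' z')) (l13 a b c X $$ lten a (tn b c) x $$ v))"
  "bounded_linear (%v. ip (vc a c x' z') (X $$ lten a c x $$ adj (lten b c y') $$ v))"
  by(intro bounded_linear_compose[OF bl_cinner_right] bounded_linear_compose[OF bl_right] bl_right)+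
  fix y z assume yz: "y:sp b" "z:sp c"
  have "ip (ins a b c y' $$ vc a c x' z') (ins a b c y $$ X $$ vc a c x z)
  = ip y' y * ip (vc a c x' z') (X $$ vc a c x z)"
  by(rule cinner_ins[OF o yz(1) x(3) bop_in[OF X] hvec_in[OF ac x(2,4)]])
  thus "ip (vc a (tn b c) x' (vc b c y' z')) (l13 a b c X $$ lten a (tn b c) x $$ vc b c y z)
  = ip (vc a c x' z') (X $$ lten a c x $$ adj (lten b c y') $$ vc b c y z)"
  using yz x by(simp add: lten(2) o htens hvec_in leg13(3)[OF o X] ins_apply[OF o] adj_lten(3)
  bop_scaleC[OF lten(1)] bop_scaleC[OF X] cinner_scaleC_right)
 qed
 thus ?thesis using Lv lten(2)[OF ac x(1) bop_in[OF adj_lten(1)[OF bc x(3)]]] by simp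
qed

text \<open>Pairing off the third leg of \<open>X\<close> on legs \<open>2\<close> and
  \<open>3\<close> leaves its slice on the second. For the multiplicative unitary this brings the
  middle factor \<open>1 \<otimes> x\<close> of \<open>\<delta>(x)\<close> into play.\<close>

lemma leg23_coeff:
 assumes o: "a:Ob" "b:Ob" "c:Ob" and X: "X:BL (tn b c) (tn b c)"
  and x: "u:sp (tn a b)" "u':sp (tn a b)" "z:sp c" "z':sp c"
 shows "ip (vc (tn a b) c u' z') (l23 a b c X $$ vc (tn a b) c u z)
  = ip u' (ot a b a b (hI a) (vslice2 D b c z' z X) $$ u)"
proof -
 note ab = o(1,2) and bc = o(2,3) and abc = htens[OF o(1,2)] o(3)
 have S: "vslice2 D b c z' z X:BL b b" by(rule vslice2(2)[OF bc X x(4,3)])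
 note O = optensI[OF ab ab hid_bop[OF o(1)] S]
 have assoc: "vc (tn a b) c (vc a b p q) w = vc a (tn b c) p (vc b c q w)" if "p:sp a" "q:sp b" "w:sp c" for p q w
  by(rule hvec_assoc[OF o that])
 have pure: "adj (rten (tn a b) c z') oL l23 a b c X oL rten (tn a b) c z = ot a b a b (hI a) (vslice2 D b c z' z X)"
 proof (rule tens_ext_coeff[OF ab _ O(1)])
  have L: "l23 a b c X:BL (tn (tn a b) c) (tn (tn a b) c)" using leg23(1)[OF o X] by(simp add: htens_assoc o)
  show "adj (rten (tn a b) c z') oL l23 a b c X oL rten (tn a b) c z:BL (tn a b) (tn a b)"
  by(rule blin_comp[OF rten(1)[OF abc x(3)] blin_comp[OF L adj_rten(1)[OF abc x(4)]]])
  fix p q p' q' assume pq: "p:sp a" "q:sp b" "p':sp a" "q':sp b"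
  have "ip (vc a b p' q') ((adj (rten (tn a b) c z') oL l23 a b c X oL rten (tn a b) c z) $$ vc a b p q)
  = ip (vc a (tn b c) p' (vc b c q' z')) (vc a (tn b c) p (X $$ vc b c q z))"
  using pq x by(simp add: adj_rten(2)[OF abc] hvec_in o rten(2)[OF abc] assoc leg23(2)[OF o X])
  also have "... = ip (vc a b p' q') (ot a b a b (hI a) (vslice2 D b c z' z X) $$ vc a b p q)"
  using pq x by(simp add: hvec_cinner o htens hvec_in bop_in[OF X] O(2) hid_apply bop_in[OF S] vslice2(3)[OF bc X])
  finally show "ip (vc a b p' q') ((adj (rten (tn a b) c z') oL l23 a b c X oL rten (tn a b) c z) $$ vc a b p q)
  = ip (vc a b p' q') (ot a b a b (hI a) (vslice2 D b c z' z X) $$ vc a b p q)" .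
 qed
 have "ip u' ((adj (rten (tn a b) c z') oL l23 a b c X oL rten (tn a b) c z) $$ u)
  = ip (vc (tn a b) c u' z') (l23 a b c X $$ vc (tn a b) c u z)"
  using x by(simp add: adj_rten(2)[OF abc] rten(2)[OF abc])
 thus ?thesis unfolding pure by simp
qed

end

context corep_setting begin

abbreviation (input) "CR == coreps D"
abbreviation (input) "ct == corep_tens D"
abbreviation (input) "vs == vslice2 D K"
abbreviation (input) "MM == Mhat D"
abbreviation (input) "cA == conj_arr D"
abbreviation (input) "cC == conj_c D"
abbreviation (input) "Bar == cbar D"
abbreviation (input) "BF == bounded_families D"

section \<open>Corepresentations and their conjugates\<close>

lemma cobj_hobj[simp]: "a:cobj D ==> a:Ob"
 using cobj(1) by blast

lemma cbar_hobj[simp]: "a:cobj D ==> Bar a:Ob"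
 using cbar by simp

lemma J_facts:
 assumes "a:cobj D"
 shows "cJ D a:banti (sp a) (sp (Bar a))" "adj (cJ D a):banti (sp (Bar a)) (sp a)"
  "adj (cJ D a) oL cJ D a = hI a" "cJ D a oL adj (cJ D a) = hI (Bar a)"
  "x:sp a ==> adj (cJ D a) $$ cJ D a $$ x = x"
  "y:sp (Bar a) ==> cJ D a $$ adj (cJ D a) $$ y = y"
  "x:sp a ==> x':sp a ==> ip (cJ D a $$ x) (cJ D a $$ x') = ip x' x"
  "cJ D a $$ z:sp (Bar a)" "adj (cJ D a) $$ z:sp a"
proof -
 note H = hsp[OF cobj_hobj[OF assms]] hsp[OF cbar_hobj[OF assms]]
 note u = unitary_opD[OF H cJ[OF assms]]
 show "cJ D a:banti (sp a) (sp (Bar a))" "adj (cJ D a):banti (sp (Bar a)) (sp a)"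
  "adj (cJ D a) oL cJ D a = hI a" "cJ D a oL adj (cJ D a) = hI (Bar a)"
  "x:sp a ==> adj (cJ D a) $$ cJ D a $$ x = x"
  "y:sp (Bar a) ==> cJ D a $$ adj (cJ D a) $$ y = y"
  using u by auto
 show "cJ D a $$ z:sp (Bar a)" "adj (cJ D a) $$ z:sp a"
  using bop_in[OF u(1)] bop_in[OF u(2)] by auto
 show "x:sp a ==> x':sp a ==> ip (cJ D a $$ x) (cJ D a $$ x') = ip x' x"
  using unitary_cinner[OF H cJ[OF assms], of x x'] cinner_commute[of x' x] by simp
qed

lemma corepD:
 assumes "(h, U):CR"
 shows "h:cobj D" "h:Ob" "tn K h:Ob" "unitary_op False (sp (tn K h)) (sp (tn K h)) U"
  "l12 K K h (qV D) oL l13 K K h U oL l23 K K h U = l23 K K h U oL l12 K K h (qV D)"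
  "csub (sp (tn K h))" "U:BL (tn K h) (tn K h)" "adj U:BL (tn K h) (tn K h)"
  "adj U oL U = hI (tn K h)" "U oL adj U = hI (tn K h)"
proof -
 show c: "h:cobj D" and u: "unitary_op False (sp (tn K h)) (sp (tn K h)) U"
  and "l12 K K h (qV D) oL l13 K K h U oL l23 K K h U = l23 K K h U oL l12 K K h (qV D)"
  using assms by(auto simp: coreps_def)
 thus h: "h:Ob" "tn K h:Ob" using htens by auto
 thus H: "csub (sp (tn K h))" by(blast intro: hsp)
 show "U:BL (tn K h) (tn K h)" "adj U:BL (tn K h) (tn K h)"
  "adj U oL U = hI (tn K h)" "U oL adj U = hI (tn K h)"
  using unitary_opD[OF H H u] by auto
qed

text \<open>\<open>W\<^sub>1\<^sub>3 = V\<^sub>1\<^sub>2\<^sup>* W\<^sub>2\<^sub>3 V\<^sub>1\<^sub>2 W\<^sub>2\<^sub>3\<^sup>*\<close>: the first leg of \<open>W\<close> is contained in that of \<open>V\<close>.\<close>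

lemma corep_slice_Mhat:
 assumes W: "(h, U):CR" and pq: "p:sp h" "q:sp h"
 shows "vs h p q U:MM"
\<comment> \<open>The argument below inserts a nonzero vector of \<open>K\<close> as a middle leg in
  order to pass from \<open>W\<close> on legs \<open>1\<close> and \<open>3\<close> back to
  \<open>W\<close>.\<close>
proof (cases "sp K = {0}")
 case True
 have "vs h p q U = 0"
  using bop_in[OF vslice2(2)[OF qK corepD(2,7)[OF W] pq]] True by(intro blinfun_eqI) auto
 thus ?thesis using subspace_0[OF Mhat_closed(6)] by simp
next
 case False
 then obtain y where y: "y:sp K" "y ~= 0" using csubD(4)[OF K_sub] by blast
 note w = corepD[OF W]
 let ?S = "{slice2 D K K om (qV D) |om. normal_fun (sp K) (BL K K) om}"
 let ?L = "sp (tn K (tn K h))"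
 have LH: "csub ?L" by(rule hsp[OF htens[OF qK w(3)]])
 have "vs h p q U oL t = t oL vs h p q U" if t: "t:commutant (sp K) (?S \<union> adj ` ?S)" for t
 proof -
  have tB: "t:BL K K" using t by(simp add: commutant_def)
  have tV: "t oL vs K a b (qV D) = vs K a b (qV D) oL t" if ab: "a:sp K" "b:sp K" for a b
  proof -
  have "slice2 D K K (%x. ip a (x $$ b)) (qV D) = vs K a b (qV D)"
  unfolding slice2_def
  by(rule form_op_eqI[OF K_sub vslice2(2)[OF qK qK V_bop(1) ab]])
  (simp add: vslice2(3)[OF qK qK V_bop(1)] vslice1(3)[OF qK qK V_bop(1)] ab)
  hence "vs K a b (qV D):?S"
  by(intro CollectI exI[of _ "%x. ip a (x $$ b)"] conjI normal_fun_vector[OF ab csubD(4)[OF K_sub]]) simp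
  thus ?thesis using t by(simp add: commutant_def)
  qed
  let ?t1 = "qtens D t (qid D)"
  note t1 = optens_alg[OF tB hid_bop[OF qK]]
  have tVc: "?t1 oL qV D = qV D oL ?t1" by(rule commute_tensor[OF qK qK tB V_bop(1) tV])
  define T where "T = ot K (tn K h) K (tn K h) t (hI (tn K h))"
  have T': "T = l12 K K h ?t1"
  unfolding T_def leg12_def optens_id[OF qK w(2), symmetric]
  by(rule optens_assoc[OF qK qK w(2) qK qK w(2) tB hid_bop[OF qK] hid_bop[OF w(2)], symmetric])
  note TB = optensI[OF qK w(3) qK w(3) tB hid_bop[OF w(3)], folded T_def]
  let ?V = "l12 K K h (qV D)" and ?W = "l23 K K h U" and ?X = "l13 K K h U"
  note o3 = qK qK w(2)
  have LV: "?V:blin ?L ?L" "unitary_op False ?L ?L ?V"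
  using leg12(1)[OF o3 V_bop(1)] leg12_comp[OF o3 V_bop(2) V_bop(1)] leg12_comp[OF o3 V_bop(1) V_bop(2)] leg_id(1)[OF o3]
  by(auto simp: unitary_op_def adj_leg12[OF o3 V_bop(1)] V_bop(3,4))
  have LW: "?W:blin ?L ?L" "unitary_op False ?L ?L ?W"
  using leg23(1)[OF o3 w(7)] leg23_comp[OF o3 w(8) w(7)] leg23_comp[OF o3 w(7) w(8)] leg_id(2)[OF o3]
  by(auto simp: unitary_op_def adj_leg23[OF o3 w(7)] w(9,10))
  have LX: "?X:blin ?L ?L" by(rule leg13(1)[OF o3 w(7)])
  have cV: "T oL ?V = ?V oL T"
  unfolding T' using leg12_comp[OF o3 t1(1) V_bop(1)] leg12_comp[OF o3 V_bop(1) t1(1)] tVc by simp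
  have cW: "T oL ?W = ?W oL T"
  unfolding T_def leg23_def
  using optens_comp[OF qK w(3) qK w(3) qK w(3) hid_bop[OF qK] w(7) tB hid_bop[OF w(3)]]
  optens_comp[OF qK w(3) qK w(3) qK w(3) tB hid_bop[OF w(3)] hid_bop[OF qK] w(7)]
  by(simp add: comp_idop[OF K_sub tB] idop_comp[OF K_sub tB] comp_idop[OF w(6,7)] idop_comp[OF w(6,7)])
  have cV': "T oL adj ?V = adj ?V oL T" by(rule unitary_commutes_adj[OF LH LV(2) TB(1) cV])
  have cW': "T oL adj ?W = adj ?W oL T" by(rule unitary_commutes_adj[OF LH LW(2) TB(1) cW])
  have X: "?X = adj ?V oL ?W oL ?V oL adj ?W"
  proof -
  note uV = unitary_opD[OF LH LH LV(2)] and uW = unitary_opD[OF LH LH LW(2)]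
  have "adj ?V oL (?V oL ?X oL ?W) oL adj ?W = adj ?V oL (?W oL ?V) oL adj ?W" by(simp add: w(5))
  moreover have "adj ?V oL (?V oL ?X oL ?W) oL adj ?W = (adj ?V oL ?V) oL ?X oL (?W oL adj ?W)"
  by(simp add: oo_assoc)
  ultimately show ?thesis by(simp add: uV(3) uW(4) idop_comp[OF LH LX] comp_idop[OF LH LX] oo_assoc)
  qed
  have cX: "T oL ?X = ?X oL T"
  unfolding X by(intro commute_comp cV cW cV' cW')
  let ?s = "ot K h K h t (hI h)"
  note s = optensI[OF qK w(2) qK w(2) tB hid_bop[OF w(2)]]
  \<comment> \<open>Insertion of \<open>y\<close> intertwines \<open>t \<otimes> 1\<close> with
    \<open>t \<otimes> 1 \<otimes> 1\<close> and multiplies inner products by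
    \<open>ip y y \<noteq> 0\<close>; commutation on three legs therefore descends to two.\<close>
  have Tins: "T oL ins K K h y = ins K K h y oL ?s"
  by(rule tens_ext[OF qK w(2) zorth_oo[OF zorth_bop[OF ins_bop[OF o3 y(1)]]] zorth_oo[OF zorth_bop[OF s(1)]]])
  (simp add: ins_apply[OF o3] y TB(2) s(2) hvec_in w qK hid_apply bop_in[OF tB])
  have cU: "?s oL U = U oL ?s"
  proof (rule bop_eqI[OF w(6) blin_comp[OF w(7) s(1)] blin_comp[OF s(1) w(7)]])
  fix u assume u: "u:sp (tn K h)"
  define d where "d = ?s $$ U $$ u - U $$ ?s $$ u"
  have d: "d:sp (tn K h)" unfolding d_def by(rule csubD(6)[OF w(6) bop_in[OF s(1)] bop_in[OF w(7)]])
  have ia: "T $$ ins K K h y $$ v = ins K K h y $$ ?s $$ v" for v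
  using arg_cong[OF Tins, of "%S. S $$ v"] by simp
  have ix: "?X $$ ins K K h y $$ v = ins K K h y $$ U $$ v" if "v:sp (tn K h)" for v
  by(rule leg13(2)[OF o3 w(7) y(1) that])
  have "T $$ ?X $$ ins K K h y $$ u = ?X $$ T $$ ins K K h y $$ u"
  using arg_cong[OF cX, of "%S. S $$ ins K K h y $$ u"] by simp
  hence "ins K K h y $$ d = 0"
  by(simp add: ia ix u bop_in[OF s(1)] d_def blinfun.diff_right)
  hence "ip y y * ip d d = 0" using cinner_ins[OF o3 y(1) y(1) d d] by simp
  hence "d = 0" using y by simp
  thus "(?s oL U) $$ u = (U oL ?s) $$ u" by(simp add: d_def)
  qed
  have "vs h p q U oL t = adj (rten K h p) oL U oL (?s oL rten K h q)"
  by(simp add: vslice2(1)[OF qK w(2,7) pq] rten_natural(1)[OF qK qK w(2) tB pq(2)] oo_assoc)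
  also have "... = adj (rten K h p) oL (U oL ?s) oL rten K h q" by(simp add: oo_assoc)
  also have "... = (adj (rten K h p) oL ?s) oL U oL rten K h q" by(simp add: cU[symmetric] oo_assoc)
  also have "... = t oL vs h p q U"
  by(simp add: vslice2(1)[OF qK w(2,7) pq] rten_natural(2)[OF qK qK w(2) tB pq(1)] oo_assoc)
  finally show ?thesis .
 qed
 thus ?thesis
  using vslice2(2)[OF qK w(2,7) pq] by(simp add: Mhat_def vn_gen_def commutant_def[of _ "commutant _ _"])
qed

end

lemma has_sum_eq: "(f has_sum s) A ==> (!!x. x:A ==> f x = g x) ==> (g has_sum s) A"
 using has_sum_cong[of A f g] by blast

context strict_hilb_cat begin

text \<open>The components along the basis form square summable double families, so the expanded sum
  is absolutely convergent and its order may be exchanged afterwards.\<close>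

lemma parseval_double:
 assumes o: "a:Ob" "b:Ob" and E: "onb (sp b) E"
  and A: "!!n::nat. A n:sp (tn a b)" "(%n. (norm (A n))^2) summable_on UNIV"
  and B: "!!n. B n:sp (tn a b)" "(%n. (norm (B n))^2) summable_on UNIV"
  and S: "((%n. ip (A n) (B n)) has_sum s) UNIV"
 shows "((%(n, e). ip (adj (rten a b e) $$ A n) (adj (rten a b e) $$ B n)) has_sum s) (UNIV \<times> E)"
proof -
 have sq: "(%p. (norm (adj (rten a b (snd p)) $$ C (fst p)))^2) summable_on UNIV \<times> E"
  if "!!n::nat. C n:sp (tn a b)" "(%n. (norm (C n))^2) summable_on UNIV" for C
  by(rule summable_on_SigmaI[where g = "%n. (norm (C n))^2"]) (simp_all add: parseval_norm[OF o E that(1)] that(2))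
 have "(%p. ip (adj (rten a b (snd p)) $$ A (fst p)) (adj (rten a b (snd p)) $$ B (fst p))) summable_on UNIV \<times> E"
  using cinner_summable[OF sq[OF A] sq[OF B], of id_blinfun] by simp
 thus ?thesis
  by(intro has_sum_SigmaI[where g = "%n. ip (A n) (B n)"])
  (auto simp: S case_prod_unfold intro: parseval[OF o E A(1)])
qed

end

section \<open>Construction of the conjugate unitary from its coefficients\<close>

context corep_setting begin

context
 fixes h U assumes h: "h:cobj D" and U: "U:BL (tn K h) (tn K h)" and UU: "U oL adj U = hI (tn K h)"
  and Us: "!!p q. p:sp h ==> q:sp h ==> vs h p q U:MM"
begin

private lemma o: "K:Ob" "h:Ob" "K:Ob" "Bar h:Ob"
 using qK h by simp_all

private lemma Hs: "csub (sp (tn K h))" "csub (sp h)" "csub (sp (Bar h))"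
  "csub (sp (tn K (Bar h)))"
 using hsp htens o by auto

private abbreviation (input) "w \<equiv> %p q. vs h p q U"
private abbreviation (input) "J \<equiv> cJ D h"

text \<open>Slicing \<open>U (adj U) = 1\<close> gives that the products
  \<open>w q' e (adj (w q e))\<close>, summed over \<open>e\<close>, equal \<open>ip q' q\<close>
  times \<open>1\<close>. \<open>R\<close> reverses each product and fixes \<open>1\<close>; it may
  be applied termwise because \<open>y \<mapsto> \<langle>k, R(y) k'\<rangle>\<close> is a normal
  functional.\<close>

private lemma slice_sum:
 assumes E: "onb (sp h) E" and k: "k:sp K" "k':sp K" and q: "q:sp h" "q':sp h"
 shows "((%e. ip (qR D (w q e) $$ k) (qR D (w q' e) $$ k')) has_sum ip k k' * ip q' q) E"
proof -
 have EH: "e:sp h" if "e:E" for e using E that by(auto simp: onb_def)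
 note aU = adj_bop[OF Hs(1) U]
 obtain et xi where r: "normal_rep (sp K) (MM) (%y. ip k (qR D y $$ k')) et xi"
  using normal_R[OF k] by(elim exE)
 note d = normal_repD[OF r]
 define A where "A n = adj U $$ vc K h (et n) q'" for n
 define B where "B n = adj U $$ vc K h (xi n) q" for n
 have uu: "U $$ (adj U $$ z) = z" if "z:sp (tn K h)" for z
  using arg_cong[OF UU, of "%T. T $$ z"] idop_in[OF Hs(1) that] by simp
 have iso: "ip (adj U $$ z) (adj U $$ z') = ip z z'" if "z':sp (tn K h)" for z z'
  using bop_cinner[OF aU, of z "adj U $$ z'"] uu[OF that] by simp
 have nrm: "norm (adj U $$ z) = norm z" if "z:sp (tn K h)" for z
  using iso[OF that, of z] by(metis cinner_self norm_ge_zero of_real_eq_iff power2_eq_imp_eq)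
 have AB: "A n:sp (tn K h)" "B n:sp (tn K h)" for n unfolding A_def B_def by(rule bop_in[OF aU])+
 have sA: "(%n. (norm (A n))^2) summable_on UNIV"
  by(simp add: A_def nrm hvec_in o d(1) q norm_hvec power_mult_distrib summable_on_cmult_left[OF d(3)])
 have sB: "(%n. (norm (B n))^2) summable_on UNIV"
  by(simp add: B_def nrm hvec_in o d(2) q norm_hvec power_mult_distrib summable_on_cmult_left[OF d(4)])
 have S: "((%n. ip (A n) (B n)) has_sum (ip k k' * ip q' q)) UNIV"
  using has_sum_cmult_left[OF d(5)[OF Mhat_closed(3)], of "ip q' q"]
  by(simp add: A_def B_def iso hvec_in o d(1,2) q hvec_cinner R_simps(6) idop_in[OF K_sub] k)
 have wB: "w p e:BL K K" if "p:sp h" "e:sp h" for p e by(rule vslice2(2)[OF o(1,2) U that])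
 have sl: "adj (rten K h e) $$ (adj U $$ vc K h x p) = adj (w p e) $$ x" if "e:sp h" "p:sp h" "x:sp K" for e p x
  using vslice2_linear(6)[OF o(1,2) U that(2,2,1,1)] vslice2(1)[OF o(1,2) aU that(1,2)]
  by(simp add: rten(2)[OF o(1,2) that(2,3)])
 have "((%(n, e). ip (adj (w q' e) $$ et n) (adj (w q e) $$ xi n)) has_sum (ip k k' * ip q' q)) (UNIV \<times> E)"
 proof -
  have "((%(n, e). ip (adj (w q' e) $$ et n) (adj (w q e) $$ xi n)) has_sum (ip k k' * ip q' q)) (UNIV \<times> E)
  \<longleftrightarrow> ((%(n, e). ip (adj (rten K h e) $$ A n) (adj (rten K h e) $$ B n)) has_sum (ip k k' * ip q' q)) (UNIV \<times> E)"
  by(rule has_sum_cong) (auto simp: A_def B_def sl EH d(1,2) q)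
  thus ?thesis using parseval_double[OF o(1,2) E AB(1) sA AB(2) sB S] by blast
 qed
 hence "((%(e, n). ip (adj (w q' e) $$ et n) (adj (w q e) $$ xi n)) has_sum (ip k k' * ip q' q)) (E \<times> UNIV)"
  by(subst (asm) has_sum_swap) (simp add: case_prod_unfold)
 thus ?thesis
 proof (rule has_sum_SigmaD)
  fix e assume e: "e:E"
  note M = Us[OF q(1) EH[OF e]] Us[OF q(2) EH[OF e]]
  have "((%n. ip (et n) ((w q' e oL adj (w q e)) $$ xi n)) has_sum ip k (qR D (w q' e oL adj (w q e)) $$ k')) UNIV"
  by(rule d(5)[OF Mhat_closed(1)[OF M(2) Mhat_closed(2)[OF M(1)]]])
  moreover have "qR D (w q' e oL adj (w q e)) = adj (qR D (w q e)) oL qR D (w q' e)"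
  by(simp add: R_simps(2,3) M Mhat_closed(2))
  ultimately show "((%n. case (e, n) of (e, n) => ip (adj (w q' e) $$ et n) (adj (w q e) $$ xi n)) has_sum
  ip (qR D (w q e) $$ k) (qR D (w q' e) $$ k')) UNIV"
  using bop_cinner[OF Mhat_bop[OF R_simps(1)[OF M(1)]]]
  bop_cinner[OF adj_bop[OF K_sub wB[OF q(2) EH[OF e]]]]
  by simp
 qed
qed

text \<open>\<open>X\<close> sends \<open>k \<otimes> J q\<close> to the sum over the basis of
  \<open>R(w q e) k \<otimes> J e\<close>, the only choice with the required coefficients;
  \<open>slice_sum\<close> gives convergence and preservation of inner products. Only
  \<open>U (adj U) = 1\<close> is assumed, so that the lemma also applies to
  \<open>adj U\<close>.\<close>

lemma conj_isometry:
 "EX X:BL (tn K (Bar h)) (tn K (Bar h)). adj X oL X = hI (tn K (Bar h)) &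
  (ALL p:sp h. ALL q:sp h. vs (Bar h) (J $$ p) (J $$ q) X = qR D (vs h q p U))"
proof -
 obtain E where E: "onb (sp h) E" using onb_exists[OF Hs(2)] by(elim exE)
 have EH: "e:sp h" if "e:E" for e using E that by(auto simp: onb_def)
 have EE: "ip e e' = (if e = e' then 1 else 0)" if "e:E" "e':E" for e e' using E that by(auto simp: onb_def)
 note J = J_facts[OF h]
 define g where "g k q e = qR D (w q e) $$ k" for k q e
 define t where "t k q e = vc K (Bar h) (g k q e) (J $$ e)" for k q e
 define f where "f k z = infsum (t k (adj J $$ z)) E" for k z
 have gK: "g k q e:sp K" if "q:sp h" "e:E" for k q e
  unfolding g_def by(rule bop_in[OF Mhat_bop[OF R_simps(1)[OF Us[OF that(1) EH[OF that(2)]]]]])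
 have tin: "t k q e:sp (tn K (Bar h))" if "q:sp h" "e:E" for k q e
  unfolding t_def by(rule hvec_in[OF o(1,4) gK[OF that] J(8)])
 have ct: "ip (vc K (Bar h) a (J $$ p)) (t k q e) = ip a (g k q e) * ip e p"
  if "a:sp K" "p:sp h" "q:sp h" "e:E" for a p k q e
  using hvec_cinner[OF o(1,4) that(1) gK[OF that(3,4)] J(8) J(8), of p k e] J(7)[OF that(2) EH[OF that(4)]] by(simp add: t_def)
 have ts: "t k q summable_on E" if k: "k:sp K" and q: "q:sp h" for k q
 proof (rule orthogonal_summable(1))
  have "((%e. Re (ip (g k q e) (g k q e))) has_sum Re (ip k k * ip q q)) E"
  unfolding g_def by(rule has_sum_Re[OF slice_sum[OF E k k q q]])
  moreover have "Re (ip (g k q e) (g k q e)) = (norm (t k q e))^2" if "e:E" for e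
  proof -
  have "ip (t k q e) (t k q e) = ip (g k q e) (g k q e)"
  using ct[OF gK[OF q that] EH[OF that] q that] EE[OF that that] by(simp add: t_def)
  hence "Re (ip (g k q e) (g k q e)) = Re (ip (t k q e) (t k q e))" by(simp only:)
  thus ?thesis by(simp only: cinner_self[of "t k q e"] Re_complex_of_real)
  qed
  ultimately show "((%e. (norm (t k q e))^2) has_sum Re (ip k k * ip q q)) E"
  using has_sum_cong[of E "%e. Re (ip (g k q e) (g k q e))" "%e. (norm (t k q e))^2"] by blast
  show "inner (t k q e) (t k q e') = 0" if "e:E" "e':E" "e ~= e'" for e e'
  using ct[OF gK[OF q that(1)] EH[OF that(1)] q that(2)] EE[OF that(2,1)] that(3) by(simp add: t_def inner_eq_Re_cinner)
 qed
 have fs: "(t k (adj J $$ z) has_sum f k z) E" if "k:sp K" for k z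
  unfolding f_def by(rule has_sum_infsum[OF ts[OF that J(9)]])
 have coe: "ip (t a q e) (f k z) = ip (g a q e) (g k (adj J $$ z) e)" if "k:sp K" "q:sp h" "e:E" for a q e k z
 proof -
  have "((%e'. ip (t a q e) (t k (adj J $$ z) e')) has_sum ip (t a q e) (f k z)) E"
  by(rule has_sum_bounded_linear[OF bl_cinner_right fs[OF that(1)]])
  moreover have "((%e'. ip (t a q e) (t k (adj J $$ z) e')) has_sum ip (g a q e) (g k (adj J $$ z) e)) E"
  by(rule has_sum_finite_neutralI[of "{e}"])
  (use that EE in \<open>auto simp: t_def[of a] ct[OF gK EH J(9)]\<close>)
  ultimately show ?thesis by(rule has_sum_unique)
 qed
 have coe2: "ip (vc K (Bar h) a (J $$ e)) (f k z) = ip a (g k (adj J $$ z) e)" if "k:sp K" "a:sp K" "e:E" for a e k z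
 proof -
  have "((%e'. ip (vc K (Bar h) a (J $$ e)) (t k (adj J $$ z) e')) has_sum ip (vc K (Bar h) a (J $$ e)) (f k z)) E"
  by(rule has_sum_bounded_linear[OF bl_cinner_right fs[OF that(1)]])
  moreover have "((%e'. ip (vc K (Bar h) a (J $$ e)) (t k (adj J $$ z) e')) has_sum ip a (g k (adj J $$ z) e)) E"
  by(rule has_sum_finite_neutralI[of "{e}"])
  (use that EE in \<open>auto simp: ct[OF that(2) EH[OF that(3)] J(9)]\<close>)
  ultimately show ?thesis by(rule has_sum_unique)
 qed
 have ff: "ip (f k z) (f k' z') = ip k k' * ip z z'"
  if k: "k:sp K" "k':sp K" and z: "z:sp (Bar h)" "z':sp (Bar h)" for k k' z z'
 proof -
  have "((%e. ip (t k (adj J $$ z) e) (f k' z')) has_sum ip (f k z) (f k' z')) E"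
  by(rule has_sum_bounded_linear[OF bounded_bilinear.bounded_linear_left[OF bb_cinner] fs[OF k(1)]])
  hence "((%e. ip (g k (adj J $$ z) e) (g k' (adj J $$ z') e)) has_sum ip (f k z) (f k' z')) E"
  by(rule has_sum_eq) (rule coe[OF k(2) J(9)])
  from has_sum_unique[OF this slice_sum[OF E k J(9,9), folded g_def]]
  have "ip (f k z) (f k' z') = ip k k' * ip (adj J $$ z') (adj J $$ z)" .
  also have "ip (adj J $$ z') (adj J $$ z) = ip z z'"
  using J(7)[OF J(9) J(9), of z z'] z by(simp add: J(6))
  finally show ?thesis .
 qed
 have sumeq: "norm (SUM i<n. f (xs i) (ys i)) = norm (SUM i<n. vc K (Bar h) (xs i) (ys i))"
  if "!!i. i < n ==> xs i:sp K & ys i:sp (Bar h)" for n :: nat and xs ys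
 proof -
  have "cor ((norm (SUM i<n. f (xs i) (ys i)))^2) = cor ((norm (SUM i<n. vc K (Bar h) (xs i) (ys i)))^2)"
  unfolding norm_sum_square using that by(intro sum.cong) (simp_all add: ff hvec_cinner[OF o(1,4)])
  thus ?thesis using power2_eq_imp_eq[OF _ norm_ge_zero norm_ge_zero] of_real_eq_iff by blast
 qed
 have gsc: "g (c *\<^sub>C k) q e = c *\<^sub>C g k q e" if "q:sp h" "e:E" for c k q e
  unfolding g_def using bop_scaleC[OF Mhat_bop[OF R_simps(1)[OF Us[OF that(1) EH[OF that(2)]]]]] by simp
 have "EX X:bop False (sp (tn K (Bar h))) (sp (tn K (Bar h))). (ALL x:sp K. ALL y:sp (Bar h). X $$ vc K (Bar h) x y = f x y) & norm X <= 1"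
 proof (rule tensor_map_exists[OF o(1,4) Hs(4)])
  fix c x y assume x: "x:sp K" and y: "y:sp (Bar h)"
  have "((%e. c *\<^sub>C t x (adj J $$ y) e) has_sum c *\<^sub>C f x y) E"
  by(rule has_sum_bounded_linear[OF bounded_linear_scaleC_right fs[OF x]])
  moreover have "c *\<^sub>C t x (adj J $$ y) e = t (c *\<^sub>C x) (adj J $$ y) e" if "e:E" for e
  by(simp add: t_def gsc J(9) that hvec_scaleC_left o gK J(8))
  ultimately have "(t (c *\<^sub>C x) (adj J $$ y) has_sum c *\<^sub>C f x y) E"
  using has_sum_cong[of E "%e. c *\<^sub>C t x (adj J $$ y) e" "t (c *\<^sub>C x) (adj J $$ y)"] by blast
  from has_sum_unique[OF fs[OF csubD(7)[OF K_sub x]] this]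
  show "f (c *\<^sub>C x) y = cj False c *\<^sub>C f x y" by simp
  show "f x y:sp (tn K (Bar h))"
  proof -
  have "((%e. proj_on (sp (tn K (Bar h))) (t x (adj J $$ y) e)) has_sum proj_on (sp (tn K (Bar h))) (f x y)) E"
  by(rule has_sum_bounded_linear[OF proj_on_linear[OF Hs(4)] fs[OF x]])
  hence "(t x (adj J $$ y) has_sum proj_on (sp (tn K (Bar h))) (f x y)) E"
  using has_sum_cong[of E "%e. proj_on (sp (tn K (Bar h))) (t x (adj J $$ y) e)"] proj_on_in[OF Hs(4) tin[OF J(9)]] by blast
  from has_sum_unique[OF this fs[OF x]] show ?thesis using proj_on(1)[OF Hs(4), of "f x y"] by simp
  qed
 qed (simp_all add: sumeq)
 then obtain X where X: "X:BL (tn K (Bar h)) (tn K (Bar h))"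
  and Xf: "!!x y. x:sp K ==> y:sp (Bar h) ==> X $$ vc K (Bar h) x y = f x y" by blast
 have "adj X oL X = hI (tn K (Bar h))"
 proof (rule tens_ext_coeff[OF o(1,4) blin_comp[OF X adj_bop[OF Hs(4) X]] idop_bop[OF Hs(4)]])
  fix x y x' y' assume xy: "x:sp K" "y:sp (Bar h)" "x':sp K" "y':sp (Bar h)"
  show "ip (vc K (Bar h) x' y') ((adj X oL X) $$ vc K (Bar h) x y)
  = ip (vc K (Bar h) x' y') (hI (tn K (Bar h)) $$ vc K (Bar h) x y)"
  using bop_cinner[OF X, of "vc K (Bar h) x' y'" "X $$ vc K (Bar h) x y"]
  by(simp add: Xf xy ff hvec_cinner o idop_in[OF Hs(4)] hvec_in)
 qed
 moreover have "vs (Bar h) (J $$ p) (J $$ q) X = qR D (w q p)" if p: "p:sp h" and q: "q:sp h" for p q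
 proof (rule bop_eqI[OF K_sub vslice2(2)[OF o(1,4) X J(8,8)] Mhat_bop[OF R_simps(1)[OF Us[OF q p]]]])
  fix k assume k: "k:sp K"
  have "ip k' (vs (Bar h) (J $$ p) (J $$ q) X $$ k) = ip k' (qR D (w q p) $$ k)" if k': "k':sp K" for k'
  proof -
  \<comment> \<open>The series yields the coefficients against \<open>J e\<close> for basis vectors
    \<open>e\<close>. Both sides are linear and continuous in \<open>p\<close>, \<open>J\<close> and
    the first slot being both antilinear; the projection makes them functions on the whole
    space.\<close>
  let ?P = "proj_on (sp h)"
  note PH = proj_on(1)[OF Hs(2)]
  have P: "bounded_linear ?P" by(rule proj_on_linear[OF Hs(2)])
  have "ip k' (vs (Bar h) (J $$ ?P p) (J $$ q) X $$ k) = ip k' (qR D (w q (?P p)) $$ k)"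
  proof (rule eq_on_closure_span[where z = p and B = "{c *\<^sub>C e |c e. e:E}"
  and f = "%p. ip k' (vs (Bar h) (J $$ ?P p) (J $$ q) X $$ k)" and g = "%p. ip k' (qR D (w q (?P p)) $$ k)"])
  have "bounded_linear (%p. ip (vc K (Bar h) k' (J $$ ?P p)) (f k (J $$ q)))"
  unfolding lten(2)[OF o(1,4) k' J(8), symmetric]
  by(intro bounded_linear_compose[OF bounded_bilinear.bounded_linear_left[OF bb_cinner]]
  bounded_linear_compose[OF bl_right] P)
  thus "bounded_linear (%p. ip k' (vs (Bar h) (J $$ ?P p) (J $$ q) X $$ k))"
  by(simp add: vslice2(3)[OF o(1,4) X J(8,8) k k'] Xf k J(8))
  show "bounded_linear (%p. ip k' (qR D (w q (?P p)) $$ k))"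
  proof (rule bounded_linear_compose[OF bl_cinner_right], rule bounded_linear_intro[where K = "norm q * norm U * norm k"])
  fix x y r
  have a: "?P (x + y) = ?P x + ?P y" "?P (r *\<^sub>R x) = cor r *\<^sub>C ?P x"
  by(simp_all add: linear_add[OF bounded_linear.linear[OF P]] linear_scale[OF bounded_linear.linear[OF P]] scaleC_of_real)
  show "qR D (w q (?P (x + y))) $$ k = qR D (w q (?P x)) $$ k + qR D (w q (?P y)) $$ k"
  by(simp add: a vslice2_linear(1)[OF o(1,2) U q q PH PH] R_simps(4)[OF Us[OF q PH] Us[OF q PH]] blinfun.add_left)
  show "qR D (w q (?P (r *\<^sub>R x))) $$ k = r *\<^sub>R (qR D (w q (?P x)) $$ k)"
  unfolding a vslice2_linear(2)[OF o(1,2) U q q PH PH] R_simps(5)[OF Us[OF q PH]] scl_apply by(rule scaleC_of_real)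
  have "norm (qR D (w q (?P x)) $$ k) <= norm (qR D (w q (?P x))) * norm k" by(rule norm_blinfun)
  also have "... <= (norm q * norm U * norm (?P x)) * norm k"
  by(intro mult_right_mono order_trans[OF R_simps(7)[OF Us[OF q PH]]] vslice2_linear(5)[OF o(1,2) U q q PH PH]) simp
  also have "... <= (norm q * norm U * norm x) * norm k"
  by(intro mult_right_mono mult_left_mono norm_proj_on_le[OF Hs(2)]) simp_all
  finally show "norm (qR D (w q (?P x)) $$ k) <= norm x * (norm q * norm U * norm k)" by(simp add: mult_ac)
  qed
  show "p:closure (span {c *\<^sub>C e |c e. e:E})" using E p by(simp add: onb_def)
  fix x assume "x:{c *\<^sub>C e |c e. e:E}"
  then obtain c e where x: "x = c *\<^sub>C e" and e: "e:E" by blast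
  have xH: "x:sp h" unfolding x by(rule csubD(7)[OF Hs(2) EH[OF e]])
  have "ip k' (vs (Bar h) (J $$ x) (J $$ q) X $$ k) = c * ip k' (g k q e)"
  unfolding vslice2(3)[OF o(1,4) X J(8,8) k k'] x by(simp add: Xf k J(8) bop_scaleC[OF J(1)] hvec_scaleC_right o k' cinner_scaleC_left coe2 e J(5)[OF q])
  moreover have "ip k' (qR D (w q x) $$ k) = c * ip k' (g k q e)"
  by(simp add: x vslice2_linear(2)[OF o(1,2) U q q EH[OF e] EH[OF e]] R_simps(5)[OF Us[OF q EH[OF e]]] scl_apply cinner_scaleC_right g_def)
  ultimately show "ip k' (vs (Bar h) (J $$ ?P x) (J $$ q) X $$ k) = ip k' (qR D (w q (?P x)) $$ k)"
  by(simp add: proj_on_in[OF Hs(2) xH])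
  qed
  thus ?thesis by(simp add: proj_on_in[OF Hs(2) p])
  qed
  note A = this
  let ?d = "vs (Bar h) (J $$ p) (J $$ q) X $$ k - qR D (w q p) $$ k"
  have "?d:sp K" by(rule csubD(6)[OF K_sub bop_in[OF vslice2(2)[OF o(1,4) X J(8,8)]] bop_in[OF Mhat_bop[OF R_simps(1)[OF Us[OF q p]]]]])
  hence "ip ?d ?d = 0" using A[of ?d] by(simp add: cinner_diff_right)
  thus "vs (Bar h) (J $$ p) (J $$ q) X $$ k = qR D (w q p) $$ k" by simp
 qed
 ultimately show ?thesis using X by blast
qed

end

end

context corep_setting begin

lemma slice_adj_Mhat:
 assumes "(h, U):CR" "p:sp h" "q:sp h"
 shows "vs h p q (adj U):MM"
 using Mhat_closed(2)[OF corep_slice_Mhat[OF assms(1,3,2)]]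
  vslice2_linear(6)[OF qK corepD(2,7)[OF assms(1)] assms(3,3,2,2)] by simp

lemma vslice2_cbar_ext:
 assumes h: "h:cobj D" and X: "X:BL (tn K (Bar h)) (tn K (Bar h))" "Y:BL (tn K (Bar h)) (tn K (Bar h))"
  and eq: "!!p q. p:sp h ==> q:sp h ==>
  vs (Bar h) (cJ D h $$ p) (cJ D h $$ q) X = vs (Bar h) (cJ D h $$ p) (cJ D h $$ q) Y"
 shows "X = Y"
proof (rule vslice2_ext[OF qK cbar_hobj[OF h] X])
 fix y y' assume y: "y:sp (Bar h)" "y':sp (Bar h)"
 show "vs (Bar h) y' y X = vs (Bar h) y' y Y"
  using eq[OF J_facts(9)[OF h] J_facts(9)[OF h], of y' y] by(simp add: J_facts(6)[OF h] y)
qed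

text \<open>The isometry built from \<open>adj U\<close> has the adjoint coefficients, hence is the
  adjoint of the one built from \<open>U\<close>; so both composites are identities.\<close>

lemma conj_unitary:
 assumes W: "(h, U):CR"
 shows "EX X. unitary_op False (sp (tn K (Bar h))) (sp (tn K (Bar h))) X &
  (ALL p:sp h. ALL q:sp h. vs (Bar h) (cJ D h $$ p) (cJ D h $$ q) X = qR D (vs h q p U))"
proof -
 note w = corepD[OF W] and J = J_facts[OF corepD(1)[OF W]]
 note o = qK cbar_hobj[OF w(1)]
 note H = hsp[OF htens[OF o]]
 obtain X where X: "X:BL (tn K (Bar h)) (tn K (Bar h))" "adj X oL X = hI (tn K (Bar h))"
  "!!p q. p:sp h ==> q:sp h ==> vs (Bar h) (cJ D h $$ p) (cJ D h $$ q) X = qR D (vs h q p U)"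
  using conj_isometry[OF w(1,7,10) corep_slice_Mhat[OF W]] by blast
 have "adj U oL adj (adj U) = hI (tn K h)" using w(9) by simp
 from conj_isometry[OF w(1,8) this slice_adj_Mhat[OF W]]
 obtain Y where Y: "Y:BL (tn K (Bar h)) (tn K (Bar h))" "adj Y oL Y = hI (tn K (Bar h))"
  "!!p q. p:sp h ==> q:sp h ==> vs (Bar h) (cJ D h $$ p) (cJ D h $$ q) Y = qR D (vs h q p (adj U))" by blast
 have "Y = adj X"
 proof (rule vslice2_cbar_ext[OF w(1) Y(1) adj_bop[OF H X(1)]])
  fix p q assume pq: "p:sp h" "q:sp h"
  show "vs (Bar h) (cJ D h $$ p) (cJ D h $$ q) Y = vs (Bar h) (cJ D h $$ p) (cJ D h $$ q) (adj X)"
  using vslice2_linear(6)[OF o X(1) J(8)[of q] J(8)[of q] J(8)[of p] J(8)[of p]] vslice2_linear(6)[OF qK w(2,7) pq(1,1,2,2)]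
  by(simp add: X(3)[OF pq(2,1)] Y(3)[OF pq] R_simps(3)[OF corep_slice_Mhat[OF W pq], symmetric])
 qed
 thus ?thesis using X Y by(intro exI[of _ X]) (simp add: unitary_op_def)
qed

text \<open>The coefficients of \<open>X\<close> on legs \<open>23\<close> conjugated by
  \<open>V\<close> on legs \<open>12\<close> are those of \<open>\<delta>(R(w q p))\<close>. By
  \<open>delta_R\<close> they become sums over coefficients of \<open>\<delta>(w q p)\<close> with
  exchanged legs, which factor by the equation for \<open>U\<close>. \<open>R\<close> reverses the
  product of coefficients, the flip in \<open>delta_R\<close> reverses it again, and the equation
  for \<open>X\<close> comes out in the right order.\<close>

lemma conj_corep_equation:
 assumes W: "(h, U):CR" and X: "X:BL (tn K (Bar h)) (tn K (Bar h))"
  and Xs: "!!p q. p:sp h ==> q:sp h ==> vs (Bar h) (cJ D h $$ p) (cJ D h $$ q) X = qR D (vs h q p U)"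
 shows "l12 K K (Bar h) (qV D) oL l13 K K (Bar h) X oL l23 K K (Bar h) X
  = l23 K K (Bar h) X oL l12 K K (Bar h) (qV D)"
proof -
 let ?b = "Bar h" and ?J = "cJ D h"
 note w = corepD[OF W] and J = J_facts[OF corepD(1)[OF W]]
 note b = cbar_hobj[OF w(1)]
 note o3 = qK qK w(2) and b3 = qK qK b
 let ?w = "%p q. vs h p q U"
 let ?V = "l12 K K ?b (qV D)" and ?X13 = "l13 K K ?b X" and ?X23 = "l23 K K ?b X"
 note M = corep_slice_Mhat[OF W]
 have Kh: "csub (sp (tn K (tn K h)))" "csub (sp (tn K (tn K ?b)))"
  using hsp[OF htens[OF qK w(3)]] hsp[OF htens[OF qK htens[OF qK b]]] by auto
 have XJ: "ip (vc K ?b a (?J $$ p)) (X $$ vc K ?b c (?J $$ q)) = ip a (qR D (?w q p) $$ c)"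
  if "a:sp K" "c:sp K" "p:sp h" "q:sp h" for a c p q
  using vslice2(3)[OF qK b X J(8) J(8) that(2,1), of p q] Xs[OF that(3,4)] by simp
 have UJ: "ip (vc K h a p) (U $$ vc K h c q) = ip a (?w p q $$ c)"
  if "a:sp K" "c:sp K" "p:sp h" "q:sp h" for a c p q
  using vslice2(3)[OF qK w(2,7) that(3,4,2,1)] by simp
 have VV: "ip (vc K (tn K d) x' (vc K d y' z')) (adj (l12 K K d (qV D)) $$ (l23 K K d Y $$ (l12 K K d (qV D) $$ vc K (tn K d) x (vc K d y z))))
  = ip (qV D $$ vc K K x' y') (qtens D (qid D) (vs d z' z Y) $$ (qV D $$ vc K K x y))"
  if d: "d:Ob" and Y: "Y:BL (tn K d) (tn K d)"
  and x: "x:sp K" "y:sp K" "z:sp d" "x':sp K" "y':sp K" "z':sp d" for d Y x y z x' y' z'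
 proof -
  have "ip (vc K (tn K d) x' (vc K d y' z')) (adj (l12 K K d (qV D)) $$ (l23 K K d Y $$ (l12 K K d (qV D) $$ vc K (tn K d) x (vc K d y z))))
  = ip (vc (tn K K) d (qV D $$ vc K K x' y') z') (l23 K K d Y $$ vc (tn K K) d (qV D $$ vc K K x y) z)"
  using bop_cinner[OF leg12(1)[OF qK qK d V_bop(1)], of "vc K (tn K d) x' (vc K d y' z')"]
  by(simp add: leg12_apply[OF qK qK d V_bop(1)] x)
  also have "... = ip (qV D $$ vc K K x' y') (qtens D (qid D) (vs d z' z Y) $$ (qV D $$ vc K K x y))"
  by(rule leg23_coeff[OF qK qK d Y bop_in[OF V_bop(1)] bop_in[OF V_bop(1)] x(3,6)])
  finally show ?thesis .
 qed
 have VW: "adj (l12 K K h (qV D)) oL l23 K K h U oL l12 K K h (qV D) = l13 K K h U oL l23 K K h U"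
 proof -
  have "adj (l12 K K h (qV D)) oL (l23 K K h U oL l12 K K h (qV D))
  = (adj (l12 K K h (qV D)) oL l12 K K h (qV D)) oL (l13 K K h U oL l23 K K h U)"
  by(simp only: w(5)[symmetric] oo_assoc)
  also have "... = l13 K K h U oL l23 K K h U"
  unfolding adj_leg12[OF o3 V_bop(1)] leg12_comp[OF o3 V_bop(2,1), symmetric] V_bop(3) leg_id(1)[OF o3]
  by(rule idop_comp[OF Kh(1) blin_comp[OF leg23(1)[OF o3 w(7)] leg13(1)[OF o3 w(7)]]])
  finally show ?thesis by(simp only: oo_assoc)
 qed
 have coeff: "ip (vc K (tn K ?b) (c1 $$ p1) (vc K ?b (c2 $$ p2) (?J $$ p))) (?X13 $$ (?X23 $$ vc K (tn K ?b) k1 (vc K ?b k2 (?J $$ q))))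
  = ip (vc K (tn K ?b) (c1 $$ p1) (vc K ?b (c2 $$ p2) (?J $$ p))) (adj ?V $$ (?X23 $$ (?V $$ vc K (tn K ?b) k1 (vc K ?b k2 (?J $$ q)))))"
  if c: "c1:\<A>" "c2:\<A>" and k: "p1:sp K" "p2:sp K" "k1:sp K" "k2:sp K" and pq: "p:sp h" "q:sp h"
  for c1 c2 p1 p2 k1 k2 p q
 proof -
  have cp: "c1 $$ p1:sp K" "c2 $$ p2:sp K" using bop_in[OF alg_bop] c by auto
  from delta_R[OF c k] obtain et1 xi1 et2 xi2 where
  r1: "normal_rep (sp K) (MM) (%y. ip (c1 $$ p1) (qR D y $$ k1)) et1 xi1" and
  r2: "normal_rep (sp K) (MM) (%y. ip (c2 $$ p2) (qR D y $$ k2)) et2 xi2" and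
  dl: "ALL x:MM. ((%q. ip (qV D $$ vc K K (et2 (fst q)) (et1 (snd q)))
  (qtens D (qid D) x $$ (qV D $$ vc K K (xi2 (fst q)) (xi1 (snd q)))))
  has_sum ip (qV D $$ vc K K (c1 $$ p1) (c2 $$ p2)) (qtens D (qid D) (qR D x) $$ (qV D $$ vc K K k1 k2))) (UNIV \<times> UNIV)"
  by(elim exE conjE)
  note d1 = normal_repD[OF r1] and d2 = normal_repD[OF r2]
  \<comment> \<open>\<open>s\<close> is what remains of \<open>X\<close> on legs \<open>23\<close>
    after pairing with \<open>c2 $$ p2\<close>, and \<open>r\<close> is its preimage under
    \<open>J\<close>. Then \<open>ip r e\<close> is the second normal functional at
    \<open>w q e\<close>, for every \<open>e\<close>.\<close>
  define s where "s = adj (lten K ?b (c2 $$ p2)) $$ (X $$ vc K ?b k2 (?J $$ q))"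
  define r where "r = adj ?J $$ s"
  have s: "s:sp ?b" unfolding s_def by(rule bop_in[OF adj_lten(1)[OF qK b cp(2)]])
  have r: "r:sp h" "?J $$ r = s" unfolding r_def using J(9) J(6)[OF s] by auto
  have rr: "ip r e = ip (c2 $$ p2) (qR D (?w q e) $$ k2)" if e: "e:sp h" for e
  proof -
  have "ip r e = ip (?J $$ e) s" using J(7)[OF e r(1)] r(2) by simp
  also have "... = ip (vc K ?b (c2 $$ p2) (?J $$ e)) (X $$ vc K ?b k2 (?J $$ q))"
  unfolding s_def by(rule adj_lten(2)[OF qK b cp(2) J(8)])
  also have "... = ip (c2 $$ p2) (qR D (?w q e) $$ k2)" by(rule XJ[OF cp(2) k(4) e pq(2)])
  finally show ?thesis .
  qed
  define t where "t n = adj (lten K h (et1 n)) $$ (U $$ vc K h (xi1 n) p)" for n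
  have t: "t n:sp h" for n unfolding t_def by(rule bop_in[OF adj_lten(1)[OF qK w(2) d1(1)]])
  have rt: "ip r (t n) = ip (et1 n) (?w r p $$ xi1 n)" for n
  unfolding t_def using adj_lten(2)[OF qK w(2) d1(1) r(1)] UJ[OF d1(1,2) r(1) pq(1)] by simp
  have tm: "ip (qV D $$ vc K K (et2 m) (et1 n)) (qtens D (qid D) (?w q p) $$ (qV D $$ vc K K (xi2 m) (xi1 n)))
  = ip (et2 m) (?w q (t n) $$ xi2 m)" for m n
  proof -
  let ?u = "vc K (tn K h) (xi2 m) (vc K h (xi1 n) p)" and ?v = "vc K (tn K h) (et2 m) (vc K h (et1 n) q)"
  have "ip (qV D $$ vc K K (et2 m) (et1 n)) (qtens D (qid D) (?w q p) $$ (qV D $$ vc K K (xi2 m) (xi1 n)))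
  = ip ?v (adj (l12 K K h (qV D)) $$ (l23 K K h U $$ (l12 K K h (qV D) $$ ?u)))"
  by(rule VV[OF w(2,7) d2(2) d1(2) pq(1) d2(1) d1(1) pq(2), symmetric])
  also have "... = ip ?v (l13 K K h U $$ (l23 K K h U $$ ?u))"
  using arg_cong[OF VW, of "%T. T $$ ?u"] by simp
  also have "l23 K K h U $$ ?u = vc K (tn K h) (xi2 m) (U $$ vc K h (xi1 n) p)"
  by(rule leg23(2)[OF o3 w(7) d2(2) hvec_in[OF qK w(2) d1(2) pq(1)]])
  also have "ip ?v (l13 K K h U $$ ...) = ip (vc K h (et2 m) q) (U $$ vc K h (xi2 m) (t n))"
  unfolding t_def by(rule leg13_coeff[OF o3 w(7) d2(2) d2(1) d1(1) pq(2) bop_in[OF w(7)]])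
  also have "... = ip (et2 m) (?w q (t n) $$ xi2 m)" by(rule UJ[OF d2(1,2) pq(2) t])
  finally show ?thesis .
  qed
  let ?R = "ip (qV D $$ vc K K (c1 $$ p1) (c2 $$ p2)) (qtens D (qid D) (qR D (?w q p)) $$ (qV D $$ vc K K k1 k2))"
  have "((%(m, n). ip (et2 m) (?w q (t n) $$ xi2 m)) has_sum ?R) (UNIV \<times> UNIV)"
  using bspec[OF dl M[OF pq(2,1)]] by(simp add: case_prod_unfold tm)
  \<comment> \<open>With this order the inner sum is the second functional at
    \<open>w q (t n)\<close>, that is \<open>ip r (t n)\<close>; the outer sum is then the first
    functional at \<open>w r p\<close>.\<close>
  hence "((%(n, m). ip (et2 m) (?w q (t n) $$ xi2 m)) has_sum ?R) (UNIV \<times> UNIV)"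
  by(subst (asm) has_sum_swap) (simp add: case_prod_unfold)
  hence "((%n. ip r (t n)) has_sum ?R) UNIV"
  proof (rule has_sum_SigmaD)
  fix n
  show "((%m. case (n, m) of (n, m) => ip (et2 m) (?w q (t n) $$ xi2 m)) has_sum ip r (t n)) UNIV"
  unfolding rr[OF t] prod.case by(rule d2(5)[OF M[OF pq(2) t]])
  qed
  hence "?R = ip (c1 $$ p1) (qR D (?w r p) $$ k1)"
  unfolding rt using d1(5)[OF M[OF r(1) pq(1)]] by(rule has_sum_unique)
  also have "... = ip (vc K ?b (c1 $$ p1) (?J $$ p)) (X $$ vc K ?b k1 s)"
  using XJ[OF cp(1) k(3) pq(1) r(1)] r(2) by simp
  also have "... = ip (vc K (tn K ?b) (c1 $$ p1) (vc K ?b (c2 $$ p2) (?J $$ p))) (?X13 $$ vc K (tn K ?b) k1 (X $$ vc K ?b k2 (?J $$ q)))"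
  unfolding s_def by(rule leg13_coeff[OF b3 X k(3) cp(1) cp(2) J(8) bop_in[OF X], symmetric])
  also have "vc K (tn K ?b) k1 (X $$ vc K ?b k2 (?J $$ q)) = ?X23 $$ vc K (tn K ?b) k1 (vc K ?b k2 (?J $$ q))"
  by(rule leg23(2)[OF b3 X k(3) hvec_in[OF qK b k(4) J(8)], symmetric])
  finally show ?thesis unfolding VV[OF b X k(3,4) J(8) cp J(8)] Xs[OF pq] by simp
 qed
 note X13 = leg13(1)[OF b3 X] and X23 = leg23(1)[OF b3 X] and V12 = leg12(1)[OF b3 V_bop(1)]
 note aV12 = adj_bop[OF Kh(2) V12]
 have eq: "?X13 oL ?X23 = adj ?V oL ?X23 oL ?V"
 proof (rule tens_ext3[OF b3 zorth_bop[OF blin_comp[OF X23 X13]] zorth_bop[OF blin_comp[OF V12 blin_comp[OF X23 aV12]]]])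
  fix k1 k2 z assume k: "k1:sp K" "k2:sp K" "z:sp ?b"
  let ?u = "vc K (tn K ?b) k1 (vc K ?b k2 z)"
  define d where "d = ?X13 $$ (?X23 $$ ?u) - adj ?V $$ (?X23 $$ (?V $$ ?u))"
  have d: "d:sp (tn K (tn K ?b))" unfolding d_def
  by(rule csubD(6)[OF Kh(2) bop_in[OF X13] bop_in[OF aV12]])
  have "d = 0"
  proof (rule tens_total3[OF b3 d csubD(4)[OF Kh(2)]])
  fix x y v assume x: "x:sp K" "y:sp K" "v:sp ?b"
  note KKb = htens[OF qK qK] b
  have "adj (rten (tn K K) ?b v) $$ d = 0"
  proof (rule alg2_nondeg[OF bop_in[OF adj_rten(1)[OF KKb x(3)]]])
  fix a b' p1 p2 assume a: "a:\<A>" "b':\<A>" "p1:sp K" "p2:sp K"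
  have ab: "a $$ p1:sp K" "b' $$ p2:sp K" using bop_in[OF alg_bop] a by auto
  have "ip (vc K K (a $$ p1) (b' $$ p2)) (adj (rten (tn K K) ?b v) $$ d) = ip (vc (tn K K) ?b (vc K K (a $$ p1) (b' $$ p2)) v) d"
  by(rule adj_rten(2)[OF KKb x(3) hvec_in[OF qK qK ab]])
  also have "... = ip (vc K (tn K ?b) (a $$ p1) (vc K ?b (b' $$ p2) v)) d"
  by(simp add: hvec_assoc[OF b3 ab x(3)])
  also have "... = 0"
  using coeff[OF a(1,2,3,4) k(1,2) J(9)[of v] J(9)[of z]] J(6)[OF x(3)] J(6)[OF k(3)] by(simp add: d_def cinner_diff_right)
  finally show "ip (vc K K (a $$ p1) (b' $$ p2)) (adj (rten (tn K K) ?b v) $$ d) = 0" .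
  qed
  hence "ip (vc K K x y) (adj (rten (tn K K) ?b v) $$ d) = 0" by simp
  thus "ip (vc K (tn K ?b) x (vc K ?b y v)) d = ip (vc K (tn K ?b) x (vc K ?b y v)) 0"
  using adj_rten(2)[OF KKb x(3) hvec_in[OF qK qK x(1,2)]] by(simp add: hvec_assoc[OF b3 x])
  qed
  thus "(?X13 oL ?X23) $$ ?u = (adj ?V oL ?X23 oL ?V) $$ ?u" by(simp add: d_def)
 qed
 have "?V oL (?X13 oL ?X23) = (?V oL adj ?V) oL (?X23 oL ?V)" unfolding eq by(simp only: oo_assoc)
 also have "?V oL adj ?V = hI (tn K (tn K ?b))"
  by(simp only: adj_leg12[OF b3 V_bop(1)] leg12_comp[OF b3 V_bop(1,2), symmetric] V_bop(4) leg_id(1)[OF b3])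
 also have "hI (tn K (tn K ?b)) oL (?X23 oL ?V) = ?X23 oL ?V" by(rule idop_comp[OF Kh(2) blin_comp[OF V12 X23]])
 finally show ?thesis by(simp only: oo_assoc)
qed

text \<open>The conjugate pinned down by its coefficients. \<open>conj_corep\<close> below
  identifies it with the one prescribed through the maximal algebra.\<close>

definition bar_of where
 "bar_of W = (THE X. fst X = Bar (fst W) & X:CR &
  (ALL p:sp (fst W). ALL q:sp (fst W). vs (Bar (fst W)) (cJ D (fst W) $$ p) (cJ D (fst W) $$ q) (snd X)
  = qR D (vs (fst W) q p (snd W))))"

lemma bar_of:
 assumes W: "(h, U):CR"
 shows "fst (bar_of (h, U)) = Bar h" "bar_of (h, U):CR"
  "[|p:sp h; q:sp h|] ==> vs (Bar h) (cJ D h $$ p) (cJ D h $$ q) (snd (bar_of (h, U))) = qR D (vs h q p U)"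
  "[|X:CR; fst X = Bar h; !!p q. [|p:sp h; q:sp h|] ==>
  vs (Bar h) (cJ D h $$ p) (cJ D h $$ q) (snd X) = qR D (vs h q p U)|] ==> X = bar_of (h, U)"
proof -
 let ?P = "%X. fst X = Bar h & X:CR & (ALL p:sp h. ALL q:sp h. vs (Bar h) (cJ D h $$ p) (cJ D h $$ q) (snd X)
  = qR D (vs h q p U))"
 note h = corepD(1)[OF W]
 obtain Z where Z: "unitary_op False (sp (tn K (Bar h))) (sp (tn K (Bar h))) Z"
  "!!p q. p:sp h ==> q:sp h ==> vs (Bar h) (cJ D h $$ p) (cJ D h $$ q) Z = qR D (vs h q p U)"
  using conj_unitary[OF W] by blast
 have XB: "Z:BL (tn K (Bar h)) (tn K (Bar h))" using Z(1) by(simp add: unitary_op_def)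
 have P: "?P (Bar h, Z)"
  using Z conj_corep_equation[OF W XB Z(2)] cbar[OF h] by(simp add: coreps_def)
 have u: "X = Y" if "?P X" "?P Y" for X Y
 proof (rule prod_eqI)
  show "fst X = fst Y" using that by simp
  have B: "snd X:BL (tn K (Bar h)) (tn K (Bar h))" "snd Y:BL (tn K (Bar h)) (tn K (Bar h))"
  using corepD(7)[of "Bar h" "snd X"] corepD(7)[of "Bar h" "snd Y"] that by(metis prod.collapse)+
  show "snd X = snd Y" by(rule vslice2_cbar_ext[OF h B]) (use that in simp)
 qed
 have "?P (bar_of (h, U))" unfolding bar_of_def fst_conv snd_conv by(rule theI[of ?P, OF P u[OF _ P]])
 thus "fst (bar_of (h, U)) = Bar h" "bar_of (h, U):CR"
  "[|p:sp h; q:sp h|] ==> vs (Bar h) (cJ D h $$ p) (cJ D h $$ q) (snd (bar_of (h, U))) = qR D (vs h q p U)"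
  "[|X:CR; fst X = Bar h; !!p q. [|p:sp h; q:sp h|] ==>
  vs (Bar h) (cJ D h $$ p) (cJ D h $$ q) (snd X) = qR D (vs h q p U)|] ==> X = bar_of (h, U)"
  using u[of X "bar_of (h, U)"] by blast+
qed

end

lemma norm_idop_le: "csub H ==> norm (idop H) <= 1"
 by(rule norm_blinfun_bound) (simp_all add: idop_apply norm_proj_on_le)

lemma unitary_norm_le:
 assumes "csub H" "csub H'" "unitary_op b H H' U"
 shows "norm U <= 1"
proof -
 have "(norm U)^2 <= 1" using norm_adj_comp[of U] unitary_opD(3)[OF assms] norm_idop_le[OF assms(1)] by simp
 thus ?thesis by(simp add: power_le_one_iff abs_square_le_1)
qed

lemma norm_conj_le:
 assumes "csub H" "csub H'" "unitary_op b H H' U"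
 shows "norm (adj U oL X oL U) <= norm X"
proof -
 note n = unitary_norm_le[OF assms]
 have "norm (adj U oL X oL U) <= norm (adj U oL X) * norm U" by(rule norm_blinfun_compose)
 also have "... <= (norm (adj U) * norm X) * norm U" by(intro mult_right_mono norm_blinfun_compose norm_ge_zero)
 also have "... <= (1 * norm X) * 1" using n by(intro mult_mono) auto
 finally show ?thesis by simp
qed

lemma has_sum_norm_bound:
 fixes f :: "'i => 'a::real_normed_vector"
 assumes f: "(f has_sum s) A" and g: "(g has_sum t) A" and le: "!!x. norm (f x) <= g x"
 shows "norm s <= t"
proof (rule tendsto_le[OF finite_subsets_at_top_neq_bot g[unfolded has_sum_def] tendsto_norm[OF f[unfolded has_sum_def]]])
 show "\<forall>\<^sub>F F in finite_subsets_at_top A. norm (sum f F) <= sum g F"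
  by(intro eventually_finite_subsets_at_top_weakI order_trans[OF norm_sum] sum_mono le)
qed

lemma normal_rep_linear:
 assumes r: "normal_rep H M om et xi" and H: "csub H" and M: "M <= blin H H"
 shows "[|x:M; y:M; x + y:M|] ==> om (x + y) = om x + om y" "[|x:M; scl c x:M|] ==> om (scl c x) = c * om x"
  "EX C>=0. ALL x:M. cmod (om x) <= C * norm x"
proof -
 note d = normal_repD[OF r]
 show "om (x + y) = om x + om y" if "x:M" "y:M" "x + y:M"
 proof (rule has_sum_unique[OF d(5)[OF that(3)]])
  show "((%n. ip (et n) ((x + y) $$ xi n)) has_sum om x + om y) UNIV"
  using has_sum_add[OF d(5)[OF that(1)] d(5)[OF that(2)]] by(simp add: blinfun.add_left cinner_add_right)
 qed
 show "om (scl c x) = c * om x" if "x:M" "scl c x:M"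
 proof (rule has_sum_unique[OF d(5)[OF that(2)]])
  show "((%n. ip (et n) (scl c x $$ xi n)) has_sum c * om x) UNIV"
  using has_sum_cmult_right[OF d(5)[OF that(1)], of c] by(simp add: scl_apply cinner_scaleC_right)
 qed
 define C where "C = infsum (%n. (norm (et n))^2 + (norm (xi n))^2) UNIV"
 have s: "((%n. (norm (et n))^2 + (norm (xi n))^2) has_sum C) UNIV"
  unfolding C_def by(rule has_sum_infsum[OF summable_on_add[OF d(3,4)]])
 have "cmod (om x) <= C * norm x" if x: "x:M" for x
 proof (rule has_sum_norm_bound)
  show "((%n. ip (et n) (x $$ xi n)) has_sum om x) UNIV" by(rule d(5)[OF x])
  show "((%n. norm x * ((norm (et n))^2 + (norm (xi n))^2)) has_sum C * norm x) UNIV"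
  using has_sum_cmult_right[OF s, of "norm x"] by(simp add: mult.commute)
 qed (rule norm_cinner_sq_bound)
 moreover have "0 <= C" unfolding C_def by(rule infsum_nonneg) simp
 ultimately show "EX C>=0. ALL x:M. cmod (om x) <= C * norm x" by blast
qed

section \<open>The maximal C*-algebra and its antiautomorphism R'\<close>

context corep_setting begin

lemma corep_cases:
 assumes "W:CR"
 obtains h U where "W = (h, U)" "(h, U):CR"
 using assms by(cases W) blast

text \<open>The bound \<open>C\<close> depends on the functional alone: a corepresentation is
  unitary, so its slices at \<open>p\<close> and \<open>q\<close> have norm at most
  \<open>norm p * norm q\<close>. This puts the family of all slices among the bounded
  families.\<close>

lemma pi_slice:
 assumes om: "normal_fun (sp K) (MM) om"
 shows "EX C>=0. ALL h U. (h, U):CR --> slice1 D K h om U:BL h h & norm (slice1 D K h om U) <= C &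
  (ALL p:sp h. ALL q:sp h. ip p (slice1 D K h om U $$ q) = om (vs h p q U))"
proof -
 obtain et xi where r: "normal_rep (sp K) (MM) om et xi" using normal_fun_rep[OF om] by(elim exE)
 have sub: "MM <= BL K K" using Mhat_bop by blast
 note l = normal_rep_linear[OF r K_sub sub]
 obtain C where C: "0 <= C" "ALL x:MM. cmod (om x) <= C * norm x" using l(3) by blast
 have "slice1 D K h om U:BL h h & norm (slice1 D K h om U) <= C &
  (ALL p:sp h. ALL q:sp h. ip p (slice1 D K h om U $$ q) = om (vs h p q U))" if W: "(h, U):CR" for h U
 proof -
  note w = corepD[OF W]
  note H = hsp[OF w(2)]
  note M = corep_slice_Mhat[OF W] and v = vslice2_linear[OF qK w(2,7)]
  have "EX T:BL h h. (ALL xi:sp h. ALL et:sp h. ip et (T $$ xi) = om (vs h et xi U)) & norm T <= C"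
  proof (rule bounded_form_op[OF H H C(1)])
  fix p p' q assume x: "p:sp h" "p':sp h" "q:sp h"
  show "om (vs h (p + p') q U) = om (vs h p q U) + om (vs h p' q U)"
  using l(1)[OF M[OF x(1,3)] M[OF x(2,3)] Mhat_closed(4)[OF M[OF x(1,3)] M[OF x(2,3)]]] v(3)[OF x(1,2,3,3)] by simp
  show "om (vs h q (p + p') U) = om (vs h q p U) + om (vs h q p' U)"
  using l(1)[OF M[OF x(3,1)] M[OF x(3,2)] Mhat_closed(4)[OF M[OF x(3,1)] M[OF x(3,2)]]] v(1)[OF x(3,3,1,2)] by simp
  next
  fix c p q assume x: "p:sp h" "q:sp h"
  show "om (vs h (c *\<^sub>C p) q U) = cnj c * om (vs h p q U)"
  using l(2)[OF M[OF x] Mhat_closed(5)[OF M[OF x]]] v(4)[OF x(1,1,2,2)] by simp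
  show "om (vs h p (c *\<^sub>C q) U) = cj False c * om (vs h p q U)"
  using l(2)[OF M[OF x] Mhat_closed(5)[OF M[OF x]]] v(2)[OF x(1,1,2,2)] by simp
  next
  fix p q assume x: "p:sp h" "q:sp h"
  have "cmod (om (vs h p q U)) <= C * norm (vs h p q U)" using C(2) M[OF x] by blast
  also have "... <= C * (norm p * 1 * norm q)"
  by(intro mult_left_mono C(1) order_trans[OF v(5)[OF x(1,1,2,2)]] mult_right_mono unitary_norm_le[OF w(6,6,4)] norm_ge_zero)
  finally show "cmod (om (vs h p q U)) <= C * norm p * norm q" by(simp add: mult_ac)
  qed
  then obtain T where T: "T:BL h h" "ALL xi:sp h. ALL et:sp h. ip et (T $$ xi) = om (vs h et xi U)" "norm T <= C"
  by blast
  have "slice1 D K h om U = T" unfolding slice1_def by(rule form_op_eqI[OF H T(1)]) (use T(2) in blast)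
  thus ?thesis using T by simp
 qed
 thus ?thesis using C(1) by blast
qed

lemma pi_family:
 assumes "normal_fun (sp K) (MM) om"
 shows "pi_family D om:BF"
  "[|(h, U):CR; p:sp h; q:sp h|] ==> ip p (pi_family D om (h, U) $$ q) = om (vs h p q U)"
 using pi_slice[OF assms] unfolding bounded_families_def pi_family_def by(auto simp: fst_def snd_def split: prod.splits)

lemma bounded_familiesD:
 assumes "A:BF"
 shows "(h, U):CR ==> A (h, U):BL h h" "W ~: CR ==> A W = 0"
  "EX c. ALL W:CR. norm (A W) <= c"
 using assms unfolding bounded_families_def by(auto simp del: split_paired_All split_paired_Ex)

lemma corep_space: "(h, U):CR ==> csub (sp h)"
 by(rule hsp[OF corepD(2)])

lemma bounded_familiesI:
 assumes "!!h U. (h, U):CR ==> A (h, U):BL h h" "!!W. W ~: CR ==> A W = 0"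
  "!!W. W:CR ==> norm (A W) <= c"
 shows "A:BF"
 using assms by(force simp: bounded_families_def)

lemma cstar_bounded_families: "cstar_families D (BF)"
proof -
 have "(%W. A W + B W):BF & (%W. A W oL B W):BF"
  if AB: "A:BF" "B:BF" for A B
 proof -
  note a = bounded_familiesD[OF AB(1)] and b = bounded_familiesD[OF AB(2)]
  obtain c where c: "!!W. W:CR ==> norm (A W) <= c" using a(3) by blast
  obtain d where d: "!!W. W:CR ==> norm (B W) <= d" using b(3) by blast
  have "(%W. A W + B W):BF"
  by(rule bounded_familiesI[where c = "c + d"]) (auto intro!: bop_add[OF corep_space] a b norm_triangle_mono c d simp: a(2) b(2))
  moreover have "(%W. A W oL B W):BF"
  proof (rule bounded_familiesI[where c = "c * d"])
  show "norm (A W oL B W) <= c * d" if "W:CR" for W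
  using order_trans[OF norm_blinfun_compose mult_mono[OF c[OF that] d[OF that]]] c[OF that] norm_ge_zero[of "A W"] by force
  qed (auto intro!: blin_comp a b simp: a(2) b(2))
  ultimately show ?thesis by blast
 qed
 moreover have "(%W. adj (A W)):BF & (ALL c. (%W. scl c (A W)):BF)"
  if A: "A:BF" for A
 proof -
  note a = bounded_familiesD[OF A]
  obtain d where d: "!!W. W:CR ==> norm (A W) <= d" using a(3) by blast
  have "(%W. scl c (A W)):BF" for c
  by(rule bounded_familiesI[where c = "cmod c * d"])
  (auto intro!: bop_scl[OF corep_space] a mult_left_mono d simp: a(2) norm_scl blinfun_eqI scl_apply)
  moreover have "(%W. adj (A W)):BF"
  by(rule bounded_familiesI[where c = d]) (auto intro: adj_bop[OF corep_space] a d simp: a(2))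
  ultimately show ?thesis by blast
 qed
 moreover have "(%W. 0):BF"
  by(rule bounded_familiesI[where c = 0]) (auto intro: bop_zero[OF corep_space])
 ultimately show ?thesis unfolding cstar_families_def by blast
qed

lemma cstar_familiesD:
 assumes "cstar_families D S"
 shows "S <= BF" "(%W. 0):S" "A:S ==> B:S ==> (%W. A W + B W):S"
  "A:S ==> B:S ==> (%W. A W oL B W):S" "A:S ==> (%W. adj (A W)):S"
  "A:S ==> (%W. scl c (A W)):S"
  "[|A:BF; ALL e>0. EX B:S. ALL W:CR. norm (A W - B W) <= e|] ==> A:S"
 using assms unfolding cstar_families_def by blast+

lemma cstar_familiesI:
 assumes "S <= BF" "(%W. 0):S" "!!A B. A:S ==> B:S ==> (%W. A W + B W):S"
  "!!A B. A:S ==> B:S ==> (%W. A W oL B W):S" "!!A. A:S ==> (%W. adj (A W)):S"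
  "!!A c. A:S ==> (%W. scl c (A W)):S"
  "!!A. [|A:BF; ALL e>0. EX B:S. ALL W:CR. norm (A W - B W) <= e|] ==> A:S"
 shows "cstar_families D S"
 unfolding cstar_families_def by(intro conjI ballI allI impI; (rule assms; assumption))

lemma cstar_Amax: "cstar_families D (Amax D)"
proof -
 define F where "F = {S. cstar_families D S & (ALL om. normal_fun (sp K) (MM) om --> pi_family D om:S)}"
 have B: "BF:F" using cstar_bounded_families pi_family(1) by(simp add: F_def)
 have c: "cstar_families D S" if "S:F" for S using that by(simp add: F_def)
 have "cstar_families D (\<Inter>F)"
  unfolding cstar_families_def[of D "\<Inter>F"]
 proof (intro conjI ballI allI impI InterI)
  show "\<Inter>F <= BF" using B by blast
 next
  fix A S assume A: "A:BF" "ALL e>0. EX B:\<Inter>F. ALL W:CR. norm (A W - B W) <= e" "S:F"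
  have "EX B:S. ALL W:CR. norm (A W - B W) <= e" if "e > 0" for e
  using bexE[OF A(2)[rule_format, OF that]] InterD[OF _ A(3)] by metis
  thus "A:S" by(intro cstar_familiesD(7)[OF c[OF A(3)] A(1)]) simp
 qed (auto intro: cstar_familiesD(2-6)[OF c])
 thus ?thesis by(simp add: Amax_def F_def)
qed

lemma Amax:
 shows "A:Amax D ==> A:BF" "A:Amax D ==> B:Amax D ==> (%W. A W + B W):Amax D"
  "A:Amax D ==> B:Amax D ==> (%W. A W oL B W):Amax D" "A:Amax D ==> (%W. adj (A W)):Amax D"
  "A:Amax D ==> (%W. scl c (A W)):Amax D" "(%W. 0):Amax D"
  "[|A:BF; !!e. e > 0 ==> EX B:Amax D. ALL W:CR. norm (A W - B W) <= e|] ==> A:Amax D"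
 using cstar_Amax unfolding cstar_families_def by blast+

lemma pi_family_Amax: "normal_fun (sp K) (MM) om ==> pi_family D om:Amax D"
 by(simp add: Amax_def)

lemma Amax_induct:
 assumes A: "A:Amax D" and S: "cstar_families D {A:Amax D. P A}"
  and P: "!!om. normal_fun (sp K) (MM) om ==> P (pi_family D om)"
 shows "P A"
proof -
 have "A:{A:Amax D. P A}"
  by(rule InterD[OF A[unfolded Amax_def[of D]]]) (simp add: S P pi_family_Amax)
 thus ?thesis by simp
qed

text \<open>The explicit form of \<open>R'\<close>. On the family of \<open>\<omega>\<close> the
  slice of the conjugate at \<open>\<omega>\<close> is the adjoint of the slice of \<open>W\<close>
  at \<open>\<omega> \<circ> R\<close>, transported by \<open>J\<close>; solving for the latter
  gives this formula.\<close>

definition Rfam where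
 "Rfam A W = (if W:CR then adj (cJ D (fst W)) oL adj (A (bar_of W)) oL cJ D (fst W) else 0)"

lemma bar_fam:
 assumes "A:BF" "(h, U):CR"
 shows "A (bar_of (h, U)):BL (Bar h) (Bar h)" "adj (A (bar_of (h, U))):BL (Bar h) (Bar h)"
proof -
 note b = bar_of[OF assms(2)]
 show B: "A (bar_of (h, U)):BL (Bar h) (Bar h)"
  using bounded_familiesD(1)[OF assms(1), of "fst (bar_of (h, U))" "snd (bar_of (h, U))"] b(1,2) by(metis prod.collapse)
 show "adj (A (bar_of (h, U))):BL (Bar h) (Bar h)"
  by(rule adj_bop[OF hsp[OF cbar_hobj[OF corepD(1)[OF assms(2)]]] B])
qed

lemma J_conj_bop:
 assumes "h:cobj D" "B:BL (Bar h) (Bar h)"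
 shows "adj (cJ D h) oL B oL cJ D h:BL h h"
 using bop_comp[OF J_facts(1)[OF assms(1)] bop_comp[OF assms(2) J_facts(2)[OF assms(1)]]] by simp

lemma norm_Rfam_le: "W:CR ==> norm (Rfam A W) <= norm (A (bar_of W))"
 unfolding Rfam_def
 by(erule corep_cases) (simp add: order_trans[OF norm_conj_le[OF corep_space hsp[OF cbar_hobj[OF corepD(1)]] cJ[OF corepD(1)]]])

lemma Rfam_alg:
 assumes A: "A:BF" and B: "B:BF"
 shows "Rfam A:BF" "Rfam (%W. A W + B W) = (%W. Rfam A W + Rfam B W)"
  "Rfam (%W. A W oL B W) = (%W. Rfam B W oL Rfam A W)" "Rfam (%W. adj (A W)) = (%W. adj (Rfam A W))"
  "Rfam (%W. scl c (A W)) = (%W. scl c (Rfam A W))"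
proof -
 have bar_in: "W:CR ==> bar_of W:CR" for W by(erule corep_cases) (simp add: bar_of)
 obtain m where m: "!!W. W:CR ==> norm (A W) <= m" using bounded_familiesD(3)[OF A] by blast
 show "Rfam A:BF"
 proof (rule bounded_familiesI[where c = m])
  show "Rfam A (h, U):BL h h" if "(h, U):CR" for h U
  using J_conj_bop[OF corepD(1)[OF that] bar_fam(2)[OF A that]] that by(simp add: Rfam_def)
  show "norm (Rfam A W) <= m" if "W:CR" for W
  by(rule order_trans[OF norm_Rfam_le[OF that, of A] m[OF bar_in[OF that]]])
 qed (simp add: Rfam_def)
 show "Rfam (%W. A W + B W) = (%W. Rfam A W + Rfam B W)"
  by(rule ext) (simp add: Rfam_def adj_add blinfun_compose_add_left blinfun_compose_add_right)
 show "Rfam (%W. adj (A W)) = (%W. adj (Rfam A W))"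
  by(rule ext) (simp add: Rfam_def adj_comp oo_assoc)
 show "Rfam (%W. A W oL B W) = (%W. Rfam B W oL Rfam A W)"
 proof
  fix W show "Rfam (%W. A W oL B W) W = Rfam B W oL Rfam A W"
  proof (cases "W:CR")
  case True
  then obtain h U where W: "W = (h, U)" "(h, U):CR" by(rule corep_cases)
  note h = corepD(1)[OF W(2)]
  let ?a = "adj (A (bar_of (h, U)))" and ?b = "adj (B (bar_of (h, U)))" and ?J = "cJ D h"
  have "(adj ?J oL ?b oL ?J) oL (adj ?J oL ?a oL ?J) = adj ?J oL ?b oL ((?J oL adj ?J) oL ?a) oL ?J"
  by(simp only: oo_assoc)
  also have "(?J oL adj ?J) oL ?a = ?a"
  unfolding J_facts(4)[OF h] by(rule idop_comp[OF hsp[OF cbar_hobj[OF h]] bar_fam(2)[OF A W(2)]])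
  finally show ?thesis using W by(simp add: Rfam_def adj_comp oo_assoc)
  qed (simp add: Rfam_def)
 qed
 show "Rfam (%W. scl c (A W)) = (%W. scl c (Rfam A W))"
 proof
  fix W show "Rfam (%W. scl c (A W)) W = scl c (Rfam A W)"
  proof (cases "W:CR")
  case True
  then obtain h U where W: "W = (h, U)" "(h, U):CR" by(rule corep_cases)
  note H = hsp[OF cbar_hobj[OF corepD(1)[OF W(2)]]]
  show ?thesis using W adj_scl[OF H H bar_fam(1)[OF A W(2)], of c] scl_comp_right[OF J_facts(2)[OF corepD(1)[OF W(2)]]]
  by(simp add: Rfam_def scl_comp_left)
  qed (simp add: Rfam_def blinfun_eqI scl_apply)
 qed
qed

lemma Rfam_Amax_alg:
 shows "A:Amax D ==> Rfam A:BF"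
  "A:Amax D ==> B:Amax D ==> Rfam (%W. A W + B W) = (%W. Rfam A W + Rfam B W)"
  "A:Amax D ==> B:Amax D ==> Rfam (%W. A W oL B W) = (%W. Rfam B W oL Rfam A W)"
  "A:Amax D ==> Rfam (%W. adj (A W)) = (%W. adj (Rfam A W))"
  "A:Amax D ==> Rfam (%W. scl c (A W)) = (%W. scl c (Rfam A W))"
 by(rule Rfam_alg; rule Amax(1); assumption)+

lemma Rfam_pi:
 assumes om: "normal_fun (sp K) (MM) om"
 shows "Rfam (pi_family D om) = pi_family D (om \<circ> qR D)"
proof
 fix W show "Rfam (pi_family D om) W = pi_family D (om \<circ> qR D) W"
 proof (cases "W:CR")
  case True
  then obtain h U where W: "W = (h, U)" "(h, U):CR" by(rule corep_cases)
  let ?J = "cJ D h" and ?P = "pi_family D om (bar_of (h, U))"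
  note J = J_facts[OF corepD(1)[OF W(2)]] and b = bar_of[OF W(2)]
  note P = bar_fam[OF pi_family(1)[OF om] W(2)] and R = R_normal[OF om]
  note B = J_conj_bop[OF corepD(1)[OF W(2)] P(2)] bounded_familiesD(1)[OF pi_family(1)[OF R] W(2)]
  have "adj ?J oL adj ?P oL ?J = pi_family D (om \<circ> qR D) (h, U)"
  proof (rule bop_eqI[OF corep_space[OF W(2)] B])
  fix q assume q: "q:sp h"
  have e: "ip p ((adj ?J oL adj ?P oL ?J) $$ q) = ip p (pi_family D (om \<circ> qR D) (h, U) $$ q)" if p: "p:sp h" for p
  proof -
  have "ip p ((adj ?J oL adj ?P oL ?J) $$ q) = cnj (ip (?J $$ p) (adj ?P $$ (?J $$ q)))"
  using bop_cinner[OF J(1), of p "adj ?P $$ (?J $$ q)"] by simp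
  also have "... = ip (?J $$ q) (?P $$ (?J $$ p))"
  using bop_cinner[OF P(1), of "?J $$ p" "?J $$ q"] cinner_commute[of "?J $$ q" "?P $$ (?J $$ p)"] by simp
  also have "... = om (vs (Bar h) (?J $$ q) (?J $$ p) (snd (bar_of (h, U))))"
  using pi_family(2)[OF om, of "Bar h" "snd (bar_of (h, U))" "?J $$ q" "?J $$ p"] b(1,2) J(8) by(metis prod.collapse)
  also have "... = ip p (pi_family D (om \<circ> qR D) (h, U) $$ q)"
  unfolding b(3)[OF q p] pi_family(2)[OF R W(2) p q] by simp
  finally show ?thesis .
  qed
  let ?d = "(adj ?J oL adj ?P oL ?J) $$ q - pi_family D (om \<circ> qR D) (h, U) $$ q"
  have "?d:sp h" by(rule csubD(6)[OF corep_space[OF W(2)] bop_in[OF B(1)] bop_in[OF B(2)]])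
  hence "ip ?d ?d = 0" unfolding cinner_diff_right using e by simp
  thus "(adj ?J oL adj ?P oL ?J) $$ q = pi_family D (om \<circ> qR D) (h, U) $$ q" by simp
  qed
  thus ?thesis using W by(simp add: Rfam_def)
 qed (simp add: Rfam_def pi_family_def)
qed

lemma Rfam_diff_le:
 assumes "W:CR"
 shows "norm (Rfam A W - Rfam B W) <= norm (A (bar_of W) - B (bar_of W))"
proof -
 have "Rfam A W - Rfam B W = Rfam (%W. A W - B W) W"
  by(simp add: Rfam_def adj_diff blinfun_compose_diff_left blinfun_compose_diff_right)
 thus ?thesis using norm_Rfam_le[OF assms, of "%W. A W - B W"] by simp
qed

lemma bar_in: "W:CR ==> bar_of W:CR"
 by(erule corep_cases) (simp add: bar_of)

lemma Rfam_Amax: "A:Amax D ==> Rfam A:Amax D"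
proof (erule Amax_induct)
 let ?S = "{A:Amax D. Rfam A:Amax D}"
 have lim: "A:?S" if A: "A:BF" "ALL e>0. EX B:?S. ALL W:CR. norm (A W - B W) <= e" for A
 proof -
  have "A:Amax D" using A by(intro Amax(7)) auto
  moreover have "Rfam A:Amax D"
  proof (rule Amax(7)[OF Rfam_alg(1)[OF A(1,1)]])
  fix e :: real assume "0 < e"
  then obtain B where B: "B:?S" "ALL W:CR. norm (A W - B W) <= e" using A(2) by blast
  have "norm (Rfam A W - Rfam B W) <= e" if "W:CR" for W
  using order_trans[OF Rfam_diff_le[OF that, of A B] B(2)[rule_format, OF bar_in[OF that]]] .
  thus "EX B:Amax D. ALL W:CR. norm (Rfam A W - B W) <= e" using B(1) by blast
  qed
  ultimately show ?thesis by simp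
 qed
 have "Rfam (%W. 0) = (%W. 0)" by(rule ext) (simp add: Rfam_def)
 thus "cstar_families D ?S"
  using Amax(1) lim by(intro cstar_familiesI) (simp_all add: Amax(2-6) Rfam_Amax_alg subset_iff)
qed (use Rfam_pi R_normal pi_family_Amax in metis)

text \<open>\<open>Rfam\<close> satisfies every clause of the description of \<open>Rmax\<close>.
  Another solution agrees with it on the generators, and the set of agreement is a C*-algebra of
  families, closed because both maps are bounded for the uniform norm.\<close>

lemma Rmax_eq:
 assumes "A:Amax D"
 shows "Rmax D A = Rfam A"
proof -
 let ?P = "%Ph. Ph:Amax D \<rightarrow>\<^sub>E Amax D &
  (ALL A:Amax D. ALL B:Amax D. Ph (%W. A W + B W) = (%W. Ph A W + Ph B W) &
  Ph (%W. A W oL B W) = (%W. Ph B W oL Ph A W)) &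
  (ALL A:Amax D. Ph (%W. adj (A W)) = (%W. adj (Ph A W)) &
  (ALL c. Ph (%W. scl c (A W)) = (%W. scl c (Ph A W)))) &
  (EX K. ALL A:Amax D. ALL c. (ALL W:CR. norm (A W) <= c) --> (ALL W:CR. norm (Ph A W) <= K * c)) &
  (ALL om. normal_fun (sp K) (MM) om --> Ph (pi_family D om) = pi_family D (om \<circ> qR D))"
 define Ps where "Ps = restrict Rfam (Amax D)"
 have Ps: "Ps A = Rfam A" if "A:Amax D" for A using that by(simp add: Ps_def)
 have "norm (Rfam A W) <= 1 * c" if "ALL W:CR. norm (A W) <= c" "W:CR" for A c W
  using order_trans[OF norm_Rfam_le[OF that(2), of A]] that(1) bar_in[OF that(2)] by simp
 hence bd: "EX K. ALL A:Amax D. ALL c. (ALL W:CR. norm (A W) <= c) --> (ALL W:CR. norm (Ps A W) <= K * c)"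
  using Ps by(intro exI[of _ 1]) simp
 have P: "?P Ps"
  using bd by(simp add: Ps Amax(2-6) Rfam_Amax_alg Rfam_pi pi_family_Amax) (simp add: Ps_def Rfam_Amax)
 have "Ph = Ps" if Ph: "?P Ph" for Ph
 proof (rule PiE_ext)
  show "Ph:Amax D \<rightarrow>\<^sub>E Amax D" "Ps:Amax D \<rightarrow>\<^sub>E Amax D" by(rule conjunct1[OF Ph], rule conjunct1[OF P])
  fix A assume A: "A:Amax D"
  obtain k where k: "!!A c W. [|A:Amax D; ALL W:CR. norm (A W) <= c; W:CR|] ==> norm (Ph A W) <= k * c"
  using Ph by blast
  have add: "Ph (%W. A W + B W) = (%W. Ph A W + Ph B W)" "Ph (%W. A W oL B W) = (%W. Ph B W oL Ph A W)"
  "Ph (%W. adj (A W)) = (%W. adj (Ph A W))" "Ph (%W. scl c (A W)) = (%W. scl c (Ph A W))"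
  "Ph A:Amax D" if "A:Amax D" "B:Amax D" for A B c
  using Ph that by blast+
  have pi: "Ph (pi_family D om) = pi_family D (om \<circ> qR D)" if "normal_fun (sp K) (MM) om" for om using Ph that by blast
  let ?S = "{A:Amax D. Ph A = Rfam A}"
  have lim: "A:?S" if A: "A:BF" "ALL e>0. EX B:?S. ALL W:CR. norm (A W - B W) <= e" for A
  proof -
  have AA: "A:Amax D" using A by(intro Amax(7)) auto
  have "Ph A W = Rfam A W" for W
  proof (cases "W:CR")
  case True
  have "norm (Ph A W - Rfam A W) <= e * (\<bar>k\<bar> + 1)" if e: "e > 0" for e
  proof -
  obtain B where B: "B:Amax D" "Ph B = Rfam B" "ALL W:CR. norm (A W - B W) <= e" using A(2) e by blast
  let ?C = "%W. A W + scl (-1) (B W)"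
  have C: "ALL W:CR. norm (?C W) <= e" using B(3) by(simp add: scl_minus_one)
  have "Ph ?C W = Ph A W - Rfam B W"
  using add(1)[OF AA Amax(5)[OF B(1), of "-1"]] add(4)[OF B(1) B(1), of "-1"] B(2) by(simp add: scl_minus_one)
  hence "norm (Ph A W - Rfam B W) <= k * e" using k[OF Amax(2)[OF AA Amax(5)[OF B(1)]] C True] by simp
  moreover have "norm (Rfam A W - Rfam B W) <= e"
  using order_trans[OF Rfam_diff_le[OF True, of A B] B(3)[rule_format, OF bar_in[OF True]]] .
  moreover have "norm (Ph A W - Rfam A W) <= norm (Ph A W - Rfam B W) + norm (Rfam A W - Rfam B W)"
  using norm_triangle_ineq4[of "Ph A W - Rfam B W" "Rfam A W - Rfam B W"] by simp
  moreover have "k * e <= \<bar>k\<bar> * e" using e by(intro mult_right_mono) auto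
  ultimately show ?thesis by(simp add: algebra_simps)
  qed
  note le = this
  have m: "0 < \<bar>k\<bar> + 1" by linarith
  have "norm (Ph A W - Rfam A W) <= d" if "d > 0" for d
  using le[OF divide_pos_pos[OF that m]] nonzero_divide_mult_cancel_right[of "\<bar>k\<bar> + 1" d] m
  by(metis less_irrefl nonzero_eq_divide_eq)
  hence "norm (Ph A W - Rfam A W) <= 0 + d" if "d > 0" for d using that by(simp only: add_0)
  hence "norm (Ph A W - Rfam A W) <= 0" by(rule field_le_epsilon)
  thus ?thesis by simp
  next
  case False
  thus ?thesis using bounded_familiesD(2)[OF Amax(1)[OF add(5)[OF AA AA]]] by(simp add: Rfam_def)
  qed
  thus ?thesis using AA by blast
  qed
  have z: "scl 0 T = 0" for T :: "'h oper" by(rule blinfun_eqI) (simp add: scl_apply)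
  have "Ph (%W. 0) = Rfam (%W. 0)"
  using add(4)[OF Amax(6) Amax(6), of 0] unfolding z by(simp add: Rfam_def fun_eq_iff del: split_paired_All)
  hence "cstar_families D ?S"
  using lim Amax(1) by(intro cstar_familiesI) (simp_all add: Amax(2-6) add(1,2) add(3,4)[OF _ Amax(6)] Rfam_Amax_alg subset_iff)
  from Amax_induct[OF A this] show "Ph A = Ps A" by(simp add: pi Rfam_pi Ps A)
 qed
 hence "Rmax D = Ps" unfolding Rmax_def by(rule the_equality[of ?P, OF P])
 thus ?thesis by(simp add: Ps assms)
qed

text \<open>Existence is \<open>Rfam\<close> read backwards with \<open>J\<close> cancelled. For
  uniqueness, vector functionals have their families in the maximal algebra, and on them equality of
  representations is equality of all coefficients.\<close>

lemma conj_corep: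
 assumes "W:CR"
 shows "is_conj_corep D W W' \<longleftrightarrow> W' = bar_of W"
proof -
 obtain h U where W: "W = (h, U)" "(h, U):CR" using assms by(rule corep_cases)
 note J = J_facts[OF corepD(1)[OF W(2)]] and b = bar_of[OF W(2)] and H = hsp[OF cbar_hobj[OF corepD(1)[OF W(2)]]]
 have jm: "cJ D h oL jmax D A (h, U) oL adj (cJ D h) = A (bar_of (h, U))" if A: "A:Amax D" for A
 proof -
  note B = bar_fam(1)[OF Amax(1)[OF A] W(2)]
  have "jmax D A (h, U) = adj (cJ D h) oL A (bar_of (h, U)) oL cJ D h"
  using W(2) by(simp add: jmax_def Rmax_eq[OF Amax(4)[OF A]] Rfam_def)
  hence "cJ D h oL jmax D A (h, U) oL adj (cJ D h)
  = (cJ D h oL adj (cJ D h)) oL A (bar_of (h, U)) oL (cJ D h oL adj (cJ D h))"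
  by(simp only: oo_assoc)
  thus ?thesis by(simp add: J(4) idop_comp[OF H B] comp_idop[OF H B])
 qed
 have "W' = bar_of (h, U)" if W': "W':CR" "fst W' = Bar h" "ALL A:Amax D. A W' = A (bar_of (h, U))"
 proof (rule b(4)[OF W'(1,2)])
  fix p q assume pq: "p:sp h" "q:sp h"
  obtain U' where U': "W' = (Bar h, U')" using W'(2) by(cases W') auto
  obtain V' where V': "bar_of (h, U) = (Bar h, V')" using b(1) by(cases "bar_of (h, U)") auto
  note cU = W'(1)[unfolded U'] and cV = b(2)[unfolded V']
  let ?x = "vs (Bar h) (cJ D h $$ p) (cJ D h $$ q)"
  note S = vslice2(2)[OF qK corepD(2,7)[OF cU] J(8) J(8)] vslice2(2)[OF qK corepD(2,7)[OF cV] J(8) J(8)]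
  have "?x U' = ?x V'"
  proof (rule bop_eqI[OF K_sub S])
  fix k assume k: "k:sp K"
  have e: "ip a (?x U' $$ k) = ip a (?x V' $$ k)" if "a:sp K" for a
  proof -
  note n = normal_fun_vector[OF that k csubD(4)[OF K_sub]]
  show ?thesis
  using pi_family(2)[OF n cU J(8) J(8), of p q] pi_family(2)[OF n cV J(8) J(8), of p q]
  bspec[OF W'(3) pi_family_Amax[OF n], unfolded U' V'] by simp
  qed
  let ?d = "?x U' $$ k - ?x V' $$ k"
  have "?d:sp K" by(rule csubD(6)[OF K_sub bop_in[OF S(1)] bop_in[OF S(2)]])
  hence "ip ?d ?d = 0" unfolding cinner_diff_right using e by simp
  thus "?x U' $$ k = ?x V' $$ k" by simp
  qed
  thus "?x (snd W') = qR D (vs h q p U)"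
  using b(3)[OF pq] U' V' by simp
 qed
 thus ?thesis using b(1,2) jm unfolding is_conj_corep_def W(1) pi_rep_def by fastforce
qed

end

section \<open>Leg notation on four tensor factors\<close>

context strict_hilb_cat begin

context
 fixes a b c d assumes o: "a:Ob" "b:Ob" "c:Ob" "d:Ob"
begin

private lemma o2': "tn b c:Ob" "tn c d:Ob" "tn a b:Ob" "tn a c:Ob" "tn a d:Ob"
 "tn (tn b c) d:Ob"
 using htens o by auto

lemma leg12_leg12:
 assumes X: "X:BL (tn a b) (tn a b)"
 shows "l12 a (tn b c) d (l12 a b c X) = l12 a b (tn c d) X"
 unfolding leg12_def optens_id[OF o(3,4), symmetric]
 using optens_assoc[OF o2'(3) o(3,4) o2'(3) o(3,4) X hid_bop[OF o(3)] hid_bop[OF o(4)]] by(simp add: htens_assoc o)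

lemma leg12_leg23:
 assumes X: "X:BL (tn b c) (tn b c)"
 shows "l12 a (tn b c) d (l23 a b c X) = l23 a b (tn c d) (l12 b c d X)"
 unfolding leg12_def leg23_def
 using optens_assoc[OF o(1) o2'(1) o(4) o(1) o2'(1) o(4) hid_bop[OF o(1)] X hid_bop[OF o(4)]] by(simp add: htens_assoc o)

private lemma ins_tens:
 assumes y: "y:sp b" "z:sp d" and u: "u:sp (tn a c)"
 shows "ins a b (tn c d) y $$ vc (tn a c) d u z = vc (tn a (tn b c)) d (ins a b c y $$ u) z"
proof -
 have "ins a b (tn c d) y $$ (rten (tn a c) d z $$ u) = rten (tn a (tn b c)) d z $$ (ins a b c y $$ u)"
 proof (rule eq_on_tensor[OF o(1,3) _ _ _ u])
  show "bounded_linear (%u. ins a b (tn c d) y $$ (rten (tn a c) d z $$ u))"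
  "bounded_linear (%u. rten (tn a (tn b c)) d z $$ (ins a b c y $$ u))"
  by(intro bounded_linear_compose[OF bl_right] bl_right)+
  fix x v assume xv: "x:sp a" "v:sp c"
  show "ins a b (tn c d) y $$ (rten (tn a c) d z $$ vc a c x v) = rten (tn a (tn b c)) d z $$ (ins a b c y $$ vc a c x v)"
  by(simp add: rten(2) o o2' htens hvec_in y xv hvec_assoc ins_apply htens_assoc)
 qed
 thus ?thesis by(simp add: rten(2) o o2' htens y u bop_in[OF ins_bop[OF o(1-3) y(1)]])
qed

lemma leg12_leg13:
 assumes X: "X:BL (tn a c) (tn a c)"
 shows "l12 a (tn b c) d (l13 a b c X) = l13 a b (tn c d) (l12 a c d X)"
proof -
 note X13 = leg13(1)[OF o(1-3) X] and X12 = leg12[OF o(1,3,4) X]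
 have s: "tn a (tn b (tn c d)) = tn a (tn (tn b c) d)" by(simp add: htens_assoc o)
 show ?thesis
 proof (rule tens_ext[OF o(1) o2'(6) zorth_bop[OF leg12(1)[OF o(1) o2'(1) o(4) X13]]])
  show "zorth (sp (tn a (tn (tn b c) d))) (l13 a b (tn c d) (l12 a c d X))"
  using zorth_bop[OF leg13(1)[OF o(1,2) o2'(2) X12(1)]] unfolding s .
  fix x v assume x: "x:sp a" and v: "v:sp (tn (tn b c) d)"
  let ?P = "l12 a (tn b c) d (l13 a b c X)" and ?Q = "l13 a b (tn c d) (l12 a c d X)"
  have "lten a (tn (tn b c) d) x:BL (tn (tn b c) d) (tn a (tn (tn b c) d))" by(rule lten(1)[OF o(1) o2'(6) x])
  have v': "v:sp (tn b (tn c d))" using v by(simp add: htens_assoc o)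
  have "?P oL lten a (tn (tn b c) d) x = ?Q oL lten a (tn (tn b c) d) x"
  proof (rule tens_ext3[OF o(2-4)])
  show "zorth (sp (tn b (tn c d))) (?P oL lten a (tn (tn b c) d) x)" "zorth (sp (tn b (tn c d))) (?Q oL lten a (tn (tn b c) d) x)"
  using lten(1)[OF o(1) o2'(6) x] by(auto intro!: zorth_oo intro: zorth_bop simp: htens_assoc o)
  fix y z w assume y: "y:sp b" "z:sp c" "w:sp d"
  have "?P $$ vc a (tn (tn b c) d) x (vc (tn b c) d (vc b c y z) w) = vc (tn a (tn b c)) d (ins a b c y $$ (X $$ vc a c x z)) w"
  by(simp add: leg12_apply[OF o(1) o2'(1) o(4) X13] x y hvec_in o leg13(3)[OF o(1-3) X])
  moreover have "?Q $$ vc a (tn b (tn c d)) x (vc b (tn c d) y (vc c d z w)) = vc (tn a (tn b c)) d (ins a b c y $$ (X $$ vc a c x z)) w"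
  by(simp add: leg13(3)[OF o(1,2) o2'(2) X12(1)] x y hvec_in o leg12_apply[OF o(1,3,4) X] ins_tens bop_in[OF X])
  ultimately show "(?P oL lten a (tn (tn b c) d) x) $$ vc b (tn c d) y (vc c d z w) = (?Q oL lten a (tn (tn b c) d) x) $$ vc b (tn c d) y (vc c d z w)"
  by(simp add: lten(2) o o2' htens_assoc x y hvec_in htens hvec_assoc)
  qed
  from arg_cong[OF this, of "%T. T $$ v"]
  show "?P $$ vc a (tn (tn b c) d) x v = ?Q $$ vc a (tn (tn b c) d) x v"
  by(simp add: lten(2)[OF o(1) o2'(6) x v])
 qed
qed

private lemma ins_ins:
 assumes y: "y:sp b" "z:sp c" and u: "u:sp (tn a d)"
 shows "ins a b (tn c d) y $$ (ins a c d z $$ u) = ins a (tn b c) d (vc b c y z) $$ u"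
 by(rule eq_on_tensor[OF o(1,4) _ _ _ u])
  (auto intro!: bounded_linear_compose[OF bl_right] bl_right
  simp: ins_apply o o2' y hvec_in hvec_assoc htens_assoc)

lemma leg13_leg13:
 assumes X: "X:BL (tn a d) (tn a d)"
 shows "l13 a b (tn c d) (l13 a c d X) = l13 a (tn b c) d X"
proof -
 note X13 = leg13[OF o(1,3,4) X] and X13' = leg13[OF o(1) o2'(1) o(4) X]
 let ?P = "l13 a b (tn c d) (l13 a c d X)" and ?Q = "l13 a (tn b c) d X"
 have s: "tn a (tn (tn b c) d) = tn a (tn b (tn c d))" by(simp add: htens_assoc o)
 show ?thesis
 proof (rule tens_ext[OF o(1) htens[OF o(2) o2'(2)] zorth_bop[OF leg13(1)[OF o(1,2) o2'(2) X13(1)]]])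
  show "zorth (sp (tn a (tn b (tn c d)))) ?Q" using zorth_bop[OF X13'(1)] unfolding s .
  fix x v assume x: "x:sp a" and v: "v:sp (tn b (tn c d))"
  note L = lten[OF o(1) htens[OF o(2) o2'(2)] x]
  have "?P oL lten a (tn b (tn c d)) x = ?Q oL lten a (tn b (tn c d)) x"
  proof (rule tens_ext3[OF o(2-4) zorth_oo[OF zorth_bop[OF L(1)]] zorth_oo[OF zorth_bop[OF L(1)]]])
  fix y z w assume y: "y:sp b" "z:sp c" "w:sp d"
  have "?P $$ vc a (tn b (tn c d)) x (vc b (tn c d) y (vc c d z w)) = ins a (tn b c) d (vc b c y z) $$ (X $$ vc a d x w)"
  by(simp add: leg13(3)[OF o(1,2) o2'(2) X13(1)] x y hvec_in o X13(3) ins_ins bop_in[OF X])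
  also have "... = ?Q $$ vc a (tn (tn b c) d) x (vc (tn b c) d (vc b c y z) w)"
  by(simp add: X13'(3) x y hvec_in o)
  finally show "(?P oL lten a (tn b (tn c d)) x) $$ vc b (tn c d) y (vc c d z w) = (?Q oL lten a (tn b (tn c d)) x) $$ vc b (tn c d) y (vc c d z w)"
  by(simp add: L(2) y hvec_in o o2' hvec_assoc htens_assoc)
  qed
  from arg_cong[OF this, of "%T. T $$ v"]
  show "?P $$ vc a (tn b (tn c d)) x v = ?Q $$ vc a (tn b (tn c d)) x v" by(simp add: L(2)[OF v])
 qed
qed

text \<open>The operators act on disjoint legs, \<open>X\<close> on the first and fourth,
  \<open>Y\<close> on the second and third.\<close>

lemma leg13_leg12_commute:
 assumes X: "X:BL (tn a d) (tn a d)" and Y: "Y:BL (tn b c) (tn b c)"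
 shows "l13 a (tn b c) d X oL l23 a (tn b c) d (l12 b c d Y)
  = l23 a (tn b c) d (l12 b c d Y) oL l13 a (tn b c) d X"
proof -
 note X13 = leg13[OF o(1) o2'(1) o(4) X] and Y12 = leg12[OF o(2-4) Y]
 have Y12': "l12 b c d Y:BL (tn (tn b c) d) (tn (tn b c) d)" using Y12(1) by(simp add: htens_assoc o)
 note Y23 = leg23[OF o(1) o2'(1) o(4) Y12']
 have e: "l23 a (tn b c) d (l12 b c d Y) $$ (ins a (tn b c) d u $$ v) = ins a (tn b c) d (Y $$ u) $$ v"
  if u: "u:sp (tn b c)" and v: "v:sp (tn a d)" for u v
  by(rule eq_on_tensor[OF o(1,4) _ _ _ v])
  (auto intro!: bounded_linear_compose[OF bl_right] bl_right
  simp: ins_apply o o2' u bop_in[OF Y] Y23(2) hvec_in Y12(2))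
 show ?thesis
 proof (rule tens_ext3[OF o(1) o2'(1) o(4) zorth_oo[OF zorth_bop[OF Y23(1)]] zorth_oo[OF zorth_bop[OF X13(1)]]])
  fix x u z assume "x:sp a" "u:sp (tn b c)" "z:sp d"
  thus "(l13 a (tn b c) d X oL l23 a (tn b c) d (l12 b c d Y)) $$ vc a (tn (tn b c) d) x (vc (tn b c) d u z)
  = (l23 a (tn b c) d (l12 b c d Y) oL l13 a (tn b c) d X) $$ vc a (tn (tn b c) d) x (vc (tn b c) d u z)"
  by(simp add: X13(3) Y23(2) Y12(2) hvec_in o o2' bop_in[OF Y] e bop_in[OF X])
 qed
qed

text \<open>The operators \<open>I z\<close> insert \<open>z\<close> as an inert third leg. They
  intertwine each factor on three legs with its counterpart on four, and their ranges together are
  total.\<close>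

lemma pentagon_ins:
 assumes V: "V:BL (tn a b) (tn a b)" and X: "X:BL (tn a d) (tn a d)" and X': "X':BL (tn b d) (tn b d)"
  and eq: "l12 a b d V oL l13 a b d X oL l23 a b d X' = l23 a b d X' oL l12 a b d V"
 shows "l12 a b (tn c d) V oL l13 a b (tn c d) (l13 a c d X) oL l23 a b (tn c d) (l13 b c d X')
  = l23 a b (tn c d) (l13 b c d X') oL l12 a b (tn c d) V"
proof -
 note abd = o(1,2,4) and abcd = o(1,2) o2'(2)
 note X1 = leg13[OF o(1,3,4) X] and X2 = leg13[OF o(2,3,4) X']
 note A = leg12[OF abcd V] and B = leg13[OF abcd X1(1)] and C = leg23[OF abcd X2(1)]
 note A' = leg12[OF abd V] and B' = leg13[OF abd X] and C' = leg23[OF abd X']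
 define I where "I z = ot (tn a b) d (tn a b) (tn c d) (hI (tn a b)) (lten c d z)" for z
 have s: "tn (tn a b) d = tn a (tn b d)" "tn (tn a b) (tn c d) = tn a (tn b (tn c d))" by(simp_all add: htens_assoc o o2')
 have I: "I z:BL (tn a (tn b d)) (tn a (tn b (tn c d)))"
  "[|u:sp (tn a b); w:sp d|] ==> I z $$ vc (tn a b) d u w = vc (tn a b) (tn c d) u (vc c d z w)" if z: "z:sp c" for z u w
  unfolding I_def s[symmetric]
  using optensI(1,2)[OF o2'(3) o(4) o2'(3) o2'(2) hid_bop[OF o2'(3)] lten(1)[OF o(3,4) z]]
  by(auto simp: hid_apply o2'(3) lten(2)[OF o(3,4) z])
 have I3: "I z $$ vc a (tn b d) x (vc b d y w) = vc a (tn b (tn c d)) x (vc b (tn c d) y (vc c d z w))"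
  if "x:sp a" "y:sp b" "z:sp c" "w:sp d" for x y z w
  using I(2)[OF that(3) hvec_in[OF o(1,2) that(1,2)] that(4)] that by(simp add: hvec_assoc o o2' hvec_in)
 have Iins: "I z $$ (ins a b d y $$ v) = ins a b (tn c d) y $$ (ins a c d z $$ v)"
  if y: "y:sp b" "z:sp c" and v: "v:sp (tn a d)" for y z v
  by(rule eq_on_tensor[OF o(1,4) _ _ _ v])
  (auto intro!: bounded_linear_compose[OF bl_right] bl_right
  simp: ins_apply o o2' y hvec_in I3)
 have Il: "I z $$ (lten a (tn b d) x $$ v) = lten a (tn b (tn c d)) x $$ (ins b c d z $$ v)"
  if x: "x:sp a" "z:sp c" and v: "v:sp (tn b d)" for x z v
  by(rule eq_on_tensor[OF o(2,4) _ _ _ v])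
  (auto intro!: bounded_linear_compose[OF bl_right] bl_right
  simp: ins_apply o o2' x hvec_in I3 lten(2) htens)
 have cA: "l12 a b (tn c d) V oL I z = I z oL l12 a b d V" if z: "z:sp c" for z
 proof (rule tens_ext3[OF abd zorth_oo[OF zorth_bop[OF I(1)[OF z]]] zorth_oo[OF zorth_bop[OF A'(1)]]])
  fix x y w assume "x:sp a" "y:sp b" "w:sp d"
  thus "(l12 a b (tn c d) V oL I z) $$ vc a (tn b d) x (vc b d y w) = (I z oL l12 a b d V) $$ vc a (tn b d) x (vc b d y w)"
  using z by(simp add: I3 leg12_apply[OF abd V] leg12_apply[OF abcd V] hvec_in o I(2) bop_in[OF V])
 qed
 have cB: "l13 a b (tn c d) (l13 a c d X) oL I z = I z oL l13 a b d X" if z: "z:sp c" for z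
 proof (rule tens_ext3[OF abd zorth_oo[OF zorth_bop[OF I(1)[OF z]]] zorth_oo[OF zorth_bop[OF B'(1)]]])
  fix x y w assume "x:sp a" "y:sp b" "w:sp d"
  thus "(l13 a b (tn c d) (l13 a c d X) oL I z) $$ vc a (tn b d) x (vc b d y w) = (I z oL l13 a b d X) $$ vc a (tn b d) x (vc b d y w)"
  using z by(simp add: I3 B(3) B'(3) X1(3) hvec_in o Iins bop_in[OF X])
 qed
 have cC: "l23 a b (tn c d) (l13 b c d X') oL I z = I z oL l23 a b d X'" if z: "z:sp c" for z
 proof (rule tens_ext3[OF abd zorth_oo[OF zorth_bop[OF I(1)[OF z]]] zorth_oo[OF zorth_bop[OF C'(1)]]])
  fix x y w assume x: "x:sp a" "y:sp b" "w:sp d"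
  have "I z $$ vc a (tn b d) x (X' $$ vc b d y w) = vc a (tn b (tn c d)) x (ins b c d z $$ (X' $$ vc b d y w))"
  using Il[OF x(1) z bop_in[OF X']] by(simp add: lten(2) o o2' htens x bop_in[OF X'] bop_in[OF ins_bop[OF o(2-4) z]])
  thus "(l23 a b (tn c d) (l13 b c d X') oL I z) $$ vc a (tn b d) x (vc b d y w) = (I z oL l23 a b d X') $$ vc a (tn b d) x (vc b d y w)"
  using x z by(simp add: I3 C(2) C'(2) X2(3) hvec_in o o2')
 qed
 let ?L = "l12 a b (tn c d) V oL l13 a b (tn c d) (l13 a c d X) oL l23 a b (tn c d) (l13 b c d X')"
 let ?R = "l23 a b (tn c d) (l13 b c d X') oL l12 a b (tn c d) V"
 have LR: "?L oL I z = ?R oL I z" if z: "z:sp c" for z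
 proof -
  have "?L oL I z = I z oL (l12 a b d V oL l13 a b d X oL l23 a b d X')"
  by(metis oo_assoc cA[OF z] cB[OF z] cC[OF z])
  also have "... = ?R oL I z"
  unfolding eq by(metis oo_assoc cA[OF z] cC[OF z])
  finally show ?thesis .
 qed
 show ?thesis
 proof (rule tens_ext[OF o2'(3) o2'(2)])
  show "zorth (sp (tn (tn a b) (tn c d))) ?L" "zorth (sp (tn (tn a b) (tn c d))) ?R"
  unfolding s by(rule zorth_oo[OF zorth_bop[OF C(1)]] zorth_oo[OF zorth_bop[OF A(1)]])+
  fix u v assume u: "u:sp (tn a b)" and v: "v:sp (tn c d)"
  have "?L $$ (lten (tn a b) (tn c d) u $$ v) = ?R $$ (lten (tn a b) (tn c d) u $$ v)"
  proof (rule eq_on_tensor[OF o(3,4) _ _ _ v])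
  fix z w assume zw: "z:sp c" "w:sp d"
  have "lten (tn a b) (tn c d) u $$ vc c d z w = I z $$ vc (tn a b) d u w"
  by(simp add: lten(2) o o2' u zw hvec_in I(2))
  thus "?L $$ (lten (tn a b) (tn c d) u $$ vc c d z w) = ?R $$ (lten (tn a b) (tn c d) u $$ vc c d z w)"
  using arg_cong[OF LR[OF zw(1)], of "%T. T $$ vc (tn a b) d u w"] by simp
  qed (intro bounded_linear_compose[OF bl_right] bl_right)+
  thus "?L $$ vc (tn a b) (tn c d) u v = ?R $$ vc (tn a b) (tn c d) u v" by(simp add: lten(2) o2' u v)
 qed
qed

end

lemma leg13_unit:
 assumes o: "a:Ob" "c:Ob" and X: "X:BL (tn a c) (tn a c)"
 shows "l13 a (hunit D) c X = X"
proof -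
 have one: "hone D:sp (hunit D)" unfolding hunit(2) using scaleC_one[of "hone D"] by(metis rangeI)
 note ou = o(1) hunit(1) o(2)
 have i: "ins a (hunit D) c (hone D) $$ u = u" if u: "u:sp (tn a c)" for u
  by(rule eq_on_tensor[OF o _ _ _ u]) (auto intro: bl_right bounded_linear_ident simp: ins_apply ou one hvec_unit htens_unit)
 show ?thesis
 proof (rule tens_ext[OF o])
  show "zorth (sp (tn a c)) (l13 a (hunit D) c X)"
  using zorth_bop[OF leg13(1)[OF ou X]] by(simp add: htens_unit o)
  fix x z assume xz: "x:sp a" "z:sp c"
  show "l13 a (hunit D) c X $$ vc a c x z = X $$ vc a c x z"
  using leg13(3)[OF ou X xz(1) one xz(2)] by(simp add: hvec_unit htens_unit o xz i bop_in[OF X])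
 qed (rule zorth_bop[OF X])
qed

end

lemma unitary_comp:
 assumes H: "csub H" "csub H'" "csub H''"
  and U: "unitary_op b H H' U" and V: "unitary_op b' H' H'' V"
 shows "unitary_op (b ~= b') H H'' (V oL U)"
proof -
 note u = unitary_opD[OF H(1,2) U] and v = unitary_opD[OF H(2,3) V]
 have "(adj U oL adj V) oL (V oL U) = adj U oL ((adj V oL V) oL U)" by(simp only: oo_assoc)
 moreover have "(V oL U) oL (adj U oL adj V) = V oL ((U oL adj U) oL adj V)" by(simp only: oo_assoc)
 ultimately show ?thesis
  using bop_comp[OF u(1) v(1)] by(simp add: unitary_op_def adj_comp v(3) u(4) idop_comp[OF H(2) u(1)] idop_comp[OF H(2) v(2)] u(3) v(4))
qed

lemma blin_eqI:
 assumes H: "csub H" "csub H'" and ST: "S:bop b H H'" "T:bop b' H H'"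
  and eq: "!!x y. x:H ==> y:H' ==> ip y (S $$ x) = ip y (T $$ x)"
 shows "S = T"
proof (rule bop_eqI[OF H(1) ST])
 fix x assume x: "x:H"
 have "S $$ x - T $$ x:H'" by(rule csubD(6)[OF H(2) bop_in[OF ST(1)] bop_in[OF ST(2)]])
 hence "ip (S $$ x - T $$ x) (S $$ x - T $$ x) = 0" using eq[OF x] by(simp only: cinner_diff_right) simp
 thus "S $$ x = T $$ x" by simp
qed

context strict_hilb_cat begin

lemma unitary_leg12:
 assumes o: "a:Ob" "b:Ob" "c:Ob" and U: "unitary_op False (sp (tn a b)) (sp (tn a b)) U"
 shows "unitary_op False (sp (tn a (tn b c))) (sp (tn a (tn b c))) (l12 a b c U)"
proof -
 note u = unitary_opD[OF hsp[OF htens[OF o(1,2)]] hsp[OF htens[OF o(1,2)]] U]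
 show ?thesis by(simp add: unitary_op_def leg12(1)[OF o u(1)] adj_leg12[OF o u(1)] leg12_comp[OF o, symmetric] u leg_id(1)[OF o])
qed

lemma unitary_leg13:
 assumes o: "a:Ob" "b:Ob" "c:Ob" and U: "unitary_op False (sp (tn a c)) (sp (tn a c)) U"
 shows "unitary_op False (sp (tn a (tn b c))) (sp (tn a (tn b c))) (l13 a b c U)"
proof -
 note u = unitary_opD[OF hsp[OF htens[OF o(1,3)]] hsp[OF htens[OF o(1,3)]] U]
 show ?thesis by(simp add: unitary_op_def leg13(1)[OF o u(1)] adj_leg13[OF o u(1)] leg13_comp[OF o, symmetric] u leg_id(3)[OF o])
qed

end

section \<open>Tensor products of corepresentations\<close>

context corep_setting begin

lemma corepW:
 assumes "W:CR"
 shows "(fst W, snd W):CR" "fst W:cobj D" "fst W:Ob" "csub (sp (fst W))"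
  "snd W:BL (tn K (fst W)) (tn K (fst W))"
 using assms corepD[of "fst W" "snd W"] hsp by simp_all

text \<open>The equation for the product splits into those of the factors, each with an inert leg.
  The rearrangement between them uses only that \<open>?G\<close>, on legs \<open>1\<close> and
  \<open>4\<close>, commutes with \<open>?Z\<close>, on legs \<open>2\<close> and
  \<open>3\<close>.\<close>

lemma ct_in:
 assumes "W:CR" "W':CR"
 shows "ct W W':CR"
proof -
 obtain h U where W: "W = (h, U)" "(h, U):CR" using assms(1) by(rule corep_cases)
 obtain h' U' where W': "W' = (h', U')" "(h', U'):CR" using assms(2) by(rule corep_cases)
 note w = corepD[OF W(2)] and w' = corepD[OF W'(2)]
 let ?L = "tn K (tn K (tn h h'))" and ?hh = "tn h h'"
 note o3 = qK w(2) w'(2) and Ko3 = qK qK w(2) w'(2)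
 have hh: "?hh:cobj D" "?hh:Ob" using cobj(3)[OF w(1) w'(1)] by auto
 have LH: "csub (sp (tn K ?hh))" "csub (sp ?L)" using hsp htens qK hh(2) by auto
 note U12 = leg12(1)[OF o3 w(7)] and U13 = leg13(1)[OF o3 w'(7)]
 let ?Y = "l12 K h h' U oL l13 K h h' U'"
 have un: "unitary_op False (sp (tn K ?hh)) (sp (tn K ?hh)) ?Y"
  using unitary_comp[OF LH(1,1,1) unitary_leg13[OF o3 w'(4)] unitary_leg12[OF o3 w(4)]] by simp
 note kkh = qK qK hh(2)
 let ?A = "l12 K K ?hh (qV D)"
 let ?X = "l13 K K ?hh (l12 K h h' U)" and ?G = "l13 K K ?hh (l13 K h h' U')"
 let ?Z = "l23 K K ?hh (l12 K h h' U)" and ?H = "l23 K K ?hh (l13 K h h' U')"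
 have AXZ: "?A oL ?X oL ?Z = ?Z oL ?A"
 proof -
  note l = leg12(1)[OF qK qK w(2) V_bop(1)] leg13(1)[OF qK qK w(2) w(7)] leg23(1)[OF qK qK w(2) w(7)]
  note c = leg12_comp[OF qK htens[OF qK w(2)] w'(2)]
  show ?thesis
  unfolding leg12_leg12[OF Ko3 V_bop(1), symmetric] leg12_leg13[OF Ko3 w(7), symmetric] leg12_leg23[OF Ko3 w(7), symmetric]
  c[OF l(1,2), symmetric] c[OF blin_comp[OF l(2,1)] l(3), symmetric] c[OF l(3,1), symmetric] w(5) ..
 qed
 have AGH: "?A oL ?G oL ?H = ?H oL ?A" by(rule pentagon_ins[OF Ko3 V_bop(1) w'(7,7,5)])
 have s: "l23 K (tn K h) h' (l12 K h h' U) = ?Z"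
  unfolding leg23_def by(simp add: htens_assoc qK w(2) w'(2))
 have GZ: "?G oL ?Z = ?Z oL ?G"
  using leg13_leg12_commute[OF qK qK w(2) w'(2,7) w(7)] unfolding leg13_leg13[OF Ko3 w'(7)] s .
 have "?A oL l13 K K ?hh ?Y oL l23 K K ?hh ?Y = ?A oL ?X oL (?G oL ?Z) oL ?H"
  by(simp only: leg13_comp[OF kkh U12 U13] leg23_comp[OF kkh U12 U13] oo_assoc)
 also have "... = (?A oL ?X oL ?Z) oL ?G oL ?H" unfolding GZ by(simp only: oo_assoc)
 also have "... = ?Z oL (?A oL ?G oL ?H)" unfolding AXZ by(simp only: oo_assoc)
 also have "... = l23 K K ?hh ?Y oL ?A" unfolding AGH by(simp only: leg23_comp[OF kkh U12 U13] oo_assoc)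
 finally show ?thesis using un hh(1) by(simp add: coreps_def corep_tens_def W W')
qed

lemma corep_tens_assoc:
 assumes "W:CR" "W':CR" "W'':CR"
 shows "ct (ct W W') W'' = ct W (ct W' W'')"
proof -
 note w = corepW[OF assms(1)] and w' = corepW[OF assms(2)] and w'' = corepW[OF assms(3)]
 note o = qK w(3) w'(3) w''(3)
 have o': "tn (fst W) (fst W'):Ob" "tn (fst W') (fst W''):Ob" using htens o by auto
 let ?h = "fst W" and ?h' = "fst W'" and ?h'' = "fst W''"
 have "l12 K (tn ?h ?h') ?h'' (l12 K ?h ?h' (snd W) oL l13 K ?h ?h' (snd W')) oL l13 K (tn ?h ?h') ?h'' (snd W'')
  = l12 K ?h (tn ?h' ?h'') (snd W) oL l13 K ?h (tn ?h' ?h'') (l12 K ?h' ?h'' (snd W') oL l13 K ?h' ?h'' (snd W''))"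
  unfolding leg12_comp[OF qK o'(1) o(4) leg12(1)[OF o(1-3) w(5)] leg13(1)[OF o(1-3) w'(5)]]
  leg13_comp[OF qK o(2) o'(2) leg12(1)[OF o(1,3,4) w'(5)] leg13(1)[OF o(1,3,4) w''(5)]]
  leg12_leg12[OF o w(5)] leg12_leg13[OF o w'(5)] leg13_leg13[OF o w''(5)] by(simp only: oo_assoc)
 thus ?thesis by(simp add: corep_tens_def htens_assoc o)
qed

lemma triv_corep_in:
 assumes "h:cobj D"
 shows "triv_corep D h:CR"
proof -
 have h: "h:Ob" using assms by simp
 note H = hsp[OF htens[OF qK htens[OF qK h]]]
 note V = leg12(1)[OF qK qK h V_bop(1)]
 show ?thesis
  using assms by(simp add: triv_corep_def coreps_def unitary_op_def adj_idop[OF hsp[OF htens[OF qK h]]] idop_bop[OF hsp[OF htens[OF qK h]]]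
  comp_idop[OF hsp[OF htens[OF qK h]] idop_bop[OF hsp[OF htens[OF qK h]]]] leg_id(2,3)[OF qK qK h] comp_idop[OF H V] idop_comp[OF H V] comp_idop[OF H idop_bop[OF H]])
qed

lemma corep_tens_unit:
 assumes "W:CR"
 shows "ct (triv_corep D (hunit D)) W = W" "ct W (triv_corep D (hunit D)) = W"
proof -
 note w = corepW[OF assms]
 note H = hsp[OF htens[OF qK w(3)]]
 have "l12 K (fst W) (hunit D) (snd W) = snd W"
  unfolding leg12_def using optens_unit_right[OF htens[OF qK w(3)] htens[OF qK w(3)] w(5)] .
 thus "ct (triv_corep D (hunit D)) W = W" "ct W (triv_corep D (hunit D)) = W"
  using leg_id(1)[OF qK hunit(1) w(3)] leg_id(3)[OF qK w(3) hunit(1)] leg13_unit[OF qK w(3,5)] idop_comp[OF H w(5)] comp_idop[OF H w(5)]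
  by(simp_all add: corep_tens_def triv_corep_def htens_unit w qK htens)
qed

section \<open>Coefficients of corepresentations and the description of arrows\<close>

lemma conj_corep_eq: "W:CR ==> conj_corep D W = bar_of W"
 unfolding conj_corep_def by(rule the_equality; use conj_corep in blast)

text \<open>For \<open>b = False\<close> the coefficient of \<open>W\<close>; for
  \<open>b = True\<close> the coefficient of its conjugate, pulled back along \<open>J\<close>. With
  it one criterion covers linear and antilinear arrows.\<close>

definition sl where
 "sl b W p q = (if b then qR D (vs (fst W) q p (snd W)) else vs (fst W) p q (snd W))"

lemma barW:
 assumes "W:CR"
 shows "bar_of W:CR" "fst (bar_of W) = Bar (fst W)"
  "[|p:sp (fst W); q:sp (fst W)|] ==> sl False (bar_of W) (cJ D (fst W) $$ p) (cJ D (fst W) $$ q) = sl True W p q"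
 using bar_of(1-3)[OF corepW(1)[OF assms]] by(simp_all add: sl_def)

lemma sl_Mhat: "[|W:CR; p:sp (fst W); q:sp (fst W)|] ==> sl b W p q:MM"
 using corep_slice_Mhat[OF corepW(1)] by(simp add: sl_def R_simps(1))

lemma R_sl: "[|W:CR; p:sp (fst W); q:sp (fst W)|] ==> qR D (sl b W p q) = sl (\<not> b) W q p"
 using corep_slice_Mhat[OF corepW(1)] by(simp add: sl_def R_antiaut(2))

lemma sl_eqI:
 assumes "x:MM" "y:MM" "!!k k'. [|k:sp K; k':sp K|] ==> ip k' (x $$ k) = ip k' (y $$ k)"
 shows "x = y"
 by(rule blin_eqI[OF K_sub K_sub Mhat_bop[OF assms(1)] Mhat_bop[OF assms(2)] assms(3)])

lemma sl_coeff:
 assumes "W:CR" "k:sp K" "k':sp K" "p:sp (fst W)" "q:sp (fst W)"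
 shows "ip k' (sl False W p q $$ k) = ip (vc K (fst W) k' p) (snd W $$ vc K (fst W) k q)"
 using vslice2(3)[OF qK corepW(3,5)[OF assms(1)] assms(4,5,2,3)] by(simp add: sl_def)

text \<open>For fixed \<open>k\<close>, \<open>k'\<close> and one fixed argument the coefficient is
  a bounded functional of the other, represented here by a vector. The antilinear case is the linear
  one for the conjugate. These vectors make coefficients accessible to density arguments and to
  equations between matrix entries.\<close>

lemma sl_vectors:
 assumes W: "W:CR" and k: "k:sp K" "k':sp K" and q: "q:sp (fst W)"
 shows "EX y:sp (fst W). ALL x:sp (fst W). ip k' (sl b W x q $$ k) = cj b (ip x y)"
  "EX z:sp (fst W). ALL x:sp (fst W). ip k' (sl b W q x $$ k) = cj b (ip z x)"
proof -
 have F: "EX y:sp (fst W). ALL x:sp (fst W). ip k' (sl False W x q $$ k) = ip x y"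
  "EX z:sp (fst W). ALL x:sp (fst W). ip k' (sl False W q x $$ k) = ip z x"
  if W: "W:CR" and q: "q:sp (fst W)" for W q
 proof -
  note w = corepW[OF W]
  let ?y = "adj (lten K (fst W) k') $$ (snd W $$ vc K (fst W) k q)" and ?z = "adj (lten K (fst W) k) $$ (adj (snd W) $$ vc K (fst W) k' q)"
  show "EX y:sp (fst W). ALL x:sp (fst W). ip k' (sl False W x q $$ k) = ip x y"
  using bop_in[OF adj_lten(1)[OF qK w(3) k(2)], of "snd W $$ vc K (fst W) k q"]
  by(intro bexI[of _ ?y]) (simp_all add: sl_coeff[OF W k] q adj_lten(2)[OF qK w(3) k(2)])
  have "ip k' (sl False W q x $$ k) = ip ?z x" if x: "x:sp (fst W)" for x
  proof -
  have "ip x ?z = ip (vc K (fst W) k x) (adj (snd W) $$ vc K (fst W) k' q)" by(rule adj_lten(2)[OF qK w(3) k(1) x])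
  also have "... = ip (snd W $$ vc K (fst W) k x) (vc K (fst W) k' q)" using bop_cinner[OF w(5), of "vc K (fst W) k x"] by simp
  finally show ?thesis using cinner_commute[of ?z x] cinner_commute[of "vc K (fst W) k' q"] by(simp add: sl_coeff[OF W k q x])
  qed
  thus "EX z:sp (fst W). ALL x:sp (fst W). ip k' (sl False W q x $$ k) = ip z x"
  using bop_in[OF adj_lten(1)[OF qK w(3) k(1)], of "adj (snd W) $$ vc K (fst W) k' q"] by(intro bexI[of _ ?z]) simp_all
 qed
 note J = J_facts[OF corepW(2)[OF W]] and b = barW[OF W]
 let ?J = "cJ D (fst W)"
 have Jq: "?J $$ q:sp (fst (bar_of W))" using J(8) b(2) by simp
 show "EX y:sp (fst W). ALL x:sp (fst W). ip k' (sl b W x q $$ k) = cj b (ip x y)"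
 proof (cases b)
  case True
  obtain y where y: "y:sp (Bar (fst W))" "ALL x:sp (Bar (fst W)). ip k' (sl False (bar_of W) x (?J $$ q) $$ k) = ip x y"
  using F(1)[OF b(1) Jq] unfolding b(2) by blast
  have "ip k' (sl True W x q $$ k) = cnj (ip x (adj ?J $$ y))" if "x:sp (fst W)" for x
  using y(2) J(8)[of x] J(7)[OF that J(9), of y] cinner_commute[of "adj ?J $$ y" x] by(simp add: b(3)[OF that q, symmetric] J(6)[OF y(1)])
  thus ?thesis using True J(9)[of y] by(intro bexI[of _ "adj ?J $$ y"]) simp_all
 qed (use F(1)[OF W q] in simp)
 show "EX z:sp (fst W). ALL x:sp (fst W). ip k' (sl b W q x $$ k) = cj b (ip z x)"
 proof (cases b)
  case True
  obtain z where z: "z:sp (Bar (fst W))" "ALL x:sp (Bar (fst W)). ip k' (sl False (bar_of W) (?J $$ q) x $$ k) = ip z x"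
  using F(2)[OF b(1) Jq] unfolding b(2) by blast
  have "ip k' (sl True W q x $$ k) = cnj (ip (adj ?J $$ z) x)" if "x:sp (fst W)" for x
  using z(2) J(8)[of x] J(7)[OF J(9) that, of z] cinner_commute[of x "adj ?J $$ z"] by(simp add: b(3)[OF q that, symmetric] J(6)[OF z(1)])
  thus ?thesis using True J(9)[of z] by(intro bexI[of _ "adj ?J $$ z"]) simp_all
 qed (use F(2)[OF W q] in simp)
qed

text \<open>Slicing the intertwining relation in the second leg puts \<open>T\<close> on the right
  vector on one side and \<open>adj T\<close> on the left vector on the other.\<close>

lemma hom_iff:
 assumes W: "W:CR" "W':CR"
 shows "T:corep_hom D W W' \<longleftrightarrow> T:BL (fst W) (fst W') &
  (ALL p:sp (fst W'). ALL q:sp (fst W). sl False W' p (T $$ q) = sl False W (adj T $$ p) q)"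
proof (cases "T:BL (fst W) (fst W')")
 case T: True
 note w = corepW[OF W(1)] and w' = corepW[OF W(2)]
 let ?O = "ot K (fst W) K (fst W') (qid D) T"
 note O = optensI[OF qK w(3) qK w'(3) hid_bop[OF qK] T]
 note aT = adj_bop[OF w(4) T]
 have aO: "adj ?O = ot K (fst W') K (fst W) (qid D) (adj T)"
  using adj_optens[OF qK w(3) qK w'(3) hid_bop[OF qK] T] by(simp add: adj_idop[OF K_sub])
 note O' = optensI[OF qK w'(3) qK w(3) hid_bop[OF qK] aT, folded aO]
 have c1: "ip (vc K (fst W') k' p) ((?O oL snd W) $$ vc K (fst W) k q) = ip k' (sl False W (adj T $$ p) q $$ k)"
  and c2: "ip (vc K (fst W') k' p) ((snd W' oL ?O) $$ vc K (fst W) k q) = ip k' (sl False W' p (T $$ q) $$ k)"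
  if k: "k:sp K" "k':sp K" "p:sp (fst W')" "q:sp (fst W)" for k k' p q
  using bop_cinner2[OF O(1), of "vc K (fst W') k' p" "snd W $$ vc K (fst W) k q"] sl_coeff[OF W(1) k(1,2) bop_in[OF aT] k(4)]
  sl_coeff[OF W(2) k(1,2,3) bop_in[OF T]]
  by(simp_all add: O'(2) O(2) k idop_in[OF K_sub])
 have "?O oL snd W = snd W' oL ?O \<longleftrightarrow> (ALL p:sp (fst W'). ALL q:sp (fst W). sl False W' p (T $$ q) = sl False W (adj T $$ p) q)"
 proof (intro iffI ballI)
  fix p q assume e: "?O oL snd W = snd W' oL ?O" and pq: "p:sp (fst W')" "q:sp (fst W)"
  show "sl False W' p (T $$ q) = sl False W (adj T $$ p) q"
  proof (rule sl_eqI[OF sl_Mhat[OF W(2) pq(1) bop_in[OF T]] sl_Mhat[OF W(1) bop_in[OF aT] pq(2)]])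
  fix k k' assume k: "k:sp K" "k':sp K"
  show "ip k' (sl False W' p (T $$ q) $$ k) = ip k' (sl False W (adj T $$ p) q $$ k)"
  using c1[OF k pq] c2[OF k pq] e by simp
  qed
 next
  assume e: "ALL p:sp (fst W'). ALL q:sp (fst W). sl False W' p (T $$ q) = sl False W (adj T $$ p) q"
  show "?O oL snd W = snd W' oL ?O"
  proof (rule tens_ext[OF qK w(3) zorth_oo[OF zorth_bop[OF w(5)]] zorth_oo[OF zorth_bop[OF O(1)]]])
  fix k q assume kq: "k:sp K" "q:sp (fst W)"
  show "(?O oL snd W) $$ vc K (fst W) k q = (snd W' oL ?O) $$ vc K (fst W) k q"
  proof (rule tens_total[OF qK w'(3) bop_in[OF blin_comp[OF w(5) O(1)]] bop_in[OF blin_comp[OF O(1) w'(5)]]])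
  fix k' p assume k': "k':sp K" "p:sp (fst W')"
  show "ip (vc K (fst W') k' p) ((?O oL snd W) $$ vc K (fst W) k q) = ip (vc K (fst W') k' p) ((snd W' oL ?O) $$ vc K (fst W) k q)"
  using c1[OF kq(1) k' kq(2)] c2[OF kq(1) k' kq(2)] e k' kq by simp
  qed
  qed
 qed
 thus ?thesis using T by(simp add: corep_hom_def)
qed (simp add: corep_hom_def)

text \<open>Unitarity of both corepresentations turns the intertwining relation into the one for
  their adjoints, whose adjoint is the claim.\<close>

lemma hom_adj:
 assumes W: "W:CR" "W':CR" and T: "T:corep_hom D W W'"
 shows "adj T:corep_hom D W' W"
proof -
 note w = corepW[OF W(1)] and w' = corepW[OF W(2)] and u = corepD[OF corepW(1)[OF W(1)]] and u' = corepD[OF corepW(1)[OF W(2)]]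
 have TB: "T:BL (fst W) (fst W')" using T by(simp add: corep_hom_def)
 let ?O = "ot K (fst W) K (fst W') (qid D) T"
 note O = optensI[OF qK w(3) qK w'(3) hid_bop[OF qK] TB]
 have e: "?O oL snd W = snd W' oL ?O" using T by(simp add: corep_hom_def)
 have aO: "adj ?O = ot K (fst W') K (fst W) (qid D) (adj T)"
  using adj_optens[OF qK w(3) qK w'(3) hid_bop[OF qK] TB] by(simp add: adj_idop[OF K_sub])
 have "adj (snd W') oL ?O = adj (snd W') oL (?O oL snd W) oL adj (snd W)"
  using comp_idop[OF u(6) O(1)] by(simp add: oo_assoc u(10))
 also have "... = (adj (snd W') oL snd W') oL (?O oL adj (snd W))" unfolding e by(simp only: oo_assoc)
 also have "... = ?O oL adj (snd W)" unfolding u'(9) by(rule idop_comp[OF u'(6) blin_comp[OF u(8) O(1)]])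
 finally have "adj (adj (snd W') oL ?O) = adj (?O oL adj (snd W))" by(rule arg_cong)
 hence "adj ?O oL snd W' = snd W oL adj ?O" by(simp only: adj_comp adj_adj)
 thus ?thesis using adj_bop[OF w(4) TB] by(simp add: corep_hom_def aO)
qed

abbreviation (input) "SV \<equiv> semilinear_corep_cat D"

lemma SV_simps: "tobj SV = CR" "thom SV = corep_hom D" "tid SV W = hI (fst W)" "tcomp SV = (oL)" "tstar SV = adj"
 "tscl SV = scl" "tunit SV = triv_corep D (hunit D)" "ttob SV = ct"
 "ttar SV W1 W2 W1' W2' = ot (fst W1) (fst W1') (fst W2) (fst W2')"
 "tahom SV W W' = {S oL corep_J D W |S. S:corep_hom D (conj_corep D W) W'}" "ttara SV = anti_tens D"
 "corep_J D W = cJ D (fst W)"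
 by(simp_all add: semilinear_corep_cat_def corep_cat_def tensor_cat.extend_def semilinear_cat.fields_def corep_J_def ciota_def triv_corep_def)

lemma arr_iff:
 assumes W: "W:CR" "W':CR"
 shows "T:arr SV b W W' \<longleftrightarrow> T:bop b (sp (fst W)) (sp (fst W')) &
  (ALL p:sp (fst W'). ALL q:sp (fst W). sl False W' p (T $$ q) = sl b W (adj T $$ p) q)"
proof (cases b)
 case False
 thus ?thesis by(simp add: arr_def SV_simps hom_iff[OF W])
next
 case True
 let ?J = "cJ D (fst W)" and ?h = "fst W"
 note w = corepW[OF W(1)] and w' = corepW[OF W(2)]
 note J = J_facts[OF w(2)] and b = barW[OF W(1)]
 have aSJ: "?J $$ (adj (S oL ?J) $$ p) = adj S $$ p" if "S:BL (Bar ?h) (fst W')" for S p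
  using J(6) bop_in[OF adj_bop[OF hsp[OF cbar_hobj[OF w(2)]] that]] by(simp add: adj_comp)
 show ?thesis
 proof
  assume "T:arr SV b W W'"
  then obtain S where S: "T = S oL ?J" "S:corep_hom D (bar_of W) W'"
  using True by(auto simp: arr_def SV_simps conj_corep_eq[OF W(1)])
  note h = S(2)[unfolded hom_iff[OF b(1) W(2)] b(2)]
  have SB: "S:BL (Bar ?h) (fst W')" using h by blast
  have "T:banti (sp ?h) (sp (fst W'))" unfolding S(1) using bop_comp[OF J(1) SB] by simp
  moreover have "sl False W' p (T $$ q) = sl True W (adj T $$ p) q" if pq: "p:sp (fst W')" "q:sp ?h" for p q
  proof -
  have "sl False W' p (S $$ (?J $$ q)) = sl False (bar_of W) (adj S $$ p) (?J $$ q)" using h pq(1) J(8) by blast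
  also have "... = sl True W (adj T $$ p) q"
  unfolding aSJ[OF SB, symmetric] S(1)[symmetric]
  by(rule b(3)[OF _ pq(2)]) (simp add: S(1) adj_comp J(9))
  finally show ?thesis by(simp add: S(1))
  qed
  ultimately show "T:bop b (sp ?h) (sp (fst W')) & (ALL p:sp (fst W'). ALL q:sp ?h. sl False W' p (T $$ q) = sl b W (adj T $$ p) q)"
  using True by simp
 next
  assume r: "T:bop b (sp ?h) (sp (fst W')) & (ALL p:sp (fst W'). ALL q:sp ?h. sl False W' p (T $$ q) = sl b W (adj T $$ p) q)"
  hence TB: "T:banti (sp ?h) (sp (fst W'))" using True by simp
  define S where "S = T oL adj ?J"
  have SJ: "S oL ?J = T" unfolding S_def oo_assoc J(3) by(rule comp_idop[OF w(4) TB])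
  have SB: "S:BL (Bar ?h) (fst W')" unfolding S_def using bop_comp[OF J(2) TB] by simp
  have "S:corep_hom D (bar_of W) W'"
  unfolding hom_iff[OF b(1) W(2)] b(2)
  proof (intro conjI ballI SB)
  fix p y assume p: "p:sp (fst W')" and y: "y:sp (Bar ?h)"
  let ?q = "adj ?J $$ y"
  have "sl False W' p (S $$ y) = sl True W (adj T $$ p) ?q" using r True p J(9) by(simp add: S_def)
  also have "... = sl False (bar_of W) (?J $$ (adj T $$ p)) (?J $$ ?q)"
  by(rule b(3)[OF bop_in[OF adj_bop[OF w(4) TB]] J(9), symmetric])
  finally show "sl False W' p (S $$ y) = sl False (bar_of W) (adj S $$ p) y"
  using aSJ[OF SB, of p] unfolding SJ J(6)[OF y] by simp
  qed
  thus "T:arr SV b W W'" using True SJ by(auto simp: arr_def SV_simps conj_corep_eq[OF W(1)])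
 qed
qed

text \<open>The last relation, with the roles of the two arguments exchanged, comes from the
  criterion for the adjoint of the linear arrow behind \<open>T\<close>.\<close>

lemma arrD:
 assumes W: "W:CR" "W':CR" and T: "T:arr SV b W W'"
 shows "T:bop b (sp (fst W)) (sp (fst W'))" "adj T:bop b (sp (fst W')) (sp (fst W))"
  "[|p:sp (fst W'); q:sp (fst W)|] ==> sl False W' p (T $$ q) = sl b W (adj T $$ p) q"
  "[|p:sp (fst W'); q:sp (fst W)|] ==> sl False W' (T $$ q) p = sl b W q (adj T $$ p)"
proof -
 note w = corepW[OF W(1)] and J = J_facts[OF corepW(2)[OF W(1)]] and bb = barW[OF W(1)]
 let ?J = "cJ D (fst W)"
 show TB: "T:bop b (sp (fst W)) (sp (fst W'))" and c: "[|p:sp (fst W'); q:sp (fst W)|] ==> sl False W' p (T $$ q) = sl b W (adj T $$ p) q" for p q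
  using T[unfolded arr_iff[OF W]] by auto
 thus "adj T:bop b (sp (fst W')) (sp (fst W))" by(intro adj_bop[OF w(4)])
 assume pq: "p:sp (fst W')" "q:sp (fst W)"
 show "sl False W' (T $$ q) p = sl b W q (adj T $$ p)"
 proof (cases b)
  case False
  hence "adj T:corep_hom D W' W" using hom_adj[OF W] T by(simp add: arr_def SV_simps)
  thus ?thesis using False pq by(simp add: hom_iff[OF W(2,1)])
 next
  case True
  then obtain S where S: "T = S oL ?J" "S:corep_hom D (bar_of W) W'"
  using T by(auto simp: arr_def SV_simps conj_corep_eq[OF W(1)])
  have SB: "S:BL (Bar (fst W)) (fst W')" using S(2) bb(2) by(simp add: corep_hom_def)
  have aS: "adj S $$ p = ?J $$ (adj T $$ p)"
  using J(6) bop_in[OF adj_bop[OF hsp[OF cbar_hobj[OF w(2)]] SB]] by(simp add: adj_comp S(1))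
  have "sl False W' (S $$ (?J $$ q)) p = sl False (bar_of W) (?J $$ q) (adj S $$ p)"
  using hom_adj[OF bb(1) W(2) S(2)] pq(1) J(8)[of q] by(simp add: hom_iff[OF W(2) bb(1)] bb(2))
  also have "... = sl True W q (adj T $$ p)" unfolding aS by(rule bb(3)[OF pq(2)]) (simp add: S(1) adj_comp J(9))
  finally show ?thesis using True by(simp add: S(1))
 qed
qed

lemma arr_star:
 assumes W: "W:CR" "W':CR" and T: "T:arr SV b W W'"
 shows "adj T:arr SV b W' W"
 unfolding arr_iff[OF W(2,1)]
proof (intro conjI ballI arrD(2)[OF W T])
 note t = arrD[OF W T]
 fix q p assume pq: "q:sp (fst W)" "p:sp (fst W')"
 show "sl False W q (adj T $$ p) = sl b W' (adj (adj T) $$ q) p"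
 proof (cases b)
  case True
  have "sl True W' (T $$ q) p = qR D (sl False W' p (T $$ q))" using R_sl[OF W(2) pq(2) bop_in[OF t(1)], of False q] by simp
  also have "... = qR D (sl True W (adj T $$ p) q)" using t(3)[OF pq(2,1)] True by simp
  also have "... = sl False W q (adj T $$ p)" using R_sl[OF W(1) bop_in[OF t(2)] pq(1), of True] by simp
  finally show ?thesis using True by simp
 qed (use t(4)[OF pq(2,1)] in simp)
qed

text \<open>An antilinear \<open>S\<close> produces a coefficient under \<open>R\<close> with
  exchanged arguments, so in that case the exchanged relation of \<open>arrD\<close> is the one to
  use for \<open>T\<close>.\<close>

lemma arr_comp:
 assumes W: "W:CR" "W':CR" "W'':CR" and T: "T:arr SV b W W'" and S: "S:arr SV b' W' W''"
 shows "S oL T:arr SV (b ~= b') W W''"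
 unfolding arr_iff[OF W(1,3)]
proof (intro conjI ballI)
 note t = arrD[OF W(1,2) T] and s = arrD[OF W(2,3) S]
 show "S oL T:bop (b ~= b') (sp (fst W)) (sp (fst W''))" by(rule bop_comp[OF t(1) s(1)])
 fix p q assume p: "p:sp (fst W'')" and q: "q:sp (fst W)"
 note sp = bop_in[OF s(2)] and Tq = bop_in[OF t(1)]
 have "sl False W'' p (S $$ (T $$ q)) = sl b' W' (adj S $$ p) (T $$ q)" by(rule s(3)[OF p Tq])
 also have "... = sl (b ~= b') W (adj T $$ (adj S $$ p)) q"
 proof (cases b')
  case True
  have "sl True W' (adj S $$ p) (T $$ q) = qR D (sl False W' (T $$ q) (adj S $$ p))" using R_sl[OF W(2) Tq sp, of False q p] by simp
  also have "... = qR D (sl b W q (adj T $$ (adj S $$ p)))" using t(4)[OF sp q] by simp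
  also have "... = sl (\<not> b) W (adj T $$ (adj S $$ p)) q" by(rule R_sl[OF W(1) q bop_in[OF t(2)]])
  finally show ?thesis using True by simp
 qed (use t(3)[OF sp q] in simp)
 finally show "sl False W'' p ((S oL T) $$ q) = sl (b ~= b') W (adj (S oL T) $$ p) q" by(simp add: adj_comp)
qed

end

context strict_hilb_cat begin

text \<open>Common form of the two tensor products of arrows. In the antilinear case the flip is
  included; \<open>ttgt\<close> and \<open>vv\<close> record the reversed target and the reversed
  elementary tensors.\<close>

definition tensop where
 "tensop b a c a' c' T S = (if b then hf c c' oL ot a a' c c' T S else ot a a' c c' T S)"

definition ttgt where "ttgt b c c' = (if b then tn c' c else tn c c')"

definition vv where "vv b c c' x y = (if b then vc c' c y x else vc c c' x y)"

lemma unitary_hflip: "a:Ob ==> b:Ob ==> unitary_op False (sp (tn a b)) (sp (tn b a)) (hf a b)"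
 by(simp add: unitary_op_def hflip_works(1) adj_hflip hflip_hflip)

context
 fixes a c a' c' assumes o: "a:Ob" "c:Ob" "a':Ob" "c':Ob"
begin

private lemma o3': "tn a a':Ob" "tn c c':Ob" "tn c' c:Ob"
 using htens o by auto

lemma tensop:
 assumes T: "T:bop b (sp a) (sp c)" and S: "S:bop b (sp a') (sp c')"
 shows "tensop b a c a' c' T S:bop b (sp (tn a a')) (sp (ttgt b c c'))"
  "[|x:sp a; y:sp a'|] ==> tensop b a c a' c' T S $$ vc a a' x y = vv b c c' (T $$ x) (S $$ y)"
  "norm (tensop b a c a' c' T S) <= (norm T + 1) * (norm S + 1)"
proof -
 note O = optensI[OF o(1,3,2,4) T S] and F = hflip_works[OF o(2,4)]
 show "tensop b a c a' c' T S:bop b (sp (tn a a')) (sp (ttgt b c c'))"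
  using bop_comp[OF O(1) F(1)] O(1) by(auto simp: tensop_def ttgt_def)
 show "[|x:sp a; y:sp a'|] ==> tensop b a c a' c' T S $$ vc a a' x y = vv b c c' (T $$ x) (S $$ y)"
  by(simp add: tensop_def vv_def O(2) F(2) bop_in[OF T] bop_in[OF S])
 have "norm (hf c c') <= 1" by(rule unitary_norm_le[OF hsp[OF o3'(2)] hsp[OF o3'(3)] unitary_hflip[OF o(2,4)]])
 hence "norm (hf c c' oL ot a a' c c' T S) <= 1 * norm (ot a a' c c' T S)"
  by(intro order_trans[OF norm_blinfun_compose] mult_right_mono) simp_all
 thus "norm (tensop b a c a' c' T S) <= (norm T + 1) * (norm S + 1)"
  using O(3) by(auto simp: tensop_def)
qed

lemma tensop_linear:
 assumes T: "T:bop b (sp a) (sp c)" "T':bop b (sp a) (sp c)" and S: "S:bop b (sp a') (sp c')" "S':bop b (sp a') (sp c')"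
 shows "tensop b a c a' c' (T + T') S = tensop b a c a' c' T S + tensop b a c a' c' T' S"
  "tensop b a c a' c' T (S + S') = tensop b a c a' c' T S + tensop b a c a' c' T S'"
  "tensop b a c a' c' (scl z T) S = scl z (tensop b a c a' c' T S)"
  "tensop b a c a' c' T (scl z S) = scl z (tensop b a c a' c' T S)"
 using scl_comp_right[OF hflip_works(1)[OF o(2,4)]]
 by(simp_all add: tensop_def optens_add_left[OF o(1,3,2,4) T S(1)] optens_add_right[OF o(1,3,2,4) T(1) S]
  optens_scl[OF o(1,3,2,4) T(1) S(1)] blinfun_compose_add_right)

lemma adj_tensop:
 assumes T: "T:bop b (sp a) (sp c)" and S: "S:bop b (sp a') (sp c')"
 shows "adj (tensop b a c a' c' T S)
  = (if b then tensop b c' a' c a (adj S) (adj T) else tensop b c a c' a' (adj T) (adj S))"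
 using hflip_natural[OF o(4,2,3,1) adj_bop[OF hsp[OF o(3)] S] adj_bop[OF hsp[OF o(1)] T]]
 by(simp add: tensop_def adj_comp adj_optens[OF o(1,3,2,4) T S] adj_hflip[OF o(2,4)])

end

lemma exchange_tensop:
 assumes o: "a:Ob" "c:Ob" "e:Ob" "a':Ob" "c':Ob" "e':Ob"
  and T: "T:bop be (sp a) (sp c)" "T':bop be (sp a') (sp c')"
  and S: "S:bop b (sp c) (sp e)" "S':bop b (sp c') (sp e')"
 shows "(if be then tensop b c' e' c e S' S else tensop b c e c' e' S S') oL tensop be a c a' c' T T'
  = tensop (b ~= be) a e a' e' (S oL T) (S' oL T')"
proof -
 have TB: "S oL T:bop (b ~= be) (sp a) (sp e)" "S' oL T':bop (b ~= be) (sp a') (sp e')"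
  using bop_comp[OF T(1) S(1)] bop_comp[OF T(2) S(2)] by(cases b; cases be; simp)+
 note t = tensop[OF o(1,2,4,5) T] and s = tensop[OF o(2,3,5,6) S] tensop[OF o(5,6,2,3) S(2,1)] and st = tensop[OF o(1,3,4,6) TB]
 show ?thesis
 proof (rule tens_ext[OF o(1,4) zorth_oo[OF zorth_bop[OF t(1)]] zorth_bop[OF st(1)]])
  fix x y assume x: "x:sp a" "y:sp a'"
  show "((if be then tensop b c' e' c e S' S else tensop b c e c' e' S S') oL tensop be a c a' c' T T') $$ vc a a' x y
  = tensop (b ~= be) a e a' e' (S oL T) (S' oL T') $$ vc a a' x y"
  unfolding st(2)[OF x] using t(2)[OF x] s(2)[of "T $$ x" "T' $$ y"] s(5)[of "T' $$ y" "T $$ x"]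
  by(cases b; cases be; simp add: vv_def bop_in[OF T(1)] bop_in[OF T(2)])
 qed
qed

lemma tensop_assoc:
 assumes o: "a:Ob" "c:Ob" "a':Ob" "c':Ob" "a'':Ob" "c'':Ob"
  and T: "T:bop b (sp a) (sp c)" "T':bop b (sp a') (sp c')" "T'':bop b (sp a'') (sp c'')"
 shows "tensop b (tn a a') (ttgt b c c') a'' c'' (tensop b a c a' c' T T') T''
  = tensop b a c (tn a' a'') (ttgt b c' c'') T (tensop b a' c' a'' c'' T' T'')"
proof -
 note t = tensop[OF o(1-4) T(1,2)] and t' = tensop[OF o(3-6) T(2,3)]
 have o3': "tn a a':Ob" "ttgt b c c':Ob" "tn a' a'':Ob" "ttgt b c' c'':Ob"
  using htens o by(auto simp: ttgt_def)
 note l = tensop[OF o3'(1,2) o(5,6) t(1) T(3)] and r = tensop[OF o(1,2) o3'(3,4) T(1) t'(1)]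
 have s: "sp (tn (tn a a') a'') = sp (tn a (tn a' a''))" by(simp add: htens_assoc o)
 show ?thesis
 proof (rule tens_ext3[OF o(1,3,5) zorth_bop[OF l(1), unfolded s] zorth_bop[OF r(1)]])
  fix x y z assume x: "x:sp a" "y:sp a'" "z:sp a''"
  have "tensop b (tn a a') (ttgt b c c') a'' c'' (tensop b a c a' c' T T') T'' $$ vc (tn a a') a'' (vc a a' x y) z
  = vv b (ttgt b c c') c'' (vv b c c' (T $$ x) (T' $$ y)) (T'' $$ z)"
  by(simp add: l(2) t(2) hvec_in o x)
  also have "... = vv b c (ttgt b c' c'') (T $$ x) (vv b c' c'' (T' $$ y) (T'' $$ z))"
  by(simp add: vv_def ttgt_def hvec_assoc o bop_in[OF T(1)] bop_in[OF T(2)] bop_in[OF T(3)])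
  also have "... = tensop b a c (tn a' a'') (ttgt b c' c'') T (tensop b a' c' a'' c'' T' T'') $$ vc a (tn a' a'') x (vc a' a'' y z)"
  by(simp add: r(2) t'(2) hvec_in o x)
  finally show "tensop b (tn a a') (ttgt b c c') a'' c'' (tensop b a c a' c' T T') T'' $$ vc a (tn a' a'') x (vc a' a'' y z)
  = tensop b a c (tn a' a'') (ttgt b c' c'') T (tensop b a' c' a'' c'' T' T'') $$ vc a (tn a' a'') x (vc a' a'' y z)"
  by(simp add: hvec_assoc[OF o(1,3,5) x])
 qed
qed

end

section \<open>Coefficients of tensor products, and tensor products of arrows\<close>

context corep_setting begin

text \<open>Coefficients multiply because \<open>W\<close> and \<open>W'\<close> share only the
  first leg, while each leaves the Hilbert space of the other untouched.\<close>

lemma corep_tens_slice: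
 assumes W: "W:CR" "W':CR" and p: "p:sp (fst W)" "q:sp (fst W)" "p':sp (fst W')" "q':sp (fst W')"
 shows "sl False (ct W W') (vc (fst W) (fst W') p p') (vc (fst W) (fst W') q q') = sl False W p q oL sl False W' p' q'"
proof -
 let ?h = "fst W" and ?h' = "fst W'" and ?Y = "ct W W'"
 note Y = ct_in[OF W]
 note w = corepW[OF W(1)] and w' = corepW[OF W(2)]
 note o = qK w(3) w'(3) and Ko = qK w(3) and Ko' = qK w'(3)
 have f: "fst ?Y = tn ?h ?h'" "snd ?Y = l12 K ?h ?h' (snd W) oL l13 K ?h ?h' (snd W')" by(simp_all add: corep_tens_def)
 have m: "vc ?h ?h' p p':sp (fst ?Y)" "vc ?h ?h' q q':sp (fst ?Y)" unfolding f by(simp_all add: hvec_in o p)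
 have S: "vs ?h p q (snd W):BL K K" by(rule vslice2(2)[OF Ko w(5) p(1,2)])
 show ?thesis
 proof (rule sl_eqI[OF sl_Mhat[OF Y m] Mhat_closed(1)[OF sl_Mhat[OF W(1) p(1,2)] sl_Mhat[OF W(2) p(3,4)]]])
  fix k k' assume k: "k:sp K" "k':sp K"
  have e: "ip (vc K (tn ?h ?h') k' (vc ?h ?h' p p')) (l12 K ?h ?h' (snd W) $$ (ins K ?h ?h' q $$ x))
  = ip k' (sl False W p q $$ (adj (rten K ?h' p') $$ x))" if x: "x:sp (tn K ?h')" for x
  proof (rule eq_on_tensor[OF Ko' _ _ _ x])
  show "bounded_linear (%x. ip (vc K (tn ?h ?h') k' (vc ?h ?h' p p')) (l12 K ?h ?h' (snd W) $$ (ins K ?h ?h' q $$ x)))"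
  "bounded_linear (%x. ip k' (sl False W p q $$ (adj (rten K ?h' p') $$ x)))"
  by(intro bounded_linear_compose[OF bl_cinner_right] bounded_linear_compose[OF bl_right] bl_right)+
  fix y z assume y: "y:sp K" "z:sp ?h'"
  have "ip (vc K (tn ?h ?h') k' (vc ?h ?h' p p')) (l12 K ?h ?h' (snd W) $$ (ins K ?h ?h' q $$ vc K ?h' y z))
  = ip (vc (tn K ?h) ?h' (vc K ?h k' p) p') (vc (tn K ?h) ?h' (snd W $$ vc K ?h y q) z)"
  by(simp add: ins_apply[OF o] y p leg12_apply[OF o w(5)] hvec_assoc[OF o] k)
  also have "... = ip (vc K ?h k' p) (snd W $$ vc K ?h y q) * ip p' z"
  by(rule hvec_cinner[OF htens[OF Ko] o(3) hvec_in[OF Ko k(2) p(1)] bop_in[OF w(5)] p(3) y(2)])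
  also have "... = ip k' (sl False W p q $$ (adj (rten K ?h' p') $$ vc K ?h' y z))"
  by(simp add: adj_rten(3)[OF Ko' p(3) y] sl_coeff[OF W(1) y(1) k(2) p(1,2), symmetric] cinner_scaleC_right
  bop_scaleC[OF Mhat_bop[OF sl_Mhat[OF W(1) p(1,2)]]])
  finally show "ip (vc K (tn ?h ?h') k' (vc ?h ?h' p p')) (l12 K ?h ?h' (snd W) $$ (ins K ?h ?h' q $$ vc K ?h' y z))
  = ip k' (sl False W p q $$ (adj (rten K ?h' p') $$ vc K ?h' y z))" .
  qed
  have "ip k' (sl False ?Y (vc ?h ?h' p p') (vc ?h ?h' q q') $$ k)
  = ip (vc K (tn ?h ?h') k' (vc ?h ?h' p p')) (l12 K ?h ?h' (snd W) $$ (ins K ?h ?h' q $$ (snd W' $$ vc K ?h' k q')))"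
  using sl_coeff[OF Y k m] unfolding f by(simp add: leg13(3)[OF o w'(5) k(1) p(2,4)])
  also have "... = ip k' (sl False W p q $$ (adj (rten K ?h' p') $$ (snd W' $$ vc K ?h' k q')))" by(rule e[OF bop_in[OF w'(5)]])
  also have "adj (rten K ?h' p') $$ (snd W' $$ vc K ?h' k q') = sl False W' p' q' $$ k"
  using k(1) by(simp add: sl_def vslice2(1)[OF Ko' w'(5) p(3,4)] rten(2)[OF Ko' p(4)])
  finally show "ip k' (sl False ?Y (vc ?h ?h' p p') (vc ?h ?h' q q') $$ k) = ip k' ((sl False W p q oL sl False W' p' q') $$ k)" by simp
 qed
qed

lemma bounded_linear_cj_cinner:
 "bounded_linear (%x. cj b (ip z x))" "bounded_linear (%x. cj b (ip x z))"
 by(cases b; auto intro: bounded_linear_compose[OF bounded_linear_cnj] bl_cinner_right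
  bounded_bilinear.bounded_linear_left[OF bb_cinner])+

text \<open>By \<open>sl_vectors\<close> both sides of the arrow criterion are continuous in each
  argument, so elementary tensors suffice.\<close>

lemma arr_tensI:
 assumes W: "W:CR" "W':CR" and f: "fst W = tn a c" "fst W' = tn a' c'"
  and o: "a:Ob" "c:Ob" "a':Ob" "c':Ob"
  and T: "T:bop b (sp (fst W)) (sp (fst W'))"
  and eq: "!!q1 q2 p1 p2. [|q1:sp a; q2:sp c; p1:sp a'; p2:sp c'|] ==>
  sl False W' (vc a' c' p1 p2) (T $$ vc a c q1 q2) = sl b W (adj T $$ vc a' c' p1 p2) (vc a c q1 q2)"
 shows "T:arr SV b W W'"
 unfolding arr_iff[OF W]
proof (intro conjI ballI T)
 fix p q assume p: "p:sp (fst W')" and q: "q:sp (fst W)"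
 note aT = adj_bop[OF corepW(4)[OF W(1)] T]
 note r = bop_in[OF T] bop_in[OF aT]
 show "sl False W' p (T $$ q) = sl b W (adj T $$ p) q"
 proof (rule sl_eqI[OF sl_Mhat[OF W(2) p r(1)] sl_Mhat[OF W(1) r(2) q]])
  fix k k' assume k: "k:sp K" "k':sp K"
  have el: "ip k' (sl False W' (vc a' c' p1 p2) (T $$ q) $$ k) = ip k' (sl b W (adj T $$ vc a' c' p1 p2) q $$ k)"
  if pp: "p1:sp a'" "p2:sp c'" for p1 p2
  proof -
  have P: "vc a' c' p1 p2:sp (fst W')" unfolding f by(rule hvec_in[OF o(3,4) pp])
  obtain z1 where z1: "ALL x:sp (fst W'). ip k' (sl False W' (vc a' c' p1 p2) x $$ k) = cj False (ip z1 x)"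
  using sl_vectors(2)[OF W(2) k P] by blast
  obtain z2 where z2: "ALL x:sp (fst W). ip k' (sl b W (adj T $$ vc a' c' p1 p2) x $$ k) = cj b (ip z2 x)"
  using sl_vectors(2)[OF W(1) k r(2)] by blast
  have "cj False (ip z1 (T $$ q)) = cj b (ip z2 q)"
  proof (rule eq_on_tensor[OF o(1,2) _ _ _ q[unfolded f]])
  show "bounded_linear (%q. cj False (ip z1 (T $$ q)))" "bounded_linear (%q. cj b (ip z2 q))"
  by(intro bounded_linear_cj_cinner bounded_linear_compose[OF bounded_linear_cj_cinner(1) bl_right])+
  fix x y assume xy: "x:sp a" "y:sp c"
  have "vc a c x y:sp (fst W)" unfolding f by(rule hvec_in[OF o(1,2) xy])
  thus "cj False (ip z1 (T $$ vc a c x y)) = cj b (ip z2 (vc a c x y))"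
  using bspec[OF z1 r(1)[of "vc a c x y"]] bspec[OF z2, of "vc a c x y"] eq[OF xy pp] by simp
  qed
  thus ?thesis using bspec[OF z1 r(1)[of q]] bspec[OF z2 q] by simp
  qed
  obtain y1 where y1: "ALL x:sp (fst W'). ip k' (sl False W' x (T $$ q) $$ k) = cj False (ip x y1)"
  using sl_vectors(1)[OF W(2) k r(1)] by blast
  obtain y2 where y2: "ALL x:sp (fst W). ip k' (sl b W x q $$ k) = cj b (ip x y2)"
  using sl_vectors(1)[OF W(1) k q] by blast
  have "cj False (ip p y1) = cj b (ip (adj T $$ p) y2)"
  proof (rule eq_on_tensor[OF o(3,4) _ _ _ p[unfolded f]])
  show "bounded_linear (%p. cj False (ip p y1))" "bounded_linear (%p. cj b (ip (adj T $$ p) y2))"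
  by(intro bounded_linear_cj_cinner bounded_linear_compose[OF bounded_linear_cj_cinner(2) bl_right])+
  fix x y assume xy: "x:sp a'" "y:sp c'"
  have "vc a' c' x y:sp (fst W')" unfolding f by(rule hvec_in[OF o(3,4) xy])
  thus "cj False (ip (vc a' c' x y) y1) = cj b (ip (adj T $$ vc a' c' x y) y2)"
  using bspec[OF y1, of "vc a' c' x y"] bspec[OF y2 r(2)[of "vc a' c' x y"]] el[OF xy] by simp
  qed
  thus "ip k' (sl False W' p (T $$ q) $$ k) = ip k' (sl b W (adj T $$ p) q $$ k)"
  using bspec[OF y1 p] bspec[OF y2 r(2)[of p]] by simp
 qed
qed

definition ctgt where "ctgt b W W' = (if b then ct W' W else ct W W')"

lemma fst_corep_tens[simp]: "fst (ct W W') = tn (fst W) (fst W')"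
 by(simp add: corep_tens_def)

lemma fst_ctgt: "fst (ctgt b W W') = ttgt b (fst W) (fst W')"
 by(simp add: ctgt_def ttgt_def)

text \<open>\<open>R\<close> reverses the product of coefficients. This is the reason why an
  antilinear tensor product has its target in the opposite order.\<close>

lemma corep_tens_slice_anti:
 assumes W: "W:CR" "W':CR" and p: "p:sp (fst W)" "q:sp (fst W)" "p':sp (fst W')" "q':sp (fst W')"
 shows "sl True (ct W W') (vc (fst W) (fst W') p p') (vc (fst W) (fst W') q q') = sl True W' p' q' oL sl True W p q"
proof -
 note o = corepW(3)[OF W(1)] corepW(3)[OF W(2)]
 have "sl True (ct W W') (vc (fst W) (fst W') p p') (vc (fst W) (fst W') q q')
  = qR D (sl False (ct W W') (vc (fst W) (fst W') q q') (vc (fst W) (fst W') p p'))"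
  by(simp add: sl_def)
 also have "... = qR D (sl False W' q' p') oL qR D (sl False W q p)"
  by(simp add: corep_tens_slice[OF W p(2,1,4,3)] R_simps(2)[OF sl_Mhat[OF W(1) p(2,1)] sl_Mhat[OF W(2) p(4,3)]])
 finally show ?thesis by(simp add: sl_def)
qed

lemma tensop_arr:
 assumes W: "W1:CR" "W2:CR" "W1':CR" "W2':CR"
  and T: "T:arr SV b W1 W2" "T':arr SV b W1' W2'"
 shows "tensop b (fst W1) (fst W2) (fst W1') (fst W2') T T':arr SV b (ct W1 W1') (ctgt b W2 W2')"
proof -
 note t = arrD[OF W(1,2) T(1)] and t' = arrD[OF W(3,4) T(2)]
 note o = corepW(3)[OF W(1)] corepW(3)[OF W(2)] corepW(3)[OF W(3)] corepW(3)[OF W(4)]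
 note X = tensop[OF o t(1) t'(1)] and aX = adj_tensop[OF o t(1) t'(1)]
 note r = bop_in[OF t(1)] bop_in[OF t(2)] bop_in[OF t'(1)] bop_in[OF t'(2)]
 let ?X = "tensop b (fst W1) (fst W2) (fst W1') (fst W2') T T'"
 note Y = ct_in[OF W(1,3)]
 have Z: "ctgt b W2 W2':CR" using ct_in[OF W(2,4)] ct_in[OF W(4,2)] by(simp add: ctgt_def)
 have XB: "?X:bop b (sp (fst (ct W1 W1'))) (sp (fst (ctgt b W2 W2')))" using X(1) by(simp add: fst_ctgt)
 show ?thesis
 proof (cases b)
  case False
  show ?thesis
  proof (rule arr_tensI[OF Y Z fst_corep_tens _ o(1,3,2,4) XB])
  fix q q' p p' assume q: "q:sp (fst W1)" "q':sp (fst W1')" "p:sp (fst W2)" "p':sp (fst W2')"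
  have "sl False (ct W2 W2') (vc (fst W2) (fst W2') p p') (vc (fst W2) (fst W2') (T $$ q) (T' $$ q'))
  = sl False W1 (adj T $$ p) q oL sl False W1' (adj T' $$ p') q'"
  using False t(3)[OF q(3,1)] t'(3)[OF q(4,2)] by(simp add: corep_tens_slice[OF W(2,4)] q r)
  moreover have "adj ?X $$ vc (fst W2) (fst W2') p p' = vc (fst W1) (fst W1') (adj T $$ p) (adj T' $$ p')"
  unfolding aX using tensop(2)[OF o(2,1,4,3) t(2) t'(2) q(3,4)] False by(simp add: vv_def)
  ultimately show "sl False (ctgt b W2 W2') (vc (fst W2) (fst W2') p p') (?X $$ vc (fst W1) (fst W1') q q')
  = sl b (ct W1 W1') (adj ?X $$ vc (fst W2) (fst W2') p p') (vc (fst W1) (fst W1') q q')"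
  unfolding X(2)[OF q(1,2)] using False by(simp add: q vv_def ctgt_def corep_tens_slice[OF W(1,3)] r)
  qed (simp add: ctgt_def False)
 next
  case True
  show ?thesis
  proof (rule arr_tensI[OF Y Z fst_corep_tens _ o(1,3,4,2) XB])
  fix q q' p' p assume q: "q:sp (fst W1)" "q':sp (fst W1')" "p':sp (fst W2')" "p:sp (fst W2)"
  have "sl False (ct W2' W2) (vc (fst W2') (fst W2) p' p) (vc (fst W2') (fst W2) (T' $$ q') (T $$ q))
  = sl True W1' (adj T' $$ p') q' oL sl True W1 (adj T $$ p) q"
  using True t(3)[OF q(4,1)] t'(3)[OF q(3,2)] by(simp add: corep_tens_slice[OF W(4,2)] q r)
  moreover have "adj ?X $$ vc (fst W2') (fst W2) p' p = vc (fst W1) (fst W1') (adj T $$ p) (adj T' $$ p')"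
  unfolding aX using tensop(2)[OF o(4,3,2,1) t'(2) t(2) q(3,4)] True by(simp add: vv_def)
  ultimately show "sl False (ctgt b W2 W2') (vc (fst W2') (fst W2) p' p) (?X $$ vc (fst W1) (fst W1') q q')
  = sl b (ct W1 W1') (adj ?X $$ vc (fst W2') (fst W2) p' p) (vc (fst W1) (fst W1') q q')"
  unfolding X(2)[OF q(1,2)] using True by(simp add: q vv_def ctgt_def corep_tens_slice_anti[OF W(1,3)] r)
  qed (simp add: ctgt_def True)
 qed
qed

text \<open>In the arrow criterion \<open>T\<close> occurs inside coefficients. Representing vectors
  from \<open>sl_vectors\<close> rewrite each matrix entry of it as an equality between two matrix
  entries of \<open>T\<close>, uniformly in the flag \<open>b\<close>, since \<open>T\<close> and
  the coefficient are conjugate linear together.\<close>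

lemma arr_relations:
 assumes W: "W:CR" "W':CR"
 shows "EX Q. Q <= sp (fst W') \<times> sp (fst W) \<times> sp (fst W') \<times> sp (fst W) &
  (ALL T. T:arr SV b W W' \<longleftrightarrow> T:bop b (sp (fst W)) (sp (fst W')) & (ALL (p, x, e, y):Q. ip p (T $$ x) = ip e (T $$ y)))"
proof -
 define Q where "Q = {(p0, q, p, y). p0:sp (fst W') & q:sp (fst W) & p:sp (fst W') & y:sp (fst W) &
  (EX k:sp K. EX k':sp K. (ALL x:sp (fst W'). ip k' (sl False W' p x $$ k) = cj False (ip p0 x)) &
  (ALL x:sp (fst W). ip k' (sl b W x q $$ k) = cj b (ip x y)))}"
 have "T:arr SV b W W' \<longleftrightarrow> T:bop b (sp (fst W)) (sp (fst W')) & (ALL (p, x, e, y):Q. ip p (T $$ x) = ip e (T $$ y))" for T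
 proof (cases "T:bop b (sp (fst W)) (sp (fst W'))")
  case T: True
  note aT = adj_bop[OF corepW(4)[OF W(1)] T]
  have "(ALL p:sp (fst W'). ALL q:sp (fst W). sl False W' p (T $$ q) = sl b W (adj T $$ p) q) \<longleftrightarrow>
  (ALL (p, x, e, y):Q. ip p (T $$ x) = ip e (T $$ y))"
  proof (intro iffI ballI)
  fix z assume a: "ALL p:sp (fst W'). ALL q:sp (fst W). sl False W' p (T $$ q) = sl b W (adj T $$ p) q" and z: "z:Q"
  obtain p0 q p y where ze: "z = (p0, q, p, y)" by(metis prod_cases4)
  from z[unfolded ze] obtain k k' where m: "q:sp (fst W)" "p:sp (fst W')"
  and c: "ALL x:sp (fst W'). ip k' (sl False W' p x $$ k) = cj False (ip p0 x)" "ALL x:sp (fst W). ip k' (sl b W x q $$ k) = cj b (ip x y)"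
  unfolding Q_def by blast
  have "ip p0 (T $$ q) = ip k' (sl b W (adj T $$ p) q $$ k)"
  using bspec[OF c(1) bop_in[OF T, of q]] bspec[OF bspec[OF a m(2)] m(1)] by simp
  also have "... = ip p (T $$ y)" using bspec[OF c(2) bop_in[OF aT, of p]] bop_cinner2[OF T, of p y] by simp
  finally show "case z of (p, x, e, y) => ip p (T $$ x) = ip e (T $$ y)" by(simp add: ze)
  next
  fix p q assume a: "ALL (p, x, e, y):Q. ip p (T $$ x) = ip e (T $$ y)" and p: "p:sp (fst W')" and q: "q:sp (fst W)"
  show "sl False W' p (T $$ q) = sl b W (adj T $$ p) q"
  proof (rule sl_eqI[OF sl_Mhat[OF W(2) p bop_in[OF T]] sl_Mhat[OF W(1) bop_in[OF aT] q]])
  fix k k' assume k: "k:sp K" "k':sp K"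
  obtain p0 where p0: "p0:sp (fst W')" "ALL x:sp (fst W'). ip k' (sl False W' p x $$ k) = cj False (ip p0 x)"
  using sl_vectors(2)[OF W(2) k p] by blast
  obtain y where y: "y:sp (fst W)" "ALL x:sp (fst W). ip k' (sl b W x q $$ k) = cj b (ip x y)"
  using sl_vectors(1)[OF W(1) k q] by blast
  have "(p0, q, p, y):Q" using p0 y p q k unfolding Q_def by blast
  hence "ip p0 (T $$ q) = ip p (T $$ y)" using a by blast
  thus "ip k' (sl False W' p (T $$ q) $$ k) = ip k' (sl b W (adj T $$ p) q $$ k)"
  using bspec[OF p0(2) bop_in[OF T]] bspec[OF y(2) bop_in[OF aT]] bop_cinner2[OF T, of p y] by simp
  qed
  qed
  thus ?thesis using T by(simp add: arr_iff[OF W])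
 qed (simp add: arr_iff[OF W])
 moreover have "Q <= sp (fst W') \<times> sp (fst W) \<times> sp (fst W') \<times> sp (fst W)" by(auto simp: Q_def)
 ultimately show ?thesis by blast
qed

end

lemma cinner_adj_comp_self:
 assumes "T:bop b H H'"
 shows "ip x (adj T $$ (T $$ x)) = cor ((norm (T $$ x))^2)"
proof -
 have "ip (T $$ x) (T $$ x) = cj b (ip x (adj T $$ (T $$ x)))" by(rule bop_cinner[OF assms])
 hence "cj b (ip (T $$ x) (T $$ x)) = ip x (adj T $$ (T $$ x))" by(simp del: cinner_self_zero_iff)
 thus ?thesis by(simp only: cinner_self cj_simps)
qed

text \<open>The spectrum of \<open>T\<^sup>* T\<close> is in \<open>[0,\<infinity>)\<close>, as \<open>|\<langle>x, (T\<^sup>* T - z) x\<rangle>| \<ge> dist(z, [0,\<infinity>)) \<parallel>x\<parallel>\<^sup>2\<close>.\<close>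

lemma gram_resolvent:
 assumes H: "csub H" "csub H'" and T: "T:bop b H H'" and z: "\<not> (z:\<real> & 0 <= Re z)"
 shows "EX q:blin H H. q oL ((adj T oL T) - scl z (idop H)) = idop H & ((adj T oL T) - scl z (idop H)) oL q = idop H"
proof -
 define c where "c = (if Im z = 0 then - Re z else \<bar>Im z\<bar>)"
 have c0: "0 < c" using z by(auto simp: c_def complex_is_Real_iff)
 have P: "adj T oL T:blin H H" using bop_comp[OF T adj_bop[OF H(1) T]] by simp
 have A: "(adj T oL T) - scl w (idop H):blin H H" for w by(intro bop_diff[OF H(1) P] bop_scl[OF H(1)] idop_bop[OF H(1)])
 have lb: "c * norm x <= norm (((adj T oL T) - scl w (idop H)) $$ x)"
  if x: "x:H" and w: "Re w = Re z" "\<bar>Im w\<bar> = \<bar>Im z\<bar>" for x w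
 proof (cases "x = 0")
  case False
  let ?y = "((adj T oL T) - scl w (idop H)) $$ x"
  define t where "t = (norm (T $$ x))^2"
  have e: "ip x ?y = cor t - w * cor ((norm x)^2)"
  by(simp add: blinfun.diff_left scl_apply idop_in[OF H(1) x] cinner_diff_right cinner_scaleC_right cinner_adj_comp_self[OF T] cinner_self t_def)
  have "c * (norm x)^2 <= cmod (ip x ?y)"
  proof (cases "Im z = 0")
  case True
  have "0 <= t" by(simp add: t_def)
  moreover have "Re (ip x ?y) = t + c * (norm x)^2" unfolding e using True w by(simp add: c_def)
  ultimately have "c * (norm x)^2 <= \<bar>Re (ip x ?y)\<bar>" by linarith
  thus ?thesis using abs_Re_le_cmod[of "ip x ?y"] by linarith
  next
  case False
  have "c * (norm x)^2 <= \<bar>Im (ip x ?y)\<bar>" unfolding e using False w by(simp add: c_def abs_mult)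
  thus ?thesis using abs_Im_le_cmod[of "ip x ?y"] by linarith
  qed
  also have "... <= norm x * norm ?y" by(rule cinner_cauchy)
  finally have "norm x * (c * norm x) <= norm x * norm ?y" by(simp add: power2_eq_square mult_ac)
  thus ?thesis using False by simp
 qed simp
 have aA: "adj ((adj T oL T) - scl z (idop H)) = (adj T oL T) - scl (cnj z) (idop H)"
  by(simp add: adj_diff adj_comp adj_scl[OF H(1,1) idop_bop[OF H(1)]] adj_idop[OF H(1)])
 show ?thesis
  by(rule bounded_below_invertible[OF H(1) A c0]) (auto intro!: lb simp: aA)
qed

section \<open>The semilinear tensor C*-category of corepresentations\<close>

context corep_setting begin

lemma arr_linear:
 assumes W: "W:CR" "W':CR"
 shows "subspace (arr SV b W W')" "complete (arr SV b W W')" "T:arr SV b W W' ==> scl z T:arr SV b W W'"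
proof -
 note H' = corepW(4)[OF W(2)]
 obtain Q where Q: "!!T. T:arr SV b W W' \<longleftrightarrow> T:bop b (sp (fst W)) (sp (fst W')) & (ALL (p, x, e, y):Q. ip p (T $$ x) = ip e (T $$ y))"
  using arr_relations[OF W, of b] by metis
 have A: "arr SV b W W' = bop b (sp (fst W)) (sp (fst W')) \<inter> (\<Inter>(p, x, e, y)\<in>Q. {T. ip p (T $$ x) = ip e (T $$ y)})"
  using Q by(auto simp: set_eq_iff)
 show "scl z T:arr SV b W W'" if "T:arr SV b W W'"
  using that by(auto simp: Q scl_apply cinner_scaleC_right intro: bop_scl[OF H'])
 show "subspace (arr SV b W W')"
  unfolding A by(intro subspace_inter subspace_bop[OF H'] subspace_Inter)
  (auto simp: subspace_def blinfun.add_left cinner_add_right blinfun.scaleR_left cinner_scaleR_right)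
 have cl: "closed {T :: 'h oper. ip p (T $$ x) = ip e (T $$ y)}" for p x e y
  by(rule closed_Collect_eq) (intro continuous_intros)+
 have "closed (arr SV b W W')"
  unfolding A by(intro closed_Int closed_bop[OF H'] closed_INT ballI) (auto intro: cl)
 thus "complete (arr SV b W W')" by(simp add: complete_eq_closed)
qed

lemma SVc: "tobj SV = CR" "thom SV = arr SV False" "tahom SV = arr SV True" "tid SV = (%W. hI (fst W))" "tcomp SV = (oL)" "tstar SV = adj"
 "tscl SV = scl" "tunit SV = triv_corep D (hunit D)" "ttob SV = ct"
 "ttar SV = (%W1 W2 W1' W2'. tensop False (fst W1) (fst W2) (fst W1') (fst W2'))"
 "ttara SV = (%W1 W2 W1' W2'. tensop True (fst W1) (fst W2) (fst W1') (fst W2'))"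
 "arr_tens SV b = (%W1 W2 W1' W2'. tensop b (fst W1) (fst W2) (fst W1') (fst W2'))"
 by(auto simp: fun_eq_iff arr_def tensop_def arr_tens_def anti_tens_def SV_simps)

lemma id_in_hom: "W:CR ==> hI (fst W):arr SV False W W"
 using hid_bop[OF corepW(3)] by(auto simp: arr_iff adj_idop[OF corepW(4)] idop_in[OF corepW(4)])

text \<open>Inverting \<open>1 \<otimes> A\<close> in the intertwining relation for \<open>A\<close>
  gives that for \<open>B\<close>. Positivity asks for resolvents among the arrows;
  \<open>gram_resolvent\<close> provides them only as operators.\<close>

lemma hom_inverse:
 assumes W: "W:CR" and A: "A:arr SV False W W" and B: "B:BL (fst W) (fst W)"
  and AB: "B oL A = hI (fst W)" "A oL B = hI (fst W)"
 shows "B:arr SV False W W"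
proof -
 note w = corepW[OF W] and KW = corepD(6)[OF corepW(1)[OF W]]
 have A': "A:corep_hom D W W" using A by(simp add: arr_def SV_simps)
 hence AB': "A:BL (fst W) (fst W)" by(simp add: corep_hom_def)
 let ?O = "%T. ot K (fst W) K (fst W) (qid D) T"
 note OA = optensI(1)[OF qK w(3) qK w(3) hid_bop[OF qK] AB'] and OB = optensI(1)[OF qK w(3) qK w(3) hid_bop[OF qK] B]
 have c: "?O B oL ?O A = hI (tn K (fst W))" "?O A oL ?O B = hI (tn K (fst W))"
  using optens_comp[OF qK w(3) qK w(3) qK w(3) hid_bop[OF qK] AB' hid_bop[OF qK] B] optens_comp[OF qK w(3) qK w(3) qK w(3) hid_bop[OF qK] B hid_bop[OF qK] AB']
  by(simp_all add: AB idop_comp[OF K_sub hid_bop[OF qK]] optens_id[OF qK w(3)])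
 have e: "?O A oL snd W = snd W oL ?O A" using A' by(simp add: corep_hom_def)
 have "?O B oL snd W = ?O B oL (snd W oL ?O A) oL ?O B"
  using comp_idop[OF KW blin_comp[OF w(5) OB]] by(simp add: oo_assoc c(2))
 also have "... = (?O B oL ?O A) oL (snd W oL ?O B)" unfolding e[symmetric] by(simp only: oo_assoc)
 also have "... = snd W oL ?O B" unfolding c(1) by(rule idop_comp[OF KW blin_comp[OF OB w(5)]])
 finally show ?thesis using B by(simp add: corep_hom_def arr_def SV_simps)
qed

lemma arr_positive:
 assumes W: "W:CR" "W':CR" and T: "T:arr SV b W W'"
 shows "tpositive SV W (adj T oL T)"
proof -
 note t = arrD(1)[OF W T] and H = corepW(4)[OF W(1)] corepW(4)[OF W(2)]
 have P: "adj T oL T:arr SV False W W" using arr_comp[OF W W(1) T arr_star[OF W T]] by simp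
 have "EX q:arr SV False W W. q oL ((adj T oL T) - scl z (hI (fst W))) = hI (fst W) & ((adj T oL T) - scl z (hI (fst W))) oL q = hI (fst W)"
  if z: "\<not> (z:\<real> & 0 <= Re z)" for z
 proof -
  have A: "(adj T oL T) - scl z (hI (fst W)):arr SV False W W"
  by(rule subspace_diff[OF arr_linear(1)[OF W(1,1)] P arr_linear(3)[OF W(1,1) id_in_hom[OF W(1)]]])
  obtain q where q: "q:BL (fst W) (fst W)" "q oL ((adj T oL T) - scl z (hI (fst W))) = hI (fst W)"
  "((adj T oL T) - scl z (hI (fst W))) oL q = hI (fst W)"
  using gram_resolvent[OF H t z] by blast
  thus ?thesis using hom_inverse[OF W(1) A q] by blast
 qed
 thus ?thesis using P unfolding tpositive_def SVc by(simp add: adj_comp)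
qed

lemma tensop_unit:
 assumes "a:Ob" "c:Ob" "T:BL a c"
 shows "tensop False (hunit D) (hunit D) a c (hI (hunit D)) T = T" "tensop False a c (hunit D) (hunit D) T (hI (hunit D)) = T"
 using optens_unit_left[OF assms] optens_unit_right[OF assms] by(simp_all add: tensop_def)

lemma SV_Cstar: "semilinear_tensor_Cstar_category SV"
proof (unfold_locales, unfold SVc)
 fix rh sg b assume W: "rh:CR" "sg:CR"
 show "subspace (arr SV b rh sg)" "complete (arr SV b rh sg)" by(rule arr_linear[OF W])+
 show "ct rh sg:CR" by(rule ct_in[OF W])
 show "tensop False (fst rh) (fst rh) (fst sg) (fst sg) (hI (fst rh)) (hI (fst sg)) = hI (fst (ct rh sg))"
  by(simp add: tensop_def optens_id corepW(3) W)
 fix T z assume T: "T:arr SV b rh sg"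
 note t = arrD(1)[OF W T] and H = corepW(4)[OF W(1)] corepW(4)[OF W(2)]
 show "scl z T:arr SV b rh sg" by(rule arr_linear(3)[OF W T])
 show "T oL hI (fst rh) = T" "hI (fst sg) oL T = T" by(rule comp_idop[OF H(1) t], rule idop_comp[OF H(2) t])
 show "adj T:arr SV b sg rh" by(rule arr_star[OF W T])
 show "adj (scl z T) = scl (cj (\<not> b) z) (adj T)" by(rule adj_scl[OF H t])
 show "tpositive SV rh (adj T oL T)" by(rule arr_positive[OF W T])
 show "norm (adj T oL T) = (norm T)^2" by(rule norm_adj_comp)
 fix tu S b' assume X: "tu:CR" and S: "S:arr SV b' sg tu"
 show "S oL T:arr SV (b ~= b') rh tu" by(rule arr_comp[OF W X T S])
 show "S oL scl z T = scl (cj b' z) (S oL T)" by(rule scl_comp_right[OF arrD(1)[OF W(2) X S]])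
next
 fix rh assume W: "rh:CR"
 show "hI (fst rh):arr SV False rh rh" by(rule id_in_hom[OF W])
 show "ct (triv_corep D (hunit D)) rh = rh" "ct rh (triv_corep D (hunit D)) = rh" by(rule corep_tens_unit[OF W])+
next
 show "triv_corep D (hunit D):CR" by(rule triv_corep_in[OF cobj(2)])
next
 fix rh sg R assume W: "rh:CR" "sg:CR" and R: "R:arr SV False rh sg"
 show "tensop False (fst (triv_corep D (hunit D))) (fst (triv_corep D (hunit D))) (fst rh) (fst sg) (hI (fst (triv_corep D (hunit D)))) R = R"
  "tensop False (fst rh) (fst sg) (fst (triv_corep D (hunit D))) (fst (triv_corep D (hunit D))) R (hI (fst (triv_corep D (hunit D)))) = R"
  using tensop_unit[OF corepW(3)[OF W(1)] corepW(3)[OF W(2)] arrD(1)[OF W R]] by(simp_all add: triv_corep_def)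
next
 fix rh sg rh' sg' and b :: bool and R R' S z
 assume W: "rh:CR" "sg:CR" "rh':CR" "sg':CR" and R: "R:arr SV b rh sg" and R': "R':arr SV b rh' sg'"
 note o = corepW(3)[OF W(1)] corepW(3)[OF W(2)] corepW(3)[OF W(3)] corepW(3)[OF W(4)]
 note r = arrD(1)[OF W(1,2) R] arrD(1)[OF W(3,4) R']
 show "tensop b (fst rh) (fst sg) (fst rh') (fst sg') (scl z R) R' = scl z (tensop b (fst rh) (fst sg) (fst rh') (fst sg') R R')"
  "tensop b (fst rh) (fst sg) (fst rh') (fst sg') R (scl z R') = scl z (tensop b (fst rh) (fst sg) (fst rh') (fst sg') R R')"
  by(rule tensop_linear[OF o r(1,1,2,2)])+
 show "tensop b (fst rh) (fst sg) (fst rh') (fst sg') (R + S) R' = tensop b (fst rh) (fst sg) (fst rh') (fst sg') R R' + tensop b (fst rh) (fst sg) (fst rh') (fst sg') S R'"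
  if "S:arr SV b rh sg" by(rule tensop_linear(1)[OF o r(1) arrD(1)[OF W(1,2) that] r(2,2)])
 show "tensop b (fst rh) (fst sg) (fst rh') (fst sg') R (R' + S) = tensop b (fst rh) (fst sg) (fst rh') (fst sg') R R' + tensop b (fst rh) (fst sg) (fst rh') (fst sg') R S"
  if "S:arr SV b rh' sg'" by(rule tensop_linear(2)[OF o r(1,1,2) arrD(1)[OF W(3,4) that]])
next
 fix rh sg rh' sg' R R'
 assume W: "rh:CR" "sg:CR" "rh':CR" "sg':CR"
 note o = corepW(3)[OF W(1)] corepW(3)[OF W(2)] corepW(3)[OF W(3)] corepW(3)[OF W(4)]
 show "tensop False (fst rh) (fst sg) (fst rh') (fst sg') R R':arr SV False (ct rh rh') (ct sg sg')"
  "adj (tensop False (fst rh) (fst sg) (fst rh') (fst sg') R R') = tensop False (fst sg) (fst rh) (fst sg') (fst rh') (adj R) (adj R')"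
  if "R:arr SV False rh sg" "R':arr SV False rh' sg'"
  using tensop_arr[OF W that] adj_tensop[OF o arrD(1)[OF W(1,2) that(1)] arrD(1)[OF W(3,4) that(2)]] by(simp_all add: ctgt_def)
 show "tensop True (fst rh) (fst sg) (fst rh') (fst sg') R R':arr SV True (ct rh rh') (ct sg' sg)"
  "adj (tensop True (fst rh) (fst sg) (fst rh') (fst sg') R R') = tensop True (fst sg') (fst rh') (fst sg) (fst rh) (adj R') (adj R)"
  if "R:arr SV True rh sg" "R':arr SV True rh' sg'"
  using tensop_arr[OF W that] adj_tensop[OF o arrD(1)[OF W(1,2) that(1)] arrD(1)[OF W(3,4) that(2)]] by(simp_all add: ctgt_def)
next
 fix rh sg rh' sg' rh'' sg'' R R' R''
 assume W: "rh:CR" "sg:CR" "rh':CR" "sg':CR" "rh'':CR" "sg'':CR"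
 note o = corepW(3)[OF W(1)] corepW(3)[OF W(2)] corepW(3)[OF W(3)] corepW(3)[OF W(4)] corepW(3)[OF W(5)] corepW(3)[OF W(6)]
 show "tensop False (fst (ct rh rh')) (fst (ct sg sg')) (fst rh'') (fst sg'') (tensop False (fst rh) (fst sg) (fst rh') (fst sg') R R') R''
  = tensop False (fst rh) (fst sg) (fst (ct rh' rh'')) (fst (ct sg' sg'')) R (tensop False (fst rh') (fst sg') (fst rh'') (fst sg'') R' R'')"
  if "R:arr SV False rh sg" "R':arr SV False rh' sg'" "R'':arr SV False rh'' sg''"
  using tensop_assoc[OF o arrD(1)[OF W(1,2) that(1)] arrD(1)[OF W(3,4) that(2)] arrD(1)[OF W(5,6) that(3)]] by(simp add: ttgt_def)
 show "tensop True (fst (ct rh rh')) (fst (ct sg' sg)) (fst rh'') (fst sg'') (tensop True (fst rh) (fst sg) (fst rh') (fst sg') R R') R''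
  = tensop True (fst rh) (fst sg) (fst (ct rh' rh'')) (fst (ct sg'' sg')) R (tensop True (fst rh') (fst sg') (fst rh'') (fst sg'') R' R'')"
  if "R:arr SV True rh sg" "R':arr SV True rh' sg'" "R'':arr SV True rh'' sg''"
  using tensop_assoc[OF o arrD(1)[OF W(1,2) that(1)] arrD(1)[OF W(3,4) that(2)] arrD(1)[OF W(5,6) that(3)]] by(simp add: ttgt_def)
next
 fix rh sg tu rh' sg' tu' P P' and b :: bool and R R'
 assume W: "rh:CR" "sg:CR" "tu:CR" "rh':CR" "sg':CR" "tu':CR"
  and R: "R:arr SV b sg tu" "R':arr SV b sg' tu'"
 note o = corepW(3)[OF W(1)] corepW(3)[OF W(2)] corepW(3)[OF W(3)] corepW(3)[OF W(4)] corepW(3)[OF W(5)] corepW(3)[OF W(6)]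
 note r = arrD(1)[OF W(2,3) R(1)] arrD(1)[OF W(5,6) R(2)]
 show "tensop b (fst sg) (fst tu) (fst sg') (fst tu') R R' oL tensop False (fst rh) (fst sg) (fst rh') (fst sg') P P'
  = tensop b (fst rh) (fst tu) (fst rh') (fst tu') (R oL P) (R' oL P')" if "P:arr SV False rh sg" "P':arr SV False rh' sg'"
  using exchange_tensop[OF o arrD(1)[OF W(1,2) that(1)] arrD(1)[OF W(4,5) that(2)] r] by simp
 show "tensop b (fst sg') (fst tu') (fst sg) (fst tu) R' R oL tensop True (fst rh) (fst sg) (fst rh') (fst sg') P P'
  = tensop (\<not> b) (fst rh) (fst tu) (fst rh') (fst tu') (R oL P) (R' oL P')" if "P:arr SV True rh sg" "P':arr SV True rh' sg'"
  using exchange_tensop[OF o arrD(1)[OF W(1,2) that(1)] arrD(1)[OF W(4,5) that(2)] r] by simp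
qed (simp_all add: corep_tens_assoc scl_add_right scl_add_left scl_scl scl_of_real norm_scl oo_assoc blinfun_compose_add_left
 blinfun_compose_add_right scl_comp_left norm_blinfun_compose adj_add adj_comp)

end

section \<open>Preduals of spaces of operators\<close>

definition vfun :: "'h::complex_hilbert oper set => 'h => 'h => 'h oper => complex" where
 "vfun X et xi = (%x. if x:X then ip et (x $$ xi) else 0)"

definition closed_funs :: "'h::complex_hilbert oper set => ('h oper => complex) set => bool" where
 "closed_funs X S \<longleftrightarrow> S <= dual_of X scl & (ALL f:S. ALL g:S. (%x. f x + g x):S) & (ALL c. ALL f:S. (%x. c * f x):S) &
  (ALL f:dual_of X scl. (ALL e>0. EX g:S. dual_norm X (%x. f x - g x) < e) --> f:S)"

text \<open>The norm closed span of the vector functionals on \<open>X\<close>. As an intersection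
  it comes with an induction principle, the last clause of lemma \<open>vpd\<close>.\<close>

definition vpd :: "'h::complex_hilbert oper set => 'h set => 'h set => ('h oper => complex) set" where
 "vpd X H H' = \<Inter>{S. closed_funs X S & (ALL et:H'. ALL xi:H. vfun X et xi:S)}"

lemma closed_funsD:
 assumes "closed_funs X S"
 shows "S <= dual_of X scl" "f:S ==> g:S ==> (%x. f x + g x):S" "f:S ==> (%x. c * f x):S"
  "[|f:dual_of X scl; !!e. e > 0 ==> EX g:S. dual_norm X (%x. f x - g x) < e|] ==> f:S"
 using assms unfolding closed_funs_def by blast+

context
 fixes X :: "'h::complex_hilbert oper set"
 assumes X: "subspace X" "!!c x. x:X ==> scl c x:X"
begin

lemma dual_ofI:
 assumes "!!x y. x:X ==> y:X ==> f (x + y) = f x + f y" "!!c x. x:X ==> f (scl c x) = c * f x"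
  "!!x. x:X ==> cmod (f x) <= C * norm x" "!!x. x ~: X ==> f x = 0"
 shows "f:dual_of X scl"
 using assms unfolding dual_of_def clinear_on_def by blast

lemma dual_normI:
 assumes C: "0 <= C" "!!x. x:X ==> cmod (f x) <= C * norm x"
 shows "dual_norm X f <= C"
 unfolding dual_norm_def
proof (rule cSup_least)
 show "{cmod (f x) |x. x:X & norm x <= 1} ~= {}" using subspace_0[OF X(1)] by(auto intro!: exI[of _ 0])
 fix t assume "t:{cmod (f x) |x. x:X & norm x <= 1}"
 then obtain x where x: "t = cmod (f x)" "x:X" "norm x <= 1" by blast
 have "cmod (f x) <= C * norm x" by(rule C(2)[OF x(2)])
 also have "... <= C * 1" by(intro mult_left_mono x C)
 finally show "t <= C" by(simp add: x)
qed

lemma dual_norm: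
 assumes f: "f:dual_of X scl"
 shows "0 <= dual_norm X f" "x:X ==> cmod (f x) <= dual_norm X f * norm x"
proof -
 obtain C where C: "!!x. x:X ==> cmod (f x) <= C * norm x" using f by(auto simp: dual_of_def)
 have h: "f (scl c x) = c * f x" if "x:X" for c x using f that by(auto simp: dual_of_def clinear_on_def)
 have up: "cmod (f x) <= dual_norm X f" if "x:X" "norm x <= 1" for x
  unfolding dual_norm_def
 proof (rule cSup_upper)
  show "bdd_above {cmod (f x) |x. x:X & norm x <= 1}"
  proof (rule bdd_aboveI)
  fix t assume "t:{cmod (f x) |x. x:X & norm x <= 1}"
  then obtain x where x: "t = cmod (f x)" "x:X" "norm x <= 1" by blast
  have "C * norm x <= \<bar>C\<bar> * 1" by(intro mult_mono) (use x in auto)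
  thus "t <= \<bar>C\<bar>" using C[OF x(2)] x(1) by simp
  qed
 qed (use that in blast)
 show n: "0 <= dual_norm X f" using up[OF subspace_0[OF X(1)]] order_trans[OF norm_ge_zero] by simp
 show "cmod (f x) <= dual_norm X f * norm x" if x: "x:X"
 proof (cases "x = 0")
  case True
  thus ?thesis using C[OF x] by simp
 next
  case False
  let ?r = "cor (1 / norm x)"
  have "norm (scl ?r x) = 1" using False by(simp add: norm_scl norm_divide)
  hence "cmod (f (scl ?r x)) <= dual_norm X f" using up[OF X(2)[OF x], of ?r] by simp
  thus ?thesis using False by(simp add: h[OF x] norm_mult norm_divide field_simps)
 qed
qed

lemma dual_combine:
 assumes f: "f:dual_of X scl" and g: "g:dual_of X scl"
 shows "(%x. f x + g x):dual_of X scl" "dual_norm X (%x. f x + g x) <= dual_norm X f + dual_norm X g"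
  "(%x. c * f x):dual_of X scl" "dual_norm X (%x. c * f x) <= cmod c * dual_norm X f"
  "(%x. f x - g x):dual_of X scl" "dual_norm X (%x. f x - g x) = dual_norm X (%x. g x - f x)"
proof -
 note nf = dual_norm[OF f] and ng = dual_norm[OF g]
 have l: "f (x + y) = f x + f y" "g (x + y) = g x + g y" if "x:X" "y:X" for x y
  using f g that by(auto simp: dual_of_def clinear_on_def)
 have s: "f (scl c x) = c * f x" "g (scl c x) = c * g x" if "x:X" for c x using f g that by(auto simp: dual_of_def clinear_on_def)
 have z: "f x = 0" "g x = 0" if "x ~: X" for x using f g that by(auto simp: dual_of_def)
 have b: "cmod (f x + g x) <= (dual_norm X f + dual_norm X g) * norm x" "cmod (f x - g x) <= (dual_norm X f + dual_norm X g) * norm x" if "x:X" for x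
  using norm_triangle_ineq[of "f x" "g x"] norm_triangle_ineq4[of "f x" "g x"] nf(2)[OF that] ng(2)[OF that] by(simp_all add: distrib_right)
 have b': "cmod (c * f x) <= (cmod c * dual_norm X f) * norm x" if "x:X" for x
  using mult_left_mono[OF nf(2)[OF that] norm_ge_zero[of c]] by(simp add: norm_mult mult_ac)
 show "(%x. f x + g x):dual_of X scl" by(rule dual_ofI[OF _ _ b(1)]) (simp_all add: l s z distrib_left)
 show "(%x. f x - g x):dual_of X scl" by(rule dual_ofI[OF _ _ b(2)]) (simp_all add: l s z right_diff_distrib)
 show "(%x. c * f x):dual_of X scl" by(rule dual_ofI[OF _ _ b']) (simp_all add: l s z distrib_left)
 show "dual_norm X (%x. f x + g x) <= dual_norm X f + dual_norm X g" by(rule dual_normI[OF _ b(1)]) (use nf(1) ng(1) in simp)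
 show "dual_norm X (%x. c * f x) <= cmod c * dual_norm X f" by(rule dual_normI[OF _ b']) (use nf(1) in simp)
 show "dual_norm X (%x. f x - g x) = dual_norm X (%x. g x - f x)" by(simp add: dual_norm_def norm_minus_commute)
qed

lemma vfun_dual: "vfun X et xi:dual_of X scl" "dual_norm X (vfun X et xi) <= norm et * norm xi"
proof -
 have b: "cmod (vfun X et xi x) <= (norm et * norm xi) * norm x" if "x:X" for x
 proof -
  have "cmod (ip et (x $$ xi)) <= norm et * (norm x * norm xi)"
  by(rule order_trans[OF cinner_cauchy mult_left_mono[OF norm_blinfun norm_ge_zero]])
  thus ?thesis using that by(simp add: vfun_def mult_ac)
 qed
 show "vfun X et xi:dual_of X scl"
  by(rule dual_ofI[OF _ _ b]) (simp_all add: vfun_def subspace_add[OF X(1)] X(2) blinfun.add_left cinner_add_right scl_apply cinner_scaleC_right)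
 show "dual_norm X (vfun X et xi) <= norm et * norm xi" by(rule dual_normI[OF _ b]) simp
qed

lemma closed_dual: "closed_funs X (dual_of X scl)"
 unfolding closed_funs_def using dual_combine by blast

lemma vpd:
 shows "closed_funs X (vpd X H H')" "et:H' ==> xi:H ==> vfun X et xi:vpd X H H'"
  "[|f:vpd X H H'; closed_funs X S; !!et xi. et:H' ==> xi:H ==> vfun X et xi:S|] ==> f:S"
proof -
 let ?F = "{S. closed_funs X S & (ALL et:H'. ALL xi:H. vfun X et xi:S)}"
 have D: "dual_of X scl:?F" using closed_dual vfun_dual(1) by simp
 show "closed_funs X (vpd X H H')"
  unfolding closed_funs_def[of X "vpd X H H'"]
 proof (intro conjI ballI allI impI)
  show "vpd X H H' <= dual_of X scl" unfolding vpd_def using D by blast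
  fix f assume f: "f:dual_of X scl" "ALL e>0. EX g:vpd X H H'. dual_norm X (%x. f x - g x) < e"
  show "f:vpd X H H'" unfolding vpd_def
  proof
  fix S assume S: "S:?F"
  show "f:S"
  proof (rule closed_funsD(4)[OF _ f(1)])
  fix e :: real assume "e > 0"
  then obtain g where "g:vpd X H H'" "dual_norm X (%x. f x - g x) < e" using f(2) by blast
  thus "EX g:S. dual_norm X (%x. f x - g x) < e" using S unfolding vpd_def by blast
  qed (use S in blast)
  qed
 next
  fix f g assume fg: "f:vpd X H H'" "g:vpd X H H'"
  thus "(%x. f x + g x):vpd X H H'" unfolding vpd_def by(auto intro: closed_funsD(2))
 next
  fix c f assume "f:vpd X H H'"
  thus "(%x. c * f x):vpd X H H'" unfolding vpd_def by(auto intro: closed_funsD(3))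
 qed
 show "et:H' ==> xi:H ==> vfun X et xi:vpd X H H'"
  "[|f:vpd X H H'; closed_funs X S; !!et xi. et:H' ==> xi:H ==> vfun X et xi:S|] ==> f:S"
  unfolding vpd_def by blast+
qed

lemma vpd_dual: "f:vpd X H H' ==> f:dual_of X scl"
 using closed_funsD(1)[OF vpd(1)] by blast

text \<open>A functional depending linearly and continuously on a vector parameter lies in a closed
  space as soon as it does so for a total set of parameters.\<close>

lemma closed_funs_span:
 fixes G :: "'z::real_normed_vector => 'h oper => complex"
 assumes F: "closed_funs X F" and G: "!!z w x. G (z + w) x = G z x + G w x" "!!r z x. G (r *\<^sub>R z) x = r * G z x" "!!z. G z:dual_of X scl"
  and bd: "0 <= C" "!!z x. x:X ==> cmod (G z x) <= C * norm z * norm x" and B: "B ~= {}" "!!z. z:B ==> G z:F"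
  and z: "z:closure (span B)"
 shows "G z:F"
proof (rule closed_funsD(4)[OF F G(3)])
 have sub: "subspace {z. G z:F}"
 proof -
  obtain b where b: "b:B" using B(1) by blast
  have e: "G (r *\<^sub>R z) = (%x. cor r * G z x)" "G (z + w) = (%x. G z x + G w x)" for r z w by(simp_all add: fun_eq_iff G)
  have "G 0:F" using closed_funsD(3)[OF F B(2)[OF b], of "cor 0"] e(1)[of 0 b] by simp
  thus ?thesis unfolding subspace_def by(auto simp: e intro: closed_funsD(2,3)[OF F])
 qed
 have span: "w:span B ==> G w:F" for w using span_minimal[OF _ sub, of B] B(2) by blast
 fix e :: real assume e: "e > 0"
 hence "e / (C + 1) > 0" using bd(1) by simp
 then obtain w where w: "w:span B" "dist w z < e / (C + 1)" using z unfolding closure_approachable by blast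
 have "G z x - G w x = G (z - w) x" for x using G(1)[of "z - w" w x] by simp
 hence "cmod (G z x - G w x) <= (C * norm (z - w)) * norm x" if "x:X" for x using bd(2)[OF that, of "z - w"] by simp
 hence "dual_norm X (%x. G z x - G w x) <= C * norm (z - w)" by(intro dual_normI) (use bd(1) in simp_all)
 also have "... < e"
 proof -
  have "C * norm (z - w) <= (C + 1) * norm (z - w)" by(intro mult_right_mono) simp_all
  also have "... < e" using w(2) bd(1) by(simp add: dist_norm norm_minus_commute field_simps)
  finally show ?thesis .
 qed
 finally show "EX g:F. dual_norm X (%x. G z x - g x) < e" using span[OF w(1)] by blast
qed

text \<open>A bounded functional \<open>\<Phi>\<close> on the candidate predual gives the bounded
  form \<open>\<Phi>(vfun X et xi)\<close>, hence an operator \<open>T\<close>. Each relation in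
  \<open>Q\<close> says that two vector functionals coincide on \<open>X\<close>; applying
  \<open>\<Phi>\<close> gives the same relation for \<open>T\<close>, so \<open>T\<close> belongs to
  \<open>X\<close>.\<close>

lemma predual_vpd:
 assumes H: "csub H" "csub H'" and Q: "Q <= H' \<times> H \<times> H' \<times> H"
  and XQ: "!!T. T:X \<longleftrightarrow> T:bop b H H' & (ALL (p, x, e, y):Q. ip p (T $$ x) = ip e (T $$ y))"
 shows "is_predual X scl (vpd X H H')"
proof -
 let ?F = "vpd X H H'"
 note F = closed_funsD[OF vpd(1)[of H H']]
 have zero: "(%x. 0):?F"
  using F(3)[OF vpd(2)[OF csubD(4)[OF H(2)] csubD(4)[OF H(1)]], of 0] by simp
 have nrm: "norm x = Sup {cmod (f x) |f. f:?F & dual_norm X f <= 1}" if x: "x:X" for x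
 proof (rule cSup_eq_non_empty[symmetric])
  note xb = iffD1[OF XQ x, THEN conjunct1]
  have "dual_norm X (%x. 0) <= 1" by(rule dual_normI) simp_all
  thus "{cmod (f x) |f. f:?F & dual_norm X f <= 1} ~= {}" using zero by blast
  fix t assume "t:{cmod (f x) |f. f:?F & dual_norm X f <= 1}"
  then obtain f where f: "t = cmod (f x)" "f:?F" "dual_norm X f <= 1" by blast
  have "cmod (f x) <= dual_norm X f * norm x" by(rule dual_norm(2)[OF vpd_dual[OF f(2)] x])
  also have "... <= 1 * norm x" by(intro mult_right_mono f) simp
  finally show "t <= norm x" by(simp add: f)
 next
  fix t assume t: "!!s. s:{cmod (f x) |f. f:?F & dual_norm X f <= 1} ==> s <= t"
  note xb = iffD1[OF XQ x, THEN conjunct1]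
  have v: "cmod (ip et (x $$ xi)) <= t" if "et:H'" "xi:H" "norm et <= 1" "norm xi <= 1" for et xi
  proof (rule t, rule CollectI, intro exI conjI)
  show "vfun X et xi:?F" by(rule vpd(2)[OF that(1,2)])
  show "dual_norm X (vfun X et xi) <= 1"
  using vfun_dual(2)[of et xi] mult_mono[OF that(3,4)] by simp
  show "cmod (ip et (x $$ xi)) = cmod (vfun X et xi x)" by(simp add: vfun_def x)
  qed
  have t0: "0 <= t" using v[OF csubD(4)[OF H(2)] csubD(4)[OF H(1)]] by simp
  show "norm x <= t"
  proof (rule norm_blinfun_bound[OF t0])
  fix xi
  let ?u = "proj_on H xi"
  have u: "?u:H" by(rule proj_on(1)[OF H(1)])
  have "norm (x $$ ?u) <= t * norm ?u"
  proof (cases "x $$ ?u = 0 \<or> ?u = 0")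
  case False
  let ?a = "inverse (norm (x $$ ?u)) *\<^sub>R (x $$ ?u)" and ?b = "inverse (norm ?u) *\<^sub>R ?u"
  have "cmod (ip ?a (x $$ ?b)) <= t"
  by(rule v) (use False csubD(8)[OF H(1) u] csubD(8)[OF H(2) bop_in[OF xb]] in simp_all)
  moreover have "ip ?a (x $$ ?b) = cor (inverse (norm ?u) * norm (x $$ ?u))"
  using False by(simp add: blinfun.scaleR_right cinner_scaleR_left cinner_scaleR_right cinner_self power2_eq_square)
  ultimately have "inverse (norm ?u) * norm (x $$ ?u) <= t" by(simp only: norm_of_real)
  thus ?thesis using False by(simp add: field_simps)
  qed (use t0 in auto)
  also have "... <= t * norm xi" by(intro mult_left_mono norm_proj_on_le[OF H(1)] t0)
  finally show "norm (x $$ xi) <= t * norm xi" by(simp add: bop_proj[OF H(1) xb])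
  qed
 qed
 have rep: "EX x:X. ALL f:?F. Ph f = f x"
  if add: "!!f g. f:?F ==> g:?F ==> Ph (%x. f x + g x) = Ph f + Ph g" and sc: "!!c f. f:?F ==> Ph (%x. c * f x) = c * Ph f"
  and bd: "!!f. f:?F ==> cmod (Ph f) <= k * dual_norm X f" for Ph k
 proof -
  define q where "q et xi = Ph (vfun X et xi)" for et xi
  note vF = vpd(2)[of _ H' _ H]
  have bop: "x:X ==> x:bop b H H'" for x by(simp add: XQ)
  have "EX T:bop b H H'. (ALL xi:H. ALL et:H'. ip et (T $$ xi) = q et xi) & norm T <= \<bar>k\<bar>"
  proof (rule bounded_form_op[OF H])
  fix et et' xi assume a: "et:H'" "et':H'" "xi:H"
  have "vfun X (et + et') xi = (%x. vfun X et xi x + vfun X et' xi x)" by(simp add: vfun_def fun_eq_iff cinner_add_left)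
  thus "q (et + et') xi = q et xi + q et' xi" by(simp add: q_def add[OF vF[OF a(1,3)] vF[OF a(2,3)]])
  next
  fix et xi xi' assume a: "et:H'" "xi:H" "xi':H"
  have "vfun X et (xi + xi') = (%x. vfun X et xi x + vfun X et xi' x)" by(simp add: vfun_def fun_eq_iff blinfun.add_right cinner_add_right)
  thus "q et (xi + xi') = q et xi + q et xi'" by(simp add: q_def add[OF vF[OF a(1,2)] vF[OF a(1,3)]])
  next
  fix c et xi assume a: "et:H'" "xi:H"
  have "vfun X (c *\<^sub>C et) xi = (%x. cnj c * vfun X et xi x)" "vfun X et (c *\<^sub>C xi) = (%x. cj b c * vfun X et xi x)"
  by(simp_all add: vfun_def fun_eq_iff cinner_scaleC_left cinner_scaleC_right bop_scaleC[OF bop])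
  thus "q (c *\<^sub>C et) xi = cnj c * q et xi" "q et (c *\<^sub>C xi) = cj b c * q et xi" by(simp_all add: q_def sc[OF vF[OF a]])
  next
  fix et xi assume a: "et:H'" "xi:H"
  have "cmod (q et xi) <= k * dual_norm X (vfun X et xi)" unfolding q_def by(rule bd[OF vF[OF a]])
  also have "... <= \<bar>k\<bar> * (norm et * norm xi)"
  using dual_norm(1)[OF vfun_dual(1)] vfun_dual(2) by(intro mult_mono) auto
  finally show "cmod (q et xi) <= \<bar>k\<bar> * norm et * norm xi" by(simp add: mult_ac)
  qed simp
  then obtain T where T: "T:bop b H H'" "!!xi et. xi:H ==> et:H' ==> ip et (T $$ xi) = q et xi" by blast
  have TX: "T:X" unfolding XQ
  proof (intro conjI T(1) ballI)
  fix z assume z: "z:Q"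
  obtain p x e y where ze: "z = (p, x, e, y)" by(metis prod_cases4)
  have m: "p:H'" "x:H" "e:H'" "y:H" using Q z ze by auto
  \<comment> \<open>The relation holds at every element of \<open>X\<close>, so it is an identity of
    functionals on \<open>X\<close>.\<close>
  have "vfun X p x = vfun X e y" using z ze by(auto simp: vfun_def fun_eq_iff XQ)
  thus "case z of (p, x, e, y) => ip p (T $$ x) = ip e (T $$ y)" by(simp add: ze T(2) m q_def)
  qed
  have "f:{f:?F. Ph f = f T}" if f: "f:?F" for f
  proof (rule vpd(3)[OF f])
  show "closed_funs X {f:?F. Ph f = f T}"
  unfolding closed_funs_def[of X "{f:?F. Ph f = f T}"]
  proof (intro conjI ballI allI impI)
  show "{f:?F. Ph f = f T} <= dual_of X scl" using vpd_dual by blast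
  fix f assume f: "f:dual_of X scl" and ap: "ALL e>0. EX g:{f:?F. Ph f = f T}. dual_norm X (%x. f x - g x) < e"
  have fF: "f:?F" by(rule F(4)[OF f]) (use ap in blast)
  have le: "cmod (Ph f - f T) <= e * (\<bar>k\<bar> + norm T + 1)" if "e > 0" for e
  proof -
  obtain g where g: "g:?F" "Ph g = g T" "dual_norm X (%x. f x - g x) < e" using ap \<open>e > 0\<close> by blast
  let ?d = "%x. f x + (-1) * g x"
  have dF: "?d:?F" by(rule F(2)[OF fF F(3)[OF g(1)]])
  have de: "dual_norm X ?d <= e" using g(3) by simp
  have "Ph ?d = Ph f - g T" using add[OF fF F(3)[OF g(1), of "-1"]] sc[OF g(1), of "-1"] g(2) by simp
  hence e: "Ph f - f T = Ph ?d - ?d T" by simp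
  have "cmod (Ph f - f T) <= cmod (Ph ?d) + cmod (?d T)" unfolding e by(rule norm_triangle_ineq4)
  also have "... <= \<bar>k\<bar> * e + e * norm T"
  proof (rule add_mono)
  have "k * dual_norm X ?d <= \<bar>k\<bar> * e" by(intro mult_mono) (use de dual_norm(1)[OF vpd_dual[OF dF]] in auto)
  thus "cmod (Ph ?d) <= \<bar>k\<bar> * e" using bd[OF dF] by linarith
  show "cmod (?d T) <= e * norm T" by(rule order_trans[OF dual_norm(2)[OF vpd_dual[OF dF] TX] mult_right_mono[OF de norm_ge_zero]])
  qed
  also have "... <= e * (\<bar>k\<bar> + norm T + 1)" using \<open>e > 0\<close> by(simp add: algebra_simps)
  finally show ?thesis .
  qed
  have m: "0 < \<bar>k\<bar> + norm T + 1" using norm_ge_zero[of T] abs_ge_zero[of k] by linarith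
  have "cmod (Ph f - f T) <= 0 + d" if "d > 0" for d
  using le[OF divide_pos_pos[OF that m]] m by(metis add_0 less_irrefl nonzero_eq_divide_eq)
  hence "cmod (Ph f - f T) <= 0" by(rule field_le_epsilon)
  thus "f:{f:?F. Ph f = f T}" using fF by simp
  qed (auto simp: add sc F(2,3))
  show "vfun X et xi:{f:?F. Ph f = f T}" if "et:H'" "xi:H" for et xi
  using vF[OF that] T(2)[OF that(2,1)] TX by(simp add: q_def vfun_def)
  qed
  thus ?thesis using TX by blast
 qed
 show ?thesis
  unfolding is_predual_def
 proof (intro conjI ballI allI impI)
  show "f:?F" if "f:dual_of X scl" "ALL e>0. EX g:?F. dual_norm X (%x. f x - g x) < e" for f
  by(rule F(4)[OF that(1)]) (use that(2) in simp)
  fix Ph assume p: "(ALL f:?F. ALL g:?F. Ph (%x. f x + g x) = Ph f + Ph g) & (ALL c. ALL f:?F. Ph (%x. c * f x) = c * Ph f) &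
  (EX K. ALL f:?F. cmod (Ph f) <= K * dual_norm X f)"
  then obtain k where "ALL f:?F. cmod (Ph f) <= k * dual_norm X f" by blast
  thus "EX x:X. ALL f:?F. Ph f = f x" using p by(intro rep[of Ph k]) auto
 qed (use F(1-3) zero nrm in auto)
qed

end

text \<open>The functionals pulled back into the predual form a closed space, so vector functionals
  suffice; density in each of the two vectors reduces these further to total sets, in the
  application the elementary tensors.\<close>

lemma normal_map_vpd:
 fixes X Y :: "'h::complex_hilbert oper set"
 assumes X: "subspace X" "!!c x. x:X ==> scl c x:X" and Y: "subspace Y" "!!c x. x:Y ==> scl c x:Y"
  and m: "!!x. x:X ==> m x:Y" "!!x y. x:X ==> y:X ==> m (x + y) = m x + m y" "!!c x. x:X ==> m (scl c x) = scl c (m x)"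
  "!!x. x:X ==> norm (m x) <= (norm x + 1) * C"
  and B: "B ~= {}" "B' ~= {}" "L <= closure (span B)" "L' <= closure (span B')"
  and v: "!!et xi. et:B' ==> xi:B ==> (%x. if x:X then ip et (m x $$ xi) else 0):vpd X H H'"
 shows "normal_map X (vpd X H H') (vpd Y L L') m"
proof -
 have mR: "m (r *\<^sub>R x) = r *\<^sub>R m x" if "x:X" for r x
  using m(3)[OF that, of "cor r"] by(simp add: scl_of_real)
 have C: "0 <= C" using m(4)[OF subspace_0[OF X(1)]] order_trans[OF norm_ge_zero] by simp
 \<comment> \<open>The hypothesis is affine in \<open>norm x\<close>. At a normalized argument it
   reads \<open>2 * C\<close>, and homogeneity gives the linear bound.\<close>
 have nb: "norm (m x) <= 2 * C * norm x" if x: "x:X" for x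
 proof (cases "x = 0")
  case True
  thus ?thesis using mR[OF x, of 0] by simp
 next
  case False
  have "norm (m (inverse (norm x) *\<^sub>R x)) <= (norm (inverse (norm x) *\<^sub>R x) + 1) * C"
  by(rule m(4)[OF subspace_scale[OF X(1) x]])
  thus ?thesis using False unfolding mR[OF x] by(simp add: field_simps)
 qed
 let ?G = "%et xi x. if x:X then ip et (m x $$ xi) else 0"
 have Gb: "cmod (?G et xi x) <= (2 * C * norm et * norm xi) * norm x" if "x:X" for et xi x
 proof -
  have "cmod (ip et (m x $$ xi)) <= norm et * (norm (m x) * norm xi)"
  by(rule order_trans[OF cinner_cauchy mult_left_mono[OF norm_blinfun norm_ge_zero]])
  also have "... <= norm et * ((2 * C * norm x) * norm xi)" by(intro mult_left_mono mult_right_mono nb[OF that]) simp_all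
  finally show ?thesis using that by(simp add: mult_ac)
 qed
 have Gd: "?G et xi:dual_of X scl" for et xi
  by(rule dual_ofI[OF X _ _ Gb])
  (simp_all add: m subspace_add[OF X(1)] X(2) blinfun.add_left cinner_add_right scl_apply cinner_scaleC_right)
 note F = vpd(1)[OF X, of H H']
 have G1: "?G et xi:vpd X H H'" if "et:B'" "xi:L" for et xi
  by(rule closed_funs_span[OF X F, of "?G et", where C = "2 * C * norm et" and B = B])
  (use Gb B v that C Gd in \<open>auto simp: blinfun.add_right cinner_add_right blinfun.scaleR_right cinner_scaleR_right\<close>)
 have G2: "?G et xi:vpd X H H'" if "et:L'" "xi:L" for et xi
  by(rule closed_funs_span[OF X F, of "%et. ?G et xi", where C = "2 * C * norm xi" and B = B'])
  (use Gb[of _ _ xi] B G1 that C Gd in \<open>auto simp: cinner_add_left cinner_scaleR_left mult_ac\<close>)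
 let ?S = "{g:dual_of Y scl. (%x. if x:X then g (m x) else 0):vpd X H H'}"
 have gd: "(%x. if x:X then g (m x) else 0):dual_of X scl" "dual_norm X (%x. if x:X then g (m x) else 0) <= dual_norm Y g * (2 * C)"
  if g: "g:dual_of Y scl" for g
 proof -
  have b: "cmod (if x:X then g (m x) else 0) <= (dual_norm Y g * (2 * C)) * norm x" if "x:X" for x
  using order_trans[OF dual_norm(2)[OF Y g m(1)[OF that]] mult_left_mono[OF nb[OF that] dual_norm(1)[OF Y g]]] that by(simp add: mult_ac)
  have l: "g (x + y) = g x + g y" "g (scl c x) = c * g x" if "x:Y" "y:Y" for x y c
  using g that by(auto simp: dual_of_def clinear_on_def)
  show "(%x. if x:X then g (m x) else 0):dual_of X scl"
  by(rule dual_ofI[OF X _ _ b]) (use subspace_add[OF X(1)] X(2) in \<open>simp_all add: m l(1)[OF m(1) m(1)] l(2)[OF m(1) m(1)]\<close>)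
  show "dual_norm X (%x. if x:X then g (m x) else 0) <= dual_norm Y g * (2 * C)"
  by(rule dual_normI[OF X _ b]) (use C dual_norm(1)[OF Y g] in simp_all)
 qed
 have "closed_funs Y ?S"
  unfolding closed_funs_def
 proof (intro conjI ballI allI impI)
  fix f g assume "f:?S" "g:?S"
  moreover have "(%x. if x:X then f (m x) + g (m x) else 0) = (%x. (if x:X then f (m x) else 0) + (if x:X then g (m x) else 0))" by auto
  ultimately show "(%x. f x + g x):?S" using closed_funsD(2)[OF F] dual_combine(1)[OF Y] by simp
 next
  fix c f assume "f:?S"
  moreover have "(%x. if x:X then c * f (m x) else 0) = (%x. c * (if x:X then f (m x) else 0))" by auto
  ultimately show "(%x. c * f x):?S" using closed_funsD(3)[OF F] dual_combine(3)[OF Y, of f f] by simp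
 next
  fix f assume f: "f:dual_of Y scl" and ap: "ALL e>0. EX g:?S. dual_norm Y (%x. f x - g x) < e"
  have "(%x. if x:X then f (m x) else 0):vpd X H H'"
  proof (rule closed_funsD(4)[OF F gd(1)[OF f]])
  fix e :: real assume e: "e > 0"
  have C1: "2 * C + 1 > 0" using C by simp
  obtain g where g: "g:?S" "dual_norm Y (%x. f x - g x) < e / (2 * C + 1)" using ap divide_pos_pos[OF e C1] by blast
  have d: "(%x. f x - g x):dual_of Y scl" using dual_combine(5)[OF Y f] g(1) by simp
  have "dual_norm X (%x. if x:X then f (m x) - g (m x) else 0) <= dual_norm Y (%x. f x - g x) * (2 * C)" by(rule gd(2)[OF d])
  also have "... <= dual_norm Y (%x. f x - g x) * (2 * C + 1)" by(intro mult_left_mono dual_norm(1)[OF Y d]) simp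
  also have "... < e" using g(2) C1 by(simp add: pos_less_divide_eq)
  finally have "dual_norm X (%x. if x:X then f (m x) - g (m x) else 0) < e" .
  moreover have "(%x. if x:X then f (m x) - g (m x) else 0) = (%x. (if x:X then f (m x) else 0) - (if x:X then g (m x) else 0))" by auto
  ultimately show "EX g:vpd X H H'. dual_norm X (%x. (if x:X then f (m x) else 0) - g x) < e" using g(1) by auto
  qed
  thus "f:?S" using f by simp
 qed simp
 moreover have "vfun Y et xi:?S" if "et:L'" "xi:L" for et xi
 proof -
  have "(%x. if x:X then vfun Y et xi (m x) else 0) = ?G et xi" by(auto simp: vfun_def m(1))
  thus ?thesis using G2[OF that] vfun_dual(1)[OF Y] by simp
 qed
 ultimately have "g:?S" if "g:vpd Y L L'" for g using vpd(3)[OF Y that] by blast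
 thus ?thesis unfolding normal_map_def by blast
qed

context corep_setting begin

lemma SV_Wstar: "semilinear_tensor_Wstar_category SV"
proof -
 define pd where "pd b W W' = vpd (arr SV b W W') (sp (fst W)) (sp (fst W'))" for b W W'
 have pre: "is_predual (arr SV b W W') scl (pd b W W')" if W: "W:CR" "W':CR" for b W W'
 proof -
  obtain Q where Q: "Q <= sp (fst W') \<times> sp (fst W) \<times> sp (fst W') \<times> sp (fst W)"
  "ALL T. T:arr SV b W W' \<longleftrightarrow> T:bop b (sp (fst W)) (sp (fst W')) & (ALL (p, x, e, y):Q. ip p (T $$ x) = ip e (T $$ y))"
  using arr_relations[OF W, of b] by(elim exE conjE)
  show ?thesis unfolding pd_def
  by(rule predual_vpd[OF arr_linear(1,3)[OF W] corepW(4)[OF W(1)] corepW(4)[OF W(2)] Q(1) Q(2)[rule_format]])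
 qed
 have norm: "(ALL R':arr SV b W1' W2'. normal_map (arr SV b W1 W2) (pd b W1 W2) (pd b (ct W1 W1') (ctgt b W2 W2'))
  (%R. tensop b (fst W1) (fst W2) (fst W1') (fst W2') R R')) &
  (ALL R:arr SV b W1 W2. normal_map (arr SV b W1' W2') (pd b W1' W2') (pd b (ct W1 W1') (ctgt b W2 W2'))
  (%R'. tensop b (fst W1) (fst W2) (fst W1') (fst W2') R R'))"
  if W: "W1:CR" "W2:CR" "W1':CR" "W2':CR" for b W1 W2 W1' W2'
 proof -
  have Y: "ct W1 W1':CR" "ctgt b W2 W2':CR"
  using ct_in[OF W(1,3)] ct_in[OF W(2,4)] ct_in[OF W(4,2)] by(simp_all add: ctgt_def)
  note o = corepW(3)[OF W(1)] corepW(3)[OF W(2)] corepW(3)[OF W(3)] corepW(3)[OF W(4)]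
  note H = corepW(4)[OF W(1)] corepW(4)[OF W(2)] corepW(4)[OF W(3)] corepW(4)[OF W(4)]
  let ?t = "tensop b (fst W1) (fst W2) (fst W1') (fst W2')"
  let ?B = "{vc (fst W1) (fst W1') x y |x y. x:sp (fst W1) & y:sp (fst W1')}"
  let ?B' = "{vv b (fst W2) (fst W2') x y |x y. x:sp (fst W2) & y:sp (fst W2')}"
  have B: "?B ~= {}" "?B' ~= {}" using csubD(4) H by blast+
  have L: "sp (fst (ct W1 W1')) <= closure (span ?B)" using hsp_htens[OF o(1,3)] by simp
  have "?B' = (if b then {vc (fst W2') (fst W2) x y |x y. x:sp (fst W2') & y:sp (fst W2)} else {vc (fst W2) (fst W2') x y |x y. x:sp (fst W2) & y:sp (fst W2')})"
  unfolding vv_def by auto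
  hence L': "sp (fst (ctgt b W2 W2')) <= closure (span ?B')"
  using hsp_htens[OF o(2,4)] hsp_htens[OF o(4,2)] by(simp add: ctgt_def)
  have vvc: "ip (vv b (fst W2) (fst W2') x y) (vv b (fst W2) (fst W2') x' y') = ip x x' * ip y y'"
  if "x:sp (fst W2)" "y:sp (fst W2')" "x':sp (fst W2)" "y':sp (fst W2')" for x y x' y'
  using that by(simp add: vv_def hvec_cinner o)
  show ?thesis
  proof (intro conjI ballI)
  fix R' assume R': "R':arr SV b W1' W2'"
  note r' = arrD(1)[OF W(3,4) R'] and r = arrD(1)[OF W(1,2)]
  let ?X = "arr SV b W1 W2"
  have v: "(%x. if x:?X then ip et (?t x R' $$ xi) else 0):vpd ?X (sp (fst W1)) (sp (fst W2))" if e: "et:?B'" "xi:?B" for et xi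
  proof -
  obtain p p' where p: "et = vv b (fst W2) (fst W2') p p'" "p:sp (fst W2)" "p':sp (fst W2')" using e(1) by blast
  obtain q q' where q: "xi = vc (fst W1) (fst W1') q q'" "q:sp (fst W1)" "q':sp (fst W1')" using e(2) by blast
  \<comment> \<open>At elementary tensors the pulled-back functional is a scalar multiple of a
    vector functional, the scalar being an entry of the fixed factor.\<close>
  have "(%x. if x:?X then ip et (?t x R' $$ xi) else 0) = (%x. ip p' (R' $$ q') * vfun ?X p q x)"
  by(rule ext) (simp add: vfun_def p q tensop(2)[OF o r r'] vvc bop_in[OF r] bop_in[OF r'])
  thus ?thesis using closed_funsD(3)[OF vpd(1)[OF arr_linear(1,3)[OF W(1,2)]] vpd(2)[OF arr_linear(1,3)[OF W(1,2)] p(2) q(2)]] by simp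
  qed
  show "normal_map ?X (pd b W1 W2) (pd b (ct W1 W1') (ctgt b W2 W2')) (%R. ?t R R')"
  unfolding pd_def
  by(rule normal_map_vpd[OF arr_linear(1,3)[OF W(1,2)] arr_linear(1,3)[OF Y] tensop_arr[OF W _ R']
  tensop_linear(1)[OF o r r r' r'] tensop_linear(3)[OF o r r r' r'] tensop(3)[OF o r r'] B L L' v])
  next
  fix R assume R: "R:arr SV b W1 W2"
  note r = arrD(1)[OF W(1,2) R] and r' = arrD(1)[OF W(3,4)]
  let ?X = "arr SV b W1' W2'"
  have v: "(%x. if x:?X then ip et (?t R x $$ xi) else 0):vpd ?X (sp (fst W1')) (sp (fst W2'))" if e: "et:?B'" "xi:?B" for et xi
  proof -
  obtain p p' where p: "et = vv b (fst W2) (fst W2') p p'" "p:sp (fst W2)" "p':sp (fst W2')" using e(1) by blast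
  obtain q q' where q: "xi = vc (fst W1) (fst W1') q q'" "q:sp (fst W1)" "q':sp (fst W1')" using e(2) by blast
  have "(%x. if x:?X then ip et (?t R x $$ xi) else 0) = (%x. ip p (R $$ q) * vfun ?X p' q' x)"
  by(rule ext) (simp add: vfun_def p q tensop(2)[OF o r r'] vvc bop_in[OF r] bop_in[OF r'])
  thus ?thesis using closed_funsD(3)[OF vpd(1)[OF arr_linear(1,3)[OF W(3,4)]] vpd(2)[OF arr_linear(1,3)[OF W(3,4)] p(3) q(3)]] by simp
  qed
  have nb: "norm (?t R x) <= (norm x + 1) * (norm R + 1)" if "x:?X" for x
  using tensop(3)[OF o r r'[OF that]] by(simp add: mult.commute)
  show "normal_map ?X (pd b W1' W2') (pd b (ct W1 W1') (ctgt b W2 W2')) (%R'. ?t R R')"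
  unfolding pd_def
  by(rule normal_map_vpd[OF arr_linear(1,3)[OF W(3,4)] arr_linear(1,3)[OF Y] tensop_arr[OF W R]
  tensop_linear(2)[OF o r r r' r'] tensop_linear(4)[OF o r r r' r'] nb B L L' v])
  qed
 qed
 interpret semilinear_tensor_Cstar_category SV by(rule SV_Cstar)
 show ?thesis
 proof (unfold_locales, unfold SVc, intro exI[of _ pd] conjI allI ballI)
  fix b rh sg assume W: "rh:CR" "sg:CR"
  show "is_predual (arr SV b rh sg) scl (pd b rh sg)" by(rule pre[OF W])
  fix rh' sg' assume W': "rh':CR" "sg':CR"
  note n = norm[OF W W', of b, unfolded ctgt_def]
  show "normal_map (arr SV b rh sg) (pd b rh sg) (pd b (ct rh rh') (if b then ct sg' sg else ct sg sg'))
  (%R. tensop b (fst rh) (fst sg) (fst rh') (fst sg') R R')" if "R':arr SV b rh' sg'" for R' using n that by blast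
  show "normal_map (arr SV b rh' sg') (pd b rh' sg') (pd b (ct rh rh') (if b then ct sg' sg else ct sg sg'))
  (%R'. tensop b (fst rh) (fst sg) (fst rh') (fst sg') R R')" if "R:arr SV b rh sg" for R using n that by blast
 qed
qed

end

section \<open>The conjugation\<close>

context corep_setting begin

abbreviation (input) "CV \<equiv> corep_cat D"
abbreviation (input) "Jw \<equiv> %W. cJ D (fst W)"

lemma CVc: "tobj CV = CR" "thom CV = arr SV False" "tid CV = (%W. hI (fst W))" "tcomp CV = (oL)" "tstar CV = adj"
 "tscl CV = scl" "ttar CV = (%W1 W2 W1' W2'. tensop False (fst W1) (fst W2) (fst W1') (fst W2'))" "corep_hom D = arr SV False"
 by(auto simp: fun_eq_iff arr_def tensop_def corep_cat_def SV_simps)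

lemma vslice2_hid:
 assumes "h:Ob" "p:sp h" "q:sp h"
 shows "vs h p q (hI (tn K h)) = scl (ip p q) (qid D)"
proof -
 note o = qK assms(1)
 note I = hid_bop[OF htens[OF o]]
 show ?thesis
  by(rule bop_eqI[OF K_sub vslice2(2)[OF o I assms(2,3)] bop_scl[OF K_sub idop_bop[OF K_sub]]])
  (simp add: vslice2(1)[OF o I assms(2,3)] rten(2)[OF o assms(3)] hid_apply htens o hvec_in assms adj_rten(3) scl_apply)
qed

text \<open>Slices of the identity are scalars and \<open>R\<close> fixes \<open>1\<close>; the
  exchange of \<open>p\<close> and \<open>q\<close> under \<open>R\<close> matches antiunitarity of
  \<open>J\<close>.\<close>

lemma bar_triv:
 assumes h: "h:cobj D"
 shows "bar_of (triv_corep D h) = triv_corep D (Bar h)"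
proof -
 note T = triv_corep_in[OF h, unfolded triv_corep_def] and Jw = J_facts[OF h]
 show ?thesis unfolding triv_corep_def
 proof (rule bar_of(4)[OF T, symmetric])
  show "(Bar h, hI (tn K (Bar h))):CR" using triv_corep_in[OF cbar[OF h]] by(simp add: triv_corep_def)
  fix p q assume pq: "p:sp h" "q:sp h"
  show "vs (Bar h) (cJ D h $$ p) (cJ D h $$ q) (snd (Bar h, hI (tn K (Bar h)))) = qR D (vs h q p (hI (tn K h)))"
  using h pq by(simp add: vslice2_hid Jw(7,8) R_simps(5)[OF Mhat_closed(3)] R_simps(6))
 qed simp
qed

lemma J_W:
 assumes "W:CR"
 shows "Jw W:banti (sp (fst W)) (sp (fst (bar_of W)))" "adj (Jw W):banti (sp (fst (bar_of W))) (sp (fst W))"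
  "adj (Jw W) oL Jw W = hI (fst W)" "Jw W oL adj (Jw W) = hI (fst (bar_of W))"
  "Jw W:arr SV True W (bar_of W)" "adj (Jw W):arr SV True (bar_of W) W"
proof -
 note b = barW[OF assms] and f = J_facts[OF corepW(2)[OF assms]]
 show B: "Jw W:banti (sp (fst W)) (sp (fst (bar_of W)))" "adj (Jw W):banti (sp (fst (bar_of W))) (sp (fst W))"
  "adj (Jw W) oL Jw W = hI (fst W)" "Jw W oL adj (Jw W) = hI (fst (bar_of W))"
  using f(1-4) by(simp_all add: b(2))
 have "hI (fst (bar_of W)) oL Jw W = Jw W" by(rule idop_comp[OF corepW(4)[OF b(1)] B(1)])
 thus A: "Jw W:arr SV True W (bar_of W)"
  using id_in_hom[OF b(1)] by(auto simp: arr_def SV_simps conj_corep_eq[OF assms] intro!: exI[of _ "hI (fst (bar_of W))"])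
 show "adj (Jw W):arr SV True (bar_of W) W" by(rule arr_star[OF assms b(1) A])
qed

lemma J_cancel:
 assumes "W:CR"
 shows "X:bop b H (sp (fst W)) ==> adj (Jw W) oL (Jw W oL X) = X" "X:bop b H (sp (fst (bar_of W))) ==> Jw W oL (adj (Jw W) oL X) = X"
 using idop_comp[OF corepW(4)[OF assms]] idop_comp[OF corepW(4)[OF barW(1)[OF assms]]] J_W(3,4)[OF assms]
 by(simp_all flip: oo_assoc)

text \<open>The antiunitary arrow \<open>J_W \<times> J_W'\<close>. Its adjoint is again a tensor
  product, so the coherence laws for \<open>c\<close> reduce to the exchange and associativity laws
  of \<open>tensop\<close>.\<close>

definition jt where
 "jt W W' = tensop True (fst W) (fst (bar_of W)) (fst W') (fst (bar_of W')) (Jw W) (Jw W')"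

lemma jt:
 assumes W: "W:CR" "W':CR"
 shows "jt W W':arr SV True (ct W W') (ct (bar_of W') (bar_of W))"
  "adj (jt W W') = tensop True (fst (bar_of W')) (fst W') (fst (bar_of W)) (fst W) (adj (Jw W')) (adj (Jw W))"
  "adj (jt W W') oL jt W W' = hI (fst (ct W W'))"
  "jt W W' oL adj (jt W W') = hI (fst (ct (bar_of W') (bar_of W)))"
proof -
 note b = barW(1)[OF W(1)] barW(1)[OF W(2)]
 note o = corepW(3)[OF W(1)] corepW(3)[OF b(1)] corepW(3)[OF W(2)] corepW(3)[OF b(2)]
 note j = J_W[OF W(1)] and j' = J_W[OF W(2)]
 show "jt W W':arr SV True (ct W W') (ct (bar_of W') (bar_of W))"
  using tensop_arr[OF W(1) b(1) W(2) b(2) j(5) j'(5)] by(simp add: jt_def ctgt_def)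
 show a: "adj (jt W W') = tensop True (fst (bar_of W')) (fst W') (fst (bar_of W)) (fst W) (adj (Jw W')) (adj (Jw W))"
  using adj_tensop[OF o j(1) j'(1)] by(simp add: jt_def)
 show "adj (jt W W') oL jt W W' = hI (fst (ct W W'))"
  unfolding a using exchange_tensop[OF o(1,2,1,3,4,3) j(1) j'(1) j(2) j'(2)]
  by(simp add: jt_def j(3) j'(3)) (simp add: tensop_def optens_id o)
 show "jt W W' oL adj (jt W W') = hI (fst (ct (bar_of W') (bar_of W)))"
  unfolding a using exchange_tensop[OF o(4,3,4,2,1,2) j'(2) j(2) j'(1) j(1)]
  by(simp add: jt_def j(4) j'(4)) (simp add: tensop_def optens_id o)
qed

lemma conj_simps:
 "cA W W' T = Jw W' oL T oL adj (Jw W)" "W:CR ==> conj_d D W = Jw (bar_of W) oL Jw W"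
 "[|W:CR; W':CR|] ==> cC W W' = cJ D (tn (fst W) (fst W')) oL adj (jt W W')"
 by(simp_all add: conj_arr_def conj_d_def conj_c_def SV_simps conj_corep_eq jt_def tensop_def anti_tens_def)

text \<open>The last two relations let \<open>J\<close> slide past \<open>T\<close>, and
  \<open>adj J\<close> past its conjugate; naturality of \<open>d\<close> and \<open>c\<close> uses
  nothing else about the conjugate of \<open>T\<close>.\<close>

lemma barT:
 assumes W: "W:CR" "W':CR" and T: "T:arr SV False W W'"
 shows "cA W W' T:arr SV False (bar_of W) (bar_of W')"
  "cA W W' T oL Jw W = Jw W' oL T" "adj (Jw W') oL cA W W' T = T oL adj (Jw W)"
proof -
 note b = barW(1)[OF W(1)] barW(1)[OF W(2)] and t = arrD(1)[OF W T]
 show "cA W W' T:arr SV False (bar_of W) (bar_of W')"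
  using arr_comp[OF b(1) W(1) b(2) J_W(6)[OF W(1)] arr_comp[OF W b(2) T J_W(5)[OF W(2)]]] by(simp add: conj_simps)
 have "T oL hI (fst W) = T" by(rule comp_idop[OF corepW(4)[OF W(1)] t])
 thus "cA W W' T oL Jw W = Jw W' oL T" by(simp add: conj_simps oo_assoc J_W(3)[OF W(1)])
 show "adj (Jw W') oL cA W W' T = T oL adj (Jw W)"
  using J_cancel(1)[OF W(2) bop_comp[OF J_W(2)[OF W(1)] t]] by(simp add: conj_simps oo_assoc)
qed

lemma functor_bar: "antilinear_star_functor CV bar_of (cA)"
 unfolding antilinear_star_functor_def CVc
proof (intro conjI ballI allI)
 show "bar_of:CR \<rightarrow> CR" using barW(1) by blast
next
 fix W assume W: "W:CR"
 have "Jw W oL hI (fst W) = Jw W" by(rule comp_idop[OF corepW(4)[OF W] J_W(1)[OF W]])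
 thus "cA W W (hI (fst W)) = hI (fst (bar_of W))" by(simp add: conj_simps J_W(4)[OF W])
next
 fix W W' T assume W: "W:CR" "W':CR" and T: "T:arr SV False W W'"
 show "cA W W' T:arr SV False (bar_of W) (bar_of W')" by(rule barT(1)[OF W T])
 show "cA W' W (adj T) = adj (cA W W' T)" by(simp add: conj_simps adj_comp oo_assoc)
 show "cA W W' (scl z T) = scl (cnj z) (cA W W' T)" for z
  using scl_comp_right[OF J_W(1)[OF W(2)], of z T] by(simp add: conj_simps scl_comp_left)
 show "cA W W' (S + T) = cA W W' S + cA W W' T" for S
  by(simp add: conj_simps blinfun_compose_add_left blinfun_compose_add_right)
 fix W'' S assume W'': "W'':CR" and S: "S:arr SV False W' W''"
 show "cA W W'' (S oL T) = cA W' W'' S oL cA W W' T"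
  using barT(3)[OF W T] by(simp add: conj_simps(1)[of _ _ S] conj_simps(1)[of _ _ "S oL T"] oo_assoc)
qed

lemma d_W:
 assumes W: "W:CR"
 shows "conj_d D W:arr SV False W (bar_of (bar_of W))" "adj (conj_d D W) oL conj_d D W = hI (fst W)"
  "conj_d D W oL adj (conj_d D W) = hI (fst (bar_of (bar_of W)))"
proof -
 note b = barW(1)[OF W] and bb = barW(1)[OF barW(1)[OF W]]
 show "conj_d D W:arr SV False W (bar_of (bar_of W))"
  using arr_comp[OF W b bb J_W(5)[OF W] J_W(5)[OF b]] by(simp add: conj_simps W)
 show "adj (conj_d D W) oL conj_d D W = hI (fst W)"
  using J_cancel(1)[OF b J_W(1)[OF W]] by(simp add: conj_simps W adj_comp oo_assoc J_W(3)[OF W])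
 show "conj_d D W oL adj (conj_d D W) = hI (fst (bar_of (bar_of W)))"
  using J_cancel(2)[OF W J_W(2)[OF b]] by(simp add: conj_simps W adj_comp oo_assoc J_W(4)[OF b])
qed

lemma natural_d:
 "natural_unitary_from_id CV (%W. bar_of (bar_of W)) (%W W' T. cA (bar_of W) (bar_of W') (cA W W' T)) (conj_d D)"
 unfolding natural_unitary_from_id_def tunitary_def CVc
proof (intro conjI ballI)
 fix W W' T assume W: "W:CR" "W':CR" and T: "T:arr SV False W W'"
 note b = barW(1)[OF W(1)] barW(1)[OF W(2)]
 note B = barT[OF W T]
 have "cA (bar_of W) (bar_of W') (cA W W' T) oL (Jw (bar_of W) oL Jw W) = Jw (bar_of W') oL (cA W W' T oL Jw W)"
  using barT(2)[OF b B(1)] by(simp flip: oo_assoc)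
 thus "conj_d D W' oL T = cA (bar_of W) (bar_of W') (cA W W' T) oL conj_d D W"
  by(simp add: conj_simps(2) W B(2) oo_assoc)
qed (use d_W in auto)

lemma c_W:
 assumes W: "W:CR" "W':CR"
 shows "tunitary CV (ct (bar_of W') (bar_of W)) (bar_of (ct W W')) (cC W W')"
proof -
 note t = ct_in[OF W] and b = barW(1)[OF W(1)] barW(1)[OF W(2)]
 note s = ct_in[OF b(2,1)] and bt = barW(1)[OF ct_in[OF W]]
 note j = jt[OF W] and JW = J_W[OF t, unfolded fst_corep_tens]
 have aj: "adj (jt W W'):arr SV True (ct (bar_of W') (bar_of W)) (ct W W')" by(rule arr_star[OF t s j(1)])
 have "cC W W':arr SV False (ct (bar_of W') (bar_of W)) (bar_of (ct W W'))"
  using arr_comp[OF s t bt aj JW(5)] by(simp add: conj_simps W)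
 moreover have "adj (cC W W') oL cC W W' = hI (fst (ct (bar_of W') (bar_of W)))"
  using J_cancel(1)[OF t arrD(1)[OF s t aj]] j(4) by(simp add: conj_simps W adj_comp oo_assoc)
 moreover have "cC W W' oL adj (cC W W') = hI (fst (bar_of (ct W W')))"
 proof -
  have "cC W W' oL adj (cC W W') = cJ D (tn (fst W) (fst W')) oL ((adj (jt W W') oL jt W W') oL adj (cJ D (tn (fst W) (fst W'))))"
  by(simp add: conj_simps W adj_comp oo_assoc)
  also have "... = cJ D (tn (fst W) (fst W')) oL adj (cJ D (tn (fst W) (fst W')))"
  unfolding j(3) using idop_comp[OF corepW(4)[OF t] J_W(2)[OF t]] by simp
  finally show ?thesis using JW(4) by simp
 qed
 ultimately show ?thesis by(simp add: tunitary_def CVc)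
qed

lemma c_natural:
 assumes W: "W1:CR" "W2:CR" "W1':CR" "W2':CR"
  and T: "T:arr SV False W1 W2" "T':arr SV False W1' W2'"
 shows "cC W2 W2' oL tensop False (fst (bar_of W1')) (fst (bar_of W2')) (fst (bar_of W1)) (fst (bar_of W2)) (cA W1' W2' T') (cA W1 W2 T)
  = cA (ct W1 W1') (ct W2 W2') (tensop False (fst W1) (fst W2) (fst W1') (fst W2') T T') oL cC W1 W1'"
proof -
 note b = barW(1)[OF W(1)] barW(1)[OF W(2)] barW(1)[OF W(3)] barW(1)[OF W(4)]
 note o = corepW(3)[OF W(1)] corepW(3)[OF W(2)] corepW(3)[OF W(3)] corepW(3)[OF W(4)]
 note bo = corepW(3)[OF b(1)] corepW(3)[OF b(2)] corepW(3)[OF b(3)] corepW(3)[OF b(4)]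
 note B = barT[OF W(1,2) T(1)] and B' = barT[OF W(3,4) T(2)]
 note Bb = arrD(1)[OF b(1,2) B(1)] and Bb' = arrD(1)[OF b(3,4) B'(1)]
 note t = arrD(1)[OF W(1,2) T(1)] and t' = arrD(1)[OF W(3,4) T(2)]
 let ?T = "tensop False (fst W1) (fst W2) (fst W1') (fst W2') T T'"
 have TA: "?T:arr SV False (ct W1 W1') (ct W2 W2')" using tensop_arr[OF W T] by(simp add: ctgt_def)
 have "adj (jt W2 W2') oL tensop False (fst (bar_of W1')) (fst (bar_of W2')) (fst (bar_of W1)) (fst (bar_of W2)) (cA W1' W2' T') (cA W1 W2 T)
  = ?T oL adj (jt W1 W1')"
  unfolding jt(2)[OF W(2,4)] jt(2)[OF W(1,3)]
  using exchange_tensop[OF bo(3,4) o(4) bo(1,2) o(2) Bb' Bb J_W(2)[OF W(4)] J_W(2)[OF W(2)]]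
  exchange_tensop[OF bo(3) o(3,4) bo(1) o(1,2) J_W(2)[OF W(3)] J_W(2)[OF W(1)] t' t] by(simp add: B(3) B'(3))
 moreover have "cA (ct W1 W1') (ct W2 W2') ?T oL cJ D (tn (fst W1) (fst W1')) = cJ D (tn (fst W2) (fst W2')) oL ?T"
  using barT(2)[OF ct_in[OF W(1,3)] ct_in[OF W(2,4)] TA] by simp
 ultimately show ?thesis by(simp add: conj_simps(3) W oo_assoc) (simp flip: oo_assoc)
qed

lemma bar_d:
 assumes W: "W:CR"
 shows "cA W (bar_of (bar_of W)) (conj_d D W) = conj_d D (bar_of W)"
 using comp_idop[OF corepW(4)[OF barW(1)[OF W]] J_W(1)[OF barW(1)[OF W]]]
 by(simp add: conj_simps W barW(1) oo_assoc J_W(4)[OF W])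

text \<open>After the common factor \<open>J\<close> of the triple product is split off, the
  remaining \<open>J\<close> cancels against \<open>c\<close> on either side, and both sides become
  the adjoint of the threefold product of the \<open>J\<close>, bracketed in the two ways.\<close>

lemma c_assoc:
 assumes W: "X:CR" "Y:CR" "Z:CR"
 shows "cC X (ct Y Z) oL tensop False (fst (ct (bar_of Z) (bar_of Y))) (fst (bar_of (ct Y Z)))
  (fst (bar_of X)) (fst (bar_of X)) (cC Y Z) (hI (fst (bar_of X)))
  = cC (ct X Y) Z oL tensop False (fst (bar_of Z)) (fst (bar_of Z)) (fst (ct (bar_of Y) (bar_of X))) (fst (bar_of (ct X Y)))
  (hI (fst (bar_of Z))) (cC X Y)"
proof -
 note b = barW(1)[OF W(1)] barW(1)[OF W(2)] barW(1)[OF W(3)]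
 note o = corepW(3)[OF W(1)] corepW(3)[OF W(2)] corepW(3)[OF W(3)]
 note bo = corepW(3)[OF b(1)] corepW(3)[OF b(2)] corepW(3)[OF b(3)]
 note j = J_W[OF W(1)] J_W[OF W(2)] J_W[OF W(3)]
 have adjJ: "adj (Jw (ct U V)) oL cC U V = adj (jt U V)" and cB: "cC U V:BL (fst (ct (bar_of V) (bar_of U))) (fst (bar_of (ct U V)))"
  if U: "U:CR" "V:CR" for U V
 proof -
  note bU = barW(1)[OF U(1)] barW(1)[OF U(2)]
  note t = ct_in[OF U] and s = ct_in[OF bU(2,1)]
  show "adj (Jw (ct U V)) oL cC U V = adj (jt U V)"
  using J_cancel(1)[OF t arrD(2)[OF t s jt(1)[OF U]]] by(simp add: conj_simps U)
  show "cC U V:BL (fst (ct (bar_of V) (bar_of U))) (fst (bar_of (ct U V)))"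
  using c_W[OF U] arrD(1)[OF s barW(1)[OF t]] by(simp add: tunitary_def CVc)
 qed
 note YZ = ct_in[OF W(2,3)] and XY = ct_in[OF W(1,2)]
 note oYZ = corepW(3)[OF YZ] corepW(3)[OF barW(1)[OF YZ]] corepW(3)[OF ct_in[OF b(3,2)]]
 note oXY = corepW(3)[OF XY] corepW(3)[OF barW(1)[OF XY]] corepW(3)[OF ct_in[OF b(2,1)]]
 have l: "adj (jt X (ct Y Z)) oL tensop False (fst (ct (bar_of Z) (bar_of Y))) (fst (bar_of (ct Y Z)))
  (fst (bar_of X)) (fst (bar_of X)) (cC Y Z) (hI (fst (bar_of X)))
  = tensop True (fst (ct (bar_of Z) (bar_of Y))) (fst (ct Y Z)) (fst (bar_of X)) (fst X) (adj (jt Y Z)) (adj (Jw X))"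
  unfolding jt(2)[OF W(1) YZ]
  using exchange_tensop[OF oYZ(3,2,1) bo(1,1) o(1) cB[OF W(2,3)] hid_bop[OF bo(1)] J_W(2)[OF YZ] j(2)]
  unfolding adjJ[OF W(2,3)] comp_idop[OF corepW(4)[OF b(1)] j(2)] by simp
 have r: "adj (jt (ct X Y) Z) oL tensop False (fst (bar_of Z)) (fst (bar_of Z)) (fst (ct (bar_of Y) (bar_of X))) (fst (bar_of (ct X Y)))
  (hI (fst (bar_of Z))) (cC X Y)
  = tensop True (fst (bar_of Z)) (fst Z) (fst (ct (bar_of Y) (bar_of X))) (fst (ct X Y)) (adj (Jw Z)) (adj (jt X Y))"
  unfolding jt(2)[OF XY W(3)]
  using exchange_tensop[OF bo(3,3) o(3) oXY(3,2,1) hid_bop[OF bo(3)] cB[OF W(1,2)] j(14) J_W(2)[OF XY]]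
  unfolding adjJ[OF W(1,2)] comp_idop[OF corepW(4)[OF b(3)] j(14)] by simp
 have "tensop True (tn (fst (bar_of Z)) (fst (bar_of Y))) (tn (fst Y) (fst Z)) (fst (bar_of X)) (fst X) (adj (jt Y Z)) (adj (Jw X))
  = tensop True (fst (bar_of Z)) (fst Z) (tn (fst (bar_of Y)) (fst (bar_of X))) (tn (fst X) (fst Y)) (adj (Jw Z)) (adj (jt X Y))"
  unfolding jt(2)[OF W(2,3)] jt(2)[OF W(1,2)]
  using tensop_assoc[OF bo(3) o(3) bo(2) o(2) bo(1) o(1) j(14,8,2)] by(simp add: ttgt_def)
 hence "adj (jt X (ct Y Z)) oL tensop False (fst (ct (bar_of Z) (bar_of Y))) (fst (bar_of (ct Y Z)))
  (fst (bar_of X)) (fst (bar_of X)) (cC Y Z) (hI (fst (bar_of X)))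
  = adj (jt (ct X Y) Z) oL tensop False (fst (bar_of Z)) (fst (bar_of Z)) (fst (ct (bar_of Y) (bar_of X))) (fst (bar_of (ct X Y)))
  (hI (fst (bar_of Z))) (cC X Y)"
  unfolding l r by simp
 thus ?thesis
  unfolding conj_simps(3)[OF W(1) YZ] conj_simps(3)[OF XY W(3)] oo_assoc fst_corep_tens htens_assoc[OF o] by simp
qed

text \<open>Two antilinear tensor products in succession restore the order, so
  \<open>d \<times> d\<close> is \<open>jt\<close> for the conjugates after \<open>jt W W'\<close>.
  The first of these cancels in \<open>c\<close>, the second in the conjugate of
  \<open>c\<close>.\<close>

lemma c_d:
 assumes W: "W:CR" "W':CR"
 shows "cA (ct (bar_of W') (bar_of W)) (bar_of (ct W W')) (cC W W') oL cC (bar_of W') (bar_of W)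
  oL tensop False (fst W) (fst (bar_of (bar_of W))) (fst W') (fst (bar_of (bar_of W'))) (conj_d D W) (conj_d D W')
  = conj_d D (ct W W')"
proof -
 note b = barW(1)[OF W(1)] barW(1)[OF W(2)]
 note bb = barW(1)[OF b(1)] barW(1)[OF b(2)]
 note o = corepW(3)[OF W(1)] corepW(3)[OF b(1)] corepW(3)[OF bb(1)] corepW(3)[OF W(2)] corepW(3)[OF b(2)] corepW(3)[OF bb(2)]
 note t = ct_in[OF W] and s = ct_in[OF b(2,1)]
 note C = c_W[OF W]
 have CA: "cC W W':arr SV False (ct (bar_of W') (bar_of W)) (bar_of (ct W W'))" using C by(simp add: tunitary_def CVc)
 let ?A = "adj (jt (bar_of W') (bar_of W))"
 let ?d = "tensop False (fst W) (fst (bar_of (bar_of W))) (fst W') (fst (bar_of (bar_of W'))) (conj_d D W) (conj_d D W')"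
 have d: "?d = jt (bar_of W') (bar_of W) oL jt W W'"
  using exchange_tensop[OF o J_W(1)[OF W(1)] J_W(1)[OF W(2)] J_W(1)[OF b(1)] J_W(1)[OF b(2)]] by(simp add: jt_def conj_simps W)
 have ss: "ct (bar_of (bar_of W)) (bar_of (bar_of W')):CR" by(rule ct_in[OF bb])
 note j = jt[OF b(2,1)]
 have 1: "?A oL ?d = jt W W'"
  unfolding d using idop_comp[OF corepW(4)[OF s] arrD(1)[OF t s jt(1)[OF W]]] j(3) by(simp flip: oo_assoc)
 have "cA (ct (bar_of W') (bar_of W)) (bar_of (ct W W')) (cC W W') oL cC (bar_of W') (bar_of W) oL ?d
  = (cA (ct (bar_of W') (bar_of W)) (bar_of (ct W W')) (cC W W') oL Jw (ct (bar_of W') (bar_of W))) oL (?A oL ?d)"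
  by(simp add: conj_simps(3) b oo_assoc)
 also have "... = Jw (bar_of (ct W W')) oL cC W W' oL jt W W'"
  unfolding barT(2)[OF s barW(1)[OF t] CA] 1 ..
 also have "... = Jw (bar_of (ct W W')) oL (Jw (ct W W') oL (adj (jt W W') oL jt W W'))"
  by(simp add: conj_simps(3) W oo_assoc)
 also have "... = conj_d D (ct W W')"
  unfolding jt(3)[OF W] comp_idop[OF corepW(4)[OF t] J_W(1)[OF t]] by(simp add: conj_simps(2) t)
 finally show ?thesis .
qed

lemma J_antiunitary: "W:CR ==> tantiunitary SV W (bar_of W) (Jw W)"
 by(simp add: tantiunitary_def SVc J_W)

lemma functor_cong:
 assumes F: "antilinear_star_functor CV bar_of (cA)" and eq: "!!W. W:CR ==> F W = bar_of W"
 shows "antilinear_star_functor CV F (cA)"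
 using F eq unfolding antilinear_star_functor_def CVc by(auto simp del: split_paired_All)

end

theorem theorem5p10:
  fixes D :: "('o, 'h::complex_hilbert) corep_setting"
  assumes "corep_setting D"
  shows
    "let CV = corep_cat D; SV = semilinear_corep_cat D; bar = conj_corep D; barT = conj_arr D;
       d = conj_d D; c = conj_c D; tens = corep_tens D in
     (\<forall>W\<in>coreps D. \<exists>!W'. is_conj_corep D W W') \<and>
     (\<forall>W\<in>coreps D. ciota D W \<in> coreps D \<and> bar (ciota D W) = ciota D (bar W)) \<and>
     antilinear_equivalence CV bar barT \<and>
     semilinear_tensor_Wstar_category SV \<and>
     has_conjugation SV \<and>
     tensor_cat.truncate SV = CV \<and>
     (\<forall>W\<in>coreps D. tantiunitary SV W (bar W) (corep_J D W)) \<and>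
     natural_unitary_from_id CV (\<lambda>W. bar (bar W)) (\<lambda>W W' T. barT (bar W) (bar W') (barT W W' T)) d \<and>
     (\<forall>W\<in>coreps D. \<forall>W'\<in>coreps D. tunitary CV (tens (bar W') (bar W)) (bar (tens W W')) (c W W')) \<and>
     (\<forall>W1\<in>coreps D. \<forall>W2\<in>coreps D. \<forall>W1'\<in>coreps D. \<forall>W2'\<in>coreps D.
        \<forall>T\<in>corep_hom D W1 W2. \<forall>T'\<in>corep_hom D W1' W2'.
        c W2 W2' o\<^sub>L ttar CV (bar W1') (bar W2') (bar W1) (bar W2) (barT W1' W2' T') (barT W1 W2 T)
          = barT (tens W1 W1') (tens W2 W2') (ttar CV W1 W2 W1' W2' T T') o\<^sub>L c W1 W1') \<and>
     (\<forall>W\<in>coreps D. barT W (bar (bar W)) (d W) = d (bar W)) \<and>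
     (\<forall>X\<in>coreps D. \<forall>Y\<in>coreps D. \<forall>Z\<in>coreps D.
        c X (tens Y Z) o\<^sub>L ttar CV (tens (bar Z) (bar Y)) (bar (tens Y Z)) (bar X) (bar X)
            (c Y Z) (tid CV (bar X))
          = c (tens X Y) Z o\<^sub>L ttar CV (bar Z) (bar Z) (tens (bar Y) (bar X)) (bar (tens X Y))
            (tid CV (bar Z)) (c X Y)) \<and>
     (\<forall>W\<in>coreps D. \<forall>W'\<in>coreps D.
        barT (tens (bar W') (bar W)) (bar (tens W W')) (c W W') o\<^sub>L c (bar W') (bar W)
            o\<^sub>L ttar CV W (bar (bar W)) W' (bar (bar W')) (d W) (d W')
          = d (tens W W'))"
proof -
 interpret corep_setting D by(rule assms)
 have bar: "conj_corep D W = bar_of W" if "W:coreps D" for W by(rule conj_corep_eq[OF that])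
 have bb: "conj_corep D (bar_of W) = bar_of (bar_of W)" if "W:coreps D" for W by(rule bar[OF barW(1)[OF that]])
 have bt: "conj_corep D (corep_tens D W W') = bar_of (corep_tens D W W')" if "W:coreps D" "W':coreps D" for W W'
  by(rule bar[OF ct_in[OF that]])
 have fB: "antilinear_star_functor (corep_cat D) (conj_corep D) (conj_arr D)"
  by(rule functor_cong[OF functor_bar bar])
 have nat: "natural_unitary_from_id (corep_cat D) (%W. conj_corep D (conj_corep D W))
  (%W W' T. conj_arr D (conj_corep D W) (conj_corep D W') (conj_arr D W W' T)) (conj_d D)"
  using natural_d unfolding natural_unitary_from_id_def CVc by(simp add: bar bb)
 show ?thesis
  unfolding Let_def
 proof (intro conjI ballI)
  fix W assume W: "W:coreps D"
  show "EX! W'. is_conj_corep D W W'" by(simp only: conj_corep[OF W] ex1_eq)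
  show "ciota D W:coreps D" unfolding ciota_def by(rule triv_corep_in[OF corepW(2)[OF W]])
  thus "conj_corep D (ciota D W) = ciota D (conj_corep D W)"
  using bar_triv[OF corepW(2)[OF W]] by(simp add: bar W ciota_def barW(2)[OF W])
  show "tantiunitary (semilinear_corep_cat D) W (conj_corep D W) (corep_J D W)"
  using J_antiunitary[OF W] by(simp add: bar W SV_simps(12))
  show "conj_arr D W (conj_corep D (conj_corep D W)) (conj_d D W) = conj_d D (conj_corep D W)"
  by(simp add: bar W bb bar_d)
  fix W' assume W': "W':coreps D"
  show "tunitary (corep_cat D) (corep_tens D (conj_corep D W') (conj_corep D W)) (conj_corep D (corep_tens D W W')) (conj_c D W W')"
  using c_W[OF W W'] by(simp add: bar W W' bt)
  show "conj_arr D (corep_tens D (conj_corep D W') (conj_corep D W)) (conj_corep D (corep_tens D W W')) (conj_c D W W') oL conj_c D (conj_corep D W') (conj_corep D W)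
  oL ttar (corep_cat D) W (conj_corep D (conj_corep D W)) W' (conj_corep D (conj_corep D W')) (conj_d D W) (conj_d D W')
  = conj_d D (corep_tens D W W')"
  using c_d[OF W W'] by(simp add: bar W W' bt bb CVc)
 next
  \<comment> \<open>The conjugation is its own quasi-inverse, with \<open>d\<close> as the natural
    unitary for both composites.\<close>
  show "antilinear_equivalence (corep_cat D) (conj_corep D) (conj_arr D)"
  unfolding antilinear_equivalence_def using fB nat by blast
  show "semilinear_tensor_Wstar_category (semilinear_corep_cat D)" by(rule SV_Wstar)
  show "has_conjugation (semilinear_corep_cat D)"
  unfolding has_conjugation_def SVc using J_antiunitary barW(1) by blast
  show "tensor_cat.truncate (semilinear_corep_cat D) = corep_cat D"
  by(simp add: semilinear_corep_cat_def corep_cat_def tensor_cat.defs semilinear_cat.defs)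
  show "natural_unitary_from_id (corep_cat D) (%W. conj_corep D (conj_corep D W))
  (%W W' T. conj_arr D (conj_corep D W) (conj_corep D W') (conj_arr D W W' T)) (conj_d D)" by(rule nat)
 next
  fix W1 W2 W1' W2' T T'
  assume "W1:coreps D" "W2:coreps D" "W1':coreps D" "W2':coreps D" "T:corep_hom D W1 W2" "T':corep_hom D W1' W2'"
  thus "conj_c D W2 W2' oL ttar (corep_cat D) (conj_corep D W1') (conj_corep D W2') (conj_corep D W1) (conj_corep D W2) (conj_arr D W1' W2' T') (conj_arr D W1 W2 T)
  = conj_arr D (corep_tens D W1 W1') (corep_tens D W2 W2') (ttar (corep_cat D) W1 W2 W1' W2' T T') oL conj_c D W1 W1'"
  unfolding CVc using c_natural by(simp add: bar)
 next
  fix X Y Z assume W: "X:coreps D" "Y:coreps D" "Z:coreps D"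
  show "conj_c D X (corep_tens D Y Z) oL ttar (corep_cat D) (corep_tens D (conj_corep D Z) (conj_corep D Y)) (conj_corep D (corep_tens D Y Z)) (conj_corep D X) (conj_corep D X)
  (conj_c D Y Z) (tid (corep_cat D) (conj_corep D X))
  = conj_c D (corep_tens D X Y) Z oL ttar (corep_cat D) (conj_corep D Z) (conj_corep D Z) (corep_tens D (conj_corep D Y) (conj_corep D X)) (conj_corep D (corep_tens D X Y))
  (tid (corep_cat D) (conj_corep D Z)) (conj_c D X Y)"
  unfolding CVc bar[OF W(1)] bar[OF W(2)] bar[OF W(3)] bt[OF W(2,3)] bt[OF W(1,2)] by(rule c_assoc[OF W])
 qed
qed

end
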